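(* Let $N$ be a finite alphabet of node labels and $n\ge 0$. If a tree language $L\subseteq Tr(N,n)$ is the tree language of some tree abstract categorial grammar $G=(\Sigma,Tree_{N,n},\phi,S)$, then its encoding $[L]=\{[\alpha]:\alpha\in L\}\subseteq T(N,n)^*$ is the language $L(G')$ of some linear logic grammar $G'$ over the alphabet $T(N,n)$.
   Context: Trees. $Tr(N,n)$ is the set of rooted planar trees with nodes labelled in $N$ and every node having at most $n$ children; such trees are identified with terms built from function symbols $A_k$ ($A\in N$, $0\le k\le n$) of arity $k$ (root labelled $A$ with $k$ children). Let $T(N,n)=\{A^i_k: A\in N, 0\le i\le k\le n\}$ and encode trees as words: $[A_0]=A^0_0$, $[A_k(\alpha_1,\dots,\alpha_k)]=A^0_k[\alpha_1]A^1_k[\alpha_2]\cdots A^{k-1}_k[\alpha_k]A^k_k$. Linear $\lambda$-calculus and ACG. Linear implicational types over atomic types: atoms and $A\multimap B$. Linear $\lambda$-terms: variables, constants, applications $(ts)$ with disjoint free variables, and $\lambda x.t$ with $x$ free exactly once in $t$. Typing rules: $x:A\vdash x:A$; from $\Gamma\vdash t:A\multimap B$ and $\Delta\vdash s:A$ infer $\Gamma,\Delta\vdash(ts):B$; from $\Gamma,x:A,\Delta\vdash t:B$ infer $\Gamma,\Delta\vdash\lambda x.t:A\multimap B$. A linear signature $\Sigma=(N',C,\mathfrak T)$ has finite sets of atomic types and constants and a type $\mathfrak T(c)$ per constant; $\vdash_\Sigma$ means derivable with extra axioms $\vdash c:\mathfrak T(c)$. A map of signatures $\phi:\Sigma_1\to\Sigma_2$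 maps types homomorphically ($\phi(A\multimap B)=\phi(A)\multimap\phi(B)$) and constants $c$ to terms with $\vdash_{\Sigma_2}\phi(c):\phi(\mathfrak T_1(c))$, extended to terms by $\phi(x)=x$, $\phi(ts)=\phi(t)\phi(s)$, $\phi(\lambda x.t)=\lambda x.\phi(t)$. An ACG is $(\Sigma_{abstr},\Sigma_{obj},\phi,S)$ with $\phi:\Sigma_{abstr}\to\Sigma_{obj}$ and $S$ atomic in $\Sigma_{abstr}$. The tree signature $Tree_{N,n}$ has one atomic type $\mathcal T$, constants $A_k$ ($A\in N$, $k\le n$) with $\mathfrak T(A_k)=\mathcal T\multimap\dots\multimap\mathcal T\multimap\mathcal T$ ($k$ arguments). Trees are represented by terms $\rho(A_0)=A_0$, $\rho(A_k(\alpha_1,\dots,\alpha_k))=A_k\rho(\alpha_1)\cdots\rho(\alpha_k)$. A tree ACG is an ACG with $\Sigma_{obj}=Tree_{N,n}$; its tree language is $L(G)=\{\alpha\in Tr(N,n):\rho(\alpha)\text{ is }\beta\eta\text{-equivalent to }\phi(t)\text{ for some closed }t\text{ with }\vdash_\Sigma t:S\}$. Linear logic grammars (LLG) over an alphabet $T$. A boundary $X$ is $|X|\in\mathbb N$ with a subset $X_l\subseteq\{1,\dots,|X|\}$ of left endpoints, $X_r$ its complement; $X\otimes Y$: cardinality $|X|+|Y|$, left set $X_l\cup\{|X|+i:i\in Y_l\}$; $X^\perp$: same cardinality, left set $\{|X|+1-i:i\in X_r\}$. A regular multiword with boundary $X$ is a perfect matching of $\{1,\dots,|X|\}$ by edges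 $(i,w,j)$, $w\in T^*$, each from a left to a right endpoint; a multiword may additionally carry a finite multiset of cyclic words and is regular if it carries none. A cowordism $X\to Y$ is a multiword with boundary $Y\otimes X^\perp$; composition glues matching boundary vertices (order-reversingly), concatenating labels along paths and collecting closed cycles as cyclic words; identities consist of $\epsilon$-labelled edges. LL formulas over literals: $P,P^\perp$ combined by $\otimes,\wp$, De Morgan negation; rules Id, Cut, Exchange, $\wp$, $\otimes$ of multiplicative linear logic. With boundaries $[P]$ for literals, $[A\otimes B]=[A]\otimes[B]$, $[A^\perp]=[A]^\perp$, $[A_1,\dots,A_n]=[A_n]\otimes\dots\otimes[A_1]$; a derivation of $\vdash\Gamma$ is interpreted as a multiword with boundary $[\Gamma]$ (Id as the identity, Ex by permuting blocks, $\wp$ trivially, $\otimes$ as the union with blocks arranged as $[\Delta]\otimes[A]\otimes[B]\otimes[\Gamma]$, Cut by gluing the $[A]$ and $[A]^\perp$ blocks as in composition). An LLG $(N'',T,Lex,S')$ has finitely many literals with boundaries, a finite lexicon of pairs $\sigma/\vdash\Gamma$ ($\sigma$ a multiword with boundary $[\Gamma]$), and $S'$ with $[S']$ having one left and one right endpoint; a judgement is derivable if obtained by interpreting an LL derivation from lexicon sequents; its language is the set of labels of single edges of regular $\sigma$ with $\sigma/\vdash S'$ derivable. *)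

theory Defs
  imports Main "HOL-Library.Multiset"
begin

section \<open>Trees and their encoding as words\<close>

datatype 'a ptree = Node 'a "'a ptree list"

inductive_set Tr :: "'a set \<Rightarrow> nat \<Rightarrow> 'a ptree set" for N n where
  "\<lbrakk>a \<in> N; length ts \<le> n; \<forall>t\<in>set ts. t \<in> Tr N n\<rbrakk> \<Longrightarrow> Node a ts \<in> Tr N n"

text \<open>\<open>Sym A i k\<close> is the letter written A with upper index i and lower index k.\<close>

datatype 'a tsym = Sym 'a nat nat

definition tree_alphabet :: "'a set \<Rightarrow> nat \<Rightarrow> 'a tsym set" where
  "tree_alphabet N n = {Sym a i k | a i k. a \<in> N \<and> i \<le> k \<and> k \<le> n}"

primrec encode :: "'a ptree \<Rightarrow> 'a tsym list" where
  "encode (Node a ts) =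
     Sym a 0 (length ts) #
     concat (map (\<lambda>(w, i). w @ [Sym a i (length ts)])
                 (zip (map encode ts) [1..<Suc (length ts)]))"

section \<open>Linear lambda calculus\<close>

datatype 'p lty = Atom 'p | Limp "'p lty" "'p lty"  (infixr \<open>\<multimap>\<close> 60)

text \<open>Terms modulo alpha-equivalence, with de Bruijn indices.\<close>

datatype 'c lterm = Var nat | Const 'c | App "'c lterm" "'c lterm" | Abs "'c lterm"

primrec occ :: "nat \<Rightarrow> 'c lterm \<Rightarrow> nat" where
  "occ x (Var y) = (if x = y then 1 else 0)"
| "occ x (Const c) = 0"
| "occ x (App t s) = occ x t + occ x s"
| "occ x (Abs t) = occ (Suc x) t"

definition fv :: "'c lterm \<Rightarrow> nat set" where
  "fv t = {x. occ x t > 0}"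

primrec linear :: "'c lterm \<Rightarrow> bool" where
  "linear (Var x) \<longleftrightarrow> True"
| "linear (Const c) \<longleftrightarrow> True"
| "linear (App t s) \<longleftrightarrow> linear t \<and> linear s \<and> fv t \<inter> fv s = {}"
| "linear (Abs t) \<longleftrightarrow> linear t \<and> occ 0 t = 1"

primrec lift :: "'c lterm \<Rightarrow> nat \<Rightarrow> 'c lterm" where
  "lift (Var i) k = (if i < k then Var i else Var (Suc i))"
| "lift (Const c) k = Const c"
| "lift (App t s) k = App (lift t k) (lift s k)"
| "lift (Abs t) k = Abs (lift t (Suc k))"

primrec subst :: "'c lterm \<Rightarrow> 'c lterm \<Rightarrow> nat \<Rightarrow> 'c lterm" where
  "subst (Var i) u k = (if k < i then Var (i - 1) else if i = k then u else Var i)"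
| "subst (Const c) u k = Const c"
| "subst (App t s) u k = App (subst t u k) (subst s u k)"
| "subst (Abs t) u k = Abs (subst t (lift u 0) (Suc k))"

inductive red :: "'c lterm \<Rightarrow> 'c lterm \<Rightarrow> bool" where
  beta: "red (App (Abs t) s) (subst t s 0)"
| eta: "red (Abs (App (lift t 0) (Var 0))) t"
| app_left: "red t t' \<Longrightarrow> red (App t s) (App t' s)"
| app_right: "red s s' \<Longrightarrow> red (App t s) (App t s')"
| abs: "red t t' \<Longrightarrow> red (Abs t) (Abs t')"

definition beta_eta_equiv :: "'c lterm \<Rightarrow> 'c lterm \<Rightarrow> bool" where
  "beta_eta_equiv = equivclp (\<lambda>t s. linear t \<and> linear s \<and> red t s)"

section \<open>Linear signatures and abstract categorial grammars\<close>

record ('p, 'c) signature =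
  atoms :: "'p set"
  constants :: "'c set"
  ctype :: "'c \<Rightarrow> 'p lty"

definition types_over :: "('p, 'c) signature \<Rightarrow> 'p lty set" where
  "types_over \<Sigma> = {A. set_lty A \<subseteq> atoms \<Sigma>}"

definition is_signature :: "('p, 'c) signature \<Rightarrow> bool" where
  "is_signature \<Sigma> \<longleftrightarrow> finite (atoms \<Sigma>) \<and> finite (constants \<Sigma>)
     \<and> (\<forall>c\<in>constants \<Sigma>. ctype \<Sigma> c \<in> types_over \<Sigma>)"

type_synonym 'p ctxt = "(nat \<times> 'p lty) list"

text \<open>In rule \<open>abs\<close> the bound variable is index 0, so all other variables of the body are
  shifted by one.\<close>

inductive typed :: "('p, 'c) signature \<Rightarrow> 'p ctxt \<Rightarrow> 'c lterm \<Rightarrow> 'p lty \<Rightarrow> bool"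
  for \<Sigma> where
  var: "A \<in> types_over \<Sigma> \<Longrightarrow> typed \<Sigma> [(x, A)] (Var x) A"
| const: "c \<in> constants \<Sigma> \<Longrightarrow> typed \<Sigma> [] (Const c) (ctype \<Sigma> c)"
| app: "\<lbrakk>typed \<Sigma> \<Gamma> t (A \<multimap> B); typed \<Sigma> \<Delta> s A; fst ` set \<Gamma> \<inter> fst ` set \<Delta> = {}\<rbrakk>
        \<Longrightarrow> typed \<Sigma> (\<Gamma> @ \<Delta>) (App t s) B"
| abs: "typed \<Sigma> (map (apfst Suc) \<Gamma> @ (0, A) # map (apfst Suc) \<Delta>) t B
        \<Longrightarrow> typed \<Sigma> (\<Gamma> @ \<Delta>) (Abs t) (A \<multimap> B)"

primrec map_type :: "('p \<Rightarrow> 'q lty) \<Rightarrow> 'p lty \<Rightarrow> 'q lty" where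
  "map_type f (Atom p) = f p"
| "map_type f (A \<multimap> B) = map_type f A \<multimap> map_type f B"

text \<open>No lifting is needed under binders, since constants are mapped to closed terms.\<close>

primrec map_term :: "('c \<Rightarrow> 'd lterm) \<Rightarrow> 'c lterm \<Rightarrow> 'd lterm" where
  "map_term g (Var x) = Var x"
| "map_term g (Const c) = g c"
| "map_term g (App t s) = App (map_term g t) (map_term g s)"
| "map_term g (Abs t) = Abs (map_term g t)"

definition is_signature_map ::
  "('p, 'c) signature \<Rightarrow> ('q, 'd) signature \<Rightarrow> ('p \<Rightarrow> 'q lty) \<Rightarrow> ('c \<Rightarrow> 'd lterm) \<Rightarrow> bool" where
  "is_signature_map \<Sigma>1 \<Sigma>2 f g \<longleftrightarrow>
     (\<forall>p\<in>atoms \<Sigma>1. f p \<in> types_over \<Sigma>2) \<and>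
     (\<forall>c\<in>constants \<Sigma>1. typed \<Sigma>2 [] (g c) (map_type f (ctype \<Sigma>1 c)))"

record ('p, 'c, 'q, 'd) acg =
  abstr_sig :: "('p, 'c) signature"
  obj_sig :: "('q, 'd) signature"
  type_map :: "'p \<Rightarrow> 'q lty"
  const_map :: "'c \<Rightarrow> 'd lterm"
  start :: 'p

definition is_acg :: "('p, 'c, 'q, 'd) acg \<Rightarrow> bool" where
  "is_acg G \<longleftrightarrow> is_signature (abstr_sig G) \<and> is_signature (obj_sig G)
     \<and> is_signature_map (abstr_sig G) (obj_sig G) (type_map G) (const_map G)
     \<and> start G \<in> atoms (abstr_sig G)"

datatype tree_atom = TreeAtom

definition tree_sig :: "'a set \<Rightarrow> nat \<Rightarrow> (tree_atom, 'a \<times> nat) signature" where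
  "tree_sig N n =
     \<lparr>atoms = {TreeAtom},
      constants = N \<times> {..n},
      ctype = (\<lambda>(a, k). ((\<multimap>) (Atom TreeAtom) ^^ k) (Atom TreeAtom))\<rparr>"

primrec tree_term :: "'a ptree \<Rightarrow> ('a \<times> nat) lterm" where
  "tree_term (Node a ts) = foldl App (Const (a, length ts)) (map tree_term ts)"

definition is_tree_acg :: "'a set \<Rightarrow> nat \<Rightarrow> ('p, 'c, tree_atom, 'a \<times> nat) acg \<Rightarrow> bool" where
  "is_tree_acg N n G \<longleftrightarrow> is_acg G \<and> obj_sig G = tree_sig N n"

definition tree_language ::
  "'a set \<Rightarrow> nat \<Rightarrow> ('p, 'c, tree_atom, 'a \<times> nat) acg \<Rightarrow> 'a ptree set" where
  "tree_language N n G =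
     {\<alpha> \<in> Tr N n. \<exists>t. typed (abstr_sig G) [] t (Atom (start G))
                       \<and> beta_eta_equiv (tree_term \<alpha>) (map_term (const_map G) t)}"

section \<open>Boundaries and multiwords\<close>

datatype boundary = Boundary (bcard: nat) (lefts: "nat set")

definition is_boundary :: "boundary \<Rightarrow> bool" where
  "is_boundary X \<longleftrightarrow> lefts X \<subseteq> {1..bcard X}"

definition rights :: "boundary \<Rightarrow> nat set" where
  "rights X = {1..bcard X} - lefts X"

definition btensor :: "boundary \<Rightarrow> boundary \<Rightarrow> boundary"  (infixr \<open>\<otimes>\<^sub>b\<close> 70) where
  "X \<otimes>\<^sub>b Y = Boundary (bcard X + bcard Y) (lefts X \<union> {bcard X + i | i. i \<in> lefts Y})"

definition bdual :: "boundary \<Rightarrow> boundary" where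
  "bdual X = Boundary (bcard X) {bcard X + 1 - i | i. i \<in> rights X}"

definition cyc_rel :: "'a list \<Rightarrow> 'a list \<Rightarrow> bool" where
  "cyc_rel u v \<longleftrightarrow> (\<exists>x y. u = x @ y \<and> v = y @ x)"

lemma equivp_cyc_rel: "equivp (cyc_rel :: 'a list \<Rightarrow> 'a list \<Rightarrow> bool)"
proof (rule equivpI)
  show "reflp (cyc_rel :: 'a list \<Rightarrow> _)"
    by (auto simp: reflp_def cyc_rel_def)
  show "symp (cyc_rel :: 'a list \<Rightarrow> _)"
    by (auto simp: symp_def cyc_rel_def)
  show "transp (cyc_rel :: 'a list \<Rightarrow> _)"
  proof (rule transpI)
    fix u v w :: "'a list"
    assume "cyc_rel u v" "cyc_rel v w"
    then obtain x y x' y' where u: "u = x @ y" and v: "v = y @ x" "v = x' @ y'" and w: "w = y' @ x'"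
      by (auto simp: cyc_rel_def)
    from v have "y @ x = x' @ y'" by simp
    then obtain z where "y = x' @ z \<and> z @ x = y' \<or> y @ z = x' \<and> x = z @ y'"
      by (auto simp: append_eq_append_conv2)
    then show "cyc_rel u w"
    proof
      assume z: "y = x' @ z \<and> z @ x = y'"
      then have "u = (x @ x') @ z" "w = z @ (x @ x')" using u w by auto
      then show ?thesis unfolding cyc_rel_def by blast
    next
      assume z: "y @ z = x' \<and> x = z @ y'"
      then have "u = z @ (y' @ y)" "w = (y' @ y) @ z" using u w by auto
      then show ?thesis unfolding cyc_rel_def by blast
    qed
  qed
qed

quotient_type 'a cyclic_word = "'a list" / cyc_rel
  by (rule equivp_cyc_rel)

lift_definition cyclic :: "'a list \<Rightarrow> 'a cyclic_word" is "\<lambda>w. w" .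

type_synonym 'a edge = "nat \<times> 'a list \<times> nat"

abbreviation (input) src :: "'a edge \<Rightarrow> nat" where "src e \<equiv> fst e"
abbreviation (input) label :: "'a edge \<Rightarrow> 'a list" where "label e \<equiv> fst (snd e)"
abbreviation (input) tgt :: "'a edge \<Rightarrow> nat" where "tgt e \<equiv> snd (snd e)"

datatype 'a multiword = Multiword (edges: "'a edge set") (cycles: "'a cyclic_word multiset")

definition regular :: "'a multiword \<Rightarrow> bool" where
  "regular \<sigma> \<longleftrightarrow> cycles \<sigma> = {#}"

definition is_multiword :: "'a set \<Rightarrow> boundary \<Rightarrow> 'a multiword \<Rightarrow> bool" where
  "is_multiword T X \<sigma> \<longleftrightarrow>
     (\<forall>e\<in>edges \<sigma>. src e \<in> lefts X \<and> label e \<in> lists T \<and> tgt e \<in> rights X) \<and>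
     (\<forall>v\<in>{1..bcard X}. \<exists>!e. e \<in> edges \<sigma> \<and> (src e = v \<or> tgt e = v)) \<and>
     (\<forall>c\<in>#cycles \<sigma>. \<exists>w\<in>lists T. c = cyclic w)"

definition map_vertices :: "(nat \<Rightarrow> nat) \<Rightarrow> 'a multiword \<Rightarrow> 'a multiword" where
  "map_vertices f \<sigma> = Multiword ((\<lambda>(i, w, j). (f i, w, f j)) ` edges \<sigma>) (cycles \<sigma>)"

definition mw_union :: "'a multiword \<Rightarrow> 'a multiword \<Rightarrow> 'a multiword" where
  "mw_union \<sigma> \<tau> = Multiword (edges \<sigma> \<union> edges \<tau>) (cycles \<sigma> + cycles \<tau>)"

definition mw_id :: "boundary \<Rightarrow> 'a multiword" where
  "mw_id X = Multiword {(i, [], 2 * bcard X + 1 - i) | i. i \<in> lefts (X \<otimes>\<^sub>b bdual X)} {#}"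

text \<open>
  Gluing along a symmetric relation \<open>R\<close> on vertices.  Paths and cycles are lists of
  edges in which the target of each edge is glued to the source of the next one.  A closed cycle
  is a cyclic word of pairwise distinct edges, so that every cycle is counted once.
\<close>

definition glued_paths :: "(nat \<times> nat) set \<Rightarrow> 'a edge set \<Rightarrow> 'a edge list set" where
  "glued_paths R E =
     {es. es \<noteq> [] \<and> set es \<subseteq> E \<and> successively (\<lambda>e e'. (tgt e, src e') \<in> R) es}"

definition glued_edges :: "(nat \<times> nat) set \<Rightarrow> 'a edge set \<Rightarrow> 'a edge set" where
  "glued_edges R E =
     {(src (hd es), concat (map label es), tgt (last es)) | es.
        es \<in> glued_paths R E \<and> src (hd es) \<notin> Field R \<and> tgt (last es) \<notin> Field R}"

definition glued_cycles :: "(nat \<times> nat) set \<Rightarrow> 'a edge set \<Rightarrow> 'a edge cyclic_word set" where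
  "glued_cycles R E =
     {cyclic es | es. es \<in> glued_paths R E \<and> distinct es \<and> (tgt (last es), src (hd es)) \<in> R}"

lift_definition cycle_label :: "'a edge cyclic_word \<Rightarrow> 'a cyclic_word"
  is "\<lambda>es. concat (map label es)"
  by (force simp: cyc_rel_def)

definition glue :: "(nat \<times> nat) set \<Rightarrow> 'a multiword \<Rightarrow> 'a multiword" where
  "glue R \<sigma> =
     Multiword (glued_edges R (edges \<sigma>))
       (cycles \<sigma> + image_mset cycle_label (mset_set (glued_cycles R (edges \<sigma>))))"

text \<open>
  Composition of \<open>\<sigma>\<close> from X to Y, with boundary \<open>Y \<otimes>\<^sub>b bdual X\<close>, and \<open>\<tau>\<close> from Y to Z, with
  boundary \<open>Z \<otimes>\<^sub>b bdual Y\<close>, where \<open>y\<close> and \<open>z\<close> are the cardinalities of Y and Z.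
  The two are first put side by side, with boundary
  \<open>Z \<otimes>\<^sub>b bdual Y \<otimes>\<^sub>b Y \<otimes>\<^sub>b bdual X\<close>; then the i-th vertex of Y is glued to
  the (y + 1 - i)-th vertex of \<open>bdual Y\<close>, and the remaining vertices are renumbered.
\<close>

definition mw_comp :: "nat \<Rightarrow> nat \<Rightarrow> 'a multiword \<Rightarrow> 'a multiword \<Rightarrow> 'a multiword" where
  "mw_comp z y \<tau> \<sigma> =
     map_vertices (\<lambda>p. if p \<le> z then p else p - 2 * y)
       (glue {(p, q). p \<in> {z + 1..z + 2 * y} \<and> q \<in> {z + 1..z + 2 * y}
                      \<and> p + q = 2 * (z + y) + 1}
         (mw_union \<tau> (map_vertices (\<lambda>p. p + (z + y)) \<sigma>)))"

section \<open>Linear logic grammars\<close>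

datatype 'l form =
  Pos 'l | Neg 'l | Tensor "'l form" "'l form"  (infixr \<open>\<otimes>\<^sub>f\<close> 70) | Par "'l form" "'l form"

primrec dual :: "'l form \<Rightarrow> 'l form" where
  "dual (Pos P) = Neg P"
| "dual (Neg P) = Pos P"
| "dual (A \<otimes>\<^sub>f B) = Par (dual A) (dual B)"
| "dual (Par A B) = dual A \<otimes>\<^sub>f dual B"

text \<open>
  \<open>bdual\<close> reverses the order of factors, so the requirement that negation be interpreted by
  \<open>bdual\<close> (lemma \<open>fbound_dual\<close> below) forces the two factors to be swapped for \<open>Par\<close>.
\<close>

primrec fbound :: "('l \<Rightarrow> boundary) \<Rightarrow> 'l form \<Rightarrow> boundary" where
  "fbound I (Pos P) = I P"
| "fbound I (Neg P) = bdual (I P)"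
| "fbound I (A \<otimes>\<^sub>f B) = fbound I A \<otimes>\<^sub>b fbound I B"
| "fbound I (Par A B) = fbound I B \<otimes>\<^sub>b fbound I A"

primrec sbound :: "('l \<Rightarrow> boundary) \<Rightarrow> 'l form list \<Rightarrow> boundary" where
  "sbound I [] = Boundary 0 {}"
| "sbound I (A # \<Gamma>) = sbound I \<Gamma> \<otimes>\<^sub>b fbound I A"

record ('l, 'a) llg =
  literals :: "'l set"
  lit_bound :: "'l \<Rightarrow> boundary"
  alphabet :: "'a set"
  lexicon :: "('a multiword \<times> 'l form list) set"
  llg_start :: 'l

definition forms_over :: "('l, 'a) llg \<Rightarrow> 'l form set" where
  "forms_over G = {A. set_form A \<subseteq> literals G}"

definition is_llg :: "('l, 'a) llg \<Rightarrow> bool" where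
  "is_llg G \<longleftrightarrow> finite (literals G) \<and> finite (alphabet G) \<and> finite (lexicon G)
     \<and> (\<forall>P\<in>literals G. is_boundary (lit_bound G P))
     \<and> (\<forall>(\<sigma>, \<Gamma>)\<in>lexicon G. set \<Gamma> \<subseteq> forms_over G
            \<and> is_multiword (alphabet G) (sbound (lit_bound G) \<Gamma>) \<sigma>)
     \<and> llg_start G \<in> literals G
     \<and> card (lefts (lit_bound G (llg_start G))) = 1
     \<and> card (rights (lit_bound G (llg_start G))) = 1"

abbreviation fcard :: "('l, 'a) llg \<Rightarrow> 'l form \<Rightarrow> nat" where
  "fcard G A \<equiv> bcard (fbound (lit_bound G) A)"

abbreviation scard :: "('l, 'a) llg \<Rightarrow> 'l form list \<Rightarrow> nat" where
  "scard G \<Gamma> \<equiv> bcard (sbound (lit_bound G) \<Gamma>)"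

text \<open>
  \<open>mw_exchange d b a\<close> turns a multiword with consecutive boundary blocks of sizes d, b, a and an
  arbitrary remainder into one with the blocks b and a swapped.
  \<open>mw_tensor d a b \<sigma> \<tau>\<close> puts together \<open>\<sigma>\<close> with blocks A, \<open>\<Gamma>\<close> and \<open>\<tau>\<close> with
  blocks \<open>\<Delta>\<close>, B into a multiword with blocks \<open>\<Delta>\<close>, A, B, \<open>\<Gamma>\<close>, where d, a, b are
  the cardinalities of \<open>\<Delta>\<close>, A, B.
\<close>

definition mw_exchange :: "nat \<Rightarrow> nat \<Rightarrow> nat \<Rightarrow> 'a multiword \<Rightarrow> 'a multiword" where
  "mw_exchange d b a =
     map_vertices (\<lambda>p. if p \<le> d then p
                       else if p \<le> d + b then p + a
                       else if p \<le> d + b + a then p - b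
                       else p)"

definition mw_tensor :: "nat \<Rightarrow> nat \<Rightarrow> nat \<Rightarrow> 'a multiword \<Rightarrow> 'a multiword \<Rightarrow> 'a multiword" where
  "mw_tensor d a b \<sigma> \<tau> =
     mw_union (map_vertices (\<lambda>p. if p \<le> a then p + d else p + d + b) \<sigma>)
              (map_vertices (\<lambda>p. if p \<le> d then p else p + a) \<tau>)"

inductive derivable :: "('l, 'a) llg \<Rightarrow> 'a multiword \<Rightarrow> 'l form list \<Rightarrow> bool" for G where
  Lex: "(\<sigma>, \<Gamma>) \<in> lexicon G \<Longrightarrow> derivable G \<sigma> \<Gamma>"
| Id: "A \<in> forms_over G \<Longrightarrow> derivable G (mw_id (fbound (lit_bound G) A)) [dual A, A]"
| Cut: "\<lbrakk>derivable G \<sigma> (\<Gamma> @ [A]); derivable G \<tau> (dual A # \<Delta>)\<rbrakk>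
        \<Longrightarrow> derivable G (mw_comp (scard G \<Delta>) (fcard G A) \<tau> \<sigma>) (\<Gamma> @ \<Delta>)"
| Ex: "derivable G \<sigma> (\<Gamma> @ [A, B] @ \<Delta>)
        \<Longrightarrow> derivable G (mw_exchange (scard G \<Delta>) (fcard G B) (fcard G A) \<sigma>) (\<Gamma> @ [B, A] @ \<Delta>)"
| Par: "derivable G \<sigma> (\<Gamma> @ [A, B]) \<Longrightarrow> derivable G \<sigma> (\<Gamma> @ [Par A B])"
| Tensor: "\<lbrakk>derivable G \<sigma> (\<Gamma> @ [A]); derivable G \<tau> (B # \<Delta>)\<rbrakk>
        \<Longrightarrow> derivable G (mw_tensor (scard G \<Delta>) (fcard G A) (fcard G B) \<sigma> \<tau>)
              (\<Gamma> @ [A \<otimes>\<^sub>f B] @ \<Delta>)"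

definition llg_language :: "('l, 'a) llg \<Rightarrow> 'a list set" where
  "llg_language G =
     {w. \<exists>\<sigma> i j. derivable G \<sigma> [Pos (llg_start G)] \<and> regular \<sigma> \<and> edges \<sigma> = {(i, w, j)}}"

lemma is_boundary_btensor: "is_boundary X \<Longrightarrow> is_boundary Y \<Longrightarrow> is_boundary (X \<otimes>\<^sub>b Y)"
  by (force simp: is_boundary_def btensor_def)

lemma is_boundary_bdual: "is_boundary (bdual X)"
  by (auto simp: is_boundary_def bdual_def rights_def)

lemma bdual_bdual:
  assumes "is_boundary X"
  shows "bdual (bdual X) = X"
proof -
  have "{bcard X + 1 - i | i. i \<in> {1..bcard X} - {bcard X + 1 - i | i. i \<in> {1..bcard X} - lefts X}}
        = lefts X" (is "?L = _")
  proof (intro equalityI subsetI)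
    fix j assume "j \<in> ?L"
    then obtain i where i: "j = bcard X + 1 - i" "1 \<le> i" "i \<le> bcard X"
      and "i \<notin> {bcard X + 1 - i | i. i \<in> {1..bcard X} - lefts X}" by auto
    then have "i \<noteq> bcard X + 1 - j \<or> j \<notin> {1..bcard X} - lefts X" by blast
    with i show "j \<in> lefts X" by auto
  next
    fix j assume j: "j \<in> lefts X"
    with assms have r: "1 \<le> j" "j \<le> bcard X" by (auto simp: is_boundary_def)
    define i where "i = bcard X + 1 - j"
    have "j = bcard X + 1 - i" "i \<in> {1..bcard X}" using r by (auto simp: i_def)
    moreover have "i \<notin> {bcard X + 1 - i | i. i \<in> {1..bcard X} - lefts X}"
    proof
      assume "i \<in> {bcard X + 1 - i | i. i \<in> {1..bcard X} - lefts X}"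
      then obtain k where "i = bcard X + 1 - k" "1 \<le> k" "k \<le> bcard X" "k \<notin> lefts X" by auto
      moreover from this r have "k = j" by (simp add: i_def)
      ultimately show False using j by simp
    qed
    ultimately show "j \<in> ?L" by blast
  qed
  then show ?thesis by (cases X) (simp add: bdual_def rights_def)
qed

lemma bdual_btensor:
  assumes "is_boundary X" "is_boundary Y"
  shows "bdual (X \<otimes>\<^sub>b Y) = bdual Y \<otimes>\<^sub>b bdual X"
proof -
  let ?x = "bcard X" and ?y = "bcard Y"
  have "rights (X \<otimes>\<^sub>b Y) = rights X \<union> (\<lambda>i. ?x + i) ` rights Y" (is "?L = ?R")
  proof (intro equalityI subsetI)
    fix v assume v: "v \<in> ?L"
    show "v \<in> ?R"
    proof (cases "v \<le> ?x")
      case True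
      with v show ?thesis by (auto simp: rights_def btensor_def)
    next
      case False
      define i where "i = v - ?x"
      have "v = ?x + i" using False by (simp add: i_def)
      moreover from this False v have "i \<in> rights Y" by (auto simp: rights_def btensor_def)
      ultimately show ?thesis by blast
    qed
  next
    fix v assume "v \<in> ?R"
    with assms show "v \<in> ?L" by (fastforce simp: rights_def btensor_def is_boundary_def)
  qed
  moreover have "lefts (bdual Z) = (\<lambda>i. bcard Z + 1 - i) ` rights Z" for Z
    by (auto simp: bdual_def)
  ultimately have *: "lefts (bdual (X \<otimes>\<^sub>b Y)) =
      (\<lambda>i. ?x + ?y + 1 - i) ` rights X \<union> (\<lambda>i. ?x + ?y + 1 - (?x + i)) ` rights Y"
    by (simp add: image_Un image_image) (simp add: btensor_def)
  have "(\<lambda>i. ?x + ?y + 1 - i) ` rights X = (\<lambda>i. ?y + (?x + 1 - i)) ` rights X"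
    by (rule image_cong) (auto simp: rights_def)
  moreover have "(\<lambda>i. ?x + ?y + 1 - (?x + i)) ` rights Y = (\<lambda>i. ?y + 1 - i) ` rights Y"
    by (rule image_cong) auto
  ultimately have "lefts (bdual (X \<otimes>\<^sub>b Y)) = lefts (bdual Y \<otimes>\<^sub>b bdual X)"
    unfolding * by (auto simp: bdual_def btensor_def)
  then show ?thesis by (simp add: bdual_def btensor_def)
qed

lemma is_boundary_fbound:
  "(\<And>P. P \<in> set_form A \<Longrightarrow> is_boundary (I P)) \<Longrightarrow> is_boundary (fbound I A)"
  by (induction A) (auto intro: is_boundary_btensor is_boundary_bdual)

lemma fbound_dual:
  "(\<And>P. P \<in> set_form A \<Longrightarrow> is_boundary (I P)) \<Longrightarrow> fbound I (dual A) = bdual (fbound I A)"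
  by (induction A) (simp_all add: bdual_bdual bdual_btensor is_boundary_fbound)

end

theory Submission
  imports Defs
begin

text \<open>
  A constant of the abstract signature of type A becomes a lexicon entry for the formula obtained
  by reading \<open>A \<multimap> B\<close> as \<open>Par (dual A) B\<close>, with as multiword the geometric reading of the
  \<open>\<beta>\<eta>\<close>-class of its image, where the tree constructor \<open>A\<^sub>k\<close> is the bundle of k + 1 edges that walk
  around its children.  Multiwords are handled through names: a vertex numbering is replaced by a
  list of distinct names, gluing becomes union followed by hiding of names, and at the type of
  trees a correct net is a single path spelling the encoding of a tree.  A logical relation indexed
  by types, in which application is union of nets, links nets to closed terms; every typed term
  then yields a derivation whose multiword is related to it.

  Conversely, a derivation may use cuts, tensors and the law of double negation, and so need not come
  from a term directly.  Its sequent is therefore interpreted in a phase semantics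
  whose pole consists of the nets with typed hypotheses and exactly one typed conclusion that are
  related to some typed term.  Soundness, tested against the conclusion \<open>A\<close>, returns a typed term of
  type \<open>A\<close> related to the multiword.  If the start symbol is not sent to the type of trees,
  subject reduction shows that the tree language is empty.
\<close>

section \<open>Linear lambda terms\<close>

text \<open>The construction is run twice. On the tree signature itself, with the identity
  translation and the explicit multiwords of the tree constructors as lexicon, it turns every typed
  object term into a multiword; these multiwords are then the lexicon for the given grammar. For
  this reason the logical relation is an assumption on the lexicon rather than tied to one.

  Hiding introduces bound names: the names of a cut formula disappear, while a net used as argument
  may contain them by accident. Hence the relation is shown invariant under permutations of names,
  and hiding is treated like alpha-conversion. Gluing may also close cycles; a net that completes to
  a simple path has no closed walk, so composition is only claimed to preserve paths.

  Linearity gives a one-step diamond, hence unique normal forms without a termination argument. The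
  boundary of a start symbol must have one left and one right endpoint, which forces the case split
  on its image. In the degenerate case the witness has no lexicon, and a signed count of literals
  shows that its start sequent is underivable.\<close>

lemma lift_lift: "i < Suc k \<Longrightarrow> lift (lift t i) (Suc k) = lift (lift t k) i"
  by (induction t arbitrary: i k) auto

lemma lift_subst:
  "j < Suc i \<Longrightarrow> lift (subst t s j) i = subst (lift t (Suc i)) (lift s i) j"
  by (induction t arbitrary: i j s)
    (simp_all add: diff_Suc lift_lift split: nat.split)

lemma lift_subst_less:
  "i < Suc j \<Longrightarrow> lift (subst t s j) i = subst (lift t i) (lift s i) (Suc j)"
  by (induction t arbitrary: i j s) (auto simp: lift_lift)

lemma subst_lift: "subst (lift t k) s k = t"
  by (induction t arbitrary: k s) simp_all

lemma subst_subst: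
  "i < Suc j \<Longrightarrow> subst (subst t (lift v i) (Suc j)) (subst u v j) i = subst (subst t u i) v j"
  by (induction t arbitrary: i j u v)
    (simp_all add: diff_Suc subst_lift lift_lift[symmetric] lift_subst_less split: nat.split)

lemma occ_lift: "occ x (lift t k) = (if x < k then occ x t else if x = k then 0 else occ (x - 1) t)"
  by (induction t arbitrary: x k) (auto split: if_splits)

lemma occ_subst:
  "occ x (subst t s k) = (if x < k then occ x t else occ (Suc x) t) + occ k t * occ x s"
  by (induction t arbitrary: x k s) (auto simp: occ_lift algebra_simps)

text \<open>Substitution at an absent index only closes the gap at \<open>k\<close>, and lifting
  reopens it.\<close>

lemma lift_subst_notin: "occ k t = 0 \<Longrightarrow> lift (subst t u k) k = t"
  by (induction t arbitrary: k u) (auto split: if_splits)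

lemma subst_notin: "occ k t = 0 \<Longrightarrow> subst t s k = subst t s' k"
  by (induction t arbitrary: k s s') (auto split: if_splits)

lemma linear_lift: "linear (lift t k) = linear t"
proof (induction t arbitrary: k)
  case (App t s)
  have "fv (lift t k) \<inter> fv (lift s k) = {} \<longleftrightarrow> fv t \<inter> fv s = {}"
  proof
    assume *: "fv (lift t k) \<inter> fv (lift s k) = {}"
    show "fv t \<inter> fv s = {}"
    proof (rule equals0I)
      fix x assume "x \<in> fv t \<inter> fv s"
      then have "(if x < k then x else Suc x) \<in> fv (lift t k) \<inter> fv (lift s k)"
        by (auto simp: fv_def occ_lift)
      with * show False by blast
    qed
  next
    assume *: "fv t \<inter> fv s = {}"
    show "fv (lift t k) \<inter> fv (lift s k) = {}"
    proof (rule equals0I)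
      fix x assume "x \<in> fv (lift t k) \<inter> fv (lift s k)"
      then have "(if x < k then x else x - 1) \<in> fv t \<inter> fv s"
        by (auto simp: fv_def occ_lift split: if_splits)
      with * show False by blast
    qed
  qed
  with App show ?case by simp
qed (auto simp: occ_lift)

lemma linear_occ_le: "linear t \<Longrightarrow> occ x t \<le> 1"
proof (induction t arbitrary: x)
  case (App t s)
  then have "occ x t \<le> 1" "occ x s \<le> 1" "occ x t = 0 \<or> occ x s = 0" by (auto simp: fv_def)
  then show ?case by auto
qed auto

lemma linear_App_iff:
  "linear (App t s) \<longleftrightarrow> linear t \<and> linear s \<and> (\<forall>x. occ x t + occ x s \<le> 1)"
proof -
  have "fv t \<inter> fv s = {} \<longleftrightarrow> (\<forall>x. occ x t + occ x s \<le> 1)" if "linear t" "linear s"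
    using linear_occ_le[OF that(1)] linear_occ_le[OF that(2)]
    by (auto simp: fv_def disjoint_iff)
      (metis One_nat_def add_cancel_right_left add_cancel_right_right not_gr_zero,
       metis add_le_cancel_left le_zero_eq One_nat_def Suc_leI le_trans add_gr_0)
  then show ?thesis by auto
qed

text \<open>The occurrence bound is imposed on the result: it is what an application needs in order
  to have parts without common variables, and it passes down through the induction.\<close>

lemma linear_subst:
  "linear t \<Longrightarrow> linear s \<Longrightarrow> (\<And>x. occ x (subst t s k) \<le> 1) \<Longrightarrow> linear (subst t s k)"
proof (induction t arbitrary: k s)
  case (App t1 t2)
  have *: "occ x (subst t1 s k) + occ x (subst t2 s k) \<le> 1" for x using App.prems(3)[of x] by simp
  have "linear (subst t1 s k)" using App.prems App.IH(1)[of s k] *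
    by (metis add_leD1 linear.simps(3))
  moreover have "linear (subst t2 s k)" using App.prems App.IH(2)[of s k] *
    by (metis add_leD2 linear.simps(3))
  ultimately show ?case using * by (simp del: linear.simps add: linear_App_iff)
next
  case (Abs t)
  have "occ x (subst t (lift s 0) (Suc k)) \<le> 1" for x
  proof (cases x)
    case 0
    with Abs show ?thesis by (simp add: occ_subst occ_lift)
  next
    case (Suc y)
    with Abs.prems(3)[of y] show ?thesis by simp
  qed
  with Abs show ?case by (auto simp: linear_lift occ_subst occ_lift)
qed auto

section \<open>Reduction of linear terms under substitution and lifting\<close>

lemma red_occ: "red t t' \<Longrightarrow> linear t \<Longrightarrow> occ x t' = occ x t"
  by (induction arbitrary: x rule: red.induct) (auto simp: occ_subst occ_lift)

text \<open>Reduction never creates free variables, whatever the term; this is what inverts a lift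
  below.\<close>

lemma red_occ_zero: "red t t' \<Longrightarrow> occ x t = 0 \<Longrightarrow> occ x t' = 0"
  by (induction arbitrary: x rule: red.induct) (auto simp: occ_subst occ_lift)

lemma red_linear: "red t t' \<Longrightarrow> linear t \<Longrightarrow> linear t'"
proof (induction rule: red.induct)
  case (beta t s)
  then have "linear (App (Abs t) s)" by simp
  then have "\<And>x. occ (Suc x) t + occ x s \<le> 1" unfolding linear_App_iff by simp
  with beta show ?case by (intro linear_subst) (auto simp: occ_subst)
next
  case (eta t)
  then show ?case by (simp add: linear_lift)
next
  case (app_left t t' s)
  then show ?case by (simp del: linear.simps add: linear_App_iff red_occ)
next
  case (app_right s s' t)
  then show ?case by (simp del: linear.simps add: linear_App_iff red_occ)
next
  case (abs t t')
  then show ?case by (simp add: red_occ)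
qed

lemma red_subst_left: "red t t' \<Longrightarrow> red (subst t s k) (subst t' s k)"
proof (induction arbitrary: s k rule: red.induct)
  case (beta t u)
  have "red (App (Abs (subst t (lift s 0) (Suc k))) (subst u s k))
     (subst (subst t (lift s 0) (Suc k)) (subst u s k) 0)"
    by (rule red.beta)
  then show ?case by (simp add: subst_subst)
next
  case (eta t)
  then show ?case using red.eta[of "subst t s k"] by (simp add: lift_subst_less)
qed (auto intro: red.intros)

lemma red_lift: "red t t' \<Longrightarrow> red (lift t k) (lift t' k)"
proof (induction arbitrary: k rule: red.induct)
  case (beta t s)
  then show ?case using red.beta[of "lift t (Suc k)" "lift s k"] by (simp add: lift_subst)
next
  case (eta t)
  then show ?case using red.eta[of "lift t k"] by (simp add: lift_lift)
qed (auto intro: red.intros)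

text \<open>One occurrence of \<open>k\<close> turns a step of \<open>s\<close> into exactly one
  step; several occurrences would take several, and none would take zero.\<close>

lemma red_subst_right: "red s s' \<Longrightarrow> occ k t = 1 \<Longrightarrow> red (subst t s k) (subst t s' k)"
proof (induction t arbitrary: s s' k)
  case (Var x)
  then show ?case by (simp split: if_splits)
next
  case (App t1 t2)
  then have "occ k t1 = 1 \<and> occ k t2 = 0 \<or> occ k t1 = 0 \<and> occ k t2 = 1" by auto
  then show ?case
  proof
    assume "occ k t1 = 1 \<and> occ k t2 = 0"
    with App subst_notin[of k t2 s s'] show ?thesis by (auto intro: red.intros)
  next
    assume "occ k t1 = 0 \<and> occ k t2 = 1"
    with App subst_notin[of k t1 s s'] show ?thesis by (auto intro: red.intros)
  qed
next
  case (Abs t)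
  then show ?case by (auto intro!: red.abs red_lift)
qed simp

text \<open>Substituting for the absent index \<open>k\<close> removes the lift from both sides, and
  the reduct has no \<open>k\<close> either, so it is again a lift.\<close>

lemma red_lift_inv: "red (lift t k) q \<Longrightarrow> \<exists>t'. q = lift t' k \<and> red t t'"
  using red_subst_left[of "lift t k" q _ k] red_occ_zero[of "lift t k" q k]
  by (metis lift_subst_notin occ_lift order_less_irrefl subst_lift)

lemma lift_inject: "lift t k = lift s k \<Longrightarrow> t = s"
  by (metis subst_lift)

section \<open>The one-step diamond and unique normal forms\<close>

inductive_cases red_VarE: "red (Var x) t"
inductive_cases red_ConstE: "red (Const c) t"
inductive_cases red_AppE: "red (App t s) u"
inductive_cases red_AbsE: "red (Abs t) u"

lemma red_App_iff:
  "red (App t s) u \<longleftrightarrow> (\<exists>b. t = Abs b \<and> u = subst b s 0) \<or> (\<exists>t'. red t t' \<and> u = App t' s)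
     \<or> (\<exists>s'. red s s' \<and> u = App t s')"
  by (blast elim: red_AppE intro: red.intros)

lemma red_Abs_iff:
  "red (Abs t) u \<longleftrightarrow> t = App (lift u 0) (Var 0) \<or> (\<exists>t'. red t t' \<and> u = Abs t')"
  by (blast elim: red_AbsE intro: red.intros)

lemma subst_lift_Suc: "subst (lift b (Suc k)) (Var k) k = b"
  by (induction b arbitrary: k) auto

text \<open>A redex of a linear term has at most one residual, so one step on each side always suffices.\<close>

lemma red_eta_diamond:
  assumes "red (Abs (App (lift t 0) (Var 0))) w"
  shows "t = w \<or> (\<exists>x. red t x \<and> red w x)"
proof -
  from assms consider "lift t 0 = lift w 0"
    | b where "lift t 0 = Abs b" "w = Abs (subst b (Var 0) 0)"
    | r where "red (lift t 0) r" "w = Abs (App r (Var 0))"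
    unfolding red_Abs_iff red_App_iff by (auto elim: red_VarE)
  then show ?thesis
  proof cases
    case 1
    then show ?thesis using lift_inject by blast
  next
    case 2
    then obtain b' where "t = Abs b'" "b = lift b' (Suc 0)" by (cases t) (auto split: if_splits)
    with 2 show ?thesis by (simp add: subst_lift_Suc)
  next
    case 3
    then obtain t' where "r = lift t' 0" "red t t'" using red_lift_inv by blast
    with 3 show ?thesis using red.eta by blast
  qed
qed

lemma red_beta_diamond:
  assumes "red (App (Abs b) s) w" "occ 0 b = 1"
  shows "subst b s 0 = w \<or> (\<exists>x. red (subst b s 0) x \<and> red w x)"
proof -
  from assms(1) consider "w = subst b s 0"
    | t' where "b = App (lift t' 0) (Var 0)" "w = App t' s"
    | b' where "red b b'" "w = App (Abs b') s"
    | s' where "red s s'" "w = App (Abs b) s'"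
    unfolding red_App_iff[of "Abs b"] red_Abs_iff by blast
  then show ?thesis
  proof cases
    \<comment> \<open>The abstraction is also an eta-redex here; contracting either redex gives
      \<open>App t' s\<close>.\<close>
    case 2
    then show ?thesis by (simp add: subst_lift)
  next
    case 3
    then show ?thesis using red.beta red_subst_left by blast
  next
    case 4
    then show ?thesis using red.beta red_subst_right assms(2) by blast
  qed simp
qed

lemma red_diamond:
  "red u v \<Longrightarrow> red u w \<Longrightarrow> linear u \<Longrightarrow> v = w \<or> (\<exists>x. red v x \<and> red w x)"
proof (induction arbitrary: w rule: red.induct)
  case (beta b s)
  then show ?case using red_beta_diamond by auto
next
  case (eta t)
  then show ?case using red_eta_diamond by blast
next
  case (app_left t t' s)
  from app_left.prems(1) consider b where "t = Abs b" "w = subst b s 0"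
    | t'' where "red t t''" "w = App t'' s" | s' where "red s s'" "w = App t s'"
    unfolding red_App_iff by blast
  then show ?case
  proof cases
    case 1
    then show ?thesis using red_beta_diamond[of b s "App t' s"] app_left red.app_left by fastforce
  next
    case 2
    then show ?thesis using app_left by (auto intro: red.intros)
  next
    case 3
    then show ?thesis using app_left by (blast intro: red.intros)
  qed
next
  case (app_right s s' t)
  from app_right.prems(1) consider b where "t = Abs b" "w = subst b s 0"
    | t' where "red t t'" "w = App t' s" | s'' where "red s s''" "w = App t s''"
    unfolding red_App_iff by blast
  then show ?case
  proof cases
    case 1
    then show ?thesis using red_beta_diamond[of b s "App t s'"] app_right red.app_right by fastforce
  next
    case 2
    then show ?thesis using app_right by (blast intro: red.intros)
  next
    case 3
    then show ?thesis using app_right by (auto intro: red.intros)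
  qed
next
  case (abs t t')
  from abs.prems(1) consider "t = App (lift w 0) (Var 0)" | t'' where "red t t''" "w = Abs t''"
    unfolding red_Abs_iff by blast
  then show ?case
  proof cases
    \<comment> \<open>The competing step is the eta contraction of the whole abstraction, so the eta
      diamond is applied with the two reducts exchanged.\<close>
    case 1
    then show ?thesis using red_eta_diamond[of w "Abs t'"] abs red.abs by blast
  next
    case 2
    then show ?thesis using abs by (auto intro: red.intros)
  qed
qed

text \<open>The diamond closes with at most one step on each side, so the reduction to
  \<open>n\<close> is pushed past a competing step one tile at a time.\<close>

lemma red_normal_form_step:
  "red\<^sup>*\<^sup>* u n \<Longrightarrow> linear u \<Longrightarrow> (\<And>x. \<not> red n x) \<Longrightarrow> red u w \<Longrightarrow> red\<^sup>*\<^sup>* w n"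
proof (induction arbitrary: w rule: converse_rtranclp_induct)
  case base
  then show ?case by blast
next
  case (step u v)
  from red_diamond[OF step(1) step.prems(3,1)] show ?case
  proof
    assume "v = w"
    with step show ?thesis by simp
  next
    assume "\<exists>x. red v x \<and> red w x"
    then obtain x where x: "red v x" "red w x" by blast
    then have "red\<^sup>*\<^sup>* x n" using step red_linear by blast
    with x show ?thesis by (meson converse_rtranclp_into_rtranclp)
  qed
qed

text \<open>Every term on the zigzag of an equivalence reduces to the normal form: a step traversed
  backwards is prepended, a step traversed forwards is absorbed by the previous lemma.\<close>

lemma equiv_normal_form:
  assumes "beta_eta_equiv n u" "\<And>x. \<not> red n x"
  shows "red\<^sup>*\<^sup>* u n"
  using assms(1) unfolding beta_eta_equiv_def
proof (induction rule: equivclp_induct)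
  case base
  then show ?case by simp
next
  case (step y z)
  then show ?case using red_normal_form_step[of y n z] assms(2)
    by (meson converse_rtranclp_into_rtranclp)
qed

section \<open>Equivalence as a congruence on closed linear terms\<close>

lemma beta_eta_equiv_refl: "beta_eta_equiv t t"
  by (simp add: beta_eta_equiv_def)

lemma beta_eta_equiv_sym: "beta_eta_equiv t s \<Longrightarrow> beta_eta_equiv s t"
  by (simp add: beta_eta_equiv_def equivclp_sym)

lemma beta_eta_equiv_trans: "beta_eta_equiv t s \<Longrightarrow> beta_eta_equiv s u \<Longrightarrow> beta_eta_equiv t u"
  by (auto simp: beta_eta_equiv_def intro: equivclp_trans)

definition closed_linear :: "'c lterm \<Rightarrow> bool" where
  "closed_linear t \<longleftrightarrow> linear t \<and> (\<forall>x. occ x t = 0)"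

lemma closed_linear_App: "closed_linear t \<Longrightarrow> closed_linear s \<Longrightarrow> closed_linear (App t s)"
  by (simp add: closed_linear_def fv_def)

lemma red_closed_linear: "linear t \<Longrightarrow> linear s \<Longrightarrow> red t s \<Longrightarrow> closed_linear t = closed_linear s"
  using red_occ by (fastforce simp: closed_linear_def)

lemma red_imp_equiv: "red t s \<Longrightarrow> linear t \<Longrightarrow> beta_eta_equiv t s"
  unfolding beta_eta_equiv_def by (rule r_into_equivclp) (simp add: red_linear)

text \<open>\<open>beta_eta_equiv\<close> runs through linear terms only, so every intermediate
  application must be linear. Closedness, which linear steps preserve in both directions, secures
  this.\<close>

lemma beta_eta_equiv_App_left:
  assumes "beta_eta_equiv t t'" "closed_linear t" "closed_linear s"
  shows "beta_eta_equiv (App t s) (App t' s)"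
proof -
  have "closed_linear t' \<and> beta_eta_equiv (App t s) (App t' s)"
    using assms(1)[unfolded beta_eta_equiv_def]
  proof (induction rule: equivclp_induct)
    case base
    then show ?case using assms by (simp add: beta_eta_equiv_refl)
  next
    case (step y z)
    then have cl: "closed_linear z" using red_closed_linear by blast
    then have "linear (App y s)" "linear (App z s)"
      using step assms(3) closed_linear_App by (auto simp: closed_linear_def fv_def)
    then have "beta_eta_equiv (App y s) (App z s)"
      using step(2) red.app_left[of _ _ s] red_imp_equiv beta_eta_equiv_sym by blast
    with step cl show ?case using beta_eta_equiv_trans by blast
  qed
  then show ?thesis ..
qed

lemma beta_eta_equiv_App_right:
  assumes "beta_eta_equiv s s'" "closed_linear t" "closed_linear s"
  shows "beta_eta_equiv (App t s) (App t s')"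
proof -
  have "closed_linear s' \<and> beta_eta_equiv (App t s) (App t s')"
    using assms(1)[unfolded beta_eta_equiv_def]
  proof (induction rule: equivclp_induct)
    case base
    then show ?case using assms by (simp add: beta_eta_equiv_refl)
  next
    case (step y z)
    then have cl: "closed_linear z" using red_closed_linear by blast
    then have "linear (App t y)" "linear (App t z)"
      using step assms(2) closed_linear_App by (auto simp: closed_linear_def fv_def)
    then have "beta_eta_equiv (App t y) (App t z)"
      using step(2) red.app_right[of _ _ t] red_imp_equiv beta_eta_equiv_sym by blast
    with step cl show ?case using beta_eta_equiv_trans by blast
  qed
  then show ?thesis ..
qed

text \<open>Simultaneous substitution of \<open>v (i - k)\<close> for every free index
  \<open>i\<close> from \<open>k\<close> on, leaving the \<open>k\<close> innermost binders alone.
  It is used with closed values, which need no lifting.\<close>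

primrec inst :: "nat \<Rightarrow> (nat \<Rightarrow> 'c lterm) \<Rightarrow> 'c lterm \<Rightarrow> 'c lterm" where
  "inst k v (Var i) = (if i < k then Var i else v (i - k))"
| "inst k v (Const c) = Const c"
| "inst k v (App t s) = App (inst k v t) (inst k v s)"
| "inst k v (Abs t) = Abs (inst (Suc k) v t)"

lemma lift_absent: "(\<And>x. x \<ge> k \<Longrightarrow> occ x t = 0) \<Longrightarrow> lift t k = t"
proof (induction t arbitrary: k)
  case (Var x)
  from Var[of x] show ?case by (cases "x < k") auto
next
  case (Abs t)
  have "occ x t = 0" if "x \<ge> Suc k" for x using Abs.prems[of "x - 1"] that by (cases x) auto
  with Abs show ?case by simp
qed auto

lemma subst_absent: "(\<And>x. x \<ge> k \<Longrightarrow> occ x t = 0) \<Longrightarrow> subst t s k = t"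
  using lift_absent[of k t] subst_lift[of t k s] by simp

lemma closed_lift: "closed_linear t \<Longrightarrow> lift t k = t"
  by (simp add: closed_linear_def lift_absent)

lemma closed_subst: "closed_linear t \<Longrightarrow> subst t s k = t"
  by (simp add: closed_linear_def subst_absent)

text \<open>Links beta steps to environments: for \<open>k = 0\<close>, contracting an instantiated
  abstraction applied to \<open>w\<close> extends the environment by \<open>w\<close> at index
  0.\<close>

lemma subst_inst:
  assumes "\<And>x. closed_linear (v x)" "closed_linear w"
  shows "subst (inst (Suc k) v t) w k = inst k (case_nat w v) t"
  using assms
proof (induction t arbitrary: k)
  case (Var i)
  then show ?case by (cases "i - k") (auto simp: closed_subst diff_Suc)
qed (auto simp: closed_lift)

lemma inst_absent: "(\<And>x. x \<ge> k \<Longrightarrow> occ x t = 0) \<Longrightarrow> inst k v t = t"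
proof (induction t arbitrary: k)
  case (Var x)
  from Var[of x] show ?case by (cases "x < k") auto
next
  case (Abs t)
  have "occ x t = 0" if "x \<ge> Suc k" for x using Abs.prems[of "x - 1"] that by (cases x) auto
  with Abs show ?case by simp
qed auto

lemma occ_inst:
  "(\<And>x. closed_linear (v x)) \<Longrightarrow> occ x (inst k v t) = (if x < k then occ x t else 0)"
  by (induction t arbitrary: x k) (auto simp: closed_linear_def)

lemma linear_inst:
  "linear t \<Longrightarrow> (\<And>x. closed_linear (v x)) \<Longrightarrow> linear (inst k v t)"
proof (induction t arbitrary: k)
  case (Var x)
  then show ?case by (simp add: closed_linear_def)
next
  case (App t s)
  then show ?case by (auto simp: fv_def occ_inst disjoint_iff)
next
  case (Abs t)
  then show ?case by (simp add: occ_inst)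
qed simp

lemma closed_linear_inst:
  "linear t \<Longrightarrow> (\<And>x. closed_linear (v x)) \<Longrightarrow> closed_linear (inst 0 v t)"
  by (simp add: closed_linear_def linear_inst) (simp add: occ_inst closed_linear_def)

text \<open>Contexts name variables by arbitrary numbers, while an abstraction binds index 0; a
  renaming moves a variable there before it is abstracted.\<close>

primrec rename :: "(nat \<Rightarrow> nat) \<Rightarrow> 'c lterm \<Rightarrow> 'c lterm" where
  "rename \<rho> (Var i) = Var (\<rho> i)"
| "rename \<rho> (Const c) = Const c"
| "rename \<rho> (App t s) = App (rename \<rho> t) (rename \<rho> s)"
| "rename \<rho> (Abs t) = Abs (rename (case_nat 0 (Suc \<circ> \<rho>)) t)"

lemma rename_absent: "(\<And>x. occ x t > 0 \<Longrightarrow> \<rho> x = x) \<Longrightarrow> rename \<rho> t = t"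
proof (induction t arbitrary: \<rho>)
  case (Abs t)
  have "case_nat 0 (Suc \<circ> \<rho>) x = x" if "occ x t > 0" for x
    using that Abs.prems[of "x - 1"] by (cases x) auto
  with Abs show ?case by simp
qed auto

lemma inst_rename:
  "(\<And>i. i < k \<Longrightarrow> \<rho> i = i) \<Longrightarrow> (\<And>i. i \<ge> k \<Longrightarrow> \<rho> i \<ge> k \<and> v (\<rho> i - k) = v' (i - k)) \<Longrightarrow>
   inst k v (rename \<rho> t) = inst k v' t"
proof (induction t arbitrary: k \<rho>)
  case (Var x)
  from Var.prems(1)[of x] Var.prems(2)[of x] show ?case by (cases "x < k") auto
next
  case (Abs t)
  have "case_nat 0 (Suc \<circ> \<rho>) i = i" if "i < Suc k" for i
    using that Abs.prems(1) by (cases i) auto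
  moreover have "case_nat 0 (Suc \<circ> \<rho>) i \<ge> Suc k \<and> v (case_nat 0 (Suc \<circ> \<rho>) i - Suc k) = v' (i - Suc k)"
    if "i \<ge> Suc k" for i
    using that Abs.prems(2)[of "i - 1"] by (cases i) auto
  ultimately show ?case using Abs.IH by simp
qed auto

lemma map_term_rename:
  "(\<And>c. c \<in> set_lterm t \<Longrightarrow> closed_linear (g c)) \<Longrightarrow>
   map_term g (rename \<rho> t) = rename \<rho> (map_term g t)"
proof (induction t arbitrary: \<rho>)
  case (Const c)
  then show ?case using rename_absent[of "g c" \<rho>] by (simp add: closed_linear_def)
qed auto

text \<open>A context lists exactly the free variables and each of them occurs once. Hence the
  disjointness demanded by the application rule is disjointness of free variables, which makes typed
  terms linear.\<close>

lemma typed_facts: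
  "typed \<Sigma> \<Gamma> t A \<Longrightarrow> linear t \<and> (\<forall>x. occ x t = (if x \<in> fst ` set \<Gamma> then 1 else 0))
     \<and> distinct (map fst \<Gamma>) \<and> set_lterm t \<subseteq> constants \<Sigma> \<and> snd ` set \<Gamma> \<subseteq> types_over \<Sigma>"
proof (induction rule: typed.induct)
  case (app \<Gamma> t A B \<Delta> s)
  then have "fv t \<inter> fv s = {}" by (auto simp: fv_def disjoint_iff split: if_splits)
  with app show ?case by auto
next
  case (abs \<Gamma> A \<Delta> t B)
  let ?L = "map (apfst Suc) \<Gamma> @ (0, A) # map (apfst Suc) \<Delta>"
  have "occ 0 t = 1" using abs by auto
  moreover have "occ (Suc x) t = (if x \<in> fst ` set (\<Gamma> @ \<Delta>) then 1 else 0)" for x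
  proof -
    have "Suc x \<in> fst ` set ?L \<longleftrightarrow> x \<in> fst ` set (\<Gamma> @ \<Delta>)"
      by (auto simp: image_iff Bex_def)
    with abs show ?thesis by (simp del: set_append)
  qed
  moreover have "distinct (map fst (\<Gamma> @ \<Delta>))"
  proof -
    have "map fst (map (apfst Suc) l) = map Suc (map fst l)" for l :: "(nat \<times> 'a lty) list" by simp
    then have "distinct (map Suc (map fst (\<Gamma> @ \<Delta>)))" using abs by auto
    then show ?thesis unfolding distinct_map[of Suc] by blast
  qed
  moreover have "snd ` set (\<Gamma> @ \<Delta>) \<subseteq> snd ` set ?L" by force
  then have "snd ` set (\<Gamma> @ \<Delta>) \<subseteq> types_over \<Sigma>" using abs.IH by blast
  ultimately show ?case using abs.IH by (simp del: set_append)
qed auto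

lemma typed_rename:
  "typed \<Sigma> \<Gamma> t A \<Longrightarrow> inj \<rho> \<Longrightarrow> typed \<Sigma> (map (apfst \<rho>) \<Gamma>) (rename \<rho> t) A"
proof (induction arbitrary: \<rho> rule: typed.induct)
  case (var A x)
  then show ?case by (simp add: typed.var)
next
  case (const c)
  then show ?case by (simp add: typed.const)
next
  case (app \<Gamma> t A B \<Delta> s)
  have "fst ` set (map (apfst \<rho>) l) = \<rho> ` fst ` set l" for l :: "(nat \<times> 'a lty) list"
    by (simp add: image_image)
  then have "fst ` set (map (apfst \<rho>) \<Gamma>) \<inter> fst ` set (map (apfst \<rho>) \<Delta>) = {}"
    using app.hyps(3) image_Int[OF app.prems] by (metis image_empty)
  from typed.app[OF app.IH(1)[OF app.prems] app.IH(2)[OF app.prems] this]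
  show ?case by simp
next
  case (abs \<Gamma> A \<Delta> t B)
  let ?\<rho> = "case_nat 0 (Suc \<circ> \<rho>)"
  have inj: "inj ?\<rho>"
  proof (rule injI)
    fix x y assume "?\<rho> x = ?\<rho> y"
    then show "x = y" using abs.prems by (cases x; cases y) (auto dest: injD)
  qed
  have eq: "map (apfst ?\<rho>) (map (apfst Suc) l) = map (apfst Suc) (map (apfst \<rho>) l)"
    for l :: "(nat \<times> 'a lty) list" by auto
  have "typed \<Sigma> (map (apfst Suc) (map (apfst \<rho>) \<Gamma>) @ (0, A) # map (apfst Suc) (map (apfst \<rho>) \<Delta>))
      (rename ?\<rho> t) B"
    using abs.IH[OF inj] unfolding map_append list.map eq by simp
  from typed.abs[OF this] show ?case by simp
qed

section \<open>Nets and simple paths\<close>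

definition verts :: "'a edge set \<Rightarrow> nat set" where
  "verts E = fst ` E \<union> (\<lambda>e. tgt e) ` E"

lemma verts_Un [simp]: "verts (E \<union> F) = verts E \<union> verts F"
  by (auto simp: verts_def)

lemma verts_empty [simp]: "verts {} = {}"
  by (simp add: verts_def)

lemma verts_UN: "verts (\<Union>x\<in>I. F x) = (\<Union>x\<in>I. verts (F x))"
  by (auto simp: verts_def)

lemma verts_insert: "verts (insert e E) = {src e, tgt e} \<union> verts E"
  by (auto simp: verts_def)

lemma src_in_verts: "e \<in> E \<Longrightarrow> src e \<in> verts E"
  by (auto simp: verts_def)

lemma tgt_in_verts: "e \<in> E \<Longrightarrow> tgt e \<in> verts E"
  by (auto simp: verts_def)

fun trail :: "'a edge list \<Rightarrow> nat \<Rightarrow> nat \<Rightarrow> bool" where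
  "trail [] a b \<longleftrightarrow> a = b"
| "trail (e # es) a b \<longleftrightarrow> src e = a \<and> trail es (tgt e) b"

lemma trail_append: "trail (es @ fs) a c \<longleftrightarrow> (\<exists>b. trail es a b \<and> trail fs b c)"
  by (induction es arbitrary: a) auto

text \<open>All of \<open>E\<close> is used and no vertex is met twice, so stray edges, loops and
  cycles are excluded. The empty net is a path from a vertex to itself. Excluding 0 sharpens
  \<open>verts E \<subseteq> insert 0 S\<close> to \<open>verts E \<subseteq> S\<close>.\<close>

definition path_net :: "'a edge set \<Rightarrow> nat \<Rightarrow> 'a list \<Rightarrow> nat \<Rightarrow> bool" where
  "path_net E a w b \<longleftrightarrow> 0 \<notin> verts E \<and> (\<exists>es. trail es a b \<and> distinct (a # map (\<lambda>e. tgt e) es) \<and> set es = E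
     \<and> concat (map (\<lambda>e. label e) es) = w)"

lemma path_net_single: "a \<noteq> b \<Longrightarrow> a \<noteq> 0 \<Longrightarrow> b \<noteq> 0 \<Longrightarrow> path_net {(a, w, b)} a w b"
  unfolding path_net_def by (intro conjI exI[of _ "[(a, w, b)]"]) (auto simp: verts_insert)

text \<open>Every vertex of a path other than its start is the target of an edge, so comparing the
  start and the targets of \<open>E\<close> with the targets of \<open>F\<close> covers all possible
  repetitions.\<close>

lemma path_net_append:
  assumes "path_net E a w b" "path_net F b w' c"
    and "insert a ((\<lambda>e. tgt e) ` E) \<inter> (\<lambda>e. tgt e) ` F = {}"
  shows "path_net (E \<union> F) a (w @ w') c"
proof -
  obtain es where es: "trail es a b" "distinct (a # map (\<lambda>e. tgt e) es)" "set es = E"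
    "concat (map (\<lambda>e. label e) es) = w"
    using assms(1) by (auto simp: path_net_def)
  obtain fs where fs: "trail fs b c" "distinct (b # map (\<lambda>e. tgt e) fs)" "set fs = F"
    "concat (map (\<lambda>e. label e) fs) = w'"
    using assms(2) by (auto simp: path_net_def)
  have "distinct (a # map (\<lambda>e. tgt e) (es @ fs))"
    using es fs assms(3) by auto
  moreover have "trail (es @ fs) a c" using es fs by (auto simp: trail_append)
  moreover have "0 \<notin> verts (E \<union> F)" using assms(1,2) by (simp add: path_net_def)
  ultimately show ?thesis unfolding path_net_def using es fs by (intro conjI exI[of _ "es @ fs"]) simp_all
qed

lemma trail_sources: "trail es a b \<Longrightarrow> e \<in> set es \<Longrightarrow> src e \<in> insert a ((\<lambda>e. tgt e) ` set es)"
  by (induction es arbitrary: a) auto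

lemma trail_inj_src: "trail es a b \<Longrightarrow> distinct (a # map (\<lambda>e. tgt e) es) \<Longrightarrow> inj_on fst (set es)"
proof (induction es arbitrary: a)
  case (Cons e es)
  have "inj_on fst (set es)" using Cons.IH[of "tgt e"] Cons.prems by simp
  moreover have "src e \<notin> fst ` set es"
  proof
    assume "src e \<in> fst ` set es"
    then obtain e' where "e' \<in> set es" "src e' = a" using Cons.prems by auto
    with trail_sources[of es "tgt e" b e'] Cons.prems show False by auto
  qed
  ultimately show ?case by auto
qed simp

text \<open>The rank is the position along the path. Since it grows along every edge, it will
  exclude closed walks.\<close>

lemma path_net_rank:
  assumes "path_net E a w b"
  shows "\<exists>r :: nat \<Rightarrow> nat. \<forall>e\<in>E. r (src e) < r (tgt e)"
proof -
  have "\<exists>r :: nat \<Rightarrow> nat. \<forall>e\<in>set es. r (src e) < r (tgt e)"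
    if "trail es a b" "distinct (a # map (\<lambda>e. tgt e) es)" for es :: "'a edge list"
    using that
  proof (induction es arbitrary: a)
    case (Cons e es)
    then obtain r :: "nat \<Rightarrow> nat" where r: "\<forall>e\<in>set es. r (src e) < r (tgt e)" by fastforce
    have "src e' \<noteq> a \<and> tgt e' \<noteq> a" if "e' \<in> set es" for e'
    proof -
      define S where "S = insert (tgt e) ((\<lambda>e. tgt e) ` set es)"
      have "src e' \<in> S" "tgt e' \<in> S" "a \<notin> S"
        using Cons.prems that trail_sources[of es "tgt e" b e'] by (simp_all add: S_def)
      then show ?thesis by auto
    qed
    \<comment> \<open>The start gets rank 0 and all other ranks are shifted up by one.\<close>
    with r Cons.prems show ?case by (intro exI[of _ "\<lambda>x. if x = a then 0 else Suc (r x)"]) auto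
  qed simp
  with assms show ?thesis by (auto simp: path_net_def)
qed

lemma path_net_no_cycle:
  assumes "path_net E a w b" "p \<noteq> []" "set p \<subseteq> E" "successively (\<lambda>e e'. tgt e = src e') p"
  shows "tgt (last p) \<noteq> src (hd p)"
proof -
  obtain r :: "nat \<Rightarrow> nat" where r: "\<forall>e\<in>E. r (src e) < r (tgt e)"
    using path_net_rank[OF assms(1)] by blast
  have "r (src (hd p)) < r (tgt (last p))"
    using assms(2-4)
  proof (induction p rule: induct_list012)
    case (3 x y zs)
    then have "r (src y) < r (tgt (last (y # zs)))" by simp
    moreover have "r (src x) < r (tgt x)" using bspec[OF r, of x] "3.prems"(2) by simp
    moreover have "tgt x = src y" using "3.prems"(3) by simp
    ultimately show ?case by simp
  qed (use r in auto)
  then show ?thesis by auto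
qed

lemma path_net_no_loop: "path_net E a w b \<Longrightarrow> (n, l, n) \<notin> E"
  using path_net_no_cycle[of E a w b "[(n, l, n)]"] by auto

section \<open>Renaming of vertices\<close>

definition ren :: "(nat \<Rightarrow> nat) \<Rightarrow> 'a edge set \<Rightarrow> 'a edge set" where
  "ren f E = (\<lambda>(i, w, j). (f i, w, f j)) ` E"

lemma ren_Un: "ren f (E \<union> F) = ren f E \<union> ren f F"
  by (simp add: ren_def image_Un)

lemma ren_UN: "ren f (\<Union>x\<in>I. F x) = (\<Union>x\<in>I. ren f (F x))"
  by (simp add: ren_def image_UN)

lemma ren_ren: "ren f (ren g E) = ren (f \<circ> g) E"
  by (auto simp: ren_def image_image split_beta)

lemma verts_ren: "verts (ren f E) = f ` verts E"
  by (auto simp: ren_def verts_def image_image image_Un split_beta)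

lemma ren_cong: "(\<And>x. x \<in> verts E \<Longrightarrow> f x = g x) \<Longrightarrow> ren f E = ren g E"
  by (force simp: ren_def verts_def intro!: image_cong)

lemma ren_ident: "(\<And>x. x \<in> verts E \<Longrightarrow> f x = x) \<Longrightarrow> ren f E = E"
  using ren_cong[of E f "\<lambda>x. x"] by (simp add: ren_def)

lemma path_net_ren:
  assumes "path_net E a w b" "inj f" "f 0 = 0"
  shows "path_net (ren f E) (f a) w (f b)"
proof -
  let ?g = "\<lambda>(i, w, j). (f i, w, f j)"
  obtain es where es: "trail es a b" "distinct (a # map (\<lambda>e. tgt e) es)" "set es = E"
    "concat (map (\<lambda>e. label e) es) = w"
    using assms(1) by (auto simp: path_net_def)
  have "trail (map ?g es) (f a) (f b)" using es(1) by (induction es arbitrary: a) auto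
  moreover have "distinct (map f (a # map (\<lambda>e. tgt e) es))"
    unfolding distinct_map using es(2) inj_on_subset[OF assms(2)] by blast
  then have "distinct (f a # map (\<lambda>e. tgt e) (map ?g es))" by (simp add: o_def split_beta)
  moreover have "map (\<lambda>e. label e) (map ?g es) = map (\<lambda>e. label e) es" by auto
  moreover have "0 \<notin> verts (ren f E)"
    using assms unfolding verts_ren path_net_def by (metis imageE injD)
  ultimately show ?thesis unfolding path_net_def using es
    by (intro conjI exI[of _ "map ?g es"]) (simp_all del: map_map add: ren_def)
qed

subsection \<open>Hiding vertices\<close>

text \<open>The start is unconstrained, so nonempty suffixes of hidden paths are hidden paths and a
  walk may begin inside \<open>X\<close>; \<open>hide\<close> adds the condition on the
  start.\<close>

fun hidden_path :: "nat set \<Rightarrow> 'a edge list \<Rightarrow> bool" where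
  "hidden_path X [] \<longleftrightarrow> False"
| "hidden_path X [e] \<longleftrightarrow> tgt e \<notin> X"
| "hidden_path X (e # e' # p) \<longleftrightarrow> tgt e = src e' \<and> tgt e \<in> X \<and> hidden_path X (e' # p)"

text \<open>The counterpart of gluing for named nets: the names in \<open>X\<close> become interior,
  and each maximal passage through them is contracted to one edge.\<close>

definition hide :: "nat set \<Rightarrow> 'a edge set \<Rightarrow> 'a edge set" where
  "hide X E = {(src (hd p), concat (map (\<lambda>e. label e) p), tgt (last p)) | p.
     hidden_path X p \<and> set p \<subseteq> E \<and> src (hd p) \<notin> X}"

lemma hidden_path_nonempty: "hidden_path X p \<Longrightarrow> p \<noteq> []"
  by (cases p) auto

lemma hidden_path_iff:
  "hidden_path X p \<longleftrightarrow> p \<noteq> [] \<and> successively (\<lambda>e e'. tgt e = src e' \<and> tgt e \<in> X) p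
     \<and> tgt (last p) \<notin> X"
  by (induction X p rule: hidden_path.induct) auto

lemma hidden_path_touches:
  "hidden_path X p \<Longrightarrow> length p \<ge> 2 \<Longrightarrow> e \<in> set p \<Longrightarrow> src e \<in> X \<or> tgt e \<in> X"
proof (induction X p rule: hidden_path.induct)
  case (3 X e' e'' p)
  then show ?case by (cases p) auto
qed auto

text \<open>An edge avoiding \<open>X\<close> cannot belong to a hidden path of two or more edges,
  so it survives unchanged and takes part in no contraction.\<close>

lemma hide_Un:
  assumes "verts Z \<inter> X = {}"
  shows "hide X (E \<union> Z) = hide X E \<union> Z"
proof (intro equalityI subsetI)
  fix e assume "e \<in> hide X (E \<union> Z)"
  then obtain p where p: "hidden_path X p" "set p \<subseteq> E \<union> Z" "src (hd p) \<notin> X"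
    and e: "e = (src (hd p), concat (map (\<lambda>e. label e) p), tgt (last p))"
    unfolding hide_def by blast
  show "e \<in> hide X E \<union> Z"
  proof (cases "set p \<subseteq> E")
    case True
    then show ?thesis using p e unfolding hide_def by blast
  next
    case False
    then obtain z where z: "z \<in> set p" "z \<in> Z" using p by blast
    then have "src z \<notin> X" "tgt z \<notin> X" using assms by (auto simp: verts_def)
    then have "length p < 2" using hidden_path_touches[OF p(1) _ z(1)] by force
    then have "p = [z]" using z(1) by (cases p) (auto simp: less_Suc_eq)
    then show ?thesis using e z by simp
  qed
next
  fix e assume e: "e \<in> hide X E \<union> Z"
  show "e \<in> hide X (E \<union> Z)"
  proof (cases "e \<in> Z")
    case True
    then have "src e \<notin> X" "tgt e \<notin> X" using assms by (auto simp: verts_def)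
    with True show ?thesis unfolding hide_def by (intro CollectI exI[of _ "[e]"]) simp
  next
    case False
    with e show ?thesis unfolding hide_def by blast
  qed
qed

text \<open>Distinct sources give each edge at most one successor, and a hidden path has to stop at
  its first target outside \<open>X\<close>.\<close>

lemma hidden_path_unique:
  "inj_on fst E \<Longrightarrow> hidden_path X p \<Longrightarrow> hidden_path X r \<Longrightarrow> set p \<subseteq> E \<Longrightarrow> set r \<subseteq> E \<Longrightarrow>
   src (hd p) = src (hd r) \<Longrightarrow> p = r"
proof (induction X p arbitrary: r rule: hidden_path.induct)
  case (2 X e)
  then obtain e' r' where r: "r = e' # r'" by (cases r) auto
  with 2 have "e' = e" by (auto dest: inj_onD)
  with 2 r show ?case by (cases r') auto
next
  case (3 X e e' p)
  then obtain f r' where r: "r = f # r'" by (cases r) auto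
  with 3 have "f = e" by (auto dest: inj_onD)
  with 3 r obtain f' r'' where r': "r' = f' # r''" by (cases r') auto
  with 3 r \<open>f = e\<close> have "e' # p = r'" by (intro "3.IH") auto
  with r \<open>f = e\<close> show ?case by simp
qed auto

text \<open>No edge leads into the source of \<open>e\<close>, so \<open>e\<close> can only be the
  first edge of a hidden path.\<close>

lemma hidden_path_Cons_cases:
  assumes "hidden_path X r" "set r \<subseteq> insert e E" "src e \<notin> insert (tgt e) ((\<lambda>e. tgt e) ` E)"
  shows "set r \<subseteq> E \<or> (\<exists>r'. r = e # r' \<and> set r' \<subseteq> E)"
  using assms
proof (induction X r rule: hidden_path.induct)
  case (3 X f f' r)
  then have "set (f' # r) \<subseteq> E \<or> (\<exists>r'. f' # r = e # r' \<and> set r' \<subseteq> E)" by auto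
  moreover have "f' \<noteq> e" using 3 by (auto simp: image_iff)
  ultimately have "set (f' # r) \<subseteq> E" by auto
  then show ?case using "3.prems"(2) by auto
qed auto

text \<open>The induction passes through suffixes that may begin inside \<open>X\<close>. For those,
  \<open>p\<close> is the hidden run up to the first visible vertex \<open>c\<close>; it contributes
  no edge, and \<open>q'\<close> is the contraction of the rest \<open>q\<close>. With a visible
  start, \<open>p\<close> is empty and \<open>q'\<close> contracts the whole trail.\<close>

lemma trail_hide:
  assumes "trail es a b" "distinct (a # map (\<lambda>e. tgt e) es)" "b \<notin> X"
  shows "\<exists>p q q' c. es = p @ q \<and> (p = [] \<and> a = c \<and> a \<notin> X \<or>
      a \<in> X \<and> hidden_path X p \<and> src (hd p) = a \<and> tgt (last p) = c)
    \<and> trail q' c b \<and> distinct (c # map (\<lambda>e. tgt e) q')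
    \<and> (\<lambda>e. tgt e) ` set q' \<subseteq> (\<lambda>e. tgt e) ` set q
    \<and> set q' = hide X (set es) \<and> concat (map (\<lambda>e. label e) q') = concat (map (\<lambda>e. label e) q)"
  using assms
proof (induction es arbitrary: a)
  case Nil
  then show ?case
    by (intro exI[of _ "[]"] exI[of _ b]) (auto simp: hide_def dest: hidden_path_nonempty)
next
  case (Cons e es)
  let ?E = "set es"
  obtain p q q' c where es: "es = p @ q" and
    p: "p = [] \<and> tgt e = c \<and> tgt e \<notin> X \<or>
        tgt e \<in> X \<and> hidden_path X p \<and> src (hd p) = tgt e \<and> tgt (last p) = c" and
    q': "trail q' c b" "distinct (c # map (\<lambda>e. tgt e) q')"
      "(\<lambda>e. tgt e) ` set q' \<subseteq> (\<lambda>e. tgt e) ` set q" "set q' = hide X ?E" and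
    lab: "concat (map (\<lambda>e. label e) q') = concat (map (\<lambda>e. label e) q)"
  proof -
    have "trail es (tgt e) b" "distinct (tgt e # map (\<lambda>e. tgt e) es)" using Cons.prems by auto
    from Cons.IH[OF this Cons.prems(3)] show thesis by (elim exE conjE) (rule that)
  qed
  have a: "src e = a" "a \<notin> insert (tgt e) ((\<lambda>e. tgt e) ` ?E)" using Cons.prems by auto
  have inj: "inj_on fst ?E" using trail_inj_src[of es "tgt e" b] Cons.prems by simp
  have cases: "set r \<subseteq> ?E \<or> (\<exists>r'. r = e # r' \<and> set r' \<subseteq> ?E)"
    if "hidden_path X r" "set r \<subseteq> insert e ?E" for r
    using hidden_path_Cons_cases[OF that] a by simp
  have mono: "hide X ?E \<subseteq> hide X (insert e ?E)" unfolding hide_def by blast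
  show ?case
  proof (cases "a \<in> X")
    case True
    \<comment> \<open>A hidden path using \<open>e\<close> would have to start at \<open>a\<close>,
      which is itself hidden.\<close>
    have "hide X (insert e ?E) \<subseteq> hide X ?E"
    proof
      fix f assume "f \<in> hide X (insert e ?E)"
      then obtain r where r: "hidden_path X r" "set r \<subseteq> insert e ?E" "src (hd r) \<notin> X"
        and f: "f = (src (hd r), concat (map (\<lambda>e. label e) r), tgt (last r))"
        unfolding hide_def by blast
      then have "set r \<subseteq> ?E" using cases[OF r(1,2)] True a by auto
      with r f show "f \<in> hide X ?E" unfolding hide_def by blast
    qed
    then have hide: "hide X (set (e # es)) = hide X ?E" using mono by auto
    have "hidden_path X (e # p) \<and> tgt (last (e # p)) = c"
      using p by (cases p) auto
    with True a es q' lab hide show ?thesis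
      by (intro exI[of _ "e # p"] exI[of _ q] exI[of _ q'] exI[of _ c]) auto
  next
    case False
    have hp: "hidden_path X (e # p)" "tgt (last (e # p)) = c" using p by (cases p; auto)+
    have sub: "set (e # p) \<subseteq> insert e ?E" using es by auto
    \<comment> \<open>The run \<open>e # p\<close> from the visible vertex \<open>a\<close> to the
      visible vertex \<open>c\<close> becomes the single edge \<open>?f\<close>.\<close>
    let ?f = "(a, concat (map (\<lambda>e. label e) (e # p)), c)"
    have "hide X (insert e ?E) = insert ?f (hide X ?E)"
    proof (intro equalityI subsetI)
      fix f assume "f \<in> hide X (insert e ?E)"
      then obtain r where r: "hidden_path X r" "set r \<subseteq> insert e ?E" "src (hd r) \<notin> X"
        and f: "f = (src (hd r), concat (map (\<lambda>e. label e) r), tgt (last r))"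
        unfolding hide_def by blast
      show "f \<in> insert ?f (hide X ?E)"
      proof (cases "set r \<subseteq> ?E")
        case True
        then show ?thesis using r f unfolding hide_def by blast
      next
        case False
        then obtain r' where r': "r = e # r'" "set r' \<subseteq> ?E" using cases[OF r(1,2)] by blast
        have "r' = p"
        proof (cases r')
          case Nil
          then show ?thesis using r(1) r' p by auto
        next
          case (Cons g gs)
          then have "hidden_path X r'" "tgt e \<in> X" "src (hd r') = tgt e" using r(1) r' by auto
          then show ?thesis using hidden_path_unique[OF inj, of X r' p] p r' es by auto
        qed
        then show ?thesis using f r' a hp(2) by auto
      qed
    next
      fix f assume "f \<in> insert ?f (hide X ?E)"
      moreover have "?f \<in> hide X (insert e ?E)"
        unfolding hide_def using hp sub a False
        by (intro CollectI exI[of _ "e # p"]) auto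
      ultimately show "f \<in> hide X (insert e ?E)" using mono by blast
    qed
    then have "set (?f # q') = hide X (set (e # es))" using q'(4) by simp
    moreover have c: "c \<in> insert (tgt e) ((\<lambda>e. tgt e) ` set p)"
      using p by (auto intro!: imageI dest: hidden_path_nonempty)
    moreover have "trail (?f # q') a b" using q'(1) by simp
    moreover have "(\<lambda>e. tgt e) ` set (?f # q') \<subseteq> (\<lambda>e. tgt e) ` set (e # es)"
      using c q'(3) es by auto
    moreover have "distinct (a # map (\<lambda>e. tgt e) (?f # q'))"
    proof -
      have "a \<notin> (\<lambda>e. tgt e) ` set q'" using a(2) es q'(3) by auto
      moreover have "a \<noteq> c" using a(2) es c by auto
      ultimately show ?thesis using q'(2) by simp
    qed
    moreover have "concat (map (\<lambda>e. label e) (?f # q')) = concat (map (\<lambda>e. label e) (e # es))"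
      using lab es by simp
    ultimately show ?thesis using False
      by (rule_tac exI[of _ "[]"], rule_tac exI[of _ "e # es"], rule_tac exI[of _ "?f # q'"],
          rule_tac exI[of _ a]) simp
  qed
qed

lemma verts_hide: "verts (hide X E) \<subseteq> verts E - X"
proof
  fix v assume "v \<in> verts (hide X E)"
  then obtain p where p: "hidden_path X p" "set p \<subseteq> E" "src (hd p) \<notin> X"
    and v: "v = src (hd p) \<or> v = tgt (last p)"
    unfolding verts_def hide_def by auto
  have "p \<noteq> []" "tgt (last p) \<notin> X" using p(1) by (auto simp: hidden_path_iff)
  then have "hd p \<in> E" "last p \<in> E" using p(2) by auto
  with p v \<open>tgt (last p) \<notin> X\<close> show "v \<in> verts E - X" by (auto simp: verts_def)
qed

lemma path_net_hide:
  assumes "path_net (E \<union> Z) a w b" "a \<notin> X" "b \<notin> X" "verts Z \<inter> X = {}"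
  shows "path_net (hide X E \<union> Z) a w b"
proof -
  obtain es where es: "trail es a b" "distinct (a # map (\<lambda>e. tgt e) es)" "set es = E \<union> Z"
    "concat (map (\<lambda>e. label e) es) = w"
    using assms(1) by (auto simp: path_net_def)
  from trail_hide[OF es(1,2) assms(3)] assms(2) obtain q' where
    "trail q' a b" "distinct (a # map (\<lambda>e. tgt e) q')" "set q' = hide X (set es)"
    "concat (map (\<lambda>e. label e) q') = concat (map (\<lambda>e. label e) es)" by auto
  moreover have "0 \<notin> verts (hide X E \<union> Z)"
    using assms(1) verts_hide[of X E] by (auto simp: path_net_def)
  ultimately show ?thesis unfolding path_net_def using es hide_Un[OF assms(4), of E]
    by (intro conjI exI[of _ q']) simp_all
qed

text \<open>The bridge between numbered gluing and named hiding: when \<open>\<eta>\<close>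
  identifies exactly the glued ends and \<open>X\<close> consists of the names of glued vertices,
  the paths through the gluing are the hidden paths.\<close>

lemma ren_glued_edges:
  assumes R: "\<And>e e'. e \<in> E \<Longrightarrow> e' \<in> E \<Longrightarrow>
      (tgt e, src e') \<in> R \<longleftrightarrow> \<eta> (tgt e) = \<eta> (src e') \<and> \<eta> (tgt e) \<in> X"
    and src: "\<And>e. e \<in> E \<Longrightarrow> src e \<in> Field R \<longleftrightarrow> \<eta> (src e) \<in> X"
    and tgt: "\<And>e. e \<in> E \<Longrightarrow> tgt e \<in> Field R \<longleftrightarrow> \<eta> (tgt e) \<in> X"
  shows "ren \<eta> (glued_edges R E) = hide X (ren \<eta> E)"
proof -
  let ?g = "\<lambda>(i, w, j). (\<eta> i, w, \<eta> j)"
  have succ: "successively (\<lambda>e e'. (tgt e, src e') \<in> R) es \<longleftrightarrow>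
      successively (\<lambda>e e'. tgt e = src e' \<and> tgt e \<in> X) (map ?g es)" if "set es \<subseteq> E" for es
    using that by (induction es rule: induct_list012) (auto simp: R split_beta)
  have props: "src (hd (map ?g es)) = \<eta> (src (hd es))" "tgt (last (map ?g es)) = \<eta> (tgt (last es))"
    "hd es \<in> set es" "last es \<in> set es" if "es \<noteq> []" for es :: "'a edge list"
    using that by (auto simp: hd_map last_map split_beta)
  have lab: "concat (map (\<lambda>e. label e) (map ?g es)) = concat (map (\<lambda>e. label e) es)"
    for es :: "'a edge list" by (induction es) auto
  have iff: "es \<in> glued_paths R E \<and> src (hd es) \<notin> Field R \<and> tgt (last es) \<notin> Field R \<longleftrightarrow>
      set es \<subseteq> E \<and> hidden_path X (map ?g es) \<and> src (hd (map ?g es)) \<notin> X" for es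
  proof (cases "es \<noteq> [] \<and> set es \<subseteq> E")
    case True
    then have *: "hd es \<in> E" "last es \<in> E" using props by auto
    then show ?thesis using True succ[of es] props[of es] src[OF *(1)] tgt[OF *(2)]
      unfolding glued_paths_def hidden_path_iff by auto
  qed (auto simp: glued_paths_def)
  show ?thesis
  proof (intro equalityI subsetI)
    fix f assume "f \<in> ren \<eta> (glued_edges R E)"
    then obtain es where es: "es \<in> glued_paths R E \<and> src (hd es) \<notin> Field R \<and> tgt (last es) \<notin> Field R"
      and f: "f = ?g (src (hd es), concat (map (\<lambda>e. label e) es), tgt (last es))"
      unfolding ren_def glued_edges_def by auto
    have ne: "es \<noteq> []" using es by (auto simp: glued_paths_def)
    have "set (map ?g es) \<subseteq> ren \<eta> E" using es iff[of es] by (simp add: ren_def image_mono)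
    moreover have "f = (src (hd (map ?g es)), concat (map (\<lambda>e. label e) (map ?g es)), tgt (last (map ?g es)))"
      unfolding lab using f ne props by simp
    ultimately show "f \<in> hide X (ren \<eta> E)"
      unfolding hide_def using es iff[of es] by blast
  next
    fix f assume "f \<in> hide X (ren \<eta> E)"
    then obtain p where p: "hidden_path X p" "set p \<subseteq> ren \<eta> E" "src (hd p) \<notin> X"
      and f: "f = (src (hd p), concat (map (\<lambda>e. label e) p), tgt (last p))"
      unfolding hide_def by blast
    have "\<exists>es. map ?g es = p \<and> set es \<subseteq> E" using p(2)
    proof (induction p)
      case (Cons e p)
      then obtain es x where "map ?g es = p" "set es \<subseteq> E" "x \<in> E" "e = ?g x" by (auto simp: ren_def)
      then show ?case by (intro exI[of _ "x # es"]) auto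
    qed auto
    then obtain es where es: "p = map ?g es" "set es \<subseteq> E" by blast
    have ne: "es \<noteq> []" using p es by auto
    have "f = ?g (src (hd es), concat (map (\<lambda>e. label e) es), tgt (last es))"
      using f ne props unfolding es lab by simp
    then show "f \<in> ren \<eta> (glued_edges R E)"
      unfolding ren_def glued_edges_def using iff[of es] es p by blast
  qed
qed

text \<open>A closed cycle of the gluing is visible as a closed walk in the named net, and a simple
  path contains none.\<close>

lemma glued_cycle_closed:
  assumes R: "\<And>e e'. e \<in> E \<Longrightarrow> e' \<in> E \<Longrightarrow> (tgt e, src e') \<in> R \<Longrightarrow> \<eta> (tgt e) = \<eta> (src e')"
    and "glued_cycles R E \<noteq> {}"
  shows "\<exists>p. p \<noteq> [] \<and> set p \<subseteq> ren \<eta> E \<and> successively (\<lambda>e e'. tgt e = src e') p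
    \<and> tgt (last p) = src (hd p)"
proof -
  let ?g = "\<lambda>(i, w, j). (\<eta> i, w, \<eta> j)"
  obtain es where es: "es \<noteq> []" "set es \<subseteq> E" "successively (\<lambda>e e'. (tgt e, src e') \<in> R) es"
    "(tgt (last es), src (hd es)) \<in> R"
    using assms(2) by (auto simp: glued_cycles_def glued_paths_def)
  have "successively (\<lambda>e e'. tgt e = src e') (map ?g es)"
    using es(2,3) by (induction es rule: induct_list012) (auto simp: R split_beta)
  moreover have "hd es \<in> E" "last es \<in> E" using es(1,2) by auto
  then have "tgt (last (map ?g es)) = src (hd (map ?g es))"
    using R[of "last es" "hd es"] es by (auto simp: hd_map last_map split_beta)
  moreover have "set (map ?g es) \<subseteq> ren \<eta> E" using es(2) by (simp add: ren_def image_mono)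
  ultimately show ?thesis using es(1) by (intro exI[of _ "map ?g es"]) auto
qed

section \<open>Boundaries as sign lists and well-typed multiwords\<close>

text \<open>Boundary vertices are numbered from 1, hence the shift against list positions.\<close>

definition at :: "'b list \<Rightarrow> nat \<Rightarrow> 'b" where
  "at xs p = xs ! (p - 1)"

lemma at_append:
  "1 \<le> p \<Longrightarrow> at (xs @ ys) p = (if p \<le> length xs then at xs p else at ys (p - length xs))"
  by (auto simp: at_def nth_append)

lemma at_append_right: "1 \<le> p \<Longrightarrow> at (xs @ ys) (length xs + p) = at ys p"
  by (simp add: at_append)

lemma at_rev: "1 \<le> p \<Longrightarrow> p \<le> length xs \<Longrightarrow> at (rev xs) p = at xs (length xs + 1 - p)"
  by (simp add: at_def rev_nth)

lemma at_in_set: "1 \<le> p \<Longrightarrow> p \<le> length xs \<Longrightarrow> at xs p \<in> set xs"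
  by (simp add: at_def)

lemma at_eq_iff:
  assumes "distinct xs" "p \<in> {1..length xs}" "q \<in> {1..length xs}"
  shows "at xs p = at xs q \<longleftrightarrow> p = q"
proof -
  have "p - 1 < length xs" "q - 1 < length xs" using assms(2,3) by auto
  then have "at xs p = at xs q \<longleftrightarrow> p - 1 = q - 1" using assms(1) by (simp add: at_def nth_eq_iff_index_eq)
  then show ?thesis using assms(2,3) by auto
qed

lemma inj_on_at: "distinct xs \<Longrightarrow> inj_on (at xs) {1..length xs}"
  by (rule inj_onI) (simp add: at_eq_iff)

lemma set_conv_at: "set xs = at xs ` {1..length xs}"
proof (intro equalityI subsetI)
  fix x assume "x \<in> set xs"
  then obtain i where "i < length xs" "x = xs ! i" by (metis in_set_conv_nth)
  then show "x \<in> at xs ` {1..length xs}" by (intro image_eqI[of _ _ "Suc i"]) (auto simp: at_def)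
qed (auto simp: at_in_set)

text \<open>With the sign convention below, \<open>sel True\<close> are the names that serve as
  sources and \<open>sel False\<close> those that serve as targets.\<close>

definition sel :: "bool \<Rightarrow> bool list \<Rightarrow> nat list \<Rightarrow> nat set" where
  "sel b bs \<nu> = {n. (b, n) \<in> set (zip bs \<nu>)}"

lemma sel_append:
  "length bs = length \<nu> \<Longrightarrow> sel b (bs @ cs) (\<nu> @ \<mu>) = sel b bs \<nu> \<union> sel b cs \<mu>"
  by (auto simp: sel_def)

lemma sel_dual: "length bs = length \<nu> \<Longrightarrow> sel b (map Not (rev bs)) (rev \<nu>) = sel (\<not> b) bs \<nu>"
  by (force simp: sel_def zip_map1 zip_rev)

lemma sel_subset: "sel b bs \<nu> \<subseteq> set \<nu>"
  by (auto simp: sel_def dest: set_zip_rightD)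

lemma sel_Un: "length bs = length \<nu> \<Longrightarrow> sel b bs \<nu> \<union> sel (\<not> b) bs \<nu> = set \<nu>"
proof (induction bs \<nu> rule: list_induct2)
  case (Cons x xs y ys)
  then show ?case by (cases b; cases x) (auto simp: sel_def)
qed (simp add: sel_def)

lemma sel_disjoint: "distinct \<nu> \<Longrightarrow> sel b bs \<nu> \<inter> sel (\<not> b) bs \<nu> = {}"
proof (rule equals0I)
  fix n assume d: "distinct \<nu>" and "n \<in> sel b bs \<nu> \<inter> sel (\<not> b) bs \<nu>"
  then have "(b, n) \<in> set (zip bs \<nu>)" "(\<not> b, n) \<in> set (zip bs \<nu>)" by (auto simp: sel_def)
  with d show False by (auto simp: set_zip nth_eq_iff_index_eq)
qed

lemma sel_at: "length bs = length \<nu> \<Longrightarrow> sel b bs \<nu> = at \<nu> ` {p \<in> {1..length \<nu>}. at bs p = b}"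
proof (intro equalityI subsetI)
  fix n assume l: "length bs = length \<nu>" and "n \<in> sel b bs \<nu>"
  then obtain i where "i < length \<nu>" "bs ! i = b" "\<nu> ! i = n" by (auto simp: sel_def set_zip)
  then show "n \<in> at \<nu> ` {p \<in> {1..length \<nu>}. at bs p = b}"
    by (intro image_eqI[of _ _ "Suc i"]) (auto simp: at_def)
qed (auto simp: sel_def set_zip at_def)

text \<open>\<open>True\<close> marks a left endpoint. On sign lists the tensor of boundaries is
  concatenation, and the dual is reversal with all signs flipped.\<close>

definition signs :: "boundary \<Rightarrow> bool list" where
  "signs X = map (\<lambda>i. i \<in> lefts X) [1..<Suc (bcard X)]"

lemma length_signs [simp]: "length (signs X) = bcard X"
  by (simp add: signs_def)

lemma at_signs: "p \<in> {1..bcard X} \<Longrightarrow> at (signs X) p \<longleftrightarrow> p \<in> lefts X"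
  by (auto simp: signs_def at_def nth_append simp del: upt_Suc)

lemma sign_list_eqI:
  "length xs = length ys \<Longrightarrow> (\<And>p. p \<in> {1..length ys} \<Longrightarrow> at xs p = at ys p) \<Longrightarrow> xs = ys"
proof (rule nth_equalityI)
  fix i assume "length xs = length ys" "\<And>p. p \<in> {1..length ys} \<Longrightarrow> at xs p = at ys p" "i < length xs"
  from this(2)[of "Suc i"] this(1,3) show "xs ! i = ys ! i" by (simp add: at_def)
qed

lemma signs_btensor:
  assumes "is_boundary X" "is_boundary Y"
  shows "signs (X \<otimes>\<^sub>b Y) = signs X @ signs Y"
proof (rule sign_list_eqI)
  show "length (signs (X \<otimes>\<^sub>b Y)) = length (signs X @ signs Y)" by (simp add: btensor_def)
  fix p assume "p \<in> {1..length (signs X @ signs Y)}"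
  then have p: "p \<in> {1..bcard (X \<otimes>\<^sub>b Y)}" by (simp add: btensor_def)
  show "at (signs (X \<otimes>\<^sub>b Y)) p = at (signs X @ signs Y) p"
  proof (cases "p \<le> bcard X")
    case True
    then have "p \<in> lefts (X \<otimes>\<^sub>b Y) \<longleftrightarrow> p \<in> lefts X"
      using assms by (auto simp: btensor_def is_boundary_def)
    with True p show ?thesis by (simp add: at_signs at_append)
  next
    case False
    then obtain q where q: "p = bcard X + q" "1 \<le> q" by (metis add_diff_inverse_nat linorder_not_le less_imp_le_nat One_nat_def Suc_leI zero_less_diff not_less)
    then have "p \<in> lefts (X \<otimes>\<^sub>b Y) \<longleftrightarrow> q \<in> lefts Y"
      using assms by (auto simp: btensor_def is_boundary_def)
    with q p show ?thesis by (simp add: at_signs at_append btensor_def)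
  qed
qed

lemma signs_bdual: "signs (bdual X) = map Not (rev (signs X))"
proof (rule sign_list_eqI)
  show "length (signs (bdual X)) = length (map Not (rev (signs X)))" by (simp add: bdual_def)
  fix p assume "p \<in> {1..length (map Not (rev (signs X)))}"
  then have p: "p \<in> {1..bcard X}" by simp
  define q where "q = bcard X + 1 - p"
  have q: "q \<in> {1..bcard X}" "p = bcard X + 1 - q" using p by (auto simp: q_def)
  have "at (map Not (rev (signs X))) p = (\<not> at (rev (signs X)) p)" using p by (auto simp: at_def)
  also have "\<dots> = (\<not> at (signs X) q)" using p by (simp add: at_rev q_def)
  also have "\<dots> = (q \<in> rights X)" using q by (simp add: at_signs rights_def)
  also have "\<dots> = (p \<in> lefts (bdual X))"
  proof
    assume "p \<in> lefts (bdual X)"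
    then obtain i where "i \<in> rights X" "p = bcard X + 1 - i" by (auto simp: bdual_def)
    moreover from this have "i = q" using q by (auto simp: rights_def)
    ultimately show "q \<in> rights X" by simp
  qed (use q in \<open>auto simp: bdual_def\<close>)
  also have "\<dots> = at (signs (bdual X)) p" using at_signs[of p "bdual X"] p by (simp add: bdual_def)
  finally show "at (signs (bdual X)) p = at (map Not (rev (signs X))) p" by simp
qed

text \<open>The two sets may overlap: before hiding, the name of a cut vertex is the source of one
  edge and the target of another.\<close>

definition matched :: "nat set \<Rightarrow> nat set \<Rightarrow> 'a edge set \<Rightarrow> bool" where
  "matched L K E \<longleftrightarrow> bij_betw fst E L \<and> bij_betw (\<lambda>e. tgt e) E K"

lemma matched_ren:
  assumes "matched L K E" "inj_on f (L \<union> K)"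
  shows "matched (f ` L) (f ` K) (ren f E)"
proof -
  let ?g = "\<lambda>(i, w, j). (f i, w, f j)"
  have L: "fst ` E = L" "inj_on fst E" and K: "(\<lambda>e. tgt e) ` E = K" "inj_on (\<lambda>e. tgt e) E"
    using assms(1) by (auto simp: matched_def bij_betw_def)
  have "inj_on (f \<circ> fst) E" "inj_on (f \<circ> (\<lambda>e. tgt e)) E"
    using L K assms(2) by (auto intro!: comp_inj_on intro: inj_on_subset)
  moreover have "fst \<circ> ?g = f \<circ> fst" "(\<lambda>e. tgt e) \<circ> ?g = f \<circ> (\<lambda>e. tgt e)" by auto
  ultimately have "inj_on fst (?g ` E)" "inj_on (\<lambda>e. tgt e) (?g ` E)"
    by (metis inj_on_imageI)+
  moreover have "fst ` ren f E = f ` L" "(\<lambda>e. tgt e) ` ren f E = f ` K"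
    using L(1) K(1) by (force simp: ren_def image_image split_beta)+
  ultimately show ?thesis by (simp add: matched_def bij_betw_def ren_def)
qed

lemma matched_Un:
  "matched L K E \<Longrightarrow> matched L' K' F \<Longrightarrow> L \<inter> L' = {} \<Longrightarrow> K \<inter> K' = {} \<Longrightarrow>
   matched (L \<union> L') (K \<union> K') (E \<union> F)"
  by (simp add: matched_def bij_betw_combine)

lemma matched_verts: "matched L K E \<Longrightarrow> verts E = L \<union> K"
  by (auto simp: matched_def verts_def bij_betw_def)

text \<open>Follow the edges from \<open>e\<close> as long as the target is hidden. No edge is met
  twice: a return to \<open>e\<close> would make its source hidden, and a return elsewhere would
  give two edges with the same target. Finiteness of \<open>E\<close> therefore forces the walk out
  of \<open>X\<close>.\<close>

lemma hidden_path_exists: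
  assumes fin: "finite E" and inj: "inj_on (\<lambda>e. tgt e) E" and X: "X \<subseteq> fst ` E"
    and e: "e \<in> E" "src e \<notin> X"
  shows "\<exists>p. hidden_path X p \<and> set p \<subseteq> E \<and> hd p = e"
proof (rule ccontr)
  assume none: "\<not> ?thesis"
  let ?P = "\<lambda>e e'. tgt e = src e' \<and> tgt e \<in> X"
  have "\<exists>p. length p = Suc n \<and> distinct p \<and> set p \<subseteq> E \<and> hd p = e \<and> successively ?P p" for n
  proof (induction n)
    case 0
    then show ?case using e by (intro exI[of _ "[e]"]) simp
  next
    case (Suc n)
    then obtain p where p: "length p = Suc n" "distinct p" "set p \<subseteq> E" "hd p = e" "successively ?P p"
      by blast
    have ne: "p \<noteq> []" using p(1) by auto
    have "tgt (last p) \<in> X" using none p ne by (auto simp: hidden_path_iff)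
    then obtain e' where e': "e' \<in> E" "src e' = tgt (last p)" using X by (metis imageE subsetD)
    have "e' \<notin> set p"
    proof
      assume "e' \<in> set p"
      then obtain k where k: "k < Suc n" "e' = p ! k" by (metis in_set_conv_nth p(1))
      show False
      proof (cases k)
        case 0
        then have "e' = e" using k p(4) ne by (simp add: hd_conv_nth)
        with e' e \<open>tgt (last p) \<in> X\<close> show False by simp
      next
        case (Suc j)
        then have "tgt (p ! j) = src (p ! k)" using successively_nth[OF p(5), of j] k p(1) by simp
        then have "tgt (p ! j) = tgt (p ! n)" using e' k ne p(1) by (simp add: last_conv_nth)
        moreover have "p ! j \<in> E" "p ! n \<in> E" using p(1,3) Suc k nth_mem by auto
        ultimately have "p ! j = p ! n" using inj by (auto dest: inj_onD)
        then have "j = n" using p(1,2) Suc k by (simp add: nth_eq_iff_index_eq)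
        with Suc k show False by simp
      qed
    qed
    with p ne e' \<open>tgt (last p) \<in> X\<close> show ?case
      by (intro exI[of _ "p @ [e']"]) (auto simp: successively_append_iff)
  qed
  from this[of "card E"] obtain p where "length p = Suc (card E)" "distinct p" "set p \<subseteq> E" by blast
  then show False using card_mono[OF fin, of "set p"] by (simp add: distinct_card)
qed

text \<open>The mirror image of uniqueness for forward paths: distinct targets determine the
  predecessor of each edge, and a visible source stops the walk.\<close>

lemma backward_path_unique:
  assumes inj: "inj_on (\<lambda>e. tgt e) E"
  shows "p \<noteq> [] \<Longrightarrow> r \<noteq> [] \<Longrightarrow> successively (\<lambda>e e'. tgt e = src e' \<and> tgt e \<in> X) p \<Longrightarrow>
    successively (\<lambda>e e'. tgt e = src e' \<and> tgt e \<in> X) r \<Longrightarrow> set p \<subseteq> E \<Longrightarrow> set r \<subseteq> E \<Longrightarrow>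
    src (hd p) \<notin> X \<Longrightarrow> src (hd r) \<notin> X \<Longrightarrow> tgt (last p) = tgt (last r) \<Longrightarrow> p = r"
proof (induction p arbitrary: r rule: rev_induct)
  case (snoc x p)
  obtain r' y where r': "r = r' @ [y]" using snoc.prems(2) by (cases r rule: rev_cases) auto
  have "tgt x = tgt y" "x \<in> E" "y \<in> E" using snoc.prems r' by auto
  then have xy: "y = x" using inj by (auto dest: inj_onD)
  show ?case
  proof (cases "p = []")
    case True
    then have "src x \<notin> X" using snoc.prems by simp
    then have "r' = []" using snoc.prems(4) r' xy
      by (cases "r' = []") (auto simp: successively_append_iff)
    with True r' xy show ?thesis by simp
  next
    case False
    then have px: "tgt (last p) = src x" "src x \<in> X"
      using snoc.prems(3) by (auto simp: successively_append_iff)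
    then have ne: "r' \<noteq> []" using snoc.prems(8) r' xy by auto
    then have "tgt (last r') = src x" using snoc.prems(4) r' xy by (auto simp: successively_append_iff)
    then have "p = r'" using snoc.prems r' ne False px
      by (intro snoc.IH) (auto simp: successively_append_iff)
    with r' xy show ?thesis by simp
  qed
qed simp

lemma matched_hide:
  assumes m: "matched L K E" and fin: "finite E" and X: "X \<subseteq> L" "X \<subseteq> K"
  shows "matched (L - X) (K - X) (hide X E)"
proof -
  have L: "fst ` E = L" "inj_on fst E" and K: "(\<lambda>e. tgt e) ` E = K" "inj_on (\<lambda>e. tgt e) E"
    using m by (auto simp: matched_def bij_betw_def)
  have inj_src: "inj_on fst (hide X E)"
    using hidden_path_unique[OF L(2)] by (auto simp: inj_on_def hide_def)
  have inj_tgt: "inj_on (\<lambda>e. tgt e) (hide X E)"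
    unfolding inj_on_def hide_def
    using backward_path_unique[OF K(2), of _ _ X] by (auto simp: hidden_path_iff)
  have img_src: "fst ` hide X E = L - X"
  proof (intro equalityI subsetI)
    fix v assume "v \<in> fst ` hide X E"
    then obtain p where p: "hidden_path X p" "set p \<subseteq> E" "src (hd p) \<notin> X" "v = src (hd p)"
      by (auto simp: hide_def)
    then have "hd p \<in> E" using hidden_path_nonempty[OF p(1)] by auto
    with p L show "v \<in> L - X" by auto
  next
    fix v assume v: "v \<in> L - X"
    then obtain e where e: "e \<in> E" "src e = v" using L by auto
    then obtain p where p: "hidden_path X p" "set p \<subseteq> E" "hd p = e"
      using hidden_path_exists[OF fin K(2)] X(1) L(1) v by blast
    then have "(v, concat (map (\<lambda>e. label e) p), tgt (last p)) \<in> hide X E"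
      unfolding hide_def using e v by blast
    then show "v \<in> fst ` hide X E" by force
  qed
  have sub: "(\<lambda>e. tgt e) ` hide X E \<subseteq> K - X"
  proof
    fix v assume "v \<in> (\<lambda>e. tgt e) ` hide X E"
    then obtain p where p: "hidden_path X p" "set p \<subseteq> E" "v = tgt (last p)"
      by (auto simp: hide_def)
    then have "last p \<in> E" "v \<notin> X" by (auto simp: hidden_path_iff)
    with p K show "v \<in> K - X" by auto
  qed
  \<comment> \<open>Surjectivity on the target side is obtained by counting: the contracted edges
    inject into \<open>K - X\<close>, they are as many as the elements of \<open>L - X\<close>, and
    \<open>L\<close> and \<open>K\<close> are equinumerous.\<close>
  have finLK: "finite L" "finite K" using L K fin by auto
  have "card ((\<lambda>e. tgt e) ` hide X E) = card (fst ` hide X E)"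
    using inj_src inj_tgt by (simp add: card_image)
  also have "\<dots> = card L - card X" using img_src X finLK by (simp add: card_Diff_subset finite_subset)
  also have "card L = card K" using L K by (metis card_image)
  also have "card K - card X = card (K - X)" using X finLK by (simp add: card_Diff_subset finite_subset)
  finally have "(\<lambda>e. tgt e) ` hide X E = K - X" using sub finLK by (intro card_subset_eq) auto
  with inj_src inj_tgt img_src show ?thesis by (simp add: matched_def bij_betw_def)
qed

text \<open>The matching condition is stated for arbitrary distinct names instead of vertex numbers;
  naming each vertex by its own number recovers the usual condition. A composition can then choose
  fresh names for its cut block.\<close>

definition well_typed :: "'a set \<Rightarrow> bool list \<Rightarrow> 'a multiword \<Rightarrow> bool" where
  "well_typed T bs \<sigma> \<longleftrightarrow> verts (edges \<sigma>) \<subseteq> {1..length bs} \<and> (\<forall>e\<in>edges \<sigma>. label e \<in> lists T)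
     \<and> (\<forall>c\<in>#cycles \<sigma>. \<exists>w\<in>lists T. c = cyclic w)
     \<and> (\<forall>\<nu>. distinct \<nu> \<longrightarrow> length \<nu> = length bs \<longrightarrow>
          matched (sel True bs \<nu>) (sel False bs \<nu>) (ren (at \<nu>) (edges \<sigma>)))"

lemma well_typedD:
  assumes "well_typed T bs \<sigma>"
  shows "verts (edges \<sigma>) \<subseteq> {1..length bs}"
    and "distinct \<nu> \<Longrightarrow> length \<nu> = length bs \<Longrightarrow>
      matched (sel True bs \<nu>) (sel False bs \<nu>) (ren (at \<nu>) (edges \<sigma>))"
  using assms by (auto simp: well_typed_def)

lemma at_upt: "p \<in> {1..n} \<Longrightarrow> at [1..<Suc n] p = p"
  by (auto simp: at_def simp del: upt_Suc)

lemma sel_upt: "length bs = n \<Longrightarrow> sel b bs [1..<Suc n] = {p \<in> {1..n}. at bs p = b}"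
proof -
  assume n: "length bs = n"
  have "sel b bs [1..<Suc n] = at [1..<Suc n] ` {p \<in> {1..n}. at bs p = b}"
    using n by (subst sel_at) (simp_all del: upt_Suc)
  also have "\<dots> = (\<lambda>p. p) ` {p \<in> {1..n}. at bs p = b}" by (intro image_cong refl at_upt) blast
  finally show ?thesis by simp
qed

lemma well_typed_matched:
  assumes "well_typed T bs \<sigma>"
  shows "matched {p \<in> {1..length bs}. at bs p} {p \<in> {1..length bs}. \<not> at bs p} (edges \<sigma>)"
proof -
  have "ren (at [1..<Suc (length bs)]) (edges \<sigma>) = edges \<sigma>"
    using well_typedD(1)[OF assms] by (intro ren_ident at_upt) blast
  then show ?thesis
    using well_typedD(2)[OF assms, of "[1..<Suc (length bs)]"] sel_upt[OF refl, of _ bs]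
    by (simp del: upt_Suc One_nat_def atLeastAtMost_iff)
qed

lemma well_typed_sides:
  assumes "well_typed T bs \<sigma>" "e \<in> edges \<sigma>" "e' \<in> edges \<sigma>"
  shows "tgt e \<noteq> src e'"
  using well_typed_matched[OF assms(1)] assms(2,3) unfolding matched_def bij_betw_def by blast

lemma well_typed_finite: "well_typed T bs \<sigma> \<Longrightarrow> finite (edges \<sigma>)"
  using well_typed_matched[of T bs \<sigma>] bij_betw_finite
  by (fastforce simp: matched_def)

lemma well_typedI:
  assumes "length bs = n"
    and "\<And>\<nu>. distinct \<nu> \<Longrightarrow> length \<nu> = n \<Longrightarrow>
      matched (sel True bs \<nu>) (sel False bs \<nu>) (ren (at \<nu>) (edges \<sigma>))"
    and "verts (edges \<sigma>) \<subseteq> {1..n}"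
    and "\<And>e. e \<in> edges \<sigma> \<Longrightarrow> label e \<in> lists T"
    and "\<And>c. c \<in># cycles \<sigma> \<Longrightarrow> \<exists>w\<in>lists T. c = cyclic w"
  shows "well_typed T bs \<sigma>"
  using assms by (auto simp: well_typed_def)

lemma is_multiword_iff_well_typed:
  assumes X: "is_boundary X"
  shows "is_multiword T X \<sigma> \<longleftrightarrow> well_typed T (signs X) \<sigma>"
proof
  have lefts: "lefts X = {p \<in> {1..bcard X}. at (signs X) p}"
    using X at_signs by (auto simp: is_boundary_def)
  have rights: "rights X = {p \<in> {1..bcard X}. \<not> at (signs X) p}"
    using at_signs by (auto simp: rights_def)
  {
    assume mw: "is_multiword T X \<sigma>"
    let ?E = "edges \<sigma>"
    have ends: "src e \<in> lefts X \<and> tgt e \<in> rights X" if "e \<in> ?E" for e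
      using mw that by (auto simp: is_multiword_def)
    have uniq: "\<exists>!e. e \<in> ?E \<and> (src e = v \<or> tgt e = v)" if "v \<in> {1..bcard X}" for v
      using mw that unfolding is_multiword_def by blast
    have m: "matched (lefts X) (rights X) ?E"
      unfolding matched_def bij_betw_def
    proof (intro conjI)
      show "inj_on fst ?E"
      proof (rule inj_onI)
        fix e e' assume *: "e \<in> ?E" "e' \<in> ?E" "src e = src e'"
        then have "src e \<in> {1..bcard X}" using ends lefts by blast
        from uniq[OF this] * show "e = e'" by (metis (mono_tags))
      qed
      show "inj_on (\<lambda>e. tgt e) ?E"
      proof (rule inj_onI)
        fix e e' assume *: "e \<in> ?E" "e' \<in> ?E" "tgt e = tgt e'"
        then have "tgt e \<in> {1..bcard X}" using ends rights by blast
        from uniq[OF this] * show "e = e'" by (metis (mono_tags))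
      qed
      show "fst ` ?E = lefts X"
      proof (intro equalityI subsetI)
        fix v assume v: "v \<in> lefts X"
        then obtain e where e: "e \<in> ?E" "src e = v \<or> tgt e = v" using uniq lefts by blast
        with ends[OF e(1)] v have "src e = v" by (auto simp: rights_def)
        with e show "v \<in> fst ` ?E" by auto
      qed (use ends in auto)
      show "(\<lambda>e. tgt e) ` ?E = rights X"
      proof (intro equalityI subsetI)
        fix v assume v: "v \<in> rights X"
        then obtain e where e: "e \<in> ?E" "src e = v \<or> tgt e = v" using uniq rights by blast
        with ends[OF e(1)] v have "tgt e = v" by (auto simp: rights_def)
        with e show "v \<in> (\<lambda>e. tgt e) ` ?E" by auto
      qed (use ends in auto)
    qed
    have LK: "lefts X \<union> rights X = {1..bcard X}" using lefts rights by blast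
    show "well_typed T (signs X) \<sigma>"
    proof (rule well_typedI[of _ "bcard X"])
      show "verts ?E \<subseteq> {1..bcard X}" using matched_verts[OF m] LK by simp
      fix \<nu> :: "nat list" assume \<nu>: "distinct \<nu>" "length \<nu> = bcard X"
      have "inj_on (at \<nu>) (lefts X \<union> rights X)" using LK \<nu> inj_on_at by metis
      from matched_ren[OF m this] show
        "matched (sel True (signs X) \<nu>) (sel False (signs X) \<nu>) (ren (at \<nu>) ?E)"
        using \<nu> by (simp add: sel_at lefts rights)
    qed (use mw in \<open>auto simp: is_multiword_def\<close>)
  }
  {
    assume wt: "well_typed T (signs X) \<sigma>"
    let ?E = "edges \<sigma>"
    have m: "matched (lefts X) (rights X) ?E"
      using well_typed_matched[OF wt] unfolding lefts rights by simp
    then have L: "fst ` ?E = lefts X" "inj_on fst ?E" and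
      K: "(\<lambda>e. tgt e) ` ?E = rights X" "inj_on (\<lambda>e. tgt e) ?E"
      by (auto simp: matched_def bij_betw_def)
    have disj: "lefts X \<inter> rights X = {}" by (auto simp: rights_def)
    have "\<exists>!e. e \<in> ?E \<and> (src e = v \<or> tgt e = v)" if "v \<in> {1..bcard X}" for v
    proof (cases "v \<in> lefts X")
      case True
      then obtain e where "e \<in> ?E" "src e = v" using L(1) by (metis imageE)
      moreover have "tgt e' \<noteq> v" if "e' \<in> ?E" for e' using that K(1) disj True by blast
      ultimately show ?thesis using L(2) by (metis inj_onD)
    next
      case False
      then have "v \<in> (\<lambda>e. tgt e) ` ?E" unfolding K(1) using that by (simp add: rights_def)
      then obtain e where e: "v = tgt e" "e \<in> ?E" by (rule imageE)
      moreover have "src e' \<noteq> v" if "e' \<in> ?E" for e' using that L(1) False by blast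
      ultimately show ?thesis
        by (intro ex1I[of _ e]) (use inj_onD[OF K(2), of _ e] in blast)+
    qed
    moreover have "src e \<in> lefts X \<and> tgt e \<in> rights X" if "e \<in> ?E" for e using that L(1) K(1) by blast
    ultimately show "is_multiword T X \<sigma>"
      using wt unfolding is_multiword_def well_typed_def by auto
  }
qed

section \<open>Naming the vertices of multiwords\<close>

text \<open>Empty-labelled edges that carry an interface with signs \<open>bs\<close> from the names
  \<open>\<nu>\<close> to the names \<open>\<nu>'\<close>: at a source of the old net the edge
  enters from \<open>\<nu>'\<close>, at a target it leaves to \<open>\<nu>'\<close>. This is the
  identity multiword in named form.\<close>

definition wires :: "bool list \<Rightarrow> nat list \<Rightarrow> nat list \<Rightarrow> 'a edge set" where
  "wires bs \<nu> \<nu>' = (\<lambda>(b, n, n'). if b then (n', [], n) else (n, [], n')) ` set (zip bs (zip \<nu> \<nu>'))"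

lemma wires_append:
  "length bs = length \<nu> \<Longrightarrow> length bs = length \<nu>' \<Longrightarrow>
   wires (bs @ cs) (\<nu> @ \<mu>) (\<nu>' @ \<mu>') = wires bs \<nu> \<nu>' \<union> wires cs \<mu> \<mu>'"
  by (simp add: wires_def image_Un)

lemma wires_at:
  assumes "length bs = length \<nu>" "length bs = length \<nu>'"
  shows "wires bs \<nu> \<nu>' =
    (\<lambda>k. if at bs k then (at \<nu>' k, [], at \<nu> k) else (at \<nu> k, [], at \<nu>' k)) ` {1..length bs}"
proof -
  let ?h = "\<lambda>(b, n, n'). if b then (n', [], n) else (n, [], n')"
  have len: "length (zip bs (zip \<nu> \<nu>')) = length bs" using assms by simp
  have "at (zip bs (zip \<nu> \<nu>')) k = (at bs k, at \<nu> k, at \<nu>' k)" if "k \<in> {1..length bs}" for k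
  proof -
    have "k - 1 < length bs" using that by auto
    then show ?thesis using assms by (simp add: at_def)
  qed
  then show ?thesis unfolding wires_def set_conv_at[of "zip bs (zip \<nu> \<nu>')"] len image_image
    by (intro image_cong refl) simp
qed

text \<open>Flipping the signs reverses every edge, which amounts to exchanging the two
  interfaces.\<close>

lemma wires_dual:
  assumes "length bs = length \<nu>" "length bs = length \<nu>'"
  shows "wires (map Not (rev bs)) (rev \<nu>) (rev \<nu>') = wires bs \<nu>' \<nu>"
proof -
  have "zip (map Not (rev bs)) (zip (rev \<nu>) (rev \<nu>')) =
      rev (map (\<lambda>(b, n, n'). (\<not> b, n, n')) (zip bs (zip \<nu> \<nu>')))"
    using assms by (simp add: zip_rev zip_map1 rev_map)
  moreover have "zip bs (zip \<nu>' \<nu>) = map (\<lambda>(b, n, n'). (b, n', n)) (zip bs (zip \<nu> \<nu>'))"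
    using assms by (intro nth_equalityI) auto
  ultimately show ?thesis unfolding wires_def
    by (simp only: set_rev set_map image_image) (rule image_cong, auto)
qed

lemma matched_wires:
  assumes "length bs = length \<nu>" "length bs = length \<nu>'" "distinct (\<nu> @ \<nu>')"
  shows "matched (sel True bs \<nu>' \<union> sel False bs \<nu>) (sel True bs \<nu> \<union> sel False bs \<nu>') (wires bs \<nu> \<nu>')"
  using assms(1) assms(2)[unfolded assms(1)] assms(3)
proof (induction bs \<nu> \<nu>' rule: list_induct3)
  case Nil
  then show ?case by (simp add: matched_def sel_def wires_def bij_betw_def)
next
  case (Cons b bs n \<nu> n' \<nu>')
  have cons: "sel c (b # bs) (m # \<mu>) = (if b = c then {m} else {}) \<union> sel c bs \<mu>" for c m \<mu>
    by (auto simp: sel_def)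
  let ?e = "if b then (n', [], n) else (n, [], n') :: 'a edge"
  have w: "wires (b # bs) (n # \<nu>) (n' # \<nu>') = {?e} \<union> wires bs \<nu> \<nu>'" by (auto simp: wires_def)
  have m: "matched {src ?e} {tgt ?e} {?e}" by (simp add: matched_def bij_betw_def)
  have ih: "matched (sel True bs \<nu>' \<union> sel False bs \<nu>) (sel True bs \<nu> \<union> sel False bs \<nu>') (wires bs \<nu> \<nu>' :: 'a edge set)"
    using Cons by simp
  have s: "sel c bs \<mu> \<subseteq> set \<mu>" for c \<mu> by (rule sel_subset)
  have d: "n \<notin> set \<nu>" "n \<notin> set \<nu>'" "n' \<notin> set \<nu>" "n' \<notin> set \<nu>'" using Cons.prems by auto
  have d1: "{src ?e} \<inter> (sel True bs \<nu>' \<union> sel False bs \<nu>) = {}"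
    and d2: "{tgt ?e} \<inter> (sel True bs \<nu> \<union> sel False bs \<nu>') = {}"
    using s[of True \<nu>] s[of False \<nu>] s[of True \<nu>'] s[of False \<nu>'] d by (cases b; auto)+
  have "sel True (b # bs) (n' # \<nu>') \<union> sel False (b # bs) (n # \<nu>) = {src ?e} \<union> (sel True bs \<nu>' \<union> sel False bs \<nu>)"
    "sel True (b # bs) (n # \<nu>) \<union> sel False (b # bs) (n' # \<nu>') = {tgt ?e} \<union> (sel True bs \<nu> \<union> sel False bs \<nu>')"
    unfolding cons by (cases b; auto)+
  then show ?case unfolding w using matched_Un[OF m ih d1 d2] by (simp only:)
qed

lemma verts_wires:
  assumes "length bs = length \<nu>" "length bs = length \<nu>'"
  shows "verts (wires bs \<nu> \<nu>') = set \<nu> \<union> set \<nu>'"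
  using assms(1) assms(2)[unfolded assms(1)]
proof (induction bs \<nu> \<nu>' rule: list_induct3)
  case (Cons b bs n \<nu> n' \<nu>')
  let ?e = "if b then (n', [], n) else (n, [], n') :: 'a edge"
  have w: "wires (b # bs) (n # \<nu>) (n' # \<nu>') = insert ?e (wires bs \<nu> \<nu>')" by (auto simp: wires_def)
  then show ?case unfolding w verts_insert using Cons by (cases b) auto
qed (simp add: wires_def)

section \<open>Identity, tensor and exchange under a naming\<close>

lemma edges_map_vertices [simp]: "edges (map_vertices f \<sigma>) = ren f (edges \<sigma>)"
  by (simp add: map_vertices_def ren_def)

lemma cycles_map_vertices [simp]: "cycles (map_vertices f \<sigma>) = cycles \<sigma>"
  by (simp add: map_vertices_def)

lemma edges_mw_union [simp]: "edges (mw_union \<sigma> \<tau>) = edges \<sigma> \<union> edges \<tau>"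
  by (simp add: mw_union_def)

lemma cycles_mw_union [simp]: "cycles (mw_union \<sigma> \<tau>) = cycles \<sigma> + cycles \<tau>"
  by (simp add: mw_union_def)

text \<open>The identity joins vertex \<open>k\<close> to vertex \<open>2 * bcard X + 1 - k\<close>,
  so the dual block is read backwards: position \<open>k\<close> of \<open>\<mu>\<close> meets
  position \<open>k\<close> of \<open>rev \<nu>'\<close>.\<close>

lemma ren_mw_id:
  assumes X: "is_boundary X" and len: "length \<mu> = bcard X" "length \<nu>' = bcard X"
  shows "ren (at (\<mu> @ \<nu>')) (edges (mw_id X)) = (wires (signs X) (rev \<nu>') \<mu> :: 'a edge set)"
proof -
  let ?n = "bcard X" and ?Y = "X \<otimes>\<^sub>b bdual X"
  have bY: "is_boundary ?Y" using X is_boundary_bdual is_boundary_btensor by blast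
  have cY: "bcard ?Y = 2 * ?n" by (simp add: btensor_def bdual_def)
  have sY: "signs ?Y = signs X @ map Not (rev (signs X))"
    by (simp add: signs_btensor[OF X is_boundary_bdual] signs_bdual)
  let ?w = "\<lambda>k. if at (signs X) k then (at \<mu> k, [], at (rev \<nu>') k) else (at (rev \<nu>') k, [], at \<mu> k)"
  have mirror: "at (xs @ ys) (2 * ?n + 1 - k) = at (rev ys) k"
    if "k \<in> {1..?n}" "length xs = ?n" "length ys = ?n" for k and xs ys :: "'b list"
  proof -
    have "2 * ?n + 1 - k = length xs + (?n + 1 - k)" using that by auto
    moreover have "1 \<le> ?n + 1 - k" using that by auto
    ultimately have "at (xs @ ys) (2 * ?n + 1 - k) = at ys (?n + 1 - k)" by (simp only: at_append_right)
    also have "\<dots> = at (rev ys) k" using that by (simp add: at_rev)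
    finally show ?thesis .
  qed
  have low: "at (\<mu> @ \<nu>') k = at \<mu> k" if "k \<in> {1..?n}" for k using that len by (simp add: at_append)
  have high: "at (\<mu> @ \<nu>') (2 * ?n + 1 - k) = at (rev \<nu>') k" if "k \<in> {1..?n}" for k
    using mirror[OF that len] .
  have signY: "k \<in> lefts ?Y \<longleftrightarrow> at (signs X) k" "2 * ?n + 1 - k \<in> lefts ?Y \<longleftrightarrow> \<not> at (signs X) k"
    if k: "k \<in> {1..?n}" for k
  proof -
    show "k \<in> lefts ?Y \<longleftrightarrow> at (signs X) k" using at_signs[of k ?Y] k cY by (simp add: sY at_append)
    have "at (signs ?Y) (2 * ?n + 1 - k) = at (rev (map Not (rev (signs X)))) k"
      unfolding sY by (rule mirror[OF k]) simp_all
    also have "\<dots> = at (map Not (signs X)) k" by (simp add: rev_map)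
    also have "\<dots> = (\<not> at (signs X) k)" using k by (auto simp: at_def)
    finally have "at (signs ?Y) (2 * ?n + 1 - k) = (\<not> at (signs X) k)" .
    moreover have "2 * ?n + 1 - k \<in> {1..bcard ?Y}" unfolding cY using k by auto
    ultimately show "2 * ?n + 1 - k \<in> lefts ?Y \<longleftrightarrow> \<not> at (signs X) k"
      using at_signs by blast
  qed
  have "ren (at (\<mu> @ \<nu>')) (edges (mw_id X)) =
      (\<lambda>i. (at (\<mu> @ \<nu>') i, [], at (\<mu> @ \<nu>') (2 * ?n + 1 - i)) :: 'a edge) ` lefts ?Y"
  proof -
    have "edges (mw_id X) = (\<lambda>i. (i, [], 2 * ?n + 1 - i) :: 'a edge) ` lefts ?Y" by (auto simp: mw_id_def)
    then show ?thesis by (simp only: ren_def image_image prod.case)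
  qed
  also have "\<dots> = ?w ` {1..?n}"
  proof (intro equalityI subsetI)
    fix e :: "'a edge"
    assume "e \<in> (\<lambda>i. (at (\<mu> @ \<nu>') i, [], at (\<mu> @ \<nu>') (2 * ?n + 1 - i))) ` lefts ?Y"
    then obtain i where i: "i \<in> lefts ?Y" and e: "e = (at (\<mu> @ \<nu>') i, [], at (\<mu> @ \<nu>') (2 * ?n + 1 - i))"
      by blast
    have r: "i \<in> {1..2 * ?n}" using i bY cY by (auto simp: is_boundary_def)
    show "e \<in> ?w ` {1..?n}"
    proof (cases "i \<le> ?n")
      case True
      then have k: "i \<in> {1..?n}" using r by simp
      have "e = ?w i" using e low[OF k] high[OF k] i signY(1)[OF k] by simp
      then show ?thesis using k by (rule image_eqI)
    next
      case False
      \<comment> \<open>An edge that starts in the dual block is indexed by the mirror vertex in the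
        first block.\<close>
      define k where "k = 2 * ?n + 1 - i"
      have k: "k \<in> {1..?n}" "2 * ?n + 1 - k = i" using False r by (auto simp: k_def)
      have "e = ?w k" using e low[OF k(1)] high[OF k(1)] i signY(2)[OF k(1)] unfolding k(2) k_def[symmetric]
        by simp
      then show ?thesis using k(1) by (rule image_eqI)
    qed
  next
    fix e :: "'a edge"
    assume "e \<in> ?w ` {1..?n}"
    then obtain k where k: "k \<in> {1..?n}" and e: "e = ?w k" by blast
    show "e \<in> (\<lambda>i. (at (\<mu> @ \<nu>') i, [], at (\<mu> @ \<nu>') (2 * ?n + 1 - i))) ` lefts ?Y"
    proof (cases "at (signs X) k")
      case True
      then show ?thesis using e low[OF k] high[OF k] signY(1)[OF k]
        by (intro image_eqI[of _ _ k]) simp_all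
    next
      case False
      have "2 * ?n + 1 - (2 * ?n + 1 - k) = k" using k by auto
      then show ?thesis using False e low[OF k] high[OF k] signY(2)[OF k]
        by (intro image_eqI[of _ _ "2 * ?n + 1 - k"]) simp_all
    qed
  qed
  also have "\<dots> = wires (signs X) (rev \<nu>') \<mu>" using len by (subst wires_at) simp_all
  finally show ?thesis .
qed

text \<open>The naming absorbs the renumbering of the tensor rule; what remains is the union of the
  two nets.\<close>

lemma ren_mw_tensor:
  assumes "length \<nu>d = d" "length \<nu>a = a" "length \<nu>b = b"
    and "verts (edges \<sigma>) \<subseteq> {1..m}" "verts (edges \<tau>) \<subseteq> {1..d + b}"
  shows "ren (at (\<nu>d @ \<nu>a @ \<nu>b @ \<nu>g)) (edges (mw_tensor d a b \<sigma> \<tau>)) =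
    ren (at (\<nu>a @ \<nu>g)) (edges \<sigma>) \<union> ren (at (\<nu>d @ \<nu>b)) (edges \<tau>)"
proof -
  have "(at (\<nu>d @ \<nu>a @ \<nu>b @ \<nu>g) \<circ> (\<lambda>p. if p \<le> a then p + d else p + d + b)) v = at (\<nu>a @ \<nu>g) v"
    if "1 \<le> v" for v using that assms(1-3) by (auto simp: at_append)
  then have "ren (at (\<nu>d @ \<nu>a @ \<nu>b @ \<nu>g) \<circ> (\<lambda>p. if p \<le> a then p + d else p + d + b)) (edges \<sigma>) =
      ren (at (\<nu>a @ \<nu>g)) (edges \<sigma>)"
    using assms(4) by (intro ren_cong) fastforce
  moreover have "(at (\<nu>d @ \<nu>a @ \<nu>b @ \<nu>g) \<circ> (\<lambda>p. if p \<le> d then p else p + a)) v = at (\<nu>d @ \<nu>b) v"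
    if "v \<in> {1..d + b}" for v using that assms(1-3) by (auto simp: at_append)
  then have "ren (at (\<nu>d @ \<nu>a @ \<nu>b @ \<nu>g) \<circ> (\<lambda>p. if p \<le> d then p else p + a)) (edges \<tau>) =
      ren (at (\<nu>d @ \<nu>b)) (edges \<tau>)"
    using assms(5) by (intro ren_cong) blast
  ultimately show ?thesis by (simp only: mw_tensor_def edges_mw_union edges_map_vertices ren_Un ren_ren)
qed

lemma cycles_mw_tensor: "cycles (mw_tensor d a b \<sigma> \<tau>) = cycles \<sigma> + cycles \<tau>"
  by (simp add: mw_tensor_def)

text \<open>Exchange leaves the net alone and only permutes the blocks in the list of names.\<close>

lemma ren_mw_exchange:
  assumes "length \<nu>d = d" "length \<nu>a = a" "length \<nu>b = b" "verts (edges \<sigma>) \<subseteq> {1..m}"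
  shows "ren (at (\<nu>d @ \<nu>a @ \<nu>b @ \<nu>g)) (edges (mw_exchange d b a \<sigma>)) =
    ren (at (\<nu>d @ \<nu>b @ \<nu>a @ \<nu>g)) (edges \<sigma>)"
proof -
  have "(at (\<nu>d @ \<nu>a @ \<nu>b @ \<nu>g) \<circ> (\<lambda>p. if p \<le> d then p else if p \<le> d + b then p + a
      else if p \<le> d + b + a then p - b else p)) v = at (\<nu>d @ \<nu>b @ \<nu>a @ \<nu>g) v"
    if "1 \<le> v" for v
  proof -
    consider "v \<le> d" | k where "v = d + k" "1 \<le> k" "k \<le> b"
      | k where "v = d + b + k" "1 \<le> k" "k \<le> a" | k where "v = d + b + a + k" "1 \<le> k"
    proof -
      have "v \<le> d \<or> (v = d + (v - d) \<and> 1 \<le> v - d \<and> v - d \<le> b)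
        \<or> (v = d + b + (v - d - b) \<and> 1 \<le> v - d - b \<and> v - d - b \<le> a)
        \<or> (v = d + b + a + (v - d - b - a) \<and> 1 \<le> v - d - b - a)" by linarith
      then show thesis using that by blast
    qed
    then show ?thesis using that assms(1-3) by cases (auto simp: at_append)
  qed
  then show ?thesis unfolding mw_exchange_def edges_map_vertices ren_ren
    using assms(4) by (intro ren_cong) fastforce
qed

lemma cycles_mw_exchange: "cycles (mw_exchange d b a \<sigma>) = cycles \<sigma>"
  by (simp add: mw_exchange_def)

lemma cycle_label_cyclic: "cycle_label (cyclic es) = cyclic (concat (map (\<lambda>e. label e) es))"
  by transfer (auto simp: cyc_rel_def intro: exI[of _ "[]"])

section \<open>Composition under a naming\<close>

abbreviation (input) cut_rel :: "nat \<Rightarrow> nat \<Rightarrow> (nat \<times> nat) set" where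
  "cut_rel z y \<equiv> {(p, q). p \<in> {z + 1..z + 2 * y} \<and> q \<in> {z + 1..z + 2 * y} \<and> p + q = 2 * (z + y) + 1}"

abbreviation (input) cut_base :: "nat \<Rightarrow> nat \<Rightarrow> 'a multiword \<Rightarrow> 'a multiword \<Rightarrow> 'a multiword" where
  "cut_base z y \<tau> \<sigma> \<equiv> mw_union \<tau> (map_vertices (\<lambda>p. p + (z + y)) \<sigma>)"

lemma Field_cut_rel: "Field (cut_rel z y) = {z + 1..z + 2 * y}"
proof (intro equalityI subsetI)
  fix p assume p: "p \<in> {z + 1..z + 2 * y}"
  then have "(p, 2 * (z + y) + 1 - p) \<in> cut_rel z y" by auto
  then show "p \<in> Field (cut_rel z y)" by (rule FieldI1)
qed (auto simp: Field_def)

text \<open>The juxtaposition of the two multiwords contains the cut block twice, the first time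
  reversed. Giving both copies the names \<open>\<nu>a\<close> identifies exactly the glued pairs,
  and outside the cut the naming agrees with the final renumbering.\<close>

lemma at_cut:
  assumes "distinct (\<nu>d @ \<nu>a @ \<nu>g)" "length \<nu>d = z" "length \<nu>a = y" "length \<nu>g = g"
    and p: "p \<in> {1..z + 2 * y + g}"
  defines "\<eta> \<equiv> at (\<nu>d @ rev \<nu>a @ \<nu>a @ \<nu>g)"
  shows "\<eta> p \<in> set \<nu>a \<longleftrightarrow> p \<in> {z + 1..z + 2 * y}"
    and "q \<in> {1..z + 2 * y + g} \<Longrightarrow> \<eta> p \<in> set \<nu>a \<Longrightarrow>
      \<eta> p = \<eta> q \<longleftrightarrow> p = q \<or> (p, q) \<in> cut_rel z y"
    and "p \<notin> {z + 1..z + 2 * y} \<Longrightarrow> \<eta> p = at (\<nu>d @ \<nu>g) (if p \<le> z then p else p - 2 * y)"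
proof -
  \<comment> \<open>The position in \<open>\<nu>a\<close> of a vertex of either cut block; the first
    block is named by \<open>rev \<nu>a\<close>.\<close>
  define k where "k p = (if p \<le> z + y then z + y + 1 - p else p - (z + y))" for p
  have in_cut: "\<eta> p = at \<nu>a (k p) \<and> k p \<in> {1..y}" if "p \<in> {z + 1..z + 2 * y}" for p
  proof (cases "p \<le> z + y")
    case True
    then have "\<eta> p = at (rev \<nu>a) (p - z)" using that assms(2,3) by (auto simp: \<eta>_def at_append)
    also have "\<dots> = at \<nu>a (y + 1 - (p - z))" using True that assms(3) by (subst at_rev) auto
    also have "y + 1 - (p - z) = k p" using True that by (simp add: k_def)
    finally show ?thesis using True that by (auto simp: k_def)
  next
    case False
    then show ?thesis using that assms(2,3) by (auto simp: \<eta>_def at_append k_def)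
  qed
  have out_cut: "\<eta> p = at (\<nu>d @ \<nu>g) (if p \<le> z then p else p - 2 * y) \<and> \<eta> p \<in> set \<nu>d \<union> set \<nu>g"
    if "p \<notin> {z + 1..z + 2 * y}" "p \<in> {1..z + 2 * y + g}" for p
  proof (cases "p \<le> z")
    case True
    then have "\<eta> p = at \<nu>d p" using that assms(2) by (simp add: \<eta>_def at_append)
    with True that show ?thesis using assms(2) at_in_set[of p \<nu>d] by (auto simp: at_append)
  next
    case False
    then have "z + 2 * y < p" using that(1) by auto
    define j where "j = p - (z + 2 * y)"
    have j: "p = z + 2 * y + j" "1 \<le> j" "j \<le> g"
      using that \<open>z + 2 * y < p\<close> by (auto simp: j_def)
    then have "\<eta> p = at \<nu>g j" using assms(2,3) by (simp add: \<eta>_def at_append)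
    with j show ?thesis using assms(2,3,4) at_in_set[of j \<nu>g] by (auto simp: at_append)
  qed
  show 1: "\<eta> p \<in> set \<nu>a \<longleftrightarrow> p \<in> {z + 1..z + 2 * y}"
  proof
    assume "p \<in> {z + 1..z + 2 * y}"
    then show "\<eta> p \<in> set \<nu>a" using in_cut[of p] at_in_set[of "k p" \<nu>a] assms(3) by auto
  next
    assume "\<eta> p \<in> set \<nu>a"
    then show "p \<in> {z + 1..z + 2 * y}" using out_cut[OF _ p] assms(1) by auto
  qed
  show "\<eta> p = at (\<nu>d @ \<nu>g) (if p \<le> z then p else p - 2 * y)" if "p \<notin> {z + 1..z + 2 * y}"
    using out_cut[OF that p] by blast
  show "\<eta> p = \<eta> q \<longleftrightarrow> p = q \<or> (p, q) \<in> cut_rel z y"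
    if q: "q \<in> {1..z + 2 * y + g}" and pa: "\<eta> p \<in> set \<nu>a"
  proof (cases "q \<in> {z + 1..z + 2 * y}")
    case True
    have p': "p \<in> {z + 1..z + 2 * y}" using pa 1 by simp
    have "\<eta> p = \<eta> q \<longleftrightarrow> k p = k q"
      using in_cut[OF p'] in_cut[OF True] at_eq_iff[of \<nu>a "k p" "k q"] assms(1,3) by simp
    also have "\<dots> \<longleftrightarrow> p = q \<or> p + q = 2 * (z + y) + 1"
      using p' True by (auto simp: k_def split: if_splits)
    finally show ?thesis using p' True by simp
  next
    case False
    then have "\<eta> q \<notin> set \<nu>a" using out_cut[OF False q] assms(1) by auto
    then show ?thesis using pa False by auto
  qed
qed

lemma glued_edges_ends:
  assumes "e \<in> glued_edges R E"
  shows "src e \<in> verts E - Field R" "tgt e \<in> verts E - Field R"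
proof -
  obtain es where es: "es \<noteq> []" "set es \<subseteq> E" "src (hd es) \<notin> Field R" "tgt (last es) \<notin> Field R"
    and e: "e = (src (hd es), concat (map (\<lambda>e. label e) es), tgt (last es))"
    using assms by (auto simp: glued_edges_def glued_paths_def)
  have "hd es \<in> E" "last es \<in> E" using es by auto
  then show "src e \<in> verts E - Field R" "tgt e \<in> verts E - Field R"
    using es(3,4) src_in_verts[of "hd es" E] tgt_in_verts[of "last es" E] unfolding e by simp_all
qed

text \<open>Cut in named form: the two nets share the names \<open>\<nu>a\<close> of the cut
  formula, reversed on the side of its dual. Composition is their union with \<open>\<nu>a\<close>
  hidden, and a cycle closed by the gluing shows up as a closed walk in the union.\<close>

lemma mw_comp_naming:
  assumes \<sigma>: "well_typed T bs \<sigma>" "length bs = y + g" and \<tau>: "well_typed T bs' \<tau>" "length bs' = z + y"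
    and d: "distinct (\<nu>d @ \<nu>a @ \<nu>g)" and len: "length \<nu>d = z" "length \<nu>a = y" "length \<nu>g = g"
  defines "E \<equiv> ren (at (\<nu>d @ rev \<nu>a)) (edges \<tau>) \<union> ren (at (\<nu>a @ \<nu>g)) (edges \<sigma>)"
  shows "ren (at (\<nu>d @ \<nu>g)) (edges (mw_comp z y \<tau> \<sigma>)) = hide (set \<nu>a) E"
    and "glued_cycles (cut_rel z y) (edges (cut_base z y \<tau> \<sigma>)) \<noteq> {} \<Longrightarrow>
      \<exists>p. p \<noteq> [] \<and> set p \<subseteq> E \<and> successively (\<lambda>e e'. tgt e = src e') p \<and> tgt (last p) = src (hd p)"
    and "verts (edges (mw_comp z y \<tau> \<sigma>)) \<subseteq> {1..z + g}"
proof -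
  let ?M = "edges (cut_base z y \<tau> \<sigma>)" and ?R = "cut_rel z y"
  let ?\<eta> = "at (\<nu>d @ rev \<nu>a @ \<nu>a @ \<nu>g)"
  let ?f = "\<lambda>p. if p \<le> z then p else p - 2 * y"
  have v\<sigma>: "verts (edges \<sigma>) \<subseteq> {1..y + g}" and v\<tau>: "verts (edges \<tau>) \<subseteq> {1..z + y}"
    using well_typedD(1)[OF \<sigma>(1)] well_typedD(1)[OF \<tau>(1)] \<sigma>(2) \<tau>(2) by auto
  have vM: "verts ?M \<subseteq> {1..z + 2 * y + g}"
    using v\<sigma> v\<tau> by (force simp: verts_ren)
  have "ren ?\<eta> (edges \<tau>) = ren (at (\<nu>d @ rev \<nu>a)) (edges \<tau>)"
  proof (rule ren_cong)
    fix v assume "v \<in> verts (edges \<tau>)"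
    then have "v \<in> {1..z + y}" using v\<tau> by blast
    then show "?\<eta> v = at (\<nu>d @ rev \<nu>a) v" using len by (auto simp: at_append)
  qed
  moreover have "ren (?\<eta> \<circ> (\<lambda>p. p + (z + y))) (edges \<sigma>) = ren (at (\<nu>a @ \<nu>g)) (edges \<sigma>)"
  proof (rule ren_cong)
    fix v assume "v \<in> verts (edges \<sigma>)"
    then have "1 \<le> v" using v\<sigma> by force
    then show "(?\<eta> \<circ> (\<lambda>p. p + (z + y))) v = at (\<nu>a @ \<nu>g) v" using len by (auto simp: at_append)
  qed
  ultimately have M: "ren ?\<eta> ?M = E" by (simp only: edges_mw_union edges_map_vertices ren_Un ren_ren E_def)
  have ends: "src e \<in> {1..z + 2 * y + g}" "tgt e \<in> {1..z + 2 * y + g}" if "e \<in> ?M" for e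
    using vM src_in_verts[OF that] tgt_in_verts[OF that] by blast+
  \<comment> \<open>Equal names inside the cut mean glued or identical vertices. The second
    possibility cannot occur between a target and a source, since each vertex carries an end of one
    kind only.\<close>
  have sides: "tgt e \<noteq> src e'" if e: "e \<in> ?M" and e': "e' \<in> ?M" for e e'
  proof -
    have split: "x \<in> edges \<tau> \<and> src x \<le> z + y \<and> tgt x \<le> z + y \<or>
        (\<exists>x'\<in>edges \<sigma>. src x = src x' + (z + y) \<and> tgt x = tgt x' + (z + y) \<and> 1 \<le> src x' \<and> 1 \<le> tgt x')"
      if x: "x \<in> ?M" for x
    proof (cases "x \<in> edges \<tau>")
      case True
      then show ?thesis using v\<tau> src_in_verts[OF True] tgt_in_verts[OF True] by auto
    next
      case False
      then obtain x' where x': "x' \<in> edges \<sigma>" "x = (\<lambda>(i, w, j). (i + (z + y), w, j + (z + y))) x'"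
        using x unfolding edges_mw_union edges_map_vertices ren_def by blast
      then show ?thesis using v\<sigma> src_in_verts[OF x'(1)] tgt_in_verts[OF x'(1)]
        by (intro disjI2 bexI[of _ x']) (auto simp: split_beta)
    qed
    from split[OF e] split[OF e'] show ?thesis
      using well_typed_sides[OF \<sigma>(1)] well_typed_sides[OF \<tau>(1)] by (elim disjE bexE conjE) auto
  qed
  have R: "(tgt e, src e') \<in> ?R \<longleftrightarrow> ?\<eta> (tgt e) = ?\<eta> (src e') \<and> ?\<eta> (tgt e) \<in> set \<nu>a"
    if e: "e \<in> ?M" and e': "e' \<in> ?M" for e e'
  proof -
    have "(tgt e, src e') \<in> ?R \<Longrightarrow> ?\<eta> (tgt e) \<in> set \<nu>a"
      using at_cut(1)[OF d len ends(2)[OF e]] by simp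
    moreover have "?\<eta> (tgt e) \<in> set \<nu>a \<Longrightarrow> ?\<eta> (tgt e) = ?\<eta> (src e') \<longleftrightarrow> (tgt e, src e') \<in> ?R"
      using at_cut(2)[OF d len ends(2)[OF e] ends(1)[OF e']] sides[OF e e'] by simp
    ultimately show ?thesis by blast
  qed
  have "ren ?\<eta> (glued_edges ?R ?M) = hide (set \<nu>a) (ren ?\<eta> ?M)"
    using at_cut(1)[OF d len] ends
    by (intro ren_glued_edges R) (simp_all only: Field_cut_rel)
  moreover have "ren (at (\<nu>d @ \<nu>g) \<circ> ?f) (glued_edges ?R ?M) = ren ?\<eta> (glued_edges ?R ?M)"
  proof (rule ren_cong)
    fix v assume "v \<in> verts (glued_edges ?R ?M)"
    then have "v \<in> verts ?M - Field ?R" using glued_edges_ends unfolding verts_def by blast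
    then have "v \<in> {1..z + 2 * y + g}" "v \<notin> {z + 1..z + 2 * y}" using vM by (auto simp only: Field_cut_rel)
    then show "(at (\<nu>d @ \<nu>g) \<circ> ?f) v = ?\<eta> v" using at_cut(3)[OF d len] by simp
  qed
  moreover have eq: "edges (mw_comp z y \<tau> \<sigma>) = ren ?f (glued_edges ?R ?M)"
    by (simp add: mw_comp_def glue_def)
  ultimately show "ren (at (\<nu>d @ \<nu>g)) (edges (mw_comp z y \<tau> \<sigma>)) = hide (set \<nu>a) E"
    by (simp only: ren_ren M)
  show "\<exists>p. p \<noteq> [] \<and> set p \<subseteq> E \<and> successively (\<lambda>e e'. tgt e = src e') p \<and> tgt (last p) = src (hd p)"
    if "glued_cycles ?R ?M \<noteq> {}"
    using glued_cycle_closed[of ?M ?R ?\<eta>, OF _ that] R M by blast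
  show "verts (edges (mw_comp z y \<tau> \<sigma>)) \<subseteq> {1..z + g}"
  proof
    fix v assume "v \<in> verts (edges (mw_comp z y \<tau> \<sigma>))"
    then obtain u where u: "u \<in> verts (glued_edges ?R ?M)" "v = ?f u" unfolding eq verts_ren by blast
    then have "u \<in> verts ?M - Field ?R" using glued_edges_ends unfolding verts_def by blast
    then have "u \<in> {1..z + 2 * y + g}" "u \<notin> {z + 1..z + 2 * y}" using vM by (auto simp only: Field_cut_rel)
    then show "v \<in> {1..z + g}" using u by auto
  qed
qed

lemma cycles_mw_comp:
  "cycles (mw_comp z y \<tau> \<sigma>) = cycles \<tau> + cycles \<sigma>
    + image_mset cycle_label (mset_set (glued_cycles (cut_rel z y) (edges (cut_base z y \<tau> \<sigma>))))"
  by (simp add: mw_comp_def glue_def)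

lemma labels_mw_comp:
  assumes "\<And>e. e \<in> edges \<sigma> \<Longrightarrow> label e \<in> lists T" "\<And>e. e \<in> edges \<tau> \<Longrightarrow> label e \<in> lists T"
  shows "e \<in> edges (mw_comp z y \<tau> \<sigma>) \<Longrightarrow> label e \<in> lists T"
    and "(\<And>c. c \<in># cycles \<sigma> \<Longrightarrow> \<exists>w\<in>lists T. c = cyclic w) \<Longrightarrow>
      (\<And>c. c \<in># cycles \<tau> \<Longrightarrow> \<exists>w\<in>lists T. c = cyclic w) \<Longrightarrow>
      c \<in># cycles (mw_comp z y \<tau> \<sigma>) \<Longrightarrow> \<exists>w\<in>lists T. c = cyclic w"
proof -
  let ?M = "edges (cut_base z y \<tau> \<sigma>)" and ?R = "cut_rel z y"
  have lab: "label e \<in> lists T" if "e \<in> ?M" for e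
  proof -
    have "e \<in> edges \<tau> \<or> (\<exists>e'\<in>edges \<sigma>. label e = label e')"
      using that by (force simp: ren_def)
    then show ?thesis using assms by metis
  qed
  have path: "concat (map (\<lambda>e. label e) es) \<in> lists T" if "es \<in> glued_paths ?R ?M" for es
  proof -
    have "set es \<subseteq> ?M" using that by (simp add: glued_paths_def)
    then show ?thesis using lab by (induction es) auto
  qed
  show "label e \<in> lists T" if e: "e \<in> edges (mw_comp z y \<tau> \<sigma>)" for e
  proof -
    have "e \<in> ren (\<lambda>p. if p \<le> z then p else p - 2 * y) (glued_edges ?R ?M)"
      using e by (simp add: mw_comp_def glue_def)
    then obtain e' where e': "e' \<in> glued_edges ?R ?M" "label e = label e'" by (auto simp: ren_def)
    then obtain es where "es \<in> glued_paths ?R ?M" "label e' = concat (map (\<lambda>e. label e) es)"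
      unfolding glued_edges_def by auto
    then show ?thesis using path e'(2) by (simp only:)
  qed
  show "\<exists>w\<in>lists T. c = cyclic w"
    if "\<And>c. c \<in># cycles \<sigma> \<Longrightarrow> \<exists>w\<in>lists T. c = cyclic w"
      "\<And>c. c \<in># cycles \<tau> \<Longrightarrow> \<exists>w\<in>lists T. c = cyclic w" "c \<in># cycles (mw_comp z y \<tau> \<sigma>)"
  proof -
    have "c \<in># cycles \<tau> \<or> c \<in># cycles \<sigma> \<or> c \<in> cycle_label ` glued_cycles ?R ?M"
    proof -
      have "set_mset (mset_set C) \<subseteq> C" for C :: "'a edge cyclic_word set"
        by (cases "finite C") auto
      then show ?thesis using that(3) unfolding cycles_mw_comp set_mset_union multiset.set_map by blast
    qed
    then show ?thesis
    proof (elim disjE)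
      assume "c \<in> cycle_label ` glued_cycles ?R ?M"
      then obtain es where "es \<in> glued_paths ?R ?M" "c = cycle_label (cyclic es)"
        unfolding glued_cycles_def by blast
      then show ?thesis using path cycle_label_cyclic by blast
    qed (use that in auto)
  qed
qed

section \<open>Derivable multiwords are well typed\<close>

lemma split_length:
  assumes "length xs = a + b"
  obtains ys zs where "xs = ys @ zs" "length ys = a" "length zs = b"
  by (rule that[of "take a xs" "drop a xs"]) (use assms in auto)

lemma split_length4:
  assumes "length xs = a + (b + (c + d))"
  obtains x1 x2 x3 x4 where "xs = x1 @ x2 @ x3 @ x4" "length x1 = a" "length x2 = b" "length x3 = c" "length x4 = d"
proof -
  obtain x1 y1 where 1: "xs = x1 @ y1" "length x1 = a" "length y1 = b + (c + d)" using split_length[OF assms] .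
  obtain x2 y2 where 2: "y1 = x2 @ y2" "length x2 = b" "length y2 = c + d" using split_length[OF 1(3)] .
  obtain x3 x4 where 3: "y2 = x3 @ x4" "length x3 = c" "length x4 = d" using split_length[OF 2(3)] .
  show thesis using that 1 2 3 by simp
qed

lemma fresh_list:
  assumes "finite (S :: nat set)"
  obtains \<nu> where "distinct \<nu>" "length \<nu> = n" "set \<nu> \<inter> S = {}"
proof -
  obtain m where m: "\<forall>x\<in>S. x < m" using assms finite_nat_set_iff_bounded by auto
  show thesis by (rule that[of "[m..<m + n]"]) (use m in auto)
qed

lemma well_typed_labels: "well_typed T bs \<sigma> \<Longrightarrow> e \<in> edges \<sigma> \<Longrightarrow> label e \<in> lists T"
  unfolding well_typed_def by blast

lemma well_typed_cycles: "well_typed T bs \<sigma> \<Longrightarrow> c \<in># cycles \<sigma> \<Longrightarrow> \<exists>w\<in>lists T. c = cyclic w"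
  unfolding well_typed_def by blast

lemma ren_label: "e \<in> ren f E \<Longrightarrow> \<exists>e'\<in>E. label e = label e'"
  by (force simp: ren_def)

text \<open>\<open>bnd\<close> speaks about all literals, also those outside the grammar, so the
  boundary laws hold for every formula without a membership condition.\<close>

locale llg_signs =
  fixes G :: "('l, 'a) llg"
  assumes bnd: "\<And>P. is_boundary (lit_bound G P)"
    and lex: "\<And>\<sigma> \<Gamma>. (\<sigma>, \<Gamma>) \<in> lexicon G \<Longrightarrow> well_typed (alphabet G) (signs (sbound (lit_bound G) \<Gamma>)) \<sigma>"
begin

abbreviation fs :: "'l form \<Rightarrow> bool list" where "fs A \<equiv> signs (fbound (lit_bound G) A)"
abbreviation ss :: "'l form list \<Rightarrow> bool list" where "ss \<Gamma> \<equiv> signs (sbound (lit_bound G) \<Gamma>)"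

lemma is_boundary_f: "is_boundary (fbound (lit_bound G) A)"
  by (rule is_boundary_fbound) (rule bnd)

lemma is_boundary_s: "is_boundary (sbound (lit_bound G) \<Gamma>)"
  by (induction \<Gamma>) (auto simp: is_boundary_f intro: is_boundary_btensor, simp add: is_boundary_def)

lemma fs_dual: "fs (dual A) = map Not (rev (fs A))"
  using fbound_dual[of A "lit_bound G"] bnd by (simp add: signs_bdual)

lemma fs_Tensor: "fs (A \<otimes>\<^sub>f B) = fs A @ fs B"
  by (simp add: signs_btensor is_boundary_f)

lemma fs_Par: "fs (Par A B) = fs B @ fs A"
  by (simp add: signs_btensor is_boundary_f)

lemma ss_Cons: "ss (A # \<Gamma>) = ss \<Gamma> @ fs A"
  by (simp add: signs_btensor is_boundary_f is_boundary_s)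

lemma ss_Nil: "ss [] = []"
  by (simp add: signs_def)

lemma ss_append: "ss (\<Gamma> @ \<Delta>) = ss \<Delta> @ ss \<Gamma>"
  by (induction \<Gamma>) (simp_all only: ss_Cons ss_Nil append_Nil append_Cons append_Nil2 append_assoc)

lemma fcard_dual: "fcard G (dual A) = fcard G A"
  using arg_cong[OF fs_dual[of A], of length] by simp

lemma scard_append: "scard G (\<Gamma> @ \<Delta>) = scard G \<Delta> + scard G \<Gamma>"
  using arg_cong[OF ss_append[of \<Gamma> \<Delta>], of length] by simp

lemma scard_Cons: "scard G (A # \<Gamma>) = scard G \<Gamma> + fcard G A"
  using arg_cong[OF ss_Cons[of A \<Gamma>], of length] by simp

lemma scard_Nil: "scard G [] = 0"
  by simp

text \<open>Perfect matchings are preserved by every rule. The substantial case is Cut, where fresh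
  names of the cut formula are matched in both premises, become sources and targets at once, and are
  hidden.\<close>

lemma derivable_well_typed: "derivable G \<sigma> \<Gamma> \<Longrightarrow> well_typed (alphabet G) (ss \<Gamma>) \<sigma>"
proof (induction rule: derivable.induct)
  case (Lex \<sigma> \<Gamma>)
  then show ?case by (rule lex)
next
  case (Id A)
  let ?X = "fbound (lit_bound G) A" and ?\<sigma> = "mw_id (fbound (lit_bound G) A) :: 'a multiword"
  have s: "ss [dual A, A] = fs A @ map Not (rev (fs A))" by (simp only: ss_Cons ss_Nil fs_dual append_Nil)
  have m: "matched (sel True (ss [dual A, A]) \<nu>) (sel False (ss [dual A, A]) \<nu>) (ren (at \<nu>) (edges ?\<sigma>))"
    if d: "distinct \<nu>" and l: "length \<nu> = bcard ?X + bcard ?X" for \<nu>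
  proof -
    obtain \<mu> \<nu>' where \<nu>: "\<nu> = \<mu> @ \<nu>'" and len: "length \<mu> = bcard ?X" "length \<nu>' = bcard ?X"
      using split_length[OF l] .
    have sel: "sel b (ss [dual A, A]) \<nu> = sel b (fs A) \<mu> \<union> sel (\<not> b) (fs A) (rev \<nu>')" for b
      unfolding s \<nu> using len sel_dual[of "fs A" "rev \<nu>'" b] by (simp add: sel_append)
    show ?thesis unfolding sel unfolding \<nu> ren_mw_id[OF is_boundary_f len]
      using matched_wires[of "fs A" "rev \<nu>'" \<mu>] len d \<nu> by (auto simp: Un_commute)
  qed
  show ?case
  proof (rule well_typedI)
    show "length (ss [dual A, A]) = bcard ?X + bcard ?X" unfolding s by simp
    show "verts (edges ?\<sigma>) \<subseteq> {1..bcard ?X + bcard ?X}"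
    proof -
      have "i \<in> {1..2 * bcard ?X}" if "i \<in> lefts (?X \<otimes>\<^sub>b bdual ?X)" for i
      proof -
        have "bcard (?X \<otimes>\<^sub>b bdual ?X) = 2 * bcard ?X" by (simp add: btensor_def bdual_def)
        then show ?thesis
          using that is_boundary_btensor[OF is_boundary_f[of A] is_boundary_bdual[of ?X]]
          unfolding is_boundary_def by auto
      qed
      note range = this
      show ?thesis
      proof
        fix v assume "v \<in> verts (edges ?\<sigma>)"
        then obtain i where "i \<in> lefts (?X \<otimes>\<^sub>b bdual ?X)" "v = i \<or> v = 2 * bcard ?X + 1 - i"
          unfolding mw_id_def verts_def by auto
        then show "v \<in> {1..bcard ?X + bcard ?X}" using range[of i] by auto
      qed
    qed
  qed (use m in \<open>auto simp: mw_id_def\<close>)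
next
  case (Cut \<sigma> \<Gamma> A \<tau> \<Delta>)
  let ?z = "scard G \<Delta>" and ?y = "fcard G A" and ?g = "scard G \<Gamma>"
  have s\<sigma>: "ss (\<Gamma> @ [A]) = fs A @ ss \<Gamma>" by (simp only: ss_append ss_Cons ss_Nil append_Nil)
  have s\<tau>: "ss (dual A # \<Delta>) = ss \<Delta> @ map Not (rev (fs A))" by (simp only: ss_Cons fs_dual)
  have wt: "well_typed (alphabet G) (ss (\<Gamma> @ [A])) \<sigma>" "well_typed (alphabet G) (ss (dual A # \<Delta>)) \<tau>"
    by (fact Cut.IH)+
  have l: "length (ss (\<Gamma> @ [A])) = ?y + ?g" "length (ss (dual A # \<Delta>)) = ?z + ?y"
    unfolding s\<sigma> s\<tau> by simp_all
  have naming: "ren (at (\<nu>d @ \<nu>g)) (edges (mw_comp ?z ?y \<tau> \<sigma>)) = hide (set \<nu>a)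
      (ren (at (\<nu>d @ rev \<nu>a)) (edges \<tau>) \<union> ren (at (\<nu>a @ \<nu>g)) (edges \<sigma>))"
    "verts (edges (mw_comp ?z ?y \<tau> \<sigma>)) \<subseteq> {1..?z + ?g}"
    if "distinct (\<nu>d @ \<nu>a @ \<nu>g)" "length \<nu>d = ?z" "length \<nu>a = ?y" "length \<nu>g = ?g" for \<nu>d \<nu>a \<nu>g
    using mw_comp_naming(1,3)[OF wt(1) l(1) wt(2) l(2) that] by blast+
  show ?case
  proof (rule well_typedI)
    show "length (ss (\<Gamma> @ \<Delta>)) = ?z + ?g" unfolding ss_append by simp
    show "verts (edges (mw_comp ?z ?y \<tau> \<sigma>)) \<subseteq> {1..?z + ?g}"
    proof -
      obtain \<nu> :: "nat list" where \<nu>: "distinct \<nu>" "length \<nu> = ?z + (?y + ?g)"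
        using fresh_list[of "{}"] by blast
      obtain \<nu>d \<mu> where 1: "\<nu> = \<nu>d @ \<mu>" "length \<nu>d = ?z" "length \<mu> = ?y + ?g" using split_length[OF \<nu>(2)] .
      obtain \<nu>a \<nu>g where 2: "\<mu> = \<nu>a @ \<nu>g" "length \<nu>a = ?y" "length \<nu>g = ?g" using split_length[OF 1(3)] .
      show ?thesis using naming(2)[of \<nu>d \<nu>a \<nu>g] \<nu> 1 2 by simp
    qed
    fix \<nu> :: "nat list" assume d: "distinct \<nu>" and "length \<nu> = ?z + ?g"
    then obtain \<nu>d \<nu>g where \<nu>: "\<nu> = \<nu>d @ \<nu>g" "length \<nu>d = ?z" "length \<nu>g = ?g"
      using split_length by blast
    obtain \<nu>a where \<nu>a: "distinct \<nu>a" "length \<nu>a = ?y" "set \<nu>a \<inter> set \<nu> = {}"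
      using fresh_list[of "set \<nu>"] by blast
    have dist: "distinct (\<nu>d @ \<nu>a @ \<nu>g)" using d \<nu> \<nu>a by auto
    let ?E = "ren (at (\<nu>d @ rev \<nu>a)) (edges \<tau>)" and ?F = "ren (at (\<nu>a @ \<nu>g)) (edges \<sigma>)"
    have sel\<sigma>: "sel b (ss (\<Gamma> @ [A])) (\<nu>a @ \<nu>g) = sel b (fs A) \<nu>a \<union> sel b (ss \<Gamma>) \<nu>g" for b
      unfolding s\<sigma> using \<nu>a by (simp add: sel_append)
    have sel\<tau>: "sel b (ss (dual A # \<Delta>)) (\<nu>d @ rev \<nu>a) = sel b (ss \<Delta>) \<nu>d \<union> sel (\<not> b) (fs A) \<nu>a" for b
      unfolding s\<tau> using \<nu>a \<nu> by (simp add: sel_append sel_dual)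
    have sel: "sel b (ss (\<Gamma> @ \<Delta>)) \<nu> = sel b (ss \<Delta>) \<nu>d \<union> sel b (ss \<Gamma>) \<nu>g" for b
      unfolding ss_append \<nu>(1) using \<nu>(2) by (simp add: sel_append)
    have mF: "matched (sel True (fs A) \<nu>a \<union> sel True (ss \<Gamma>) \<nu>g) (sel False (fs A) \<nu>a \<union> sel False (ss \<Gamma>) \<nu>g) ?F"
      using well_typedD(2)[OF wt(1), of "\<nu>a @ \<nu>g"] dist l(1) \<nu> \<nu>a unfolding sel\<sigma> by simp
    have mE: "matched (sel True (ss \<Delta>) \<nu>d \<union> sel False (fs A) \<nu>a) (sel False (ss \<Delta>) \<nu>d \<union> sel True (fs A) \<nu>a) ?E"
      using well_typedD(2)[OF wt(2), of "\<nu>d @ rev \<nu>a"] dist l(2) \<nu> \<nu>a unfolding sel\<tau> by auto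
    have sub: "sel b (ss \<Delta>) \<nu>d \<subseteq> set \<nu>d" "sel b (ss \<Gamma>) \<nu>g \<subseteq> set \<nu>g" "sel b (fs A) \<nu>a \<subseteq> set \<nu>a" for b
      by (rule sel_subset)+
    have dis: "sel True (fs A) \<nu>a \<inter> sel False (fs A) \<nu>a = {}"
      using sel_disjoint[OF \<nu>a(1), of True] by simp
    have all: "sel True (fs A) \<nu>a \<union> sel False (fs A) \<nu>a = set \<nu>a"
      using sel_Un[of "fs A" \<nu>a True] \<nu>a(2) by simp
    have dd: "set \<nu>d \<inter> set \<nu>a = {}" "set \<nu>d \<inter> set \<nu>g = {}" "set \<nu>a \<inter> set \<nu>g = {}" using dist by auto
    \<comment> \<open>Duality flips signs, so a cut name is a source in one net and a target in the
      other; all of \<open>\<nu>a\<close> lies in both \<open>?L\<close> and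
      \<open>?K\<close>.\<close>
    let ?L = "(sel True (ss \<Delta>) \<nu>d \<union> sel False (fs A) \<nu>a) \<union> (sel True (fs A) \<nu>a \<union> sel True (ss \<Gamma>) \<nu>g)"
    let ?K = "(sel False (ss \<Delta>) \<nu>d \<union> sel True (fs A) \<nu>a) \<union> (sel False (fs A) \<nu>a \<union> sel False (ss \<Gamma>) \<nu>g)"
    have "matched ?L ?K (?E \<union> ?F)"
      using dis sub dd by (intro matched_Un[OF mE mF]) blast+
    moreover have "finite (?E \<union> ?F)"
      using well_typed_finite[OF wt(1)] well_typed_finite[OF wt(2)] by (simp add: ren_def)
    ultimately have "matched (?L - set \<nu>a) (?K - set \<nu>a) (hide (set \<nu>a) (?E \<union> ?F))"
      using all by (intro matched_hide) blast+
    moreover have "?L - set \<nu>a = sel True (ss (\<Gamma> @ \<Delta>)) \<nu>" "?K - set \<nu>a = sel False (ss (\<Gamma> @ \<Delta>)) \<nu>"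
      unfolding sel using sub dd by blast+
    ultimately show "matched (sel True (ss (\<Gamma> @ \<Delta>)) \<nu>) (sel False (ss (\<Gamma> @ \<Delta>)) \<nu>)
        (ren (at \<nu>) (edges (mw_comp ?z ?y \<tau> \<sigma>)))"
      unfolding \<nu>(1) using naming(1)[OF dist \<nu>(2) \<nu>a(2) \<nu>(3)] by (simp only:)
  next
    show "label e \<in> lists (alphabet G)" if "e \<in> edges (mw_comp ?z ?y \<tau> \<sigma>)" for e
      by (rule labels_mw_comp(1)[OF well_typed_labels[OF wt(1)] well_typed_labels[OF wt(2)] that])
    show "\<exists>w\<in>lists (alphabet G). c = cyclic w" if "c \<in># cycles (mw_comp ?z ?y \<tau> \<sigma>)" for c
      by (rule labels_mw_comp(2)[OF well_typed_labels[OF wt(1)] well_typed_labels[OF wt(2)]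
            well_typed_cycles[OF wt(1)] well_typed_cycles[OF wt(2)] that])
  qed
next
  case (Ex \<sigma> \<Gamma> A B \<Delta>)
  let ?d = "scard G \<Delta>" and ?a = "fcard G A" and ?b = "fcard G B" and ?g = "scard G \<Gamma>"
  have s: "ss (\<Gamma> @ [A, B] @ \<Delta>) = ss \<Delta> @ fs B @ fs A @ ss \<Gamma>" for A B
    by (simp only: ss_append ss_Cons ss_Nil append_Nil append_assoc append_Cons)
  have wt: "well_typed (alphabet G) (ss (\<Gamma> @ [A, B] @ \<Delta>)) \<sigma>" by (fact Ex.IH)
  have v: "verts (edges \<sigma>) \<subseteq> {1..?d + (?b + (?a + ?g))}"
    using well_typedD(1)[OF wt] unfolding s by simp
  show ?case
  proof (rule well_typedI)
    show "length (ss (\<Gamma> @ [B, A] @ \<Delta>)) = ?d + (?a + (?b + ?g))" unfolding s by simp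
    show "verts (edges (mw_exchange ?d ?b ?a \<sigma>)) \<subseteq> {1..?d + (?a + (?b + ?g))}"
      using v by (auto simp: mw_exchange_def verts_ren)
    fix \<nu> :: "nat list" assume d: "distinct \<nu>" and l: "length \<nu> = ?d + (?a + (?b + ?g))"
    obtain \<nu>d \<nu>a \<nu>b \<nu>g where \<nu>: "\<nu> = \<nu>d @ \<nu>a @ \<nu>b @ \<nu>g"
      and len: "length \<nu>d = ?d" "length \<nu>a = ?a" "length \<nu>b = ?b" "length \<nu>g = ?g"
      using split_length4[OF l] .
    have "sel b (ss (\<Gamma> @ [B, A] @ \<Delta>)) \<nu> = sel b (ss (\<Gamma> @ [A, B] @ \<Delta>)) (\<nu>d @ \<nu>b @ \<nu>a @ \<nu>g)" for b
      unfolding s \<nu> using len by (simp add: sel_append) blast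
    moreover have "distinct (\<nu>d @ \<nu>b @ \<nu>a @ \<nu>g)" using d \<nu> by auto
    moreover have "length (\<nu>d @ \<nu>b @ \<nu>a @ \<nu>g) = length (ss (\<Gamma> @ [A, B] @ \<Delta>))"
      unfolding s using len by simp
    ultimately show "matched (sel True (ss (\<Gamma> @ [B, A] @ \<Delta>)) \<nu>) (sel False (ss (\<Gamma> @ [B, A] @ \<Delta>)) \<nu>)
        (ren (at \<nu>) (edges (mw_exchange ?d ?b ?a \<sigma>)))"
      using well_typedD(2)[OF wt, of "\<nu>d @ \<nu>b @ \<nu>a @ \<nu>g"] ren_mw_exchange[OF len(1-3) v] \<nu>
      by (simp only:)
  next
    show "label e \<in> lists (alphabet G)" if e: "e \<in> edges (mw_exchange ?d ?b ?a \<sigma>)" for e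
    proof -
      obtain e' where "e' \<in> edges \<sigma>" "label e = label e'"
        using e ren_label unfolding mw_exchange_def edges_map_vertices by blast
      then show ?thesis using well_typed_labels[OF wt] by simp
    qed
    show "\<exists>w\<in>lists (alphabet G). c = cyclic w" if "c \<in># cycles (mw_exchange ?d ?b ?a \<sigma>)" for c
      using that well_typed_cycles[OF wt] unfolding cycles_mw_exchange by blast
  qed
next
  case (Par \<sigma> \<Gamma> A B)
  then show ?case by (simp only: ss_append ss_Cons ss_Nil append_Nil fs_Par append_assoc append_Cons)
next
  case (Tensor \<sigma> \<Gamma> A \<tau> B \<Delta>)
  let ?d = "scard G \<Delta>" and ?a = "fcard G A" and ?b = "fcard G B" and ?g = "scard G \<Gamma>"
  have s: "ss (\<Gamma> @ [A \<otimes>\<^sub>f B] @ \<Delta>) = ss \<Delta> @ fs A @ fs B @ ss \<Gamma>"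
    by (simp only: ss_append ss_Cons ss_Nil append_Nil append_assoc fs_Tensor)
  have s\<sigma>: "ss (\<Gamma> @ [A]) = fs A @ ss \<Gamma>" by (simp only: ss_append ss_Cons ss_Nil append_Nil)
  have s\<tau>: "ss (B # \<Delta>) = ss \<Delta> @ fs B" by (simp only: ss_Cons)
  have wt: "well_typed (alphabet G) (ss (\<Gamma> @ [A])) \<sigma>" "well_typed (alphabet G) (ss (B # \<Delta>)) \<tau>"
    by (fact Tensor.IH)+
  have v: "verts (edges \<sigma>) \<subseteq> {1..?a + ?g}" "verts (edges \<tau>) \<subseteq> {1..?d + ?b}"
    using well_typedD(1)[OF wt(1)] well_typedD(1)[OF wt(2)] unfolding s\<sigma> s\<tau> by simp_all
  show ?case
  proof (rule well_typedI)
    show "length (ss (\<Gamma> @ [A \<otimes>\<^sub>f B] @ \<Delta>)) = ?d + (?a + (?b + ?g))" unfolding s by simp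
    show "verts (edges (mw_tensor ?d ?a ?b \<sigma> \<tau>)) \<subseteq> {1..?d + (?a + (?b + ?g))}"
      using v unfolding mw_tensor_def edges_mw_union edges_map_vertices verts_Un verts_ren by fastforce
    fix \<nu> :: "nat list" assume d: "distinct \<nu>" and l: "length \<nu> = ?d + (?a + (?b + ?g))"
    obtain \<nu>d \<nu>a \<nu>b \<nu>g where \<nu>: "\<nu> = \<nu>d @ \<nu>a @ \<nu>b @ \<nu>g"
      and len: "length \<nu>d = ?d" "length \<nu>a = ?a" "length \<nu>b = ?b" "length \<nu>g = ?g"
      using split_length4[OF l] .
    have sel: "sel b (ss (\<Gamma> @ [A \<otimes>\<^sub>f B] @ \<Delta>)) \<nu> = sel b (ss (\<Gamma> @ [A])) (\<nu>a @ \<nu>g) \<union> sel b (ss (B # \<Delta>)) (\<nu>d @ \<nu>b)" for b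
      unfolding s s\<sigma> s\<tau> \<nu> using len by (simp add: sel_append) blast
    have m: "matched (sel True (ss (\<Gamma> @ [A])) (\<nu>a @ \<nu>g)) (sel False (ss (\<Gamma> @ [A])) (\<nu>a @ \<nu>g)) (ren (at (\<nu>a @ \<nu>g)) (edges \<sigma>))"
      "matched (sel True (ss (B # \<Delta>)) (\<nu>d @ \<nu>b)) (sel False (ss (B # \<Delta>)) (\<nu>d @ \<nu>b)) (ren (at (\<nu>d @ \<nu>b)) (edges \<tau>))"
      using well_typedD(2)[OF wt(1), of "\<nu>a @ \<nu>g"] well_typedD(2)[OF wt(2), of "\<nu>d @ \<nu>b"] d len
      unfolding s\<sigma> s\<tau> \<nu> by auto
    have "set (\<nu>a @ \<nu>g) \<inter> set (\<nu>d @ \<nu>b) = {}" using d \<nu> by auto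
    then show "matched (sel True (ss (\<Gamma> @ [A \<otimes>\<^sub>f B] @ \<Delta>)) \<nu>) (sel False (ss (\<Gamma> @ [A \<otimes>\<^sub>f B] @ \<Delta>)) \<nu>)
        (ren (at \<nu>) (edges (mw_tensor ?d ?a ?b \<sigma> \<tau>)))"
      unfolding sel unfolding \<nu> ren_mw_tensor[OF len(1-3) v]
      using sel_subset[of _ "ss (\<Gamma> @ [A])" "\<nu>a @ \<nu>g"] sel_subset[of _ "ss (B # \<Delta>)" "\<nu>d @ \<nu>b"]
      by (intro matched_Un m) blast+
  next
    show "label e \<in> lists (alphabet G)" if e: "e \<in> edges (mw_tensor ?d ?a ?b \<sigma> \<tau>)" for e
    proof -
      obtain e' where "e' \<in> edges \<sigma> \<or> e' \<in> edges \<tau>" "label e = label e'"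
        using e ren_label unfolding mw_tensor_def edges_mw_union edges_map_vertices by blast
      then show ?thesis using well_typed_labels[OF wt(1), of e'] well_typed_labels[OF wt(2), of e'] by presburger
    qed
    show "\<exists>w\<in>lists (alphabet G). c = cyclic w" if "c \<in># cycles (mw_tensor ?d ?a ?b \<sigma> \<tau>)" for c
      using that well_typed_cycles[OF wt(1)] well_typed_cycles[OF wt(2)] unfolding cycles_mw_tensor by auto
  qed
qed

end

text \<open>The loop at 0, which is never used as a name, records that the multiword has cyclic words.\<close>

definition nm :: "nat list \<Rightarrow> 'a multiword \<Rightarrow> 'a edge set" where
  "nm \<nu> \<sigma> = ren (at \<nu>) (edges \<sigma>) \<union> (if cycles \<sigma> = {#} then {} else {(0, [], 0)})"

lemma verts_nm:
  assumes "well_typed T bs \<sigma>" "length \<nu> = length bs"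
  shows "verts (nm \<nu> \<sigma>) \<subseteq> insert 0 (set \<nu>)"
proof -
  have "verts (ren (at \<nu>) (edges \<sigma>)) \<subseteq> set \<nu>"
    unfolding verts_ren set_conv_at[of \<nu>] using well_typedD(1)[OF assms(1)] assms(2) by auto
  then show ?thesis unfolding nm_def by (auto simp: verts_def)
qed

text \<open>Only contexts that do not touch \<open>X\<close> may probe the nets, and only paths are
  observed. This is weaker than equality with the hidden net, which fails in the presence of cyclic
  words because of the loop at 0.\<close>

definition simulates :: "nat set \<Rightarrow> 'a edge set \<Rightarrow> 'a edge set \<Rightarrow> bool" where
  "simulates X E E' \<longleftrightarrow> (\<forall>Z a w b. verts Z \<inter> X = {} \<longrightarrow> a \<notin> X \<longrightarrow> b \<notin> X \<longrightarrow>
     path_net (E \<union> Z) a w b \<longrightarrow> path_net (E' \<union> Z) a w b)"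

lemma simulates_Un: "simulates X E E' \<Longrightarrow> verts Z \<inter> X = {} \<Longrightarrow> simulates X (E \<union> Z) (E' \<union> Z)"
  unfolding simulates_def by (metis Un_assoc inf_sup_distrib2 sup_bot.right_neutral verts_Un)

text \<open>A context that yields a path excludes the loop at 0 and all closed walks. Hence both
  multiwords are regular, gluing creates no cyclic word, and the named composite is the union with
  \<open>\<nu>a\<close> hidden.\<close>

lemma simulates_comp:
  assumes \<sigma>: "well_typed T bs \<sigma>" "length bs = y + g" and \<tau>: "well_typed T bs' \<tau>" "length bs' = z + y"
    and d: "distinct (\<nu>d @ \<nu>a @ \<nu>g)" and len: "length \<nu>d = z" "length \<nu>a = y" "length \<nu>g = g"
  shows "simulates (set \<nu>a) (nm (\<nu>d @ rev \<nu>a) \<tau> \<union> nm (\<nu>a @ \<nu>g) \<sigma>) (nm (\<nu>d @ \<nu>g) (mw_comp z y \<tau> \<sigma>))"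
  unfolding simulates_def
proof (intro allI impI)
  fix Z :: "'a edge set" and a w b
  assume Z: "verts Z \<inter> set \<nu>a = {}" and ab: "a \<notin> set \<nu>a" "b \<notin> set \<nu>a"
    and p: "path_net (nm (\<nu>d @ rev \<nu>a) \<tau> \<union> nm (\<nu>a @ \<nu>g) \<sigma> \<union> Z) a w b"
  let ?E = "ren (at (\<nu>d @ rev \<nu>a)) (edges \<tau>) \<union> ren (at (\<nu>a @ \<nu>g)) (edges \<sigma>)"
  have "(0, [], 0) \<notin> nm (\<nu>d @ rev \<nu>a) \<tau> \<union> nm (\<nu>a @ \<nu>g) \<sigma> \<union> Z" using path_net_no_loop[OF p] .
  then have reg: "cycles \<tau> = {#}" "cycles \<sigma> = {#}" by (auto simp: nm_def split: if_splits)
  then have p': "path_net (?E \<union> Z) a w b" using p by (simp add: nm_def)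
  have "glued_cycles (cut_rel z y) (edges (cut_base z y \<tau> \<sigma>)) = {}"
    using mw_comp_naming(2)[OF \<sigma> \<tau> d len] path_net_no_cycle[OF p'] by blast
  then have "cycles (mw_comp z y \<tau> \<sigma>) = {#}" unfolding cycles_mw_comp by (simp add: reg)
  then have "nm (\<nu>d @ \<nu>g) (mw_comp z y \<tau> \<sigma>) = hide (set \<nu>a) ?E"
    unfolding nm_def mw_comp_naming(1)[OF \<sigma> \<tau> d len] by simp
  then show "path_net (nm (\<nu>d @ \<nu>g) (mw_comp z y \<tau> \<sigma>) \<union> Z) a w b"
    using path_net_hide[OF p' ab Z] by simp
qed

lemma nm_mw_tensor:
  assumes "length \<nu>d = d" "length \<nu>a = a" "length \<nu>b = b"
    and "verts (edges \<sigma>) \<subseteq> {1..m}" "verts (edges \<tau>) \<subseteq> {1..d + b}"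
  shows "nm (\<nu>d @ \<nu>a @ \<nu>b @ \<nu>g) (mw_tensor d a b \<sigma> \<tau>) = nm (\<nu>a @ \<nu>g) \<sigma> \<union> nm (\<nu>d @ \<nu>b) \<tau>"
  unfolding nm_def ren_mw_tensor[OF assms] cycles_mw_tensor by auto

lemma nm_mw_exchange:
  assumes "length \<nu>d = d" "length \<nu>a = a" "length \<nu>b = b" "verts (edges \<sigma>) \<subseteq> {1..m}"
  shows "nm (\<nu>d @ \<nu>a @ \<nu>b @ \<nu>g) (mw_exchange d b a \<sigma>) = nm (\<nu>d @ \<nu>b @ \<nu>a @ \<nu>g) \<sigma>"
  unfolding nm_def ren_mw_exchange[OF assms] cycles_mw_exchange ..

lemma nm_mw_id:
  assumes "is_boundary X" "length \<mu> = bcard X" "length \<nu>' = bcard X"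
  shows "nm (\<mu> @ \<nu>') (mw_id X) = wires (signs X) (rev \<nu>') \<mu>"
  unfolding nm_def ren_mw_id[OF assms] by (simp add: mw_id_def)

section \<open>A logical relation between nets and terms\<close>

text \<open>A tree is one path from a source to a target. For an implication the result block comes
  first and the argument block follows reversed and negated, which is the order
  \<open>fbound\<close> gives to \<open>Par (dual A) B\<close>.\<close>

primrec tsg :: "tree_atom lty \<Rightarrow> bool list" where
  "tsg (Atom p) = [True, False]"
| "tsg (A \<multimap> B) = tsg B @ map Not (rev (tsg A))"

abbreviation wd :: "tree_atom lty \<Rightarrow> nat" where "wd A \<equiv> length (tsg A)"

definition net_ok :: "'a edge set \<Rightarrow> nat set \<Rightarrow> nat list \<Rightarrow> bool" where
  "net_ok E S \<nu> \<longleftrightarrow> finite S \<and> verts E \<subseteq> insert 0 S \<and> set \<nu> \<subseteq> S"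

text \<open>The set \<open>S\<close> records all names in use, including names of ports without an incident edge:
  a net may connect two ports by giving them the same name.\<close>

primrec realizes :: "'a set \<Rightarrow> nat \<Rightarrow> tree_atom lty \<Rightarrow> 'a tsym edge set \<Rightarrow> nat set \<Rightarrow> nat list \<Rightarrow>
    ('a \<times> nat) lterm \<Rightarrow> bool" where
  "realizes N n (Atom p) E S \<nu> u \<longleftrightarrow> net_ok E S \<nu> \<and> closed_linear u \<and>
     (\<exists>a b \<alpha>. \<nu> = [a, b] \<and> \<alpha> \<in> Tr N n \<and> path_net E a (encode \<alpha>) b \<and> beta_eta_equiv u (tree_term \<alpha>))"
| "realizes N n (A \<multimap> B) E S \<nu> u \<longleftrightarrow> net_ok E S \<nu> \<and> closed_linear u \<and>
     (\<forall>F S' v. realizes N n A F S' (rev (drop (wd B) \<nu>)) v \<longrightarrow> S' \<inter> S \<subseteq> set (drop (wd B) \<nu>) \<longrightarrow>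
        realizes N n B (E \<union> F) (S \<union> S') (take (wd B) \<nu>) (App u v))"

lemma realizes_Limp:
  "length \<nu>B = wd B \<Longrightarrow> realizes N n (A \<multimap> B) E S (\<nu>B @ rev \<nu>A) u \<longleftrightarrow>
     net_ok E S (\<nu>B @ rev \<nu>A) \<and> closed_linear u \<and>
     (\<forall>F S' v. realizes N n A F S' \<nu>A v \<longrightarrow> S' \<inter> S \<subseteq> set \<nu>A \<longrightarrow>
        realizes N n B (E \<union> F) (S \<union> S') \<nu>B (App u v))"
  by simp

lemma realizes_ok: "realizes N n A E S \<nu> u \<Longrightarrow> net_ok E S \<nu> \<and> closed_linear u"
  by (cases A) auto

text \<open>At the type of trees equivalence is part of the relation; at an implication it passes
  through the application, where closedness keeps it a congruence.\<close>

lemma realizes_equiv: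
  "realizes N n A E S \<nu> u \<Longrightarrow> beta_eta_equiv u u' \<Longrightarrow> closed_linear u' \<Longrightarrow> realizes N n A E S \<nu> u'"
proof (induction A arbitrary: E S \<nu> u u')
  case (Atom p)
  then show ?case using beta_eta_equiv_sym beta_eta_equiv_trans by (simp, blast)
next
  case (Limp A B)
  have "realizes N n B (E \<union> F) (S \<union> S') (take (wd B) \<nu>) (App u' v)"
    if "realizes N n A F S' (rev (drop (wd B) \<nu>)) v" "S' \<inter> S \<subseteq> set (drop (wd B) \<nu>)" for F S' v
  proof -
    have "closed_linear v" "closed_linear u" using realizes_ok that(1) Limp.prems(1) by blast+
    moreover have "realizes N n B (E \<union> F) (S \<union> S') (take (wd B) \<nu>) (App u v)"
      using Limp.prems(1) that by simp
    ultimately show ?thesis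
      using Limp.IH(2)[OF _ beta_eta_equiv_App_left[OF Limp.prems(2)] closed_linear_App[OF Limp.prems(3)]]
      by blast
  qed
  with Limp.prems show ?case by simp
qed

lemma net_ok_ren: "f 0 = 0 \<Longrightarrow> net_ok E S \<nu> \<Longrightarrow> net_ok (ren f E) (f ` S) (map f \<nu>)"
  unfolding net_ok_def verts_ren by (auto dest: image_mono[of _ _ f])

text \<open>Permutations of names that fix 0 act on nets. An argument offered to the renamed
  function is pulled back along the inverse \<open>g\<close>.\<close>

lemma realizes_ren:
  "realizes N n A E S \<nu> u \<Longrightarrow> (\<And>x. f (g x) = x) \<Longrightarrow> (\<And>x. g (f x) = x) \<Longrightarrow> f 0 = 0 \<Longrightarrow>
   realizes N n A (ren f E) (f ` S) (map f \<nu>) u"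
proof (induction A arbitrary: E S \<nu> u f g)
  case (Atom p)
  have inj: "inj f" using Atom.prems(3) by (metis injI)
  obtain a b \<alpha> where "\<nu> = [a, b]" "\<alpha> \<in> Tr N n" "path_net E a (encode \<alpha>) b"
    "beta_eta_equiv u (tree_term \<alpha>)" "net_ok E S \<nu>" "closed_linear u" using Atom.prems(1) by auto
  then show ?case using path_net_ren[OF _ inj Atom.prems(4), of E a "encode \<alpha>" b] net_ok_ren[of f E S \<nu>] Atom.prems(4)
    by auto
next
  case (Limp A B)
  have g0: "g 0 = 0" using Limp.prems(3,4) by metis
  have "realizes N n B (ren f E \<union> F) (f ` S \<union> S') (take (wd B) (map f \<nu>)) (App u v)"
    if F: "realizes N n A F S' (rev (drop (wd B) (map f \<nu>))) v" "S' \<inter> f ` S \<subseteq> set (drop (wd B) (map f \<nu>))"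
    for F S' v
  proof -
    have "realizes N n A (ren g F) (g ` S') (map g (rev (drop (wd B) (map f \<nu>)))) v"
      using Limp.IH(1)[OF F(1), of g f] Limp.prems g0 by blast
    then have "realizes N n A (ren g F) (g ` S') (rev (drop (wd B) \<nu>)) v"
      using Limp.prems(3) by (simp add: rev_map drop_map o_def)
    moreover have "g ` S' \<inter> S \<subseteq> set (drop (wd B) \<nu>)"
    proof
      fix x assume "x \<in> g ` S' \<inter> S"
      then have "f x \<in> S' \<inter> f ` S" using Limp.prems(2) by auto
      then have "f x \<in> f ` set (drop (wd B) \<nu>)" using F(2) by (auto simp: drop_map)
      then show "x \<in> set (drop (wd B) \<nu>)" using Limp.prems(3) by (metis imageE)
    qed
    ultimately have "realizes N n B (E \<union> ren g F) (S \<union> g ` S') (take (wd B) \<nu>) (App u v)"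
      using Limp.prems(1) by simp
    from Limp.IH(2)[OF this Limp.prems(2-4)] show ?thesis
      using Limp.prems(2) ren_ident[of F "f \<circ> g"]
      by (simp add: ren_Un ren_ren image_Un image_image take_map)
  qed
  then show ?case using Limp.prems net_ok_ren[of f E S \<nu>] by simp
qed

lemma path_net_start: "path_net E a w b \<Longrightarrow> a \<notin> (\<lambda>e. tgt e) ` E"
  by (auto simp: path_net_def)

text \<open>Ports may be prolonged by wires. At an implication the wires of the argument run the
  opposite way: they first adapt the argument to the old ports, and then the result is
  prolonged.\<close>

lemma realizes_wire:
  "realizes N n A E S \<nu> u \<Longrightarrow> length \<nu> = wd A \<Longrightarrow> length \<nu>' = wd A \<Longrightarrow> distinct \<nu> \<Longrightarrow> distinct \<nu>' \<Longrightarrow>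
   0 \<notin> set \<nu> \<Longrightarrow> 0 \<notin> set \<nu>' \<Longrightarrow> S \<inter> set \<nu>' = {} \<Longrightarrow>
   realizes N n A (E \<union> wires (tsg A) \<nu> \<nu>') (S \<union> set \<nu>') \<nu>' u"
proof (induction A arbitrary: E S \<nu> \<nu>' u)
  case (Atom p)
  obtain a b \<alpha> where \<nu>: "\<nu> = [a, b]" and \<alpha>: "\<alpha> \<in> Tr N n" "path_net E a (encode \<alpha>) b"
    "beta_eta_equiv u (tree_term \<alpha>)" using Atom.prems(1) by auto
  obtain a' b' where \<nu>': "\<nu>' = [a', b']" using Atom.prems(3)
    by (auto simp: length_Suc_conv numeral_2_eq_2)
  have ok: "finite S" "verts E \<subseteq> insert 0 S" "a \<in> S" "b \<in> S" "closed_linear u"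
    using Atom.prems(1) \<nu> by (auto simp: net_ok_def)
  have fresh: "a' \<notin> S" "b' \<notin> S" "a' \<noteq> b'" "a' \<noteq> 0" "b' \<noteq> 0" "a \<noteq> 0" "b \<noteq> 0"
    using Atom.prems \<nu> \<nu>' by auto
  have tE: "(\<lambda>e. tgt e) ` E \<subseteq> insert 0 S" using ok(2) by (auto simp: verts_def)
  have w: "wires (tsg (Atom p)) \<nu> \<nu>' = {(a', [], a), (b, [], b')}" by (simp add: wires_def \<nu> \<nu>')
  have "path_net ({(a', [], a)} \<union> E) a' ([] @ encode \<alpha>) b"
    using fresh tE path_net_start[OF \<alpha>(2)] ok
    by (intro path_net_append[OF path_net_single \<alpha>(2)]) auto
  then have "path_net (({(a', [], a)} \<union> E) \<union> {(b, [], b')}) a' (([] @ encode \<alpha>) @ []) b'"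
    using fresh tE ok by (intro path_net_append[OF _ path_net_single]) auto
  moreover have "({(a', [], a)} \<union> E) \<union> {(b, [], b')} = E \<union> wires (tsg (Atom p)) \<nu> \<nu>'" unfolding w by auto
  ultimately have "path_net (E \<union> wires (tsg (Atom p)) \<nu> \<nu>') a' (encode \<alpha>) b'" by simp
  moreover have "net_ok (E \<union> wires (tsg (Atom p)) \<nu> \<nu>') (S \<union> set \<nu>') \<nu>'"
    using ok \<nu>' unfolding w net_ok_def by (auto simp: verts_def)
  ultimately show ?case using \<alpha> ok(5) \<nu>' by (simp del: tsg.simps) blast
next
  case (Limp A B)
  obtain \<nu>B \<mu> where \<nu>0: "\<nu> = \<nu>B @ \<mu>" "length \<nu>B = wd B" "length \<mu> = wd A"
    using Limp.prems(2) by (auto elim: split_length)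
  obtain \<nu>B' \<mu>' where \<nu>0': "\<nu>' = \<nu>B' @ \<mu>'" "length \<nu>B' = wd B" "length \<mu>' = wd A"
    using Limp.prems(3) by (auto elim: split_length)
  define \<nu>A where "\<nu>A = rev \<mu>"
  define \<nu>A' where "\<nu>A' = rev \<mu>'"
  have \<nu>: "\<nu> = \<nu>B @ rev \<nu>A" "length \<nu>B = wd B" "length \<nu>A = wd A"
    and \<nu>': "\<nu>' = \<nu>B' @ rev \<nu>A'" "length \<nu>B' = wd B" "length \<nu>A' = wd A"
    using \<nu>0 \<nu>0' by (simp_all add: \<nu>A_def \<nu>A'_def)
  have w: "wires (tsg (A \<multimap> B)) \<nu> \<nu>' = wires (tsg B) \<nu>B \<nu>B' \<union> (wires (tsg A) \<nu>A' \<nu>A :: 'a tsym edge set)"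
    using \<nu> \<nu>' by (simp add: wires_append wires_dual)
  have ok: "net_ok E S \<nu>" "closed_linear u" using realizes_ok[OF Limp.prems(1)] by auto
  have "realizes N n B (E \<union> wires (tsg (A \<multimap> B)) \<nu> \<nu>' \<union> F) (S \<union> set \<nu>' \<union> S') \<nu>B' (App u v)"
    if F: "realizes N n A F S' \<nu>A' v" "S' \<inter> (S \<union> set \<nu>') \<subseteq> set \<nu>A'" for F S' v
  proof -
    have okF: "net_ok F S' \<nu>A'" using realizes_ok[OF F(1)] by simp
    have d: "set \<nu>A' \<inter> S = {}" "set \<nu>B' \<inter> S = {}" "set \<nu>A \<subseteq> S" "set \<nu>B \<subseteq> S" "set \<nu>A' \<inter> set \<nu>B' = {}" "set \<nu>A' \<subseteq> S'"
      using Limp.prems(5,8) ok okF \<nu> \<nu>' by (auto simp: net_ok_def)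
    have fresh: "S' \<inter> set \<nu>A = {}" "S' \<inter> S = {}" "S' \<inter> set \<nu>B' = {}"
      using d F(2) unfolding \<nu>'(1) set_append set_rev by blast+
    have dist: "distinct \<nu>A" "distinct \<nu>B" "distinct \<nu>A'" "distinct \<nu>B'"
      "0 \<notin> set \<nu>A" "0 \<notin> set \<nu>B" "0 \<notin> set \<nu>A'" "0 \<notin> set \<nu>B'"
      using Limp.prems(4-7) \<nu>(1) \<nu>'(1) by auto
    have "realizes N n A (F \<union> wires (tsg A) \<nu>A' \<nu>A) (S' \<union> set \<nu>A) \<nu>A v"
      by (rule Limp.IH(1)[OF F(1) \<nu>'(3) \<nu>(3) dist(3,1,7,5) fresh(1)])
    moreover have "(S' \<union> set \<nu>A) \<inter> S \<subseteq> set \<nu>A" using fresh by blast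
    ultimately have "realizes N n B (E \<union> (F \<union> wires (tsg A) \<nu>A' \<nu>A)) (S \<union> (S' \<union> set \<nu>A)) \<nu>B (App u v)"
      using Limp.prems(1) unfolding \<nu>(1) realizes_Limp[OF \<nu>(2)] by blast
    moreover have "(S \<union> (S' \<union> set \<nu>A)) \<inter> set \<nu>B' = {}" using fresh d by blast
    ultimately have "realizes N n B (E \<union> (F \<union> wires (tsg A) \<nu>A' \<nu>A) \<union> wires (tsg B) \<nu>B \<nu>B')
        (S \<union> (S' \<union> set \<nu>A) \<union> set \<nu>B') \<nu>B' (App u v)"
      using Limp.IH(2)[OF _ \<nu>(2) \<nu>'(2) dist(2,4,6,8)] by blast
    moreover have "E \<union> (F \<union> wires (tsg A) \<nu>A' \<nu>A) \<union> wires (tsg B) \<nu>B \<nu>B' = E \<union> wires (tsg (A \<multimap> B)) \<nu> \<nu>' \<union> F"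
      unfolding w by blast
    moreover have "S \<union> (S' \<union> set \<nu>A) \<union> set \<nu>B' = S \<union> set \<nu>' \<union> S'" using d \<nu>' by auto
    ultimately show ?thesis by (simp only:)
  qed
  moreover have "net_ok (E \<union> wires (tsg (A \<multimap> B)) \<nu> \<nu>') (S \<union> set \<nu>') \<nu>'"
    using ok(1) Limp.prems(2,3) unfolding net_ok_def by (auto simp: verts_wires simp del: tsg.simps)
  ultimately show ?case using ok(2) unfolding \<nu>'(1) realizes_Limp[OF \<nu>'(2)] by blast
qed

text \<open>An involution that exchanges \<open>X\<close> with fresh names and fixes the other names
  in \<open>Q\<close>; it serves as alpha-conversion whenever names are hidden.\<close>

lemma swap_names:
  assumes "finite (X :: nat set)" "finite Q"
  obtains f where "\<And>x. f (f x) = x" "f ` X \<inter> (X \<union> Q) = {}" "\<And>x. x \<in> Q \<Longrightarrow> x \<notin> X \<Longrightarrow> f x = x"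
proof -
  obtain m where m: "\<forall>x\<in>X \<union> Q. x < m" using assms finite_nat_set_iff_bounded[of "X \<union> Q"] by auto
  \<comment> \<open>Adding \<open>m\<close>, an upper bound of all names concerned, makes the images
    of \<open>X\<close> fresh.\<close>
  define f where "f x = (if x \<in> X then x + m else if m \<le> x \<and> x - m \<in> X then x - m else x)" for x
  have "f (f x) = x" for x using m by (auto simp: f_def)
  moreover have "f ` X \<inter> (X \<union> Q) = {}" using m by (fastforce simp: f_def)
  moreover have "f x = x" if "x \<in> Q" "x \<notin> X" for x
  proof -
    have "x < m" using m that by blast
    with that show ?thesis by (simp add: f_def)
  qed
  ultimately show thesis by (rule that)
qed

text \<open>The names in \<open>X\<close> are bound in \<open>E'\<close>, but an argument may use
  them by accident. It is renamed by a swap and applied to the unhidden net; after hiding, the swap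
  is undone. The ports avoid \<open>X\<close> and stay fixed.\<close>

lemma realizes_hide:
  "realizes N n A E S \<nu> u \<Longrightarrow> simulates X E E' \<Longrightarrow> verts E' \<subseteq> insert 0 (S - X) \<Longrightarrow> 0 \<notin> X \<Longrightarrow>
   finite X \<Longrightarrow> set \<nu> \<inter> X = {} \<Longrightarrow> realizes N n A E' (S - X) \<nu> u"
proof (induction A arbitrary: E E' S \<nu> u)
  case (Atom p)
  then obtain a b \<alpha> where \<nu>: "\<nu> = [a, b]" and \<alpha>: "\<alpha> \<in> Tr N n" "path_net E a (encode \<alpha>) b"
    "beta_eta_equiv u (tree_term \<alpha>)" by auto
  have "path_net (E' \<union> {}) a (encode \<alpha>) b"
    using Atom.prems(2)[unfolded simulates_def, rule_format, of "{}" a b "encode \<alpha>"] Atom.prems(6) \<nu> \<alpha> by simp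
  moreover have "net_ok E' (S - X) \<nu>" using Atom.prems by (auto simp: net_ok_def)
  ultimately show ?case using \<nu> \<alpha> Atom.prems(1) by auto
next
  case (Limp A B)
  let ?\<nu>A = "rev (drop (wd B) \<nu>)" and ?\<nu>B = "take (wd B) \<nu>"
  have ok: "net_ok E S \<nu>" "closed_linear u" using realizes_ok[OF Limp.prems(1)] by auto
  have sub: "set ?\<nu>A \<subseteq> set \<nu>" "set ?\<nu>B \<subseteq> set \<nu>" by (auto dest: in_set_dropD in_set_takeD)
  have "realizes N n B (E' \<union> F) (S - X \<union> S') ?\<nu>B (App u v)"
    if F: "realizes N n A F S' ?\<nu>A v" "S' \<inter> (S - X) \<subseteq> set ?\<nu>A" for F S' v
  proof -
    have okF: "net_ok F S' ?\<nu>A" using realizes_ok[OF F(1)] by simp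
    have fin: "finite (insert 0 (S \<union> S'))" using ok okF by (auto simp: net_ok_def)
    obtain f where f: "\<And>x. f (f x) = x" "f ` X \<inter> (X \<union> insert 0 (S \<union> S')) = {}"
      "\<And>x. x \<in> insert 0 (S \<union> S') \<Longrightarrow> x \<notin> X \<Longrightarrow> f x = x"
      using swap_names[OF Limp.prems(5) fin] by metis
    have f0: "f 0 = 0" using f(3) Limp.prems(4) by blast
    have fixed: "f x = x" if "x \<in> set \<nu>" for x using that f(3)[of x] ok Limp.prems(6) by (auto simp: net_ok_def)
    have notX: "f x \<notin> X" if "x \<in> S'" for x
    proof
      assume "f x \<in> X"
      then have "f (f x) \<in> f ` X" by (rule imageI)
      with that f(1,2) show False by auto
    qed
    have S'X: "f ` S' \<inter> X = {}" using notX by auto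
    have "map f ?\<nu>A = ?\<nu>A" "map f ?\<nu>B = ?\<nu>B" using fixed sub by (auto intro!: map_idI)
    note same = this
    have "realizes N n A (ren f F) (f ` S') ?\<nu>A v"
      using realizes_ren[OF F(1) f(1) f(1) f0] same by simp
    moreover have "f ` S' \<inter> S \<subseteq> set (drop (wd B) \<nu>)"
    proof
      fix z assume "z \<in> f ` S' \<inter> S"
      then obtain s where s: "s \<in> S'" "z = f s" "f s \<in> S" by auto
      have "s \<notin> X" using s f(2) by auto
      then have "f s = s" using f(3) s by auto
      with s \<open>s \<notin> X\<close> F(2) show "z \<in> set (drop (wd B) \<nu>)" by auto
    qed
    ultimately have R: "realizes N n B (E \<union> ren f F) (S \<union> f ` S') ?\<nu>B (App u v)"
      using Limp.prems(1) by simp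
    have vF: "verts (ren f F) \<subseteq> insert 0 (f ` S')"
      using okF f0 unfolding net_ok_def verts_ren by auto
    then have vF': "verts (ren f F) \<inter> X = {}" using S'X Limp.prems(4) by auto
    have "realizes N n B (E' \<union> ren f F) ((S \<union> f ` S') - X) ?\<nu>B (App u v)"
    proof (rule Limp.IH(2)[OF R simulates_Un[OF Limp.prems(2) vF']])
      show "verts (E' \<union> ren f F) \<subseteq> insert 0 (S \<union> f ` S' - X)"
        using Limp.prems(3) vF S'X by auto
    qed (use Limp.prems sub in auto)
    from realizes_ren[OF this f(1) f(1) f0]
    have "realizes N n B (ren f E' \<union> ren f (ren f F)) (f ` ((S \<union> f ` S') - X)) ?\<nu>B (App u v)"
      unfolding ren_Un same .
    moreover have "ren f E' = E'"
      using Limp.prems(3,4) f(3) by (intro ren_ident) (metis Diff_iff UnI1 insert_iff subsetD)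
    moreover have "ren f (ren f F) = F" unfolding ren_ren using f(1) by (intro ren_ident) simp
    moreover have "f ` ((S \<union> f ` S') - X) = S - X \<union> S'"
    proof -
      have "(S \<union> f ` S') - X = (S - X) \<union> f ` S'" using S'X by auto
      moreover have "f ` (S - X) = S - X" using f(3) by force
      ultimately show ?thesis using f(1) by (simp add: image_Un image_image)
    qed
    ultimately show ?thesis by simp
  qed
  moreover have "net_ok E' (S - X) \<nu>" using ok(1) Limp.prems(3,6) by (auto simp: net_ok_def)
  ultimately show ?case using ok(2) by simp
qed

subsection \<open>Open terms\<close>

text \<open>The names of the substituted nets may meet the given net and one another only at the
  ports of the hypothesis concerned, so that union plugs them in there and nowhere else.\<close>

definition closing :: "'a set \<Rightarrow> nat \<Rightarrow> nat set \<Rightarrow> (nat \<times> tree_atom lty) set \<Rightarrow> (nat \<Rightarrow> nat list) \<Rightarrow>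
    (nat \<Rightarrow> 'a tsym edge set) \<Rightarrow> (nat \<Rightarrow> nat set) \<Rightarrow> (nat \<Rightarrow> ('a \<times> nat) lterm) \<Rightarrow> bool" where
  "closing N n S D \<pi> F Q v \<longleftrightarrow> (\<forall>x. closed_linear (v x)) \<and>
     (\<forall>x A. (x, A) \<in> D \<longrightarrow> realizes N n A (F x) (Q x) (\<pi> x) (v x) \<and> Q x \<inter> S \<subseteq> set (\<pi> x)
        \<and> (\<forall>y\<in>fst ` D. y \<noteq> x \<longrightarrow> Q x \<inter> Q y \<subseteq> set (\<pi> x)))"

definition open_realizes :: "'a set \<Rightarrow> nat \<Rightarrow> 'a tsym edge set \<Rightarrow> nat set \<Rightarrow> (nat \<times> tree_atom lty) set \<Rightarrow>
    (nat \<Rightarrow> nat list) \<Rightarrow> ('a \<times> nat) lterm \<Rightarrow> tree_atom lty \<Rightarrow> nat list \<Rightarrow> bool" where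
  "open_realizes N n E S D \<pi> u B \<nu> \<longleftrightarrow> net_ok E S \<nu> \<and> finite D \<and> (\<forall>x\<in>fst ` D. set (\<pi> x) \<subseteq> S) \<and>
     (\<forall>F Q v. closing N n S D \<pi> F Q v \<longrightarrow>
        realizes N n B (E \<union> (\<Union>x\<in>fst ` D. F x)) (S \<union> (\<Union>x\<in>fst ` D. Q x)) \<nu> (inst 0 v u))"

lemma fst_imageE:
  assumes "x \<in> fst ` D"
  obtains A where "(x, A) \<in> D"
  using assms by auto

lemma closingD:
  assumes "closing N n S D \<pi> F Q v"
  shows "closed_linear (v x)"
    and "(x, A) \<in> D \<Longrightarrow> realizes N n A (F x) (Q x) (\<pi> x) (v x)"
    and "x \<in> fst ` D \<Longrightarrow> Q x \<inter> S \<subseteq> set (\<pi> x)"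
    and "x \<in> fst ` D \<Longrightarrow> y \<in> fst ` D \<Longrightarrow> y \<noteq> x \<Longrightarrow> Q x \<inter> Q y \<subseteq> set (\<pi> x)"
proof -
  note c = assms[unfolded closing_def, THEN conjunct2, rule_format]
  show "closed_linear (v x)" using assms by (simp add: closing_def)
  show "realizes N n A (F x) (Q x) (\<pi> x) (v x)" if "(x, A) \<in> D" using c[OF that] by (rule conjunct1)
  show "Q x \<inter> S \<subseteq> set (\<pi> x)" if x: "x \<in> fst ` D"
  proof -
    from x obtain A where "(x, A) \<in> D" by (rule fst_imageE)
    from c[OF this] show ?thesis by (elim conjE)
  qed
  show "Q x \<inter> Q y \<subseteq> set (\<pi> x)" if x: "x \<in> fst ` D" and y: "y \<in> fst ` D" "y \<noteq> x"
  proof -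
    from x obtain A where "(x, A) \<in> D" by (rule fst_imageE)
    from c[OF this] show ?thesis using y by blast
  qed
qed

lemma open_realizesD:
  "open_realizes N n E S D \<pi> u B \<nu> \<Longrightarrow> closing N n S D \<pi> F Q v \<Longrightarrow>
   realizes N n B (E \<union> (\<Union>x\<in>fst ` D. F x)) (S \<union> (\<Union>x\<in>fst ` D. Q x)) \<nu> (inst 0 v u)"
  by (simp add: open_realizes_def)

lemma open_realizes_cong:
  assumes "open_realizes N n E S D \<pi> u B \<nu>" "\<And>x. x \<in> fst ` D \<Longrightarrow> \<pi> x = \<pi>' x"
  shows "open_realizes N n E S D \<pi>' u B \<nu>"
proof -
  have "closing N n S D \<pi>' F Q v = closing N n S D \<pi> F Q v" for F Q v
  proof -
    have "\<pi>' x = \<pi> x" if "(x, A) \<in> D" for x A using assms(2)[of x] that by force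
    then show ?thesis unfolding closing_def by (simp cong: imp_cong)
  qed
  moreover have "\<forall>x\<in>fst ` D. set (\<pi>' x) \<subseteq> S"
    using assms unfolding open_realizes_def by metis
  ultimately show ?thesis using assms(1) unfolding open_realizes_def by metis
qed

lemma open_realizes_closed:
  assumes "open_realizes N n E S {} \<pi> u B \<nu>" "closed_linear u"
  shows "realizes N n B E S \<nu> u"
proof -
  \<comment> \<open>An environment has to give a closed linear value to every variable; the identity
    is a convenient default.\<close>
  have "closed_linear (Abs (Var 0) :: ('a \<times> nat) lterm)" by (simp add: closed_linear_def)
  then have "closing N n S {} \<pi> (\<lambda>_. {}) (\<lambda>_. {}) (\<lambda>_. Abs (Var 0) :: ('a \<times> nat) lterm)"
    by (simp add: closing_def)
  from open_realizesD[OF assms(1) this] show ?thesis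
    using inst_absent[of 0 u] assms(2) by (simp add: closed_linear_def)
qed

lemma realizes_open:
  assumes "realizes N n B E S \<nu> u"
  shows "open_realizes N n E S {} \<pi> u B \<nu>"
  using assms realizes_ok[OF assms] inst_absent[of 0 u]
  by (simp add: open_realizes_def closed_linear_def)

text \<open>An axiom is a sharing of names: the net has no edges, and hypothesis and conclusion use
  the same ports.\<close>

lemma open_realizes_var: "open_realizes N n {} (set (\<pi> x)) {(x, A)} \<pi> (Var x) A (\<pi> x)"
proof -
  have "realizes N n A (F x) (set (\<pi> x) \<union> Q x) (\<pi> x) (v x)"
    if "closing N n (set (\<pi> x)) {(x, A)} \<pi> F Q v" for F Q v
  proof -
    have "realizes N n A (F x) (Q x) (\<pi> x) (v x)" using that by (simp add: closing_def)
    moreover from this have "set (\<pi> x) \<union> Q x = Q x" using realizes_ok by (fastforce simp: net_ok_def)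
    ultimately show ?thesis by simp
  qed
  then show ?thesis by (simp add: open_realizes_def net_ok_def)
qed

text \<open>The two nets meet only at the argument ports, so their union is already the function
  plugged into its argument.\<close>

lemma open_realizes_app:
  assumes u: "open_realizes N n E S D \<pi> u (A \<multimap> B) (\<nu>B @ rev \<nu>A)"
    and s: "open_realizes N n E' S' D' \<pi> s A \<nu>A"
    and len: "length \<nu>B = wd B" and disj: "S \<inter> S' \<subseteq> set \<nu>A" "fst ` D \<inter> fst ` D' = {}"
  shows "open_realizes N n (E \<union> E') (S \<union> S') (D \<union> D') \<pi> (App u s) B \<nu>B"
proof -
  have ok: "net_ok E S (\<nu>B @ rev \<nu>A)" "net_ok E' S' \<nu>A" "finite D" "finite D'"
    "\<And>x. x \<in> fst ` D \<Longrightarrow> set (\<pi> x) \<subseteq> S" "\<And>x. x \<in> fst ` D' \<Longrightarrow> set (\<pi> x) \<subseteq> S'"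
    using u s by (auto simp: open_realizes_def)
  have "realizes N n B (E \<union> E' \<union> (\<Union>x\<in>fst ` (D \<union> D'). F x)) (S \<union> S' \<union> (\<Union>x\<in>fst ` (D \<union> D'). Q x)) \<nu>B
      (inst 0 v (App u s))" if c: "closing N n (S \<union> S') (D \<union> D') \<pi> F Q v" for F Q v
  proof -
    have cu: "closing N n S D \<pi> F Q v" and cs: "closing N n S' D' \<pi> F Q v"
      using c unfolding closing_def by blast+
    let ?FD = "\<Union>x\<in>fst ` D. F x" and ?QD = "\<Union>x\<in>fst ` D. Q x"
    let ?FD' = "\<Union>x\<in>fst ` D'. F x" and ?QD' = "\<Union>x\<in>fst ` D'. Q x"
    \<comment> \<open>A common name coming from a substituted net must be a port of its variable and
      hence lies in \<open>S\<close> or \<open>S'\<close> already; what is left is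
      \<open>S \<inter> S'\<close>.\<close>
    have "(S' \<union> ?QD') \<inter> (S \<union> ?QD) \<subseteq> set \<nu>A"
    proof
      fix z assume z: "z \<in> (S' \<union> ?QD') \<inter> (S \<union> ?QD)"
      have "z \<in> S" if "z \<in> Q x" "x \<in> fst ` D" "z \<in> S' \<union> ?QD'" for x
      proof -
        from that(2) obtain A where A: "(x, A) \<in> D" by (rule fst_imageE)
        have "Q x \<inter> (S \<union> S') \<subseteq> set (\<pi> x)" using c A unfolding closing_def by blast
        moreover have "Q x \<inter> Q y \<subseteq> set (\<pi> x)" if "y \<in> fst ` D'" for y
        proof -
          have "y \<noteq> x" "y \<in> fst ` (D \<union> D')" using that \<open>x \<in> fst ` D\<close> disj(2) by auto
          then show ?thesis using c A unfolding closing_def by blast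
        qed
        ultimately have "z \<in> set (\<pi> x)" using that by blast
        then show ?thesis using ok(5)[OF that(2)] by blast
      qed
      then have zS: "z \<in> S" using z by blast
      have "z \<in> S'" if "z \<in> Q x" "x \<in> fst ` D'" for x
      proof -
        from that(2) obtain A where A: "(x, A) \<in> D'" by (rule fst_imageE)
        have "Q x \<inter> (S \<union> S') \<subseteq> set (\<pi> x)" using c A unfolding closing_def by blast
        then have "z \<in> set (\<pi> x)" using that zS by blast
        then show ?thesis using ok(6)[OF that(2)] by blast
      qed
      then have "z \<in> S'" using z by blast
      with zS disj(1) show "z \<in> set \<nu>A" by blast
    qed
    with open_realizesD[OF u cu] open_realizesD[OF s cs]
    have "realizes N n B ((E \<union> ?FD) \<union> (E' \<union> ?FD')) ((S \<union> ?QD) \<union> (S' \<union> ?QD')) \<nu>B (App (inst 0 v u) (inst 0 v s))"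
      unfolding realizes_Limp[OF len] by blast
    moreover have "(E \<union> ?FD) \<union> (E' \<union> ?FD') = E \<union> E' \<union> (\<Union>x\<in>fst ` (D \<union> D'). F x)"
      "(S \<union> ?QD) \<union> (S' \<union> ?QD') = S \<union> S' \<union> (\<Union>x\<in>fst ` (D \<union> D'). Q x)" by (auto simp: image_Un)
    ultimately show ?thesis by (simp only: inst.simps)
  qed
  moreover have "net_ok (E \<union> E') (S \<union> S') \<nu>B" using ok(1,2) by (auto simp: net_ok_def)
  moreover have "\<forall>x\<in>fst ` (D \<union> D'). set (\<pi> x) \<subseteq> S \<union> S'"
    using ok(5,6) unfolding image_Un by blast
  ultimately show ?thesis using ok(3,4) unfolding open_realizes_def by blast
qed

lemma closing_net_ok:
  assumes "closing N n S D \<pi> F Q v" "finite D" "net_ok E S \<nu>"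
  shows "net_ok (E \<union> (\<Union>x\<in>fst ` D. F x)) (S \<union> (\<Union>x\<in>fst ` D. Q x)) \<nu>"
proof -
  have "net_ok (F x) (Q x) (\<pi> x)" if "x \<in> fst ` D" for x
  proof -
    from that obtain A where "(x, A) \<in> D" by (rule fst_imageE)
    then show ?thesis using assms(1) realizes_ok unfolding closing_def by blast
  qed
  then show ?thesis using assms(2,3) unfolding net_ok_def verts_Un verts_UN by blast
qed

text \<open>The net does not change: the ports \<open>\<rho>\<close> of the bound variable become
  the argument ports of the implication. An argument is treated as the realizer of variable 0, and a
  beta-expansion restores the application.\<close>

lemma open_realizes_abs:
  assumes u: "open_realizes N n E S (insert (0, A) (apfst Suc ` D)) (case_nat \<rho> \<pi>) u B \<nu>"
    and len: "length \<nu> = wd B" and lin: "linear (Abs u)"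
  shows "open_realizes N n E S D \<pi> (Abs u) (A \<multimap> B) (\<nu> @ rev \<rho>)"
proof -
  let ?D = "insert (0, A) (apfst Suc ` D)"
  have dom: "fst ` ?D = insert 0 (Suc ` fst ` D)" by (auto simp: image_image)
  have "finite (apfst Suc ` D)" using u by (auto simp: open_realizes_def)
  then have fin: "finite D" by (rule finite_imageD) (auto simp: inj_on_def)
  have ok: "net_ok E S \<nu>" "set \<rho> \<subseteq> S" "\<And>x. x \<in> fst ` D \<Longrightarrow> set (\<pi> x) \<subseteq> S"
    using u unfolding open_realizes_def dom by auto
  have okr: "net_ok E S (\<nu> @ rev \<rho>)" using ok by (simp add: net_ok_def)
  have "realizes N n (A \<multimap> B) (E \<union> (\<Union>x\<in>fst ` D. F x)) (S \<union> (\<Union>x\<in>fst ` D. Q x)) (\<nu> @ rev \<rho>) (inst 0 v (Abs u))"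
    if c: "closing N n S D \<pi> F Q v" for F Q v
  proof -
    let ?E = "E \<union> (\<Union>x\<in>fst ` D. F x)" and ?S = "S \<union> (\<Union>x\<in>fst ` D. Q x)"
    have clv: "closed_linear (v x)" for x using c by (simp add: closing_def)
    have cl: "closed_linear (inst 0 v (Abs u))" using closed_linear_inst[OF lin clv] .
    have "realizes N n B (?E \<union> F') (?S \<union> Q') \<nu> (App (inst 0 v (Abs u)) v')"
      if F': "realizes N n A F' Q' \<rho> v'" "Q' \<inter> ?S \<subseteq> set \<rho>" for F' Q' v'
    proof -
      have clv': "closed_linear v'" using realizes_ok F'(1) by blast
      have old: "Q y \<inter> Q' \<subseteq> set (\<pi> y)" if "y \<in> fst ` D" for y
      proof -
        from that obtain C where "(y, C) \<in> D" by (rule fst_imageE)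
        then have "Q y \<inter> S \<subseteq> set (\<pi> y)" using c by (auto simp: closing_def)
        then show ?thesis using F'(2) ok(2) that by blast
      qed
      have "closing N n S ?D (case_nat \<rho> \<pi>) (case_nat F' F) (case_nat Q' Q) (case_nat v' v)"
        unfolding closing_def dom
      proof (intro conjI allI impI ballI)
        show "closed_linear (case_nat v' v x)" for x using clv clv' by (cases x) auto
        fix x C assume x: "(x, C) \<in> ?D"
        have x0: "x = 0 \<and> C = A \<or> (\<exists>x'. x = Suc x' \<and> (x', C) \<in> D)" using x by auto
        then show "realizes N n C (case_nat F' F x) (case_nat Q' Q x) (case_nat \<rho> \<pi> x) (case_nat v' v x)"
          using closingD(2)[OF c] F'(1) by auto
        have x1: "x = 0 \<or> (\<exists>x'. x = Suc x' \<and> x' \<in> fst ` D)" using x0 by force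
        have Q'S: "Q' \<inter> S \<subseteq> set \<rho>" "\<And>y. y \<in> fst ` D \<Longrightarrow> Q' \<inter> Q y \<subseteq> set \<rho>" using F'(2) by blast+
        show "case_nat Q' Q x \<inter> S \<subseteq> set (case_nat \<rho> \<pi> x)"
          using x1 closingD(3)[OF c] Q'S(1) by (elim disjE exE conjE) simp_all
        fix y assume y: "y \<in> insert 0 (Suc ` fst ` D)" "y \<noteq> x"
        then have "y = 0 \<and> x \<noteq> 0 \<or> (\<exists>y'. y = Suc y' \<and> y' \<in> fst ` D \<and> Suc y' \<noteq> x)"
          by (cases y) auto
        then show "case_nat Q' Q x \<inter> case_nat Q' Q y \<subseteq> set (case_nat \<rho> \<pi> x)"
          using x1 Q'S(2) old closingD(4)[OF c] by (elim disjE exE conjE) simp_all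
      qed
      from open_realizesD[OF u this]
      have "realizes N n B (?E \<union> F') (?S \<union> Q') \<nu> (inst 0 (case_nat v' v) u)"
        unfolding dom by (simp add: Un_ac)
      moreover have "beta_eta_equiv (inst 0 (case_nat v' v) u) (App (inst 0 v (Abs u)) v')"
      proof -
        have "red (App (inst 0 v (Abs u)) v') (inst 0 (case_nat v' v) u)"
          using red.beta[of "inst (Suc 0) v u" v'] subst_inst[OF clv clv', where k = 0 and t = u] by simp
        moreover have "linear (App (inst 0 v (Abs u)) v')"
          using closed_linear_App[OF cl clv'] by (simp add: closed_linear_def del: inst.simps)
        ultimately show ?thesis using red_imp_equiv beta_eta_equiv_sym by blast
      qed
      ultimately show ?thesis using realizes_equiv closed_linear_App[OF cl clv'] by blast
    qed
    then show ?thesis using closing_net_ok[OF c fin okr] cl unfolding realizes_Limp[OF len] by blast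
  qed
  then show ?thesis using okr fin ok(3) unfolding open_realizes_def by blast
qed

lemma open_realizes_rename:
  assumes u: "open_realizes N n E S D \<pi> u B \<nu>" and inj: "inj \<rho>"
    and \<pi>': "\<And>x. x \<in> fst ` D \<Longrightarrow> \<pi>' (\<rho> x) = \<pi> x"
  shows "open_realizes N n E S (apfst \<rho> ` D) \<pi>' (rename \<rho> u) B \<nu>"
proof -
  have dom: "fst ` apfst \<rho> ` D = \<rho> ` fst ` D" by (auto simp: image_image)
  have "realizes N n B (E \<union> (\<Union>x\<in>fst ` apfst \<rho> ` D. F x)) (S \<union> (\<Union>x\<in>fst ` apfst \<rho> ` D. Q x)) \<nu>
      (inst 0 v (rename \<rho> u))" if c: "closing N n S (apfst \<rho> ` D) \<pi>' F Q v" for F Q v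
  proof -
    have "closing N n S D \<pi> (F \<circ> \<rho>) (Q \<circ> \<rho>) (v \<circ> \<rho>)"
      unfolding closing_def
    proof (intro conjI allI impI ballI)
      show "closed_linear ((v \<circ> \<rho>) x)" for x using c by (simp add: closing_def)
      fix x A assume x: "(x, A) \<in> D"
      then have x': "(\<rho> x, A) \<in> apfst \<rho> ` D" "\<pi>' (\<rho> x) = \<pi> x" using \<pi>' by force+
      then show "realizes N n A ((F \<circ> \<rho>) x) ((Q \<circ> \<rho>) x) (\<pi> x) ((v \<circ> \<rho>) x)"
        "(Q \<circ> \<rho>) x \<inter> S \<subseteq> set (\<pi> x)" using c unfolding closing_def by fastforce+
      fix y assume "y \<in> fst ` D" "y \<noteq> x"
      then have "\<rho> y \<in> fst ` apfst \<rho> ` D" "\<rho> y \<noteq> \<rho> x" using inj unfolding dom by (auto dest: injD)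
      then have "Q (\<rho> x) \<inter> Q (\<rho> y) \<subseteq> set (\<pi>' (\<rho> x))" using c x'(1) unfolding closing_def by blast
      then show "(Q \<circ> \<rho>) x \<inter> (Q \<circ> \<rho>) y \<subseteq> set (\<pi> x)" using x' by simp
    qed
    from open_realizesD[OF u this] show ?thesis
      using inst_rename[of 0 \<rho> v "v \<circ> \<rho>" u] unfolding dom by simp
  qed
  then show ?thesis using u \<pi>' unfolding open_realizes_def dom by auto
qed

lemma open_realizes_wire:
  assumes u: "open_realizes N n E S D \<pi> u B \<nu>"
    and \<nu>: "length \<nu> = wd B" "length \<nu>' = wd B" "distinct \<nu>" "distinct \<nu>'" "0 \<notin> set \<nu>" "0 \<notin> set \<nu>'"
      "S \<inter> set \<nu>' = {}"
  shows "open_realizes N n (E \<union> wires (tsg B) \<nu> \<nu>') (S \<union> set \<nu>') D \<pi> u B \<nu>'"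
proof -
  have ok: "net_ok E S \<nu>" "finite D" "\<And>x. x \<in> fst ` D \<Longrightarrow> set (\<pi> x) \<subseteq> S"
    using u by (auto simp: open_realizes_def)
  have "realizes N n B (E \<union> wires (tsg B) \<nu> \<nu>' \<union> (\<Union>x\<in>fst ` D. F x)) (S \<union> set \<nu>' \<union> (\<Union>x\<in>fst ` D. Q x)) \<nu>' (inst 0 v u)"
    if c: "closing N n (S \<union> set \<nu>') D \<pi> F Q v" for F Q v
  proof -
    have "closing N n S D \<pi> F Q v" using c unfolding closing_def by blast
    from open_realizesD[OF u this]
    have R: "realizes N n B (E \<union> (\<Union>x\<in>fst ` D. F x)) (S \<union> (\<Union>x\<in>fst ` D. Q x)) \<nu> (inst 0 v u)" .
    have "Q x \<inter> set \<nu>' = {}" if "x \<in> fst ` D" for x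
    proof -
      from that obtain A where "(x, A) \<in> D" by (rule fst_imageE)
      then have "Q x \<inter> (S \<union> set \<nu>') \<subseteq> set (\<pi> x)" using c by (simp add: closing_def)
      then show ?thesis using ok(3)[OF that] \<nu>(7) by blast
    qed
    then have "(S \<union> (\<Union>x\<in>fst ` D. Q x)) \<inter> set \<nu>' = {}" using \<nu>(7) by blast
    from realizes_wire[OF R \<nu>(1-6) this] show ?thesis by (simp add: Un_ac)
  qed
  moreover have "net_ok (E \<union> wires (tsg B) \<nu> \<nu>') (S \<union> set \<nu>') \<nu>'"
    using ok(1) \<nu>(1,2) by (auto simp: net_ok_def verts_wires)
  ultimately show ?thesis using ok unfolding open_realizes_def by blast
qed

text \<open>As for closed terms, with all nets of the environment moved away from the hidden names
  by one swap.\<close>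

lemma open_realizes_hide:
  assumes u: "open_realizes N n E S D \<pi> u B \<nu>"
    and sim: "simulates X E E'" and v: "verts E' \<subseteq> insert 0 (S - X)"
    and X: "0 \<notin> X" "finite X" "set \<nu> \<inter> X = {}" "\<And>x. x \<in> fst ` D \<Longrightarrow> set (\<pi> x) \<inter> X = {}"
  shows "open_realizes N n E' (S - X) D \<pi> u B \<nu>"
proof -
  have ok: "net_ok E S \<nu>" "finite D" "\<And>x. x \<in> fst ` D \<Longrightarrow> set (\<pi> x) \<subseteq> S"
    using u by (auto simp: open_realizes_def)
  have "realizes N n B (E' \<union> (\<Union>x\<in>fst ` D. F x)) (S - X \<union> (\<Union>x\<in>fst ` D. Q x)) \<nu> (inst 0 v u)"
    if c: "closing N n (S - X) D \<pi> F Q v" for F Q v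
  proof -
    let ?F = "\<Union>x\<in>fst ` D. F x" and ?Q = "\<Union>x\<in>fst ` D. Q x"
    have okF: "net_ok (F x) (Q x) (\<pi> x)" if "x \<in> fst ` D" for x
    proof -
      from that obtain A where "(x, A) \<in> D" by (rule fst_imageE)
      then show ?thesis using c realizes_ok unfolding closing_def by blast
    qed
    have fin: "finite (insert 0 (S \<union> ?Q))" using ok okF by (auto simp: net_ok_def)
    obtain f where f: "\<And>x. f (f x) = x" "f ` X \<inter> (X \<union> insert 0 (S \<union> ?Q)) = {}"
      "\<And>x. x \<in> insert 0 (S \<union> ?Q) \<Longrightarrow> x \<notin> X \<Longrightarrow> f x = x"
      using swap_names[OF X(2) fin] by metis
    have f0: "f 0 = 0" using f(3) X(1) by blast
    have same: "map f xs = xs" if "set xs \<subseteq> S" "set xs \<inter> X = {}" for xs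
      by (rule map_idI) (use f(3) that in blast)
    have same_\<pi>: "map f (\<pi> x) = \<pi> x" if "x \<in> fst ` D" for x
      using same[OF ok(3)[OF that] X(4)[OF that]] .
    have "set \<nu> \<subseteq> S" using ok(1) by (simp add: net_ok_def)
    note same = same[OF this X(3)]
    have inv: "f x \<in> Y \<longleftrightarrow> x \<in> f ` Y" for x Y using f(1) by (metis image_iff)
    have QX: "f ` ?Q \<inter> X = {}" using f(2) inv[of _ X] by auto
    have "closing N n S D \<pi> (\<lambda>x. ren f (F x)) (\<lambda>x. f ` Q x) v"
      unfolding closing_def
    proof (intro conjI allI impI ballI)
      show "closed_linear (v x)" for x using c by (simp add: closing_def)
      fix x A assume x: "(x, A) \<in> D"
      then have xD: "x \<in> fst ` D" by force
      have cx: "realizes N n A (F x) (Q x) (\<pi> x) (v x)" "Q x \<inter> (S - X) \<subseteq> set (\<pi> x)"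
        using c x by (auto simp: closing_def)
      show "realizes N n A (ren f (F x)) (f ` Q x) (\<pi> x) (v x)"
        using realizes_ren[OF cx(1) f(1) f(1) f0] same_\<pi>[OF xD] by simp
      show "f ` Q x \<inter> S \<subseteq> set (\<pi> x)"
      proof
        fix z assume "z \<in> f ` Q x \<inter> S"
        then obtain s where s: "s \<in> Q x" "z = f s" "f s \<in> S" by auto
        have "s \<notin> X" using s f(2) by auto
        moreover from this have "f s = s" using f(3) s xD by auto
        ultimately show "z \<in> set (\<pi> x)" using s cx(2) by auto
      qed
      fix y assume y: "y \<in> fst ` D" "y \<noteq> x"
      show "f ` Q x \<inter> f ` Q y \<subseteq> set (\<pi> x)"
      proof
        fix z assume "z \<in> f ` Q x \<inter> f ` Q y"
        then have "f z \<in> Q x \<inter> Q y" using inv by auto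
        then have "f z \<in> set (\<pi> x)" using closingD(4)[OF c xD y] by blast
        then have "f (f z) \<in> set (map f (\<pi> x))" by simp
        then show "z \<in> set (\<pi> x)" using f(1) same_\<pi>[OF xD] by simp
      qed
    qed
    from open_realizesD[OF u this]
    have R: "realizes N n B (E \<union> ren f ?F) (S \<union> f ` ?Q) \<nu> (inst 0 v u)" by (simp add: ren_UN image_UN)
    have "verts ?F \<subseteq> insert 0 ?Q" using okF unfolding verts_UN net_ok_def by blast
    then have vF: "verts (ren f ?F) \<subseteq> insert 0 (f ` ?Q)" unfolding verts_ren using f0 by auto
    then have vF': "verts (ren f ?F) \<inter> X = {}" using QX X(1) by auto
    have "verts (E' \<union> ren f ?F) \<subseteq> insert 0 ((S \<union> f ` ?Q) - X)"
      unfolding verts_Un using v vF QX by blast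
    then have "realizes N n B (E' \<union> ren f ?F) ((S \<union> f ` ?Q) - X) \<nu> (inst 0 v u)"
      by (rule realizes_hide[OF R simulates_Un[OF sim vF'] _ X(1-3)])
    from realizes_ren[OF this f(1) f(1) f0]
    have "realizes N n B (ren f E' \<union> ren f (ren f ?F)) (f ` ((S \<union> f ` ?Q) - X)) \<nu> (inst 0 v u)"
      unfolding ren_Un same .
    moreover have "ren f E' = E'"
      using v X(1) f(3) by (intro ren_ident) (metis Diff_iff UnI1 insert_iff subsetD)
    moreover have "ren f (ren f ?F) = ?F" unfolding ren_ren using f(1) by (intro ren_ident) simp
    moreover have "f ` ((S \<union> f ` ?Q) - X) = S - X \<union> ?Q"
    proof -
      have "(S \<union> f ` ?Q) - X = (S - X) \<union> f ` ?Q" using QX by auto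
      moreover have "f ` (S - X) = S - X" using f(3) by force
      ultimately show ?thesis using f(1) by (simp add: image_Un image_image)
    qed
    ultimately show ?thesis by simp
  qed
  moreover have "net_ok E' (S - X) \<nu>" using ok(1) v X(3) by (auto simp: net_ok_def)
  ultimately show ?thesis using ok X(4) unfolding open_realizes_def by blast
qed

section \<open>From typed terms to derivations\<close>

primrec tbound :: "tree_atom lty \<Rightarrow> boundary" where
  "tbound (Atom p) = Boundary 2 {1}"
| "tbound (A \<multimap> B) = tbound B \<otimes>\<^sub>b bdual (tbound A)"

lemma is_boundary_tbound: "is_boundary (tbound A)"
  by (induction A) (auto intro: is_boundary_btensor is_boundary_bdual, simp add: is_boundary_def)

lemma signs_tbound: "signs (tbound A) = tsg A"
  by (induction A)
    (simp_all add: signs_btensor signs_bdual is_boundary_tbound is_boundary_bdual,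
     simp add: signs_def upt_rec)

lemma dual_dual: "dual (dual A) = A"
  by (induction A) auto

lemma set_form_dual: "set_form (dual A) = set_form A"
  by (induction A) auto

lemma map_term_occ:
  "(\<And>c. c \<in> set_lterm t \<Longrightarrow> closed_linear (g c)) \<Longrightarrow> occ x (map_term g t) = occ x t"
  by (induction t arbitrary: x) (auto simp: closed_linear_def)

lemma map_term_linear:
  "(\<And>c. c \<in> set_lterm t \<Longrightarrow> closed_linear (g c)) \<Longrightarrow> linear (map_term g t) = linear t"
proof (induction t)
  case (App t s)
  then have "fv (map_term g t) = fv t" "fv (map_term g s) = fv s" by (simp_all add: fv_def map_term_occ)
  with App show ?case by simp
next
  case (Const c)
  then show ?case by (simp add: closed_linear_def)
next
  case (Abs t)
  then show ?case by (simp add: map_term_occ)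
qed simp

text \<open>\<open>lx\<close> gives the multiwords of the constants, and they are only asked to be
  well typed and to realize the images \<open>g c\<close>; \<open>atm\<close> inverts the numbering
  \<open>\<iota>\<close> of atoms by literals. This generality covers both the tree signature and
  the given abstract signature.\<close>

locale acg_llg =
  fixes N :: "'a set" and n :: nat and \<Sigma> :: "('p, 'c) signature"
    and f :: "'p \<Rightarrow> tree_atom lty" and g :: "'c \<Rightarrow> ('a \<times> nat) lterm"
    and \<iota> :: "'p \<Rightarrow> nat" and atm :: "nat \<Rightarrow> 'p"
    and G :: "(nat, 'a tsym) llg" and lx :: "'c \<Rightarrow> 'a tsym multiword"
    and tr :: "'p lty \<Rightarrow> nat form"
  assumes lit: "lit_bound G P = tbound (f (atm P))"
    and lits: "literals G = \<iota> ` atoms \<Sigma>"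
    and atm: "p \<in> atoms \<Sigma> \<Longrightarrow> atm (\<iota> p) = p"
    and tr_Atom: "tr (Atom p) = Pos (\<iota> p)"
    and tr_Limp: "tr (A \<multimap> B) = Par (dual (tr A)) (tr B)"
    and lexicon: "lexicon G = (\<lambda>c. (lx c, [tr (ctype \<Sigma> c)])) ` constants \<Sigma>"
    and ctypes: "c \<in> constants \<Sigma> \<Longrightarrow> ctype \<Sigma> c \<in> types_over \<Sigma>"
    and lx_typed: "c \<in> constants \<Sigma> \<Longrightarrow> well_typed (alphabet G) (tsg (map_type f (ctype \<Sigma> c))) (lx c)"
    and lx_realizes: "c \<in> constants \<Sigma> \<Longrightarrow> distinct \<nu> \<Longrightarrow> 0 \<notin> set \<nu> \<Longrightarrow>
      length \<nu> = wd (map_type f (ctype \<Sigma> c)) \<Longrightarrow>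
      realizes N n (map_type f (ctype \<Sigma> c)) (nm \<nu> (lx c)) (set \<nu>) \<nu> (g c)"
begin

abbreviation \<phi> :: "'p lty \<Rightarrow> tree_atom lty" where "\<phi> \<equiv> map_type f"

lemma is_boundary_lit: "is_boundary (lit_bound G P)"
  by (simp add: lit is_boundary_tbound)

lemma fbound_tr: "A \<in> types_over \<Sigma> \<Longrightarrow> fbound (lit_bound G) (tr A) = tbound (\<phi> A)"
proof (induction A)
  case (Atom p)
  then show ?case by (simp add: tr_Atom lit atm types_over_def)
next
  case (Limp A B)
  then have "A \<in> types_over \<Sigma>" "B \<in> types_over \<Sigma>" by (auto simp: types_over_def)
  with Limp show ?case
    using fbound_dual[of "tr A" "lit_bound G"] is_boundary_lit by (simp add: tr_Limp)
qed

sublocale llg_signs G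
proof
  show "is_boundary (lit_bound G P)" for P by (rule is_boundary_lit)
  show "well_typed (alphabet G) (signs (sbound (lit_bound G) \<Gamma>)) \<sigma>" if "(\<sigma>, \<Gamma>) \<in> lexicon G" for \<sigma> \<Gamma>
  proof -
    from that obtain c where c: "c \<in> constants \<Sigma>" "\<sigma> = lx c" "\<Gamma> = [tr (ctype \<Sigma> c)]"
      unfolding lexicon by auto
    have "signs (sbound (lit_bound G) \<Gamma>) = signs (fbound (lit_bound G) (tr (ctype \<Sigma> c)))"
      using c is_boundary_fbound[of "tr (ctype \<Sigma> c)" "lit_bound G"] is_boundary_lit
      by (simp add: btensor_def)
    then show ?thesis using lx_typed[OF c(1)] c fbound_tr[OF ctypes[OF c(1)]] by (simp add: signs_tbound)
  qed
qed

lemma fs_tr: "A \<in> types_over \<Sigma> \<Longrightarrow> fs (tr A) = tsg (\<phi> A)"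
  by (simp add: fbound_tr signs_tbound)

lemma fcard_tr: "A \<in> types_over \<Sigma> \<Longrightarrow> fcard G (tr A) = wd (\<phi> A)"
  using arg_cong[OF fs_tr[of A], of length] by simp

lemma tr_forms_over: "A \<in> types_over \<Sigma> \<Longrightarrow> tr A \<in> forms_over G"
  by (induction A) (auto simp: types_over_def forms_over_def tr_Atom tr_Limp set_form_dual lits)

text \<open>Closedness is part of realization, so any admissible naming of the ports of
  \<open>lx c\<close> yields it.\<close>

lemma g_closed: "c \<in> constants \<Sigma> \<Longrightarrow> closed_linear (g c)"
proof -
  assume c: "c \<in> constants \<Sigma>"
  obtain \<nu> :: "nat list" where "distinct \<nu>" "length \<nu> = wd (\<phi> (ctype \<Sigma> c))" "set \<nu> \<inter> {0} = {}"
    using fresh_list[of "{0}"] by blast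
  then show ?thesis using realizes_ok[OF lx_realizes[OF c, of \<nu>]] by auto
qed

lemma typed_type: "typed \<Sigma> \<Gamma> t A \<Longrightarrow> A \<in> types_over \<Sigma>"
proof (induction rule: typed.induct)
  case (abs \<Gamma> A \<Delta> t B)
  then have "A \<in> types_over \<Sigma>" using typed_facts[OF abs.hyps] by auto
  with abs show ?case by (auto simp: types_over_def)
qed (auto simp: types_over_def dest: ctypes[unfolded types_over_def])

lemma typed_map_linear: "typed \<Sigma> \<Gamma> t A \<Longrightarrow> linear (map_term g t)"
proof -
  assume t: "typed \<Sigma> \<Gamma> t A"
  have "linear t" "set_lterm t \<subseteq> constants \<Sigma>" using typed_facts[OF t] by auto
  then show ?thesis using g_closed by (subst map_term_linear) auto
qed

lemma typed_map_closed: "typed \<Sigma> [] t A \<Longrightarrow> closed_linear (map_term g t)"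
proof -
  assume t: "typed \<Sigma> [] t A"
  have "\<forall>x. occ x t = 0" "set_lterm t \<subseteq> constants \<Sigma>" using typed_facts[OF t] by auto
  then have "\<forall>x. occ x (map_term g t) = 0" using g_closed by (subst map_term_occ) auto
  then show ?thesis using typed_map_linear[OF t] by (simp add: closed_linear_def)
qed

lemma derivable_verts: "derivable G \<sigma> \<Gamma> \<Longrightarrow> verts (edges \<sigma>) \<subseteq> {1..scard G \<Gamma>}"
  using well_typedD(1)[OF derivable_well_typed, of \<sigma> \<Gamma>] by simp

lemma derivable_verts_nm:
  "derivable G \<sigma> \<Gamma> \<Longrightarrow> length \<nu> = scard G \<Gamma> \<Longrightarrow> verts (nm \<nu> \<sigma>) \<subseteq> insert 0 (set \<nu>)"
  using verts_nm[OF derivable_well_typed, of \<sigma> \<Gamma> \<nu>] by simp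

text \<open>Exchange swaps neighbours, and iterating it moves \<open>X\<close> past a whole block.
  The second clause records that the net stays the same once the names are permuted
  accordingly.\<close>

lemma move_right:
  "derivable G \<sigma> (\<Gamma> @ [X] @ \<Delta> @ \<Theta>) \<Longrightarrow> \<exists>\<sigma>'. derivable G \<sigma>' (\<Gamma> @ \<Delta> @ [X] @ \<Theta>) \<and>
     (\<forall>\<nu>\<Theta> \<nu>X \<nu>\<Delta> \<nu>\<Gamma>. length \<nu>\<Theta> = scard G \<Theta> \<longrightarrow> length \<nu>X = fcard G X \<longrightarrow> length \<nu>\<Delta> = scard G \<Delta> \<longrightarrow>
        nm (\<nu>\<Theta> @ \<nu>X @ \<nu>\<Delta> @ \<nu>\<Gamma>) \<sigma>' = nm (\<nu>\<Theta> @ \<nu>\<Delta> @ \<nu>X @ \<nu>\<Gamma>) \<sigma>)"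
proof (induction \<Delta> arbitrary: \<Gamma> \<sigma>)
  case Nil
  then show ?case by auto
next
  case (Cons Y \<Delta>)
  then have d: "derivable G \<sigma> (\<Gamma> @ [X, Y] @ (\<Delta> @ \<Theta>))" by simp
  let ?\<sigma> = "mw_exchange (scard G (\<Delta> @ \<Theta>)) (fcard G Y) (fcard G X) \<sigma>"
  have "derivable G ?\<sigma> ((\<Gamma> @ [Y]) @ [X] @ \<Delta> @ \<Theta>)" using derivable.Ex[OF d] by simp
  from Cons.IH[OF this] obtain \<sigma>' where \<sigma>': "derivable G \<sigma>' ((\<Gamma> @ [Y]) @ \<Delta> @ [X] @ \<Theta>)"
    and nm: "\<And>\<nu>\<Theta> \<nu>X \<nu>\<Delta> \<nu>\<Gamma>. length \<nu>\<Theta> = scard G \<Theta> \<Longrightarrow> length \<nu>X = fcard G X \<Longrightarrow> length \<nu>\<Delta> = scard G \<Delta> \<Longrightarrow>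
        nm (\<nu>\<Theta> @ \<nu>X @ \<nu>\<Delta> @ \<nu>\<Gamma>) \<sigma>' = nm (\<nu>\<Theta> @ \<nu>\<Delta> @ \<nu>X @ \<nu>\<Gamma>) ?\<sigma>" by blast
  have "nm (\<nu>\<Theta> @ \<nu>X @ \<nu>\<Delta> @ \<nu>\<Gamma>) \<sigma>' = nm (\<nu>\<Theta> @ \<nu>\<Delta> @ \<nu>X @ \<nu>\<Gamma>) \<sigma>"
    if l: "length \<nu>\<Theta> = scard G \<Theta>" "length \<nu>X = fcard G X" "length \<nu>\<Delta> = scard G (Y # \<Delta>)" for \<nu>\<Theta> \<nu>X \<nu>\<Delta> \<nu>\<Gamma>
  proof -
    obtain \<nu>\<Delta>' \<nu>Y where \<nu>\<Delta>: "\<nu>\<Delta> = \<nu>\<Delta>' @ \<nu>Y" "length \<nu>\<Delta>' = scard G \<Delta>" "length \<nu>Y = fcard G Y"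
      using l(3) scard_Cons split_length by metis
    have "nm (\<nu>\<Theta> @ \<nu>X @ \<nu>\<Delta> @ \<nu>\<Gamma>) \<sigma>' = nm (\<nu>\<Theta> @ \<nu>\<Delta>' @ \<nu>X @ \<nu>Y @ \<nu>\<Gamma>) ?\<sigma>"
      using nm[OF l(1,2) \<nu>\<Delta>(2), of "\<nu>Y @ \<nu>\<Gamma>"] \<nu>\<Delta>(1) by simp
    also have "\<dots> = nm ((\<nu>\<Theta> @ \<nu>\<Delta>') @ \<nu>X @ \<nu>Y @ \<nu>\<Gamma>) ?\<sigma>" by simp
    also have "\<dots> = nm ((\<nu>\<Theta> @ \<nu>\<Delta>') @ \<nu>Y @ \<nu>X @ \<nu>\<Gamma>) \<sigma>"
      using l \<nu>\<Delta> by (intro nm_mw_exchange[OF _ _ _ derivable_verts[OF d]]) (simp_all add: scard_append)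
    finally show ?thesis using \<nu>\<Delta>(1) by simp
  qed
  with \<sigma>' show ?case by auto
qed

lemma move_left:
  "derivable G \<sigma> (\<Gamma> @ \<Delta> @ [X] @ \<Theta>) \<Longrightarrow> \<exists>\<sigma>'. derivable G \<sigma>' (\<Gamma> @ [X] @ \<Delta> @ \<Theta>) \<and>
     (\<forall>\<nu>\<Theta> \<nu>X \<nu>\<Delta> \<nu>\<Gamma>. length \<nu>\<Theta> = scard G \<Theta> \<longrightarrow> length \<nu>X = fcard G X \<longrightarrow> length \<nu>\<Delta> = scard G \<Delta> \<longrightarrow>
        nm (\<nu>\<Theta> @ \<nu>\<Delta> @ \<nu>X @ \<nu>\<Gamma>) \<sigma>' = nm (\<nu>\<Theta> @ \<nu>X @ \<nu>\<Delta> @ \<nu>\<Gamma>) \<sigma>)"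
proof (induction \<Delta> arbitrary: \<Theta> \<sigma> rule: rev_induct)
  case Nil
  then show ?case by auto
next
  case (snoc Y \<Delta>)
  then have d: "derivable G \<sigma> ((\<Gamma> @ \<Delta>) @ [Y, X] @ \<Theta>)" by simp
  let ?\<sigma> = "mw_exchange (scard G \<Theta>) (fcard G X) (fcard G Y) \<sigma>"
  have "derivable G ?\<sigma> (\<Gamma> @ \<Delta> @ [X] @ ([Y] @ \<Theta>))" using derivable.Ex[OF d] by simp
  from snoc.IH[OF this] obtain \<sigma>' where \<sigma>': "derivable G \<sigma>' (\<Gamma> @ [X] @ \<Delta> @ [Y] @ \<Theta>)"
    and nm: "\<And>\<nu>\<Theta> \<nu>X \<nu>\<Delta> \<nu>\<Gamma>. length \<nu>\<Theta> = scard G ([Y] @ \<Theta>) \<Longrightarrow> length \<nu>X = fcard G X \<Longrightarrow> length \<nu>\<Delta> = scard G \<Delta> \<Longrightarrow>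
        nm (\<nu>\<Theta> @ \<nu>\<Delta> @ \<nu>X @ \<nu>\<Gamma>) \<sigma>' = nm (\<nu>\<Theta> @ \<nu>X @ \<nu>\<Delta> @ \<nu>\<Gamma>) ?\<sigma>" by blast
  have "nm (\<nu>\<Theta> @ \<nu>\<Delta> @ \<nu>X @ \<nu>\<Gamma>) \<sigma>' = nm (\<nu>\<Theta> @ \<nu>X @ \<nu>\<Delta> @ \<nu>\<Gamma>) \<sigma>"
    if l: "length \<nu>\<Theta> = scard G \<Theta>" "length \<nu>X = fcard G X" "length \<nu>\<Delta> = scard G (\<Delta> @ [Y])" for \<nu>\<Theta> \<nu>X \<nu>\<Delta> \<nu>\<Gamma>
  proof -
    have "length \<nu>\<Delta> = fcard G Y + scard G \<Delta>" using l(3) by (simp add: scard_append scard_Cons del: sbound.simps(2))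
    then obtain \<nu>Y \<nu>\<Delta>' where \<nu>\<Delta>: "\<nu>\<Delta> = \<nu>Y @ \<nu>\<Delta>'" "length \<nu>Y = fcard G Y" "length \<nu>\<Delta>' = scard G \<Delta>"
      using split_length by metis
    have "length (\<nu>\<Theta> @ \<nu>Y) = scard G ([Y] @ \<Theta>)"
      using l(1) \<nu>\<Delta>(2) by (simp add: scard_Cons del: sbound.simps(2))
    from nm[OF this l(2) \<nu>\<Delta>(3), of \<nu>\<Gamma>]
    have "nm (\<nu>\<Theta> @ \<nu>\<Delta> @ \<nu>X @ \<nu>\<Gamma>) \<sigma>' = nm (\<nu>\<Theta> @ \<nu>Y @ \<nu>X @ \<nu>\<Delta>' @ \<nu>\<Gamma>) ?\<sigma>" using \<nu>\<Delta>(1) by simp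
    also have "\<dots> = nm (\<nu>\<Theta> @ \<nu>X @ \<nu>Y @ \<nu>\<Delta>' @ \<nu>\<Gamma>) \<sigma>"
      by (rule nm_mw_exchange[OF l(1) \<nu>\<Delta>(2) l(2) derivable_verts[OF d]])
    finally show ?thesis using \<nu>\<Delta>(1) by simp
  qed
  with \<sigma>' show ?case by auto
qed

section \<open>Sequents for typed terms in context\<close>

definition ports :: "(nat \<Rightarrow> nat list) \<Rightarrow> 'p ctxt \<Rightarrow> nat list" where
  "ports \<pi> \<Gamma> = concat (map (\<lambda>(x, A). \<pi> x) \<Gamma>)"

definition neg :: "'p ctxt \<Rightarrow> nat form list" where
  "neg \<Gamma> = map (\<lambda>(x, A). dual (tr A)) \<Gamma>"

definition named_ok :: "nat list \<Rightarrow> (nat \<Rightarrow> nat list) \<Rightarrow> 'p ctxt \<Rightarrow> 'p lty \<Rightarrow> bool" where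
  "named_ok \<nu> \<pi> \<Gamma> A \<longleftrightarrow> length \<nu> = wd (\<phi> A) \<and> (\<forall>(x, B)\<in>set \<Gamma>. length (\<pi> x) = wd (\<phi> B))
     \<and> distinct (\<nu> @ ports \<pi> \<Gamma>) \<and> 0 \<notin> set (\<nu> @ ports \<pi> \<Gamma>)"

lemma ports_append: "ports \<pi> (\<Gamma> @ \<Delta>) = ports \<pi> \<Gamma> @ ports \<pi> \<Delta>"
  by (simp add: ports_def)

lemma neg_append: "neg (\<Gamma> @ \<Delta>) = neg \<Gamma> @ neg \<Delta>"
  by (simp add: neg_def)

lemma set_ports: "set (ports \<pi> \<Gamma>) = (\<Union>x\<in>fst ` set \<Gamma>. set (\<pi> x))"
  by (auto simp: ports_def split_beta)

lemma ports_shift: "ports (case_nat \<rho> \<pi>) (map (apfst Suc) \<Gamma>) = ports \<pi> \<Gamma>"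
  by (simp add: ports_def o_def case_prod_unfold)

lemma neg_shift: "neg (map (apfst h) \<Gamma>) = neg \<Gamma>"
  by (simp add: neg_def o_def split_beta)

lemma length_ports:
  "\<forall>(x, B)\<in>set \<Gamma>. length (\<pi> x) = wd (\<phi> B) \<Longrightarrow> snd ` set \<Gamma> \<subseteq> types_over \<Sigma> \<Longrightarrow>
   length (ports \<pi> \<Gamma>) = scard G (neg \<Gamma>)"
proof (induction \<Gamma>)
  case Nil
  then show ?case by (simp add: ports_def neg_def)
next
  case (Cons a \<Gamma>)
  obtain x B where a: "a = (x, B)" by force
  have "length (ports \<pi> (a # \<Gamma>)) = wd (\<phi> B) + scard G (neg \<Gamma>)"
    using Cons a by (simp add: ports_def)
  also have "wd (\<phi> B) = fcard G (dual (tr B))" using Cons.prems a by (simp add: fcard_dual fcard_tr)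
  finally show ?case using a scard_Cons[of "dual (tr B)" "neg \<Gamma>"] by (simp add: neg_def)
qed

abbreviation ctx :: "'p ctxt \<Rightarrow> (nat \<times> tree_atom lty) set" where
  "ctx \<Gamma> \<equiv> apsnd \<phi> ` set \<Gamma>"

text \<open>\<open>sbound\<close> starts from the last formula, so the names of the result come
  first. Those of the context follow, reversed as a sequence of blocks and also inside each block,
  because the context formulas are dualised.\<close>

definition derives :: "'p ctxt \<Rightarrow> 'c lterm \<Rightarrow> 'p lty \<Rightarrow> 'a tsym multiword \<Rightarrow> bool" where
  "derives \<Gamma> t A \<sigma> \<longleftrightarrow> derivable G \<sigma> (neg \<Gamma> @ [tr A]) \<and>
     (\<forall>\<nu> \<pi>. named_ok \<nu> \<pi> \<Gamma> A \<longrightarrow> open_realizes N n (nm (\<nu> @ rev (ports \<pi> \<Gamma>)) \<sigma>)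
        (set (\<nu> @ ports \<pi> \<Gamma>)) (ctx \<Gamma>) \<pi> (map_term g t) (\<phi> A) \<nu>)"

lemma derivesD:
  "derives \<Gamma> t A \<sigma> \<Longrightarrow> named_ok \<nu> \<pi> \<Gamma> A \<Longrightarrow> open_realizes N n (nm (\<nu> @ rev (ports \<pi> \<Gamma>)) \<sigma>)
     (set (\<nu> @ ports \<pi> \<Gamma>)) (ctx \<Gamma>) \<pi> (map_term g t) (\<phi> A) \<nu>"
  unfolding derives_def by blast

text \<open>Elimination of the implication in linear logic: its dual is
  \<open>tr A \<otimes>\<^sub>f dual (tr B)\<close>, which is obtained by tensoring the argument
  with an identity on \<open>tr B\<close>; cutting it against the function leaves
  \<open>tr B\<close>.\<close>

lemma derives_app:
  assumes t: "typed \<Sigma> \<Gamma> t (A \<multimap> B)" and s: "typed \<Sigma> \<Delta> s A"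
    and disj: "fst ` set \<Gamma> \<inter> fst ` set \<Delta> = {}"
    and \<sigma>1: "derives \<Gamma> t (A \<multimap> B) \<sigma>1" and \<sigma>2: "derives \<Delta> s A \<sigma>2"
  shows "\<exists>\<sigma>. derives (\<Gamma> @ \<Delta>) (App t s) B \<sigma>"
proof -
  have AB: "A \<in> types_over \<Sigma>" "B \<in> types_over \<Sigma>" "snd ` set \<Gamma> \<subseteq> types_over \<Sigma>" "snd ` set \<Delta> \<subseteq> types_over \<Sigma>"
    using typed_type[OF t] typed_facts[OF t] typed_facts[OF s] by (auto simp: types_over_def)
  have d1: "derivable G \<sigma>1 (neg \<Gamma> @ [tr (A \<multimap> B)])" and d2: "derivable G \<sigma>2 (neg \<Delta> @ [tr A])"
    using \<sigma>1 \<sigma>2 by (auto simp: derives_def)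
  let ?id = "mw_id (fbound (lit_bound G) (tr B)) :: 'a tsym multiword"
  let ?X = "tr A \<otimes>\<^sub>f dual (tr B)"
  have did: "derivable G ?id (dual (tr B) # [tr B])"
    using derivable.Id[OF tr_forms_over[OF AB(2)]] .
  let ?\<tau>0 = "mw_tensor (scard G [tr B]) (fcard G (tr A)) (fcard G (dual (tr B))) \<sigma>2 ?id"
  have "derivable G ?\<tau>0 ([] @ neg \<Delta> @ [?X] @ [tr B])" using derivable.Tensor[OF d2 did] by simp
  from move_left[OF this] obtain \<tau> where d\<tau>: "derivable G \<tau> ([] @ [?X] @ neg \<Delta> @ [tr B])"
    and nm\<tau>: "\<And>\<nu>\<Theta> \<nu>X \<nu>\<Delta> \<nu>\<Gamma>. length \<nu>\<Theta> = scard G [tr B] \<Longrightarrow> length \<nu>X = fcard G ?X \<Longrightarrow>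
      length \<nu>\<Delta> = scard G (neg \<Delta>) \<Longrightarrow> nm (\<nu>\<Theta> @ \<nu>\<Delta> @ \<nu>X @ \<nu>\<Gamma>) \<tau> = nm (\<nu>\<Theta> @ \<nu>X @ \<nu>\<Delta> @ \<nu>\<Gamma>) ?\<tau>0"
    by blast
  have dualX: "dual (tr (A \<multimap> B)) = ?X" by (simp add: tr_Limp dual_dual)
  let ?z = "scard G (neg \<Delta> @ [tr B])" and ?y = "fcard G (tr (A \<multimap> B))"
  let ?\<sigma> = "mw_comp ?z ?y \<tau> \<sigma>1"
  have d\<tau>': "derivable G \<tau> (dual (tr (A \<multimap> B)) # (neg \<Delta> @ [tr B]))" using d\<tau> unfolding dualX by simp
  have d: "derivable G ?\<sigma> (neg (\<Gamma> @ \<Delta>) @ [tr B])"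
    using derivable.Cut[OF d1 d\<tau>'] by (simp add: neg_append)
  have w: "wd (\<phi> A) = fcard G (tr A)" "wd (\<phi> B) = fcard G (tr B)" using AB by (simp_all add: fcard_tr)
  have sB: "scard G [tr B] = wd (\<phi> B)" using scard_Cons[of "tr B" "[]"] w scard_Nil by simp
  have z: "?z = wd (\<phi> B) + scard G (neg \<Delta>)" unfolding scard_append sB by simp
  have y: "?y = wd (\<phi> B) + wd (\<phi> A)"
    using fcard_tr[OF typed_type[OF t]] by simp
  have X: "fcard G ?X = wd (\<phi> A) + wd (\<phi> B)"
    using arg_cong[OF fs_Tensor[of "tr A" "dual (tr B)"], of length] w by (simp add: fcard_dual)
  have "open_realizes N n (nm (\<nu> @ rev (ports \<pi> (\<Gamma> @ \<Delta>))) ?\<sigma>) (set (\<nu> @ ports \<pi> (\<Gamma> @ \<Delta>)))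
      (ctx (\<Gamma> @ \<Delta>)) \<pi> (map_term g (App t s)) (\<phi> B) \<nu>"
    if ok: "named_ok \<nu> \<pi> (\<Gamma> @ \<Delta>) B" for \<nu> \<pi>
  proof -
    let ?p\<Gamma> = "ports \<pi> \<Gamma>" and ?p\<Delta> = "ports \<pi> \<Delta>"
    have lens: "length \<nu> = wd (\<phi> B)" "\<forall>(x, B)\<in>set \<Gamma>. length (\<pi> x) = wd (\<phi> B)"
      "\<forall>(x, B)\<in>set \<Delta>. length (\<pi> x) = wd (\<phi> B)" using ok by (auto simp: named_ok_def)
    have lp: "length ?p\<Gamma> = scard G (neg \<Gamma>)" "length ?p\<Delta> = scard G (neg \<Delta>)"
      using length_ports lens AB by blast+
    have dis: "distinct (\<nu> @ ?p\<Gamma> @ ?p\<Delta>)" "0 \<notin> set (\<nu> @ ?p\<Gamma> @ ?p\<Delta>)"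
      using ok by (simp_all add: named_ok_def ports_append)
    \<comment> \<open>Fresh names for the cut formula, avoiding the ports of result and context;
      they are hidden at the end.\<close>
    obtain \<nu>BA where \<nu>BA: "distinct \<nu>BA" "length \<nu>BA = wd (\<phi> B) + wd (\<phi> A)"
      "set \<nu>BA \<inter> insert 0 (set (\<nu> @ ?p\<Gamma> @ ?p\<Delta>)) = {}"
      using fresh_list[of "insert 0 (set (\<nu> @ ?p\<Gamma> @ ?p\<Delta>))"] by blast
    obtain \<nu>B \<mu> where \<mu>: "\<nu>BA = \<nu>B @ \<mu>" "length \<nu>B = wd (\<phi> B)" "length \<mu> = wd (\<phi> A)"
      using split_length[OF \<nu>BA(2)] .
    define \<nu>A where "\<nu>A = rev \<mu>"
    have \<nu>X: "\<nu>BA = \<nu>B @ rev \<nu>A" "length \<nu>A = wd (\<phi> A)" using \<mu> by (simp_all add: \<nu>A_def)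
    note fresh = \<nu>BA(1,3)[unfolded \<nu>X(1)]
    have or1: "open_realizes N n (nm ((\<nu>B @ rev \<nu>A) @ rev ?p\<Gamma>) \<sigma>1) (set ((\<nu>B @ rev \<nu>A) @ ?p\<Gamma>)) (ctx \<Gamma>) \<pi>
        (map_term g t) (\<phi> A \<multimap> \<phi> B) (\<nu>B @ rev \<nu>A)"
    proof -
      have "named_ok (\<nu>B @ rev \<nu>A) \<pi> \<Gamma> (A \<multimap> B)"
        using lens dis fresh \<mu> \<nu>X by (auto simp: named_ok_def)
      from derivesD[OF \<sigma>1 this] show ?thesis unfolding map_type.simps .
    qed
    have or2: "open_realizes N n (nm (\<nu>A @ rev ?p\<Delta>) \<sigma>2) (set (\<nu>A @ ?p\<Delta>)) (ctx \<Delta>) \<pi> (map_term g s) (\<phi> A) \<nu>A"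
    proof -
      have "named_ok \<nu>A \<pi> \<Delta> A" using lens dis fresh \<nu>X by (auto simp: named_ok_def)
      from derivesD[OF \<sigma>2 this] show ?thesis .
    qed
    let ?E0 = "nm ((\<nu>B @ rev \<nu>A) @ rev ?p\<Gamma>) \<sigma>1 \<union> nm (\<nu>A @ rev ?p\<Delta>) \<sigma>2"
    let ?S0 = "set ((\<nu>B @ rev \<nu>A) @ ?p\<Gamma>) \<union> set (\<nu>A @ ?p\<Delta>)"
    \<comment> \<open>The semantic side of the cut: application at the fresh ports, then wires from
      \<open>\<nu>B\<close> to the requested ports \<open>\<nu>\<close>, supplied by the identity,
      then hiding.\<close>
    have "open_realizes N n ?E0 ?S0 (ctx \<Gamma> \<union> ctx \<Delta>) \<pi> (App (map_term g t) (map_term g s)) (\<phi> B) \<nu>B"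
      using dis fresh disj by (intro open_realizes_app[OF or1 or2 \<mu>(2)]) (auto simp: image_image)
    from open_realizes_wire[OF this \<mu>(2) lens(1)]
    have or3: "open_realizes N n (?E0 \<union> wires (tsg (\<phi> B)) \<nu>B \<nu>) (?S0 \<union> set \<nu>) (ctx \<Gamma> \<union> ctx \<Delta>) \<pi>
        (App (map_term g t) (map_term g s)) (\<phi> B) \<nu>"
      using dis fresh by auto
    have nm0: "nm ((\<nu> @ rev ?p\<Delta>) @ rev (\<nu>B @ rev \<nu>A)) \<tau> = nm (\<nu>A @ rev ?p\<Delta>) \<sigma>2 \<union> wires (tsg (\<phi> B)) \<nu>B \<nu>"
    proof -
      have "nm ((\<nu> @ rev ?p\<Delta>) @ rev (\<nu>B @ rev \<nu>A)) \<tau> = nm (\<nu> @ rev ?p\<Delta> @ (\<nu>A @ rev \<nu>B) @ []) \<tau>" by simp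
      also have "\<dots> = nm (\<nu> @ (\<nu>A @ rev \<nu>B) @ rev ?p\<Delta> @ []) ?\<tau>0"
        by (rule nm\<tau>) (use lens lp sB X \<mu> \<nu>X in simp_all)
      also have "\<dots> = nm (\<nu> @ \<nu>A @ rev \<nu>B @ rev ?p\<Delta>) ?\<tau>0" by simp
      also have "\<dots> = nm (\<nu>A @ rev ?p\<Delta>) \<sigma>2 \<union> nm (\<nu> @ rev \<nu>B) ?id"
      proof (rule nm_mw_tensor[OF _ _ _ derivable_verts[OF d2]])
        show "verts (edges ?id) \<subseteq> {1..scard G [tr B] + fcard G (dual (tr B))}"
          using derivable_verts[OF did] unfolding scard_Cons[of "dual (tr B)"] .
      qed (use lens sB w \<mu> \<nu>X in \<open>simp_all add: fcard_dual\<close>)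
      also have "nm (\<nu> @ rev \<nu>B) ?id = wires (tsg (\<phi> B)) \<nu>B \<nu>"
        using nm_mw_id[OF is_boundary_f, of \<nu> "tr B" "rev \<nu>B"] lens \<mu> w fs_tr[OF AB(2)] by simp
      finally show ?thesis .
    qed
    have sim: "simulates (set (\<nu>B @ rev \<nu>A)) (?E0 \<union> wires (tsg (\<phi> B)) \<nu>B \<nu>)
        (nm ((\<nu> @ rev ?p\<Delta>) @ rev ?p\<Gamma>) ?\<sigma>)"
    proof -
      have "length (ss (neg \<Gamma> @ [tr (A \<multimap> B)])) = ?y + scard G (neg \<Gamma>)"
        by (simp add: scard_append scard_Cons del: sbound.simps(2))
      moreover have "length (ss (dual (tr (A \<multimap> B)) # (neg \<Delta> @ [tr B]))) = ?z + ?y"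
        by (simp add: scard_append scard_Cons fcard_dual del: sbound.simps(2))
      moreover have "distinct ((\<nu> @ rev ?p\<Delta>) @ (\<nu>B @ rev \<nu>A) @ rev ?p\<Gamma>)" using dis fresh by auto
      moreover have "length (\<nu> @ rev ?p\<Delta>) = ?z" "length (\<nu>B @ rev \<nu>A) = ?y" "length (rev ?p\<Gamma>) = scard G (neg \<Gamma>)"
        using lens lp z y \<mu> \<nu>X by simp_all
      ultimately have "simulates (set (\<nu>B @ rev \<nu>A))
          (nm ((\<nu> @ rev ?p\<Delta>) @ rev (\<nu>B @ rev \<nu>A)) \<tau> \<union> nm ((\<nu>B @ rev \<nu>A) @ rev ?p\<Gamma>) \<sigma>1)
          (nm ((\<nu> @ rev ?p\<Delta>) @ rev ?p\<Gamma>) ?\<sigma>)"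
        by (rule simulates_comp[OF derivable_well_typed[OF d1] _ derivable_well_typed[OF d\<tau>']])
      then show ?thesis unfolding nm0 by (simp only: Un_ac)
    qed
    have S: "?S0 \<union> set \<nu> - set (\<nu>B @ rev \<nu>A) = set (\<nu> @ ports \<pi> (\<Gamma> @ \<Delta>))"
      using fresh(2) by (auto simp: ports_append)
    have nd: "nm ((\<nu> @ rev ?p\<Delta>) @ rev ?p\<Gamma>) ?\<sigma> = nm (\<nu> @ rev (ports \<pi> (\<Gamma> @ \<Delta>))) ?\<sigma>"
      by (simp add: ports_append)
    have "length (\<nu> @ rev (ports \<pi> (\<Gamma> @ \<Delta>))) = scard G (neg (\<Gamma> @ \<Delta>) @ [tr B])"
      using lens(1) lp sB by (simp add: ports_append neg_append scard_append del: sbound.simps(2))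
    then have v: "verts (nm ((\<nu> @ rev ?p\<Delta>) @ rev ?p\<Gamma>) ?\<sigma>) \<subseteq> insert 0 (?S0 \<union> set \<nu> - set (\<nu>B @ rev \<nu>A))"
      unfolding nd S using derivable_verts_nm[OF d] by fastforce
    have "set (\<pi> x) \<inter> set (\<nu>B @ rev \<nu>A) = {}" if "x \<in> fst ` (ctx \<Gamma> \<union> ctx \<Delta>)" for x
    proof -
      have "x \<in> fst ` set \<Gamma> \<union> fst ` set \<Delta>" using that by (force simp: image_image)
      then have "set (\<pi> x) \<subseteq> set ?p\<Gamma> \<union> set ?p\<Delta>" unfolding set_ports by blast
      then show ?thesis using fresh(2) by auto
    qed
    then have "open_realizes N n (nm ((\<nu> @ rev ?p\<Delta>) @ rev ?p\<Gamma>) ?\<sigma>) (?S0 \<union> set \<nu> - set (\<nu>B @ rev \<nu>A))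
        (ctx \<Gamma> \<union> ctx \<Delta>) \<pi> (App (map_term g t) (map_term g s)) (\<phi> B) \<nu>"
      using fresh(2) by (intro open_realizes_hide[OF or3 sim v]) auto
    then show ?thesis unfolding S nd by (simp add: image_Un)
  qed
  with d show ?thesis unfolding derives_def by blast
qed

text \<open>The hypothesis is moved next to the conclusion and joined to it by Par; neither rule
  changes the named net.\<close>

lemma derives_abs:
  assumes t: "typed \<Sigma> (map (apfst Suc) \<Gamma> @ (0, A) # map (apfst Suc) \<Delta>) t B"
    and \<sigma>: "derives (map (apfst Suc) \<Gamma> @ (0, A) # map (apfst Suc) \<Delta>) t B \<sigma>"
  shows "\<exists>\<sigma>. derives (\<Gamma> @ \<Delta>) (Abs t) (A \<multimap> B) \<sigma>"
proof -
  let ?\<Gamma> = "map (apfst Suc) \<Gamma> @ (0, A) # map (apfst Suc) \<Delta>"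
  have neg: "neg ?\<Gamma> = neg \<Gamma> @ [dual (tr A)] @ neg \<Delta>"
    using neg_shift[of Suc] by (simp add: neg_append) (simp add: neg_def)
  have types: "snd ` set ?\<Gamma> \<subseteq> types_over \<Sigma>" "B \<in> types_over \<Sigma>"
    using typed_facts[OF t] typed_type[OF t] by auto
  then have A: "A \<in> types_over \<Sigma>" by auto
  have d0: "derivable G \<sigma> (neg \<Gamma> @ [dual (tr A)] @ neg \<Delta> @ [tr B])"
    using \<sigma> neg by (simp add: derives_def)
  from move_right[OF this] obtain \<sigma>' where d': "derivable G \<sigma>' (neg \<Gamma> @ neg \<Delta> @ [dual (tr A)] @ [tr B])"
    and nm: "\<And>\<nu>\<Theta> \<nu>X \<nu>\<Delta> \<nu>\<Gamma>. length \<nu>\<Theta> = scard G [tr B] \<Longrightarrow> length \<nu>X = fcard G (dual (tr A)) \<Longrightarrow>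
      length \<nu>\<Delta> = scard G (neg \<Delta>) \<Longrightarrow> nm (\<nu>\<Theta> @ \<nu>X @ \<nu>\<Delta> @ \<nu>\<Gamma>) \<sigma>' = nm (\<nu>\<Theta> @ \<nu>\<Delta> @ \<nu>X @ \<nu>\<Gamma>) \<sigma>" by blast
  have d: "derivable G \<sigma>' (neg (\<Gamma> @ \<Delta>) @ [tr (A \<multimap> B)])"
    using derivable.Par[of G \<sigma>' "neg \<Gamma> @ neg \<Delta>" "dual (tr A)" "tr B"] d' by (simp add: neg_append tr_Limp)
  have sB: "scard G [tr B] = wd (\<phi> B)" using scard_Cons[of "tr B" "[]"] scard_Nil types by (simp add: fcard_tr)
  have lin: "linear (Abs (map_term g t))"
  proof -
    have "set_lterm t \<subseteq> constants \<Sigma>" "occ 0 t = 1" using typed_facts[OF t] by auto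
    then have "occ 0 (map_term g t) = 1" using g_closed by (subst map_term_occ) auto
    then show ?thesis using typed_map_linear[OF t] by simp
  qed
  have "open_realizes N n (nm (\<nu> @ rev (ports \<pi> (\<Gamma> @ \<Delta>))) \<sigma>') (set (\<nu> @ ports \<pi> (\<Gamma> @ \<Delta>)))
      (ctx (\<Gamma> @ \<Delta>)) \<pi> (map_term g (Abs t)) (\<phi> (A \<multimap> B)) \<nu>"
    if ok: "named_ok \<nu> \<pi> (\<Gamma> @ \<Delta>) (A \<multimap> B)" for \<nu> \<pi>
  proof -
    have lens: "length \<nu> = wd (\<phi> B) + wd (\<phi> A)" "\<forall>(x, B)\<in>set \<Gamma>. length (\<pi> x) = wd (\<phi> B)"
      "\<forall>(x, B)\<in>set \<Delta>. length (\<pi> x) = wd (\<phi> B)" using ok by (auto simp: named_ok_def)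
    obtain \<nu>B \<mu> where \<mu>: "\<nu> = \<nu>B @ \<mu>" "length \<nu>B = wd (\<phi> B)" "length \<mu> = wd (\<phi> A)"
      using split_length[OF lens(1)] .
    define \<rho> where "\<rho> = rev \<mu>"
    have \<nu>: "\<nu> = \<nu>B @ rev \<rho>" "length \<rho> = wd (\<phi> A)" using \<mu> by (simp_all add: \<rho>_def)
    let ?p\<Gamma> = "ports \<pi> \<Gamma>" and ?p\<Delta> = "ports \<pi> \<Delta>" and ?\<pi> = "case_nat \<rho> \<pi>"
    have dis: "distinct (\<nu>B @ rev \<rho> @ ?p\<Gamma> @ ?p\<Delta>)" "0 \<notin> set (\<nu>B @ rev \<rho> @ ?p\<Gamma> @ ?p\<Delta>)"
      using ok \<nu> by (simp_all add: named_ok_def ports_append)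
    have ports: "ports ?\<pi> ?\<Gamma> = ?p\<Gamma> @ \<rho> @ ?p\<Delta>"
      using ports_shift[of \<rho> \<pi>] by (simp add: ports_append) (simp add: ports_def)
    have "named_ok \<nu>B ?\<pi> ?\<Gamma> B"
      unfolding named_ok_def ports using lens \<mu> \<nu> dis by auto
    note or = derivesD[OF \<sigma> this]
    have ctx: "ctx ?\<Gamma> = insert (0, \<phi> A) (apfst Suc ` ctx (\<Gamma> @ \<Delta>))"
      by (auto simp: image_image image_Un)
    have "snd ` set \<Delta> \<subseteq> snd ` set ?\<Gamma>" by force
    then have lp: "length ?p\<Delta> = scard G (neg \<Delta>)"
      using lens types by (intro length_ports) blast+
    have "nm (\<nu>B @ rev \<rho> @ rev ?p\<Delta> @ rev ?p\<Gamma>) \<sigma>' = nm (\<nu>B @ rev ?p\<Delta> @ rev \<rho> @ rev ?p\<Gamma>) \<sigma>"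
      by (rule nm) (use \<mu> \<nu> lp sB A in \<open>simp_all add: fcard_dual fcard_tr\<close>)
    then have n: "nm (\<nu>B @ rev (ports ?\<pi> ?\<Gamma>)) \<sigma> = nm (\<nu> @ rev (ports \<pi> (\<Gamma> @ \<Delta>))) \<sigma>'"
      unfolding ports unfolding ports_append \<nu>(1) by simp
    have S: "set (\<nu>B @ ports ?\<pi> ?\<Gamma>) = set (\<nu> @ ports \<pi> (\<Gamma> @ \<Delta>))"
      unfolding ports unfolding ports_append \<nu>(1) by auto
    from open_realizes_abs[OF or[unfolded ctx n S] \<mu>(2) lin] show ?thesis using \<nu>(1) by simp
  qed
  with d show ?thesis unfolding derives_def by blast
qed

lemma typed_derives: "typed \<Sigma> \<Gamma> t A \<Longrightarrow> \<exists>\<sigma>. derives \<Gamma> t A \<sigma>"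
proof (induction rule: typed.induct)
  case (var A x)
  let ?id = "mw_id (fbound (lit_bound G) (tr A)) :: 'a tsym multiword"
  have "derivable G ?id (neg [(x, A)] @ [tr A])"
    using derivable.Id[OF tr_forms_over[OF var]] by (simp add: neg_def)
  moreover have "open_realizes N n (nm (\<nu> @ rev (ports \<pi> [(x, A)])) ?id) (set (\<nu> @ ports \<pi> [(x, A)]))
      (ctx [(x, A)]) \<pi> (map_term g (Var x)) (\<phi> A) \<nu>" if ok: "named_ok \<nu> \<pi> [(x, A)] A" for \<nu> \<pi>
  proof -
    have p: "ports \<pi> [(x, A)] = \<pi> x" by (simp add: ports_def)
    have l: "length \<nu> = wd (\<phi> A)" "length (\<pi> x) = wd (\<phi> A)" "distinct \<nu>" "distinct (\<pi> x)"
      "0 \<notin> set \<nu>" "0 \<notin> set (\<pi> x)" "set (\<pi> x) \<inter> set \<nu> = {}"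
      using ok by (auto simp: named_ok_def p)
    have "nm (\<nu> @ rev (\<pi> x)) ?id = wires (tsg (\<phi> A)) (\<pi> x) \<nu>"
      using nm_mw_id[OF is_boundary_f, of \<nu> "tr A" "rev (\<pi> x)"] l fcard_tr[OF var] fs_tr[OF var] by simp
    then show ?thesis
      using open_realizes_wire[OF open_realizes_var[of N n \<pi> x "\<phi> A"] l(2,1,4,3,6,5,7)]
      by (simp add: p Un_commute)
  qed
  ultimately show ?case unfolding derives_def by blast
next
  case (const c)
  have "derivable G (lx c) (neg [] @ [tr (ctype \<Sigma> c)])"
    using derivable.Lex[of "lx c" "[tr (ctype \<Sigma> c)]" G] const lexicon by (auto simp: neg_def)
  moreover have "open_realizes N n (nm (\<nu> @ rev (ports \<pi> [])) (lx c)) (set (\<nu> @ ports \<pi> []))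
      (ctx []) \<pi> (map_term g (Const c)) (\<phi> (ctype \<Sigma> c)) \<nu>" if "named_ok \<nu> \<pi> [] (ctype \<Sigma> c)" for \<nu> \<pi>
    using that lx_realizes[OF const, of \<nu>] realizes_open by (auto simp: named_ok_def ports_def)
  ultimately show ?case unfolding derives_def by blast
next
  case (app \<Gamma> t A B \<Delta> s)
  from app.IH obtain \<sigma>1 \<sigma>2 where "derives \<Gamma> t (A \<multimap> B) \<sigma>1" "derives \<Delta> s A \<sigma>2" by blast
  from derives_app[OF app.hyps this] show ?case .
next
  case (abs \<Gamma> A \<Delta> t B)
  from abs.IH obtain \<sigma> where "derives (map (apfst Suc) \<Gamma> @ (0, A) # map (apfst Suc) \<Delta>) t B \<sigma>" by blast
  from derives_abs[OF abs.hyps this] show ?case .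
qed

theorem typed_derivable:
  assumes "typed \<Sigma> [] t A"
  obtains \<sigma> where "derivable G \<sigma> [tr A]"
    "\<And>\<nu>. length \<nu> = wd (\<phi> A) \<Longrightarrow> distinct \<nu> \<Longrightarrow> 0 \<notin> set \<nu> \<Longrightarrow>
      realizes N n (\<phi> A) (nm \<nu> \<sigma>) (set \<nu>) \<nu> (map_term g t)"
proof -
  obtain \<sigma> where \<sigma>: "derives [] t A \<sigma>" using typed_derives[OF assms] by blast
  have "realizes N n (\<phi> A) (nm \<nu> \<sigma>) (set \<nu>) \<nu> (map_term g t)"
    if "length \<nu> = wd (\<phi> A)" "distinct \<nu>" "0 \<notin> set \<nu>" for \<nu>
  proof -
    have "named_ok \<nu> (\<lambda>_. []) [] A" using that by (simp add: named_ok_def ports_def)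
    then have "open_realizes N n (nm \<nu> \<sigma>) (set \<nu>) {} (\<lambda>_. []) (map_term g t) (\<phi> A) \<nu>"
      using \<sigma> unfolding derives_def by (fastforce simp: ports_def)
    then show ?thesis using open_realizes_closed typed_map_closed[OF assms] by blast
  qed
  moreover have "derivable G \<sigma> [tr A]" using \<sigma> by (simp add: derives_def neg_def)
  ultimately show thesis by (rule that[rotated])
qed

end

section \<open>Phase semantics of derivations\<close>

text \<open>An element is a net together with hypotheses (variable, type, ports) and conclusions
  (type, ports) attached to some of its ports.\<close>

datatype ('a, 'p) elt =
  Elt (ed: "'a tsym edge set") (su: "nat set") (hy: "(nat \<times> 'p lty \<times> nat list) set")
    (ou: "('p lty \<times> nat list) multiset")

text \<open>Parallel composition, in which shared names are plugged together. The operation is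
  total; whether a join is meaningful is left to compatibility conditions.\<close>

definition join :: "('a, 'p) elt \<Rightarrow> ('a, 'p) elt \<Rightarrow> ('a, 'p) elt"  (infixl \<open>\<oplus>\<close> 65) where
  "e \<oplus> d = Elt (ed e \<union> ed d) (su e \<union> su d) (hy e \<union> hy d) (ou e + ou d)"

lemma join_simps [simp]:
  "ed (e \<oplus> d) = ed e \<union> ed d" "su (e \<oplus> d) = su e \<union> su d" "hy (e \<oplus> d) = hy e \<union> hy d"
  "ou (e \<oplus> d) = ou e + ou d"
  by (simp_all add: join_def)

lemma elt_eqI: "ed e = ed d \<Longrightarrow> su e = su d \<Longrightarrow> hy e = hy d \<Longrightarrow> ou e = ou d \<Longrightarrow> e = d"
  by (cases e; cases d) simp

lemma join_assoc: "(e \<oplus> d) \<oplus> c = e \<oplus> (d \<oplus> c)"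
  by (rule elt_eqI) auto

lemma join_commute: "e \<oplus> d = d \<oplus> e"
  by (rule elt_eqI) auto

lemma join_left_commute: "e \<oplus> (d \<oplus> c) = d \<oplus> (e \<oplus> c)"
  by (rule elt_eqI) auto

lemmas join_ac = join_assoc join_commute join_left_commute

definition vars :: "('a, 'p) elt \<Rightarrow> nat set" where
  "vars e = fst ` hy e"

lemma vars_join [simp]: "vars (e \<oplus> d) = vars e \<union> vars d"
  by (auto simp: vars_def image_Un)

text \<open>A marker is a requested conclusion and a hypothesis an available one, both without
  edges; on the same ports they join to an axiom.\<close>

definition marker :: "'p lty \<Rightarrow> nat list \<Rightarrow> ('a, 'p) elt" where
  "marker A \<nu> = Elt {} (set \<nu>) {} {#(A, \<nu>)#}"

definition hyp :: "nat \<Rightarrow> 'p lty \<Rightarrow> nat list \<Rightarrow> ('a, 'p) elt" where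
  "hyp x A \<nu> = Elt {} (set \<nu>) {(x, A, \<nu>)} {#}"

definition net :: "'a tsym edge set \<Rightarrow> nat list \<Rightarrow> ('a, 'p) elt" where
  "net E \<nu> = Elt E (set \<nu>) {} {#}"

lemma marker_simps [simp]:
  "ed (marker A \<nu>) = {}" "su (marker A \<nu>) = set \<nu>" "hy (marker A \<nu>) = {}" "ou (marker A \<nu>) = {#(A, \<nu>)#}"
  "vars (marker A \<nu>) = {}"
  by (simp_all add: marker_def vars_def)

lemma hyp_simps [simp]:
  "ed (hyp x A \<nu>) = {}" "su (hyp x A \<nu>) = set \<nu>" "hy (hyp x A \<nu>) = {(x, A, \<nu>)}" "ou (hyp x A \<nu>) = {#}"
  "vars (hyp x A \<nu>) = {x}"
  by (simp_all add: hyp_def vars_def)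

lemma net_simps [simp]:
  "ed (net E \<nu>) = E" "su (net E \<nu>) = set \<nu>" "hy (net E \<nu>) = {}" "ou (net E \<nu>) = {#}" "vars (net E \<nu>) = {}"
  by (simp_all add: net_def vars_def)

section \<open>Well-formed and compatible elements\<close>

definition elt_ok :: "nat list \<Rightarrow> ('a, 'p) elt \<Rightarrow> bool" where
  "elt_ok \<nu> e \<longleftrightarrow> finite (su e) \<and> finite (hy e) \<and> (\<forall>h\<in>hy e. set (snd (snd h)) \<subseteq> su e)
     \<and> (\<forall>c\<in>set_mset (ou e). set (snd c) \<subseteq> su e) \<and> verts (ed e) \<subseteq> insert 0 (su e) \<and> set \<nu> \<subseteq> su e"

lemma elt_ok_join: "elt_ok \<nu> e \<Longrightarrow> elt_ok \<mu> d \<Longrightarrow> set \<xi> \<subseteq> su e \<union> su d \<Longrightarrow> elt_ok \<xi> (e \<oplus> d)"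
  unfolding elt_ok_def join_simps verts_Un set_mset_union by blast

lemma elt_ok_marker: "elt_ok \<nu> (marker A \<nu>)"
  by (simp add: elt_ok_def)

lemma elt_ok_hyp: "elt_ok \<nu> (hyp x A \<nu>)"
  by (simp add: elt_ok_def)

lemma elt_ok_net: "verts E \<subseteq> insert 0 (set \<nu>) \<Longrightarrow> elt_ok \<nu> (net E \<nu>)"
  by (simp add: elt_ok_def)

lemma elt_okD: "elt_ok \<nu> e \<Longrightarrow> set \<nu> \<subseteq> su e" "elt_ok \<nu> e \<Longrightarrow> finite (su e)"
  "elt_ok \<nu> e \<Longrightarrow> finite (vars e)" "elt_ok \<nu> e \<Longrightarrow> verts (ed e) \<subseteq> insert 0 (su e)"
  by (simp_all add: elt_ok_def vars_def)

text \<open>The interface \<open>\<nu>\<close> is the only place where two elements may share names;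
  disjointness of the variables keeps the hypotheses linear.\<close>

definition compat :: "nat list \<Rightarrow> ('a, 'p) elt \<Rightarrow> ('a, 'p) elt \<Rightarrow> bool" where
  "compat \<nu> e d \<longleftrightarrow> su e \<inter> su d \<subseteq> set \<nu> \<and> vars e \<inter> vars d = {}"

definition compat3 :: "nat list \<Rightarrow> nat list \<Rightarrow> ('a, 'p) elt \<Rightarrow> ('a, 'p) elt \<Rightarrow> ('a, 'p) elt \<Rightarrow> bool" where
  "compat3 \<nu>A \<nu>B d a b \<longleftrightarrow> su a \<inter> su b = {} \<and> su d \<inter> su a \<subseteq> set \<nu>A \<and> su d \<inter> su b \<subseteq> set \<nu>B
     \<and> vars a \<inter> vars b = {} \<and> vars d \<inter> vars a = {} \<and> vars d \<inter> vars b = {}"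

context acg_llg
begin

definition pole :: "('a, 'p) elt \<Rightarrow> bool" where
  "pole e \<longleftrightarrow> (\<exists>B \<nu> t \<Gamma> \<pi>. ou e = {#(B, \<nu>)#} \<and> typed \<Sigma> \<Gamma> t B \<and> hy e = (\<lambda>(x, A). (x, A, \<pi> x)) ` set \<Gamma>
     \<and> open_realizes N n (ed e) (su e) (ctx \<Gamma>) \<pi> (map_term g t) (\<phi> B) \<nu>)"

text \<open>Realization is phrased through the marker, so that it becomes an instance of
  orthogonality.\<close>

definition real :: "('a, 'p) elt \<Rightarrow> 'p lty \<Rightarrow> nat list \<Rightarrow> bool" where
  "real e A \<nu> \<longleftrightarrow> pole (e \<oplus> marker A \<nu>)"

text \<open>The orthogonal of phase semantics, relative to an interface and restricted to compatible
  pairs.\<close>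

definition orth :: "('a, 'p) elt set \<Rightarrow> nat list \<Rightarrow> ('a, 'p) elt set" where
  "orth X \<nu> = {d. elt_ok \<nu> d \<and> (\<forall>e\<in>X. compat \<nu> e d \<longrightarrow> pole (e \<oplus> d))}"

text \<open>Multiplicative connectives are tested by pairs: \<open>orth2\<close> is used for Par,
  and its orthogonal for the tensor. The two components must not share names with each other, which
  compatibility with their join would not express.\<close>

definition orth2 :: "('a, 'p) elt set \<Rightarrow> nat list \<Rightarrow> ('a, 'p) elt set \<Rightarrow> nat list \<Rightarrow> nat list \<Rightarrow> ('a, 'p) elt set" where
  "orth2 X \<nu>A Y \<nu>B \<nu> = {d. elt_ok \<nu> d \<and> (\<forall>a\<in>X. \<forall>b\<in>Y. compat3 \<nu>A \<nu>B d a b \<longrightarrow> pole (d \<oplus> a \<oplus> b))}"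

definition reals :: "'p lty \<Rightarrow> nat list \<Rightarrow> ('a, 'p) elt set" where
  "reals A \<nu> = {e. elt_ok \<nu> e \<and> real e A \<nu>}"

text \<open>\<open>sem A True\<close> are the elements of \<open>A\<close> and \<open>sem A False\<close> the elements of \<open>dual A\<close>, in both
  cases with the ports listed in the order of \<open>A\<close>.\<close>

primrec sem :: "nat form \<Rightarrow> bool \<Rightarrow> nat list \<Rightarrow> ('a, 'p) elt set" where
  "sem (Pos P) s \<nu> = (if s then reals (Atom (atm P)) \<nu> else orth (reals (Atom (atm P)) \<nu>) \<nu>)"
| "sem (Neg P) s \<nu> = (if s then orth (reals (Atom (atm P)) (rev \<nu>)) \<nu> else reals (Atom (atm P)) (rev \<nu>))"
| "sem (A \<otimes>\<^sub>f B) s \<nu> =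
    (let X = orth2 (sem A True (take (fcard G A) \<nu>)) (take (fcard G A) \<nu>)
               (sem B True (drop (fcard G A) \<nu>)) (drop (fcard G A) \<nu>) \<nu>
     in if s then orth X \<nu> else X)"
| "sem (Par A B) s \<nu> =
    (let X = orth2 (sem A False (drop (fcard G B) \<nu>)) (drop (fcard G B) \<nu>)
               (sem B False (take (fcard G B) \<nu>)) (take (fcard G B) \<nu>) \<nu>
     in if s then X else orth X \<nu>)"

lemma elt_ok_rev: "elt_ok (rev \<nu>) e = elt_ok \<nu> e"
  by (simp add: elt_ok_def)

lemma orth_rev: "orth X (rev \<nu>) = orth X \<nu>"
  by (simp add: orth_def elt_ok_rev compat_def)

lemma orth2_rev: "orth2 X (rev \<nu>A) Y (rev \<nu>B) (rev \<nu>) = orth2 X \<nu>A Y \<nu>B \<nu>"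
  by (simp add: orth2_def elt_ok_rev compat3_def)

lemma fcard_Tensor: "fcard G (A \<otimes>\<^sub>f B) = fcard G A + fcard G B"
  using arg_cong[OF fs_Tensor[of A B], of length] by simp

lemma fcard_Par: "fcard G (Par A B) = fcard G B + fcard G A"
  using arg_cong[OF fs_Par[of A B], of length] by simp

lemma sem_ok: "e \<in> sem A s \<nu> \<Longrightarrow> elt_ok \<nu> e"
  by (cases A) (auto simp: reals_def orth_def orth2_def elt_ok_rev Let_def split: if_splits)

lemma sem_dual: "length \<nu> = fcard G A \<Longrightarrow> sem (dual A) s (rev \<nu>) = sem A (\<not> s) \<nu>"
proof (induction A arbitrary: s \<nu>)
  case (Tensor A B)
  obtain \<nu>A \<nu>B where \<nu>: "\<nu> = \<nu>A @ \<nu>B" "length \<nu>A = fcard G A" "length \<nu>B = fcard G B"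
    using Tensor.prems unfolding fcard_Tensor by (rule split_length)
  have "sem (dual (A \<otimes>\<^sub>f B)) s (rev \<nu>) = (let X = orth2 (sem (dual A) False (rev \<nu>A)) (rev \<nu>A)
      (sem (dual B) False (rev \<nu>B)) (rev \<nu>B) (rev \<nu>) in if s then X else orth X (rev \<nu>))"
    using \<nu> by (simp add: fcard_dual Let_def del: fbound.simps)
  also have "\<dots> = sem (A \<otimes>\<^sub>f B) (\<not> s) \<nu>"
    unfolding Tensor.IH(1)[OF \<nu>(2)] Tensor.IH(2)[OF \<nu>(3)] orth2_rev orth_rev using \<nu> by (simp add: Let_def)
  finally show ?case .
next
  case (Par A B)
  obtain \<nu>B \<nu>A where \<nu>: "\<nu> = \<nu>B @ \<nu>A" "length \<nu>B = fcard G B" "length \<nu>A = fcard G A"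
    using Par.prems unfolding fcard_Par by (rule split_length)
  have "sem (dual (Par A B)) s (rev \<nu>) = (let X = orth2 (sem (dual A) True (rev \<nu>A)) (rev \<nu>A)
      (sem (dual B) True (rev \<nu>B)) (rev \<nu>B) (rev \<nu>) in if s then orth X (rev \<nu>) else X)"
    using \<nu> by (simp add: fcard_dual Let_def del: fbound.simps)
  also have "\<dots> = sem (Par A B) (\<not> s) \<nu>"
    unfolding Par.IH(1)[OF \<nu>(3)] Par.IH(2)[OF \<nu>(2)] orth2_rev orth_rev using \<nu> by (simp add: Let_def)
  finally show ?case .
qed (simp_all add: orth_rev)

lemma compat_commute: "compat \<nu> e d \<longleftrightarrow> compat \<nu> d e"
  by (auto simp: compat_def)

lemma orthD: "d \<in> orth X \<nu> \<Longrightarrow> e \<in> X \<Longrightarrow> compat \<nu> e d \<Longrightarrow> pole (e \<oplus> d)"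
  by (simp add: orth_def)

lemma orth2D: "d \<in> orth2 X \<nu>A Y \<nu>B \<nu> \<Longrightarrow> a \<in> X \<Longrightarrow> b \<in> Y \<Longrightarrow> compat3 \<nu>A \<nu>B d a b \<Longrightarrow> pole (d \<oplus> a \<oplus> b)"
  by (simp add: orth2_def)

lemma orth_orth: "e \<in> X \<Longrightarrow> elt_ok \<nu> e \<Longrightarrow> e \<in> orth (orth X \<nu>) \<nu>"
proof -
  assume e: "e \<in> X" "elt_ok \<nu> e"
  have "pole (d \<oplus> e)" if "d \<in> orth X \<nu>" "compat \<nu> d e" for d
    using orthD[OF that(1) e(1)] that(2) compat_commute[of \<nu> d e] join_commute[of d e] by simp
  with e(2) show ?thesis by (simp add: orth_def[of "orth X \<nu>"])
qed

text \<open>\<open>marker A \<nu>\<close> belongs to the orthogonal and is compatible with every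
  element, so membership in the second orthogonal includes passing this one test, which is
  realization.\<close>

lemma orth_orth_reals: "orth (orth (reals A \<nu>) \<nu>) \<nu> = reals A \<nu>"
proof (intro equalityI subsetI)
  fix e assume e: "e \<in> orth (orth (reals A \<nu>) \<nu>) \<nu>"
  have "marker A \<nu> \<in> orth (reals A \<nu>) \<nu>"
    by (simp add: orth_def reals_def elt_ok_marker real_def)
  moreover have "compat \<nu> (marker A \<nu>) e" by (auto simp: compat_def)
  ultimately have "pole (marker A \<nu> \<oplus> e)" using orthD[OF e] by blast
  then have "real e A \<nu>" by (simp add: real_def join_commute)
  moreover have "elt_ok \<nu> e" using e by (simp add: orth_def)
  ultimately show "e \<in> reals A \<nu>" by (simp add: reals_def)
next
  fix e assume "e \<in> reals A \<nu>"
  then show "e \<in> orth (orth (reals A \<nu>) \<nu>) \<nu>" by (intro orth_orth) (simp_all add: reals_def)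
qed

text \<open>The join of an admissible pair is itself in the orthogonal, so the pair tests of
  \<open>orth2\<close> survive double orthogonality.\<close>

lemma orth_orth_orth2:
  assumes X: "\<And>a. a \<in> X \<Longrightarrow> elt_ok \<nu>A a" and Y: "\<And>b. b \<in> Y \<Longrightarrow> elt_ok \<nu>B b" and \<nu>: "set \<nu> = set \<nu>A \<union> set \<nu>B"
  shows "orth (orth (orth2 X \<nu>A Y \<nu>B \<nu>) \<nu>) \<nu> = orth2 X \<nu>A Y \<nu>B \<nu>" (is "_ = ?O")
proof (intro equalityI subsetI)
  fix d assume d: "d \<in> orth (orth ?O \<nu>) \<nu>"
  have "pole (d \<oplus> a \<oplus> b)" if ab: "a \<in> X" "b \<in> Y" and c: "compat3 \<nu>A \<nu>B d a b" for a b
  proof -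
    have sub: "set \<nu>A \<subseteq> su a" "set \<nu>B \<subseteq> su b" using elt_okD(1) X Y ab by blast+
    have "a \<oplus> b \<in> orth ?O \<nu>"
      unfolding orth_def
    proof (intro CollectI conjI ballI impI)
      show "elt_ok \<nu> (a \<oplus> b)" using elt_ok_join[OF X[OF ab(1)] Y[OF ab(2)]] sub \<nu> by blast
      fix d' assume d': "d' \<in> ?O" and c': "compat \<nu> d' (a \<oplus> b)"
      have "compat3 \<nu>A \<nu>B d' a b"
        using c c' sub \<nu> unfolding compat_def compat3_def join_simps vars_join by blast
      from orth2D[OF d' ab this] show "pole (d' \<oplus> (a \<oplus> b))" by (simp add: join_assoc)
    qed
    moreover have "compat \<nu> (a \<oplus> b) d" using c \<nu> unfolding compat_def compat3_def join_simps vars_join by blast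
    ultimately have "pole ((a \<oplus> b) \<oplus> d)" using orthD[OF d] by blast
    then show ?thesis by (simp add: join_ac)
  qed
  then show "d \<in> ?O" using d by (simp add: orth2_def orth_def)
next
  fix d assume "d \<in> ?O"
  then show "d \<in> orth (orth ?O \<nu>) \<nu>" by (intro orth_orth) (simp_all add: orth2_def)
qed

text \<open>Every interpretation is a fact in the sense of phase semantics: one polarity is an
  orthogonal by construction, the other by the two closure lemmas.\<close>

lemma sem_orth: "sem A s \<nu> = orth (sem A (\<not> s) \<nu>) \<nu>"
proof (cases A)
  case (Tensor A1 A2)
  let ?k = "fcard G A1"
  have "set \<nu> = set (take ?k \<nu>) \<union> set (drop ?k \<nu>)" by (metis append_take_drop_id set_append)
  from orth_orth_orth2[of "sem A1 True (take ?k \<nu>)" "take ?k \<nu>" "sem A2 True (drop ?k \<nu>)" "drop ?k \<nu>" \<nu>,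
      OF sem_ok sem_ok this] show ?thesis
    unfolding Tensor by (cases s) (simp_all add: Let_def)
next
  case (Par A1 A2)
  let ?k = "fcard G A2"
  have "set \<nu> = set (drop ?k \<nu>) \<union> set (take ?k \<nu>)" by (metis append_take_drop_id set_append sup_commute)
  from orth_orth_orth2[of "sem A1 False (drop ?k \<nu>)" "drop ?k \<nu>" "sem A2 False (take ?k \<nu>)" "take ?k \<nu>" \<nu>,
      OF sem_ok sem_ok this] show ?thesis
    unfolding Par by (cases s) (simp_all add: Let_def)
next
  case (Neg P)
  then show ?thesis using orth_orth_reals[of "Atom (atm P)" "rev \<nu>"] by (cases s) (simp_all add: orth_rev)
next
  case (Pos P)
  then show ?thesis using orth_orth_reals[of "Atom (atm P)" \<nu>] by (cases s) simp_all
qed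

lemma sem_pole:
  assumes "e \<in> sem A s \<nu>" "d \<in> sem A (\<not> s) \<nu>" "compat \<nu> e d"
  shows "pole (e \<oplus> d)"
proof -
  have "d \<in> orth (sem A s \<nu>) \<nu>" using assms(2) sem_orth[of A "\<not> s" \<nu>] by simp
  from orthD[OF this assms(1,3)] show ?thesis .
qed

subsection \<open>Extension by wires\<close>

text \<open>The wires are moved from the element over to its test: prolonging either of them gives
  the same joined net.\<close>

lemma orth_wire:
  assumes X: "\<And>d. d \<in> X' \<Longrightarrow> su d \<inter> set \<nu> = {} \<Longrightarrow> d \<oplus> net W \<nu> \<in> X" and X': "\<And>d. d \<in> X' \<Longrightarrow> elt_ok \<nu>' d"
    and e: "e \<in> orth X \<nu>" "su e \<inter> set \<nu>' = {}" and W: "verts W \<subseteq> set \<nu> \<union> set \<nu>'"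
  shows "e \<oplus> net W \<nu>' \<in> orth X' \<nu>'"
  unfolding orth_def
proof (intro CollectI conjI ballI impI)
  have ok: "elt_ok \<nu> e" using e(1) by (simp add: orth_def)
  then show "elt_ok \<nu>' (e \<oplus> net W \<nu>')" using W unfolding elt_ok_def by auto
  fix d assume d: "d \<in> X'" and c: "compat \<nu>' d (e \<oplus> net W \<nu>')"
  have sub: "set \<nu> \<subseteq> su e" "set \<nu>' \<subseteq> su d" using elt_okD(1) ok X'[OF d] by blast+
  have "su d \<inter> set \<nu> = {}" using c sub e(2) unfolding compat_def join_simps by blast
  from X[OF d this] have "d \<oplus> net W \<nu> \<in> X" .
  moreover have "compat \<nu> (d \<oplus> net W \<nu>) e"
    using c sub e(2) unfolding compat_def join_simps vars_join net_simps by blast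
  ultimately have "pole (d \<oplus> net W \<nu> \<oplus> e)" using orthD[OF e(1)] by blast
  moreover have "d \<oplus> net W \<nu> \<oplus> e = d \<oplus> (e \<oplus> net W \<nu>')" using sub by (intro elt_eqI) auto
  ultimately show "pole (d \<oplus> (e \<oplus> net W \<nu>'))" by simp
qed

text \<open>The same transfer for pairs, where each component takes its own half of the wires;
  disjointness of the two halves keeps the prolonged pair admissible.\<close>

lemma orth2_wire:
  assumes X: "\<And>a. a \<in> X' \<Longrightarrow> su a \<inter> set \<nu>A = {} \<Longrightarrow> a \<oplus> net WA \<nu>A \<in> X" "\<And>a. a \<in> X' \<Longrightarrow> elt_ok \<nu>A' a"
    and Y: "\<And>b. b \<in> Y' \<Longrightarrow> su b \<inter> set \<nu>B = {} \<Longrightarrow> b \<oplus> net WB \<nu>B \<in> Y" "\<And>b. b \<in> Y' \<Longrightarrow> elt_ok \<nu>B' b"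
    and e: "e \<in> orth2 X \<nu>A Y \<nu>B \<nu>" "su e \<inter> set \<nu>' = {}"
    and \<nu>: "set \<nu> = set \<nu>A \<union> set \<nu>B" "set \<nu>' = set \<nu>A' \<union> set \<nu>B'" "set \<nu>A \<inter> set \<nu>B = {}"
    and W: "verts WA \<subseteq> set \<nu>A \<union> set \<nu>A'" "verts WB \<subseteq> set \<nu>B \<union> set \<nu>B'"
  shows "e \<oplus> net (WA \<union> WB) \<nu>' \<in> orth2 X' \<nu>A' Y' \<nu>B' \<nu>'"
  unfolding orth2_def
proof (intro CollectI conjI ballI impI)
  have ok: "elt_ok \<nu> e" using e(1) by (simp add: orth2_def)
  then show "elt_ok \<nu>' (e \<oplus> net (WA \<union> WB) \<nu>')" using W \<nu> unfolding elt_ok_def by auto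
  fix a b assume ab: "a \<in> X'" "b \<in> Y'" and c: "compat3 \<nu>A' \<nu>B' (e \<oplus> net (WA \<union> WB) \<nu>') a b"
  have sub: "set \<nu>A \<subseteq> su e" "set \<nu>B \<subseteq> su e" "set \<nu>A' \<subseteq> su a" "set \<nu>B' \<subseteq> su b"
    using elt_okD(1) ok X(2)[OF ab(1)] Y(2)[OF ab(2)] \<nu> by blast+
  have c': "su e \<inter> su a = {}" "su e \<inter> su b = {}" "su a \<inter> su b = {}"
    using c e(2) \<nu>(2) unfolding compat3_def join_simps by blast+
  have "a \<oplus> net WA \<nu>A \<in> X" "b \<oplus> net WB \<nu>B \<in> Y" using X(1)[OF ab(1)] Y(1)[OF ab(2)] c' sub by blast+
  moreover have "compat3 \<nu>A \<nu>B e (a \<oplus> net WA \<nu>A) (b \<oplus> net WB \<nu>B)"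
  proof -
    have "su a \<inter> set \<nu>B = {}" "set \<nu>A \<inter> su b = {}" using c' sub(1,2) by blast+
    moreover have "vars e \<inter> vars a = {}" "vars e \<inter> vars b = {}" "vars a \<inter> vars b = {}"
      using c by (auto simp: compat3_def)
    ultimately show ?thesis using c' \<nu>(3) unfolding compat3_def join_simps vars_join net_simps
      by (simp add: Int_Un_distrib Int_Un_distrib2)
  qed
  ultimately have "pole (e \<oplus> (a \<oplus> net WA \<nu>A) \<oplus> (b \<oplus> net WB \<nu>B))" using orth2D[OF e(1)] by blast
  moreover have "e \<oplus> (a \<oplus> net WA \<nu>A) \<oplus> (b \<oplus> net WB \<nu>B) = e \<oplus> net (WA \<union> WB) \<nu>' \<oplus> a \<oplus> b"
    using sub \<nu> by (intro elt_eqI) auto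
  ultimately show "pole (e \<oplus> net (WA \<union> WB) \<nu>' \<oplus> a \<oplus> b)" by simp
qed

lemma poleE:
  assumes "real e A \<nu>"
  obtains t \<Gamma> \<pi> where "ou e = {#}" "typed \<Sigma> \<Gamma> t A" "hy e = (\<lambda>(x, A). (x, A, \<pi> x)) ` set \<Gamma>"
    "open_realizes N n (ed e) (su e \<union> set \<nu>) (ctx \<Gamma>) \<pi> (map_term g t) (\<phi> A) \<nu>"
proof -
  obtain B \<mu> t \<Gamma> \<pi> where *: "ou e + {#(A, \<nu>)#} = {#(B, \<mu>)#}" "typed \<Sigma> \<Gamma> t B"
    "hy e = (\<lambda>(x, A). (x, A, \<pi> x)) ` set \<Gamma>"
    "open_realizes N n (ed e) (su e \<union> set \<nu>) (ctx \<Gamma>) \<pi> (map_term g t) (\<phi> B) \<mu>"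
    using assms unfolding real_def pole_def by auto
  have "size (ou e + {#(A, \<nu>)#}) = 1" unfolding *(1) by simp
  then have "ou e = {#}" by simp
  with * show thesis using that by auto
qed

lemma realI:
  assumes "ou e = {#}" "typed \<Sigma> \<Gamma> t A" "hy e = (\<lambda>(x, A). (x, A, \<pi> x)) ` set \<Gamma>"
    "open_realizes N n (ed e) (su e \<union> set \<nu>) (ctx \<Gamma>) \<pi> (map_term g t) (\<phi> A) \<nu>"
  shows "real e A \<nu>"
  unfolding real_def pole_def
  by (intro exI[of _ A] exI[of _ \<nu>] exI[of _ t] exI[of _ \<Gamma>] exI[of _ \<pi>]) (use assms in simp)

lemma reals_wire:
  assumes e: "e \<in> reals (Atom p) \<nu>" and len: "length \<nu> = wd (f p)" "length \<nu>' = wd (f p)"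
    and d: "distinct \<nu>" "distinct \<nu>'" "0 \<notin> set \<nu>" "0 \<notin> set \<nu>'" "su e \<inter> set \<nu>' = {}"
  shows "e \<oplus> net (wires (tsg (f p)) \<nu> \<nu>') \<nu>' \<in> reals (Atom p) \<nu>'"
proof -
  have ok: "elt_ok \<nu> e" and r: "real e (Atom p) \<nu>" using e by (auto simp: reals_def)
  have su: "su e \<union> set \<nu> = su e" using elt_okD(1)[OF ok] by blast
  obtain t \<Gamma> \<pi> where t: "ou e = {#}" "typed \<Sigma> \<Gamma> t (Atom p)" "hy e = (\<lambda>(x, A). (x, A, \<pi> x)) ` set \<Gamma>"
    "open_realizes N n (ed e) (su e) (ctx \<Gamma>) \<pi> (map_term g t) (f p) \<nu>"
    by (rule poleE[OF r, unfolded su map_type.simps])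
  from open_realizes_wire[OF t(4) len d]
  have "real (e \<oplus> net (wires (tsg (f p)) \<nu> \<nu>') \<nu>') (Atom p) \<nu>'"
    using t(1-3) by (intro realI[of _ \<Gamma> t _ \<pi>]) auto
  moreover have "verts (wires (tsg (f p)) \<nu> \<nu>') \<subseteq> set \<nu> \<union> set \<nu>'" using len by (simp add: verts_wires)
  then have "elt_ok \<nu>' (e \<oplus> net (wires (tsg (f p)) \<nu> \<nu>') \<nu>')"
    using ok unfolding elt_ok_def by auto
  ultimately show ?thesis by (simp add: reals_def)
qed

lemma fs_Pos: "fs (Pos P) = tsg (f (atm P))"
  by (simp add: lit signs_tbound)

text \<open>The semantic content of the identity axiom: an element may be moved to a fresh
  interface. Ports are listed as for \<open>A\<close> in both polarities, so for
  \<open>False\<close> the wires run backwards.\<close>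

lemma sem_wire:
  "e \<in> sem A s \<nu> \<Longrightarrow> length \<nu> = fcard G A \<Longrightarrow> length \<nu>' = fcard G A \<Longrightarrow> distinct \<nu> \<Longrightarrow> distinct \<nu>' \<Longrightarrow>
   0 \<notin> set \<nu> \<Longrightarrow> 0 \<notin> set \<nu>' \<Longrightarrow> su e \<inter> set \<nu>' = {} \<Longrightarrow>
   e \<oplus> net (if s then wires (fs A) \<nu> \<nu>' else wires (fs A) \<nu>' \<nu>) \<nu>' \<in> sem A s \<nu>'"
proof (induction A arbitrary: s e \<nu> \<nu>')
  case (Pos P)
  have len: "length \<nu> = wd (f (atm P))" "length \<nu>' = wd (f (atm P))"
    using Pos.prems(2,3) arg_cong[OF fs_Pos[of P], of length] by simp_all
  show ?case
  proof (cases s)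
    case True
    then show ?thesis using reals_wire[OF _ len] Pos.prems by (simp add: fs_Pos[simplified])
  next
    case False
    have "e \<oplus> net (wires (tsg (f (atm P))) \<nu>' \<nu>) \<nu>' \<in> orth (reals (Atom (atm P)) \<nu>') \<nu>'"
    proof (rule orth_wire)
      show "d \<oplus> net (wires (tsg (f (atm P))) \<nu>' \<nu>) \<nu> \<in> reals (Atom (atm P)) \<nu>"
        if "d \<in> reals (Atom (atm P)) \<nu>'" "su d \<inter> set \<nu> = {}" for d
        using reals_wire[OF that(1) len(2,1)] Pos.prems that(2) by blast
    qed (use Pos.prems len False in \<open>auto simp: reals_def verts_wires\<close>)
    then show ?thesis using False by (simp add: fs_Pos[simplified])
  qed
next
  case (Neg P)
  have len: "length (rev \<nu>) = wd (f (atm P))" "length (rev \<nu>') = wd (f (atm P))"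
    using Neg.prems(2,3) fcard_dual[of "Pos P"] arg_cong[OF fs_Pos[of P], of length] by simp_all
  have fs: "fs (Neg P) = map Not (rev (tsg (f (atm P))))" using fs_dual[of "Pos P"] fs_Pos[of P] by simp
  have "wires (map Not (rev (tsg (f (atm P))))) (rev (rev \<mu>)) (rev (rev \<mu>'))
      = (wires (tsg (f (atm P))) (rev \<mu>') (rev \<mu>) :: 'a tsym edge set)"
    if "length \<mu> = wd (f (atm P))" "length \<mu>' = wd (f (atm P))" for \<mu> \<mu>'
    by (rule wires_dual) (use that in simp_all)
  then have w: "wires (fs (Neg P)) \<nu> \<nu>' = (wires (tsg (f (atm P))) (rev \<nu>') (rev \<nu>) :: 'a tsym edge set)"
    "wires (fs (Neg P)) \<nu>' \<nu> = (wires (tsg (f (atm P))) (rev \<nu>) (rev \<nu>') :: 'a tsym edge set)"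
    unfolding fs using len by (simp_all only: rev_rev_ident length_rev)
  have net_rev: "net W (rev \<mu>) = (net W \<mu> :: ('a, 'p) elt)" for W \<mu> by (simp add: net_def)
  show ?case
  proof (cases s)
    case False
    have "e \<oplus> net (wires (tsg (f (atm P))) (rev \<nu>) (rev \<nu>')) (rev \<nu>') \<in> reals (Atom (atm P)) (rev \<nu>')"
      using reals_wire[OF _ len, of e] Neg.prems False by simp
    then show ?thesis using False w(2) by (simp add: net_rev)
  next
    case True
    have "e \<oplus> net (wires (tsg (f (atm P))) (rev \<nu>') (rev \<nu>)) (rev \<nu>') \<in> orth (reals (Atom (atm P)) (rev \<nu>')) (rev \<nu>')"
    proof (rule orth_wire)
      show "d \<oplus> net (wires (tsg (f (atm P))) (rev \<nu>') (rev \<nu>)) (rev \<nu>) \<in> reals (Atom (atm P)) (rev \<nu>)"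
        if "d \<in> reals (Atom (atm P)) (rev \<nu>')" "su d \<inter> set (rev \<nu>) = {}" for d
        using reals_wire[OF that(1) len(2,1)] Neg.prems that(2) by simp
    qed (use Neg.prems len True in \<open>auto simp: reals_def verts_wires orth_rev\<close>)
    then show ?thesis using True w(1) by (simp add: net_rev orth_rev)
  qed
next
  case (Tensor A B)
  \<comment> \<open>The polarity given by \<open>orth2\<close> is treated directly; the other one is
    its orthogonal and follows by moving the wires to the tests.\<close>
  have *: "e \<oplus> net (wires (fs (A \<otimes>\<^sub>f B)) \<nu>' \<nu>) \<nu>' \<in> sem (A \<otimes>\<^sub>f B) False \<nu>'"
    if e: "e \<in> sem (A \<otimes>\<^sub>f B) False \<nu>" and l: "length \<nu> = fcard G (A \<otimes>\<^sub>f B)" "length \<nu>' = fcard G (A \<otimes>\<^sub>f B)"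
      and d: "distinct \<nu>" "distinct \<nu>'" "0 \<notin> set \<nu>" "0 \<notin> set \<nu>'" "su e \<inter> set \<nu>' = {}" for e \<nu> \<nu>'
  proof -
    obtain \<nu>A \<nu>B where \<nu>: "\<nu> = \<nu>A @ \<nu>B" "length \<nu>A = fcard G A" "length \<nu>B = fcard G B"
      using l(1) unfolding fcard_Tensor by (rule split_length)
    obtain \<nu>A' \<nu>B' where \<nu>': "\<nu>' = \<nu>A' @ \<nu>B'" "length \<nu>A' = fcard G A" "length \<nu>B' = fcard G B"
      using l(2) unfolding fcard_Tensor by (rule split_length)
    have "e \<oplus> net (wires (fs A) \<nu>A' \<nu>A \<union> wires (fs B) \<nu>B' \<nu>B) \<nu>' \<in>
        orth2 (sem A True \<nu>A') \<nu>A' (sem B True \<nu>B') \<nu>B' \<nu>'"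
    proof (rule orth2_wire)
      show "a \<oplus> net (wires (fs A) \<nu>A' \<nu>A) \<nu>A \<in> sem A True \<nu>A" if "a \<in> sem A True \<nu>A'" "su a \<inter> set \<nu>A = {}" for a
        using Tensor.IH(1)[OF that(1) \<nu>'(2) \<nu>(2)] that(2) d \<nu> \<nu>' by simp
      show "b \<oplus> net (wires (fs B) \<nu>B' \<nu>B) \<nu>B \<in> sem B True \<nu>B" if "b \<in> sem B True \<nu>B'" "su b \<inter> set \<nu>B = {}" for b
        using Tensor.IH(2)[OF that(1) \<nu>'(3) \<nu>(3)] that(2) d \<nu> \<nu>' by simp
      show "e \<in> orth2 (sem A True \<nu>A) \<nu>A (sem B True \<nu>B) \<nu>B \<nu>" using e \<nu> by simp
    qed (use d \<nu> \<nu>' sem_ok in \<open>auto simp: verts_wires\<close>)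
    moreover have "wires (fs (A \<otimes>\<^sub>f B)) \<nu>' \<nu> = wires (fs A) \<nu>A' \<nu>A \<union> (wires (fs B) \<nu>B' \<nu>B :: 'a tsym edge set)"
      unfolding fs_Tensor using \<nu> \<nu>' by (simp add: wires_append)
    ultimately show ?thesis using \<nu>' by (simp del: fbound.simps)
  qed
  show ?case
  proof (cases s)
    case False
    then show ?thesis using *[of e \<nu> \<nu>'] Tensor.prems by simp
  next
    case True
    have "e \<oplus> net (wires (fs (A \<otimes>\<^sub>f B)) \<nu> \<nu>') \<nu>' \<in> orth (sem (A \<otimes>\<^sub>f B) False \<nu>') \<nu>'"
    proof (rule orth_wire)
      show "d \<oplus> net (wires (fs (A \<otimes>\<^sub>f B)) \<nu> \<nu>') \<nu> \<in> sem (A \<otimes>\<^sub>f B) False \<nu>"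
        if "d \<in> sem (A \<otimes>\<^sub>f B) False \<nu>'" "su d \<inter> set \<nu> = {}" for d
        using *[OF that(1)] Tensor.prems that(2) by blast
      show "verts (wires (fs (A \<otimes>\<^sub>f B)) \<nu> \<nu>' :: 'a tsym edge set) \<subseteq> set \<nu> \<union> set \<nu>'"
        using Tensor.prems(2,3) by (subst verts_wires) simp_all
      show "e \<in> orth (sem (A \<otimes>\<^sub>f B) False \<nu>) \<nu>" using Tensor.prems(1) True sem_orth[of "A \<otimes>\<^sub>f B" True \<nu>] by simp
    qed (rule sem_ok, assumption, rule Tensor.prems)
    then show ?thesis using True sem_orth[of "A \<otimes>\<^sub>f B" True \<nu>'] by simp
  qed
next
  case (Par A B)
  have *: "e \<oplus> net (wires (fs (Par A B)) \<nu> \<nu>') \<nu>' \<in> sem (Par A B) True \<nu>'"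
    if e: "e \<in> sem (Par A B) True \<nu>" and l: "length \<nu> = fcard G (Par A B)" "length \<nu>' = fcard G (Par A B)"
      and d: "distinct \<nu>" "distinct \<nu>'" "0 \<notin> set \<nu>" "0 \<notin> set \<nu>'" "su e \<inter> set \<nu>' = {}" for e \<nu> \<nu>'
  proof -
    obtain \<nu>B \<nu>A where \<nu>: "\<nu> = \<nu>B @ \<nu>A" "length \<nu>B = fcard G B" "length \<nu>A = fcard G A"
      using l(1) unfolding fcard_Par by (rule split_length)
    obtain \<nu>B' \<nu>A' where \<nu>': "\<nu>' = \<nu>B' @ \<nu>A'" "length \<nu>B' = fcard G B" "length \<nu>A' = fcard G A"
      using l(2) unfolding fcard_Par by (rule split_length)
    have "e \<oplus> net (wires (fs A) \<nu>A \<nu>A' \<union> wires (fs B) \<nu>B \<nu>B') \<nu>' \<in>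
        orth2 (sem A False \<nu>A') \<nu>A' (sem B False \<nu>B') \<nu>B' \<nu>'"
    proof (rule orth2_wire)
      show "a \<oplus> net (wires (fs A) \<nu>A \<nu>A') \<nu>A \<in> sem A False \<nu>A" if "a \<in> sem A False \<nu>A'" "su a \<inter> set \<nu>A = {}" for a
        using Par.IH(1)[OF that(1) \<nu>'(3) \<nu>(3)] that(2) d \<nu> \<nu>' by simp
      show "b \<oplus> net (wires (fs B) \<nu>B \<nu>B') \<nu>B \<in> sem B False \<nu>B" if "b \<in> sem B False \<nu>B'" "su b \<inter> set \<nu>B = {}" for b
        using Par.IH(2)[OF that(1) \<nu>'(2) \<nu>(2)] that(2) d \<nu> \<nu>' by simp
      show "e \<in> orth2 (sem A False \<nu>A) \<nu>A (sem B False \<nu>B) \<nu>B \<nu>" using e \<nu> by simp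
    qed (use d \<nu> \<nu>' sem_ok in \<open>auto simp: verts_wires\<close>)
    moreover have "wires (fs (Par A B)) \<nu> \<nu>' = wires (fs A) \<nu>A \<nu>A' \<union> (wires (fs B) \<nu>B \<nu>B' :: 'a tsym edge set)"
      unfolding fs_Par using \<nu> \<nu>' by (auto simp: wires_append)
    ultimately show ?thesis using \<nu>' by (simp del: fbound.simps)
  qed
  show ?case
  proof (cases s)
    case True
    then show ?thesis using *[of e \<nu> \<nu>'] Par.prems by simp
  next
    case False
    have "e \<oplus> net (wires (fs (Par A B)) \<nu>' \<nu>) \<nu>' \<in> orth (sem (Par A B) True \<nu>') \<nu>'"
    proof (rule orth_wire)
      show "d \<oplus> net (wires (fs (Par A B)) \<nu>' \<nu>) \<nu> \<in> sem (Par A B) True \<nu>"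
        if "d \<in> sem (Par A B) True \<nu>'" "su d \<inter> set \<nu> = {}" for d
        using *[OF that(1)] Par.prems that(2) by blast
      show "verts (wires (fs (Par A B)) \<nu>' \<nu> :: 'a tsym edge set) \<subseteq> set \<nu> \<union> set \<nu>'"
        using Par.prems(2,3) by (subst verts_wires) (simp_all add: Un_commute)
      show "e \<in> orth (sem (Par A B) True \<nu>) \<nu>" using Par.prems(1) False sem_orth[of "Par A B" False \<nu>] by simp
    qed (rule sem_ok, assumption, rule Par.prems)
    then show ?thesis using False sem_orth[of "Par A B" False \<nu>'] by simp
  qed
qed

subsection \<open>Types and their realizers\<close>

lemma real_hyp:
  assumes "A \<in> types_over \<Sigma>"
  shows "real (hyp x A \<nu>) A \<nu>"
  using open_realizes_var[of N n "\<lambda>_. \<nu>" x "\<phi> A"] typed.var[OF assms, of x]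
  by (intro realI[of _ "[(x, A)]" "Var x" _ "\<lambda>_. \<nu>"]) auto

lemma real_app:
  assumes e: "real e (A \<multimap> B) (\<nu>B @ rev \<nu>A)" and d: "real d A \<nu>A"
    and ok: "elt_ok (\<nu>B @ rev \<nu>A) e" "elt_ok \<nu>A d" and len: "length \<nu>B = wd (\<phi> B)"
    and c: "su e \<inter> su d \<subseteq> set \<nu>A" "vars e \<inter> vars d = {}"
  shows "real (e \<oplus> d) B \<nu>B"
proof -
  obtain t \<Gamma> \<pi> where t: "ou e = {#}" "typed \<Sigma> \<Gamma> t (A \<multimap> B)" "hy e = (\<lambda>(x, A). (x, A, \<pi> x)) ` set \<Gamma>"
    "open_realizes N n (ed e) (su e \<union> set (\<nu>B @ rev \<nu>A)) (ctx \<Gamma>) \<pi> (map_term g t) (\<phi> (A \<multimap> B)) (\<nu>B @ rev \<nu>A)"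
    by (rule poleE[OF e])
  obtain s \<Delta> \<pi>' where s: "ou d = {#}" "typed \<Sigma> \<Delta> s A" "hy d = (\<lambda>(x, A). (x, A, \<pi>' x)) ` set \<Delta>"
    "open_realizes N n (ed d) (su d \<union> set \<nu>A) (ctx \<Delta>) \<pi>' (map_term g s) (\<phi> A) \<nu>A"
    by (rule poleE[OF d])
  have su: "su e \<union> set (\<nu>B @ rev \<nu>A) = su e" "su d \<union> set \<nu>A = su d"
    using elt_okD(1)[OF ok(1)] elt_okD(1)[OF ok(2)] by blast+
  have dom: "fst ` set \<Gamma> = vars e" "fst ` set \<Delta> = vars d"
    unfolding vars_def t(3) s(3) by (auto simp: image_image split_beta)
  \<comment> \<open>The two port assignments merged into one; their domains are disjoint.\<close>
  define \<xi> where "\<xi> x = (if x \<in> vars e then \<pi> x else \<pi>' x)" for x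
  have domc: "fst ` ctx \<Theta> = fst ` set \<Theta>" for \<Theta> by (auto simp: image_image)
  have \<xi>: "\<pi> x = \<xi> x" if "x \<in> fst ` set \<Gamma>" for x using that dom by (simp add: \<xi>_def)
  have \<xi>': "\<pi>' x = \<xi> x" if "x \<in> fst ` set \<Delta>" for x using that dom c(2) by (auto simp: \<xi>_def)
  have "open_realizes N n (ed e) (su e) (ctx \<Gamma>) \<xi> (map_term g t) (\<phi> A \<multimap> \<phi> B) (\<nu>B @ rev \<nu>A)"
    using open_realizes_cong[OF t(4)[unfolded su map_type.simps]] \<xi> domc by blast
  moreover have "open_realizes N n (ed d) (su d) (ctx \<Delta>) \<xi> (map_term g s) (\<phi> A) \<nu>A"
    using open_realizes_cong[OF s(4)[unfolded su]] \<xi>' domc by blast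
  ultimately have "open_realizes N n (ed e \<union> ed d) (su e \<union> su d) (ctx \<Gamma> \<union> ctx \<Delta>) \<xi>
      (App (map_term g t) (map_term g s)) (\<phi> B) \<nu>B"
    by (rule open_realizes_app[OF _ _ len c(1)]) (use dom c(2) domc in blast)
  moreover have "su e \<union> su d \<union> set \<nu>B = su e \<union> su d" using elt_okD(1)[OF ok(1)] by auto
  ultimately have or: "open_realizes N n (ed (e \<oplus> d)) (su (e \<oplus> d) \<union> set \<nu>B) (ctx (\<Gamma> @ \<Delta>)) \<xi>
      (map_term g (App t s)) (\<phi> B) \<nu>B" by (simp add: image_Un)
  have "hy e = (\<lambda>(x, A). (x, A, \<xi> x)) ` set \<Gamma>" unfolding t(3) using \<xi> by (intro image_cong) force+
  moreover have "hy d = (\<lambda>(x, A). (x, A, \<xi> x)) ` set \<Delta>" unfolding s(3) using \<xi>' by (intro image_cong) force+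
  ultimately have "hy (e \<oplus> d) = (\<lambda>(x, A). (x, A, \<xi> x)) ` set (\<Gamma> @ \<Delta>)" by (simp add: image_Un)
  moreover have "typed \<Sigma> (\<Gamma> @ \<Delta>) (App t s) B" using typed.app[OF t(2) s(2)] dom c(2) by blast
  ultimately show ?thesis using t(1) s(1) or by (intro realI) auto
qed

text \<open>Abstraction in the pole: a net that reaches \<open>B\<close> after being supplied with
  the hypothesis \<open>v\<close> is a function net on the combined ports.\<close>

lemma real_abs:
  assumes p: "pole (e \<oplus> hyp v A \<nu>A \<oplus> marker B \<nu>B)" and v: "v \<notin> vars e" and len: "length \<nu>B = wd (\<phi> B)"
  shows "real e (A \<multimap> B) (\<nu>B @ rev \<nu>A)"
proof -
  have "real (e \<oplus> hyp v A \<nu>A) B \<nu>B" using p by (simp add: real_def)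
  then obtain t \<Gamma> \<pi> where t: "ou (e \<oplus> hyp v A \<nu>A) = {#}" "typed \<Sigma> \<Gamma> t B"
    "hy (e \<oplus> hyp v A \<nu>A) = (\<lambda>(x, A). (x, A, \<pi> x)) ` set \<Gamma>"
    "open_realizes N n (ed (e \<oplus> hyp v A \<nu>A)) (su (e \<oplus> hyp v A \<nu>A) \<union> set \<nu>B) (ctx \<Gamma>) \<pi> (map_term g t) (\<phi> B) \<nu>B"
    by (rule poleE)
  have "(v, A, \<nu>A) \<in> (\<lambda>(x, A). (x, A, \<pi> x)) ` set \<Gamma>" using t(3) by auto
  then have vA: "(v, A) \<in> set \<Gamma>" "\<pi> v = \<nu>A" by auto
  obtain \<Gamma>1 \<Gamma>2 where \<Gamma>: "\<Gamma> = \<Gamma>1 @ (v, A) # \<Gamma>2" using split_list[OF vA(1)] by blast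
  have "distinct (map fst \<Gamma>)" using typed_facts[OF t(2)] by simp
  then have notin: "v \<notin> fst ` set \<Gamma>1" "v \<notin> fst ` set \<Gamma>2" unfolding \<Gamma> by auto
  \<comment> \<open>Moves \<open>v\<close> to the index bound by the abstraction and shifts all
    other variables past the binder.\<close>
  define \<rho> where "\<rho> y = (if y = v then 0 else Suc y)" for y
  have inj: "inj \<rho>" by (auto simp: inj_def \<rho>_def)
  have shift: "map (apfst \<rho>) \<Theta> = map (apfst Suc) \<Theta>" if "v \<notin> fst ` set \<Theta>" for \<Theta> :: "'p ctxt"
    using that by (intro map_cong) (force simp: \<rho>_def)+
  have \<rho>\<Gamma>: "map (apfst \<rho>) \<Gamma> = map (apfst Suc) \<Gamma>1 @ (0, A) # map (apfst Suc) \<Gamma>2"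
    unfolding \<Gamma> using shift notin by (simp add: \<rho>_def)
  have ty: "typed \<Sigma> (\<Gamma>1 @ \<Gamma>2) (Abs (rename \<rho> t)) (A \<multimap> B)"
    using typed.abs typed_rename[OF t(2) inj] unfolding \<rho>\<Gamma> by blast
  have gren: "map_term g (rename \<rho> t) = rename \<rho> (map_term g t)"
    using typed_facts[OF t(2)] g_closed by (intro map_term_rename) auto
  have ctx: "apfst \<rho> ` ctx \<Gamma> = insert (0, \<phi> A) (apfst Suc ` ctx (\<Gamma>1 @ \<Gamma>2))"
  proof -
    have "apfst \<rho> ` ctx \<Gamma> = apsnd \<phi> ` set (map (apfst \<rho>) \<Gamma>)" by (simp add: image_image)
    also have "\<dots> = insert (0, \<phi> A) (apfst Suc ` ctx (\<Gamma>1 @ \<Gamma>2))" unfolding \<rho>\<Gamma> by (auto simp: image_image image_Un)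
    finally show ?thesis .
  qed
  have "case_nat \<nu>A \<pi> (\<rho> x) = \<pi> x" for x using vA(2) by (simp add: \<rho>_def)
  from open_realizes_rename[OF t(4) inj this]
  have "open_realizes N n (ed e) (su e \<union> set \<nu>A \<union> set \<nu>B) (insert (0, \<phi> A) (apfst Suc ` ctx (\<Gamma>1 @ \<Gamma>2)))
      (case_nat \<nu>A \<pi>) (map_term g (rename \<rho> t)) (\<phi> B) \<nu>B" unfolding ctx gren by simp
  moreover have "linear (Abs (map_term g (rename \<rho> t)))" using typed_map_linear[OF ty] by simp
  ultimately have "open_realizes N n (ed e) (su e \<union> set \<nu>A \<union> set \<nu>B) (ctx (\<Gamma>1 @ \<Gamma>2)) \<pi>
      (Abs (map_term g (rename \<rho> t))) (\<phi> A \<multimap> \<phi> B) (\<nu>B @ rev \<nu>A)"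
    using open_realizes_abs len by blast
  moreover have "su e \<union> set \<nu>A \<union> set \<nu>B = su e \<union> set (\<nu>B @ rev \<nu>A)" by auto
  ultimately have or: "open_realizes N n (ed e) (su e \<union> set (\<nu>B @ rev \<nu>A)) (ctx (\<Gamma>1 @ \<Gamma>2)) \<pi>
      (map_term g (Abs (rename \<rho> t))) (\<phi> (A \<multimap> B)) (\<nu>B @ rev \<nu>A)" by simp
  have "hy e = (\<lambda>(x, A). (x, A, \<pi> x)) ` set (\<Gamma>1 @ \<Gamma>2)"
  proof -
    let ?h = "\<lambda>(x, A). (x, A, \<pi> x)"
    have "hy e \<union> {(v, A, \<nu>A)} = ?h ` set \<Gamma>" using t(3) by simp
    also have "\<dots> = insert (v, A, \<nu>A) (?h ` set (\<Gamma>1 @ \<Gamma>2))" unfolding \<Gamma> using vA(2) by auto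
    finally have eq: "insert (v, A, \<nu>A) (hy e) = insert (v, A, \<nu>A) (?h ` set (\<Gamma>1 @ \<Gamma>2))" by simp
    have "(v, A, \<nu>A) \<notin> hy e" using v by (force simp: vars_def)
    moreover have "(v, A, \<nu>A) \<notin> ?h ` set (\<Gamma>1 @ \<Gamma>2)" using notin by force
    ultimately show ?thesis using eq insert_ident[of "(v, A, \<nu>A)" "hy e" "?h ` set (\<Gamma>1 @ \<Gamma>2)"] by simp
  qed
  moreover have "ou e = {#}" using t(1) by simp
  ultimately show ?thesis using realI[OF _ ty _ or] by blast
qed

text \<open>Adequacy: on translated types the semantics is realization by a typed term. An element
  of an implication is tested with a fresh hypothesis for \<open>A\<close> and a marker for
  \<open>B\<close>, and the resulting term is abstracted; conversely, application turns a function
  net and an argument into an element of \<open>B\<close>.\<close>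

lemma type_sem:
  "A \<in> types_over \<Sigma> \<Longrightarrow> length \<nu> = wd (\<phi> A) \<Longrightarrow> distinct \<nu> \<Longrightarrow> sem (tr A) True \<nu> = reals A \<nu>"
proof (induction A arbitrary: \<nu>)
  case (Atom p)
  then show ?case by (simp add: tr_Atom atm types_over_def)
next
  case (Limp A B)
  have AB: "A \<in> types_over \<Sigma>" "B \<in> types_over \<Sigma>" using Limp.prems(1) by (auto simp: types_over_def)
  have l: "length \<nu> = wd (\<phi> B) + wd (\<phi> A)" using Limp.prems(2) by simp
  obtain \<nu>B \<mu> where \<mu>: "\<nu> = \<nu>B @ \<mu>" "length \<nu>B = wd (\<phi> B)" "length \<mu> = wd (\<phi> A)" using split_length[OF l] .
  define \<nu>A where "\<nu>A = rev \<mu>"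
  have \<nu>: "\<nu> = \<nu>B @ rev \<nu>A" "length \<nu>A = wd (\<phi> A)" "\<mu> = rev \<nu>A" using \<mu> by (simp_all add: \<nu>A_def)
  have dis: "distinct \<nu>A" "distinct \<nu>B" "set \<nu>A \<inter> set \<nu>B = {}" using Limp.prems(3) \<nu> by auto
  have fB: "fcard G (tr B) = wd (\<phi> B)" "length \<nu>A = fcard G (tr A)" using AB \<nu> by (simp_all add: fcard_tr)
  have semA: "sem (tr A) True \<nu>A = reals A \<nu>A" using Limp.IH(1)[OF AB(1) \<nu>(2) dis(1)] .
  have semB: "sem (tr B) True \<nu>B = reals B \<nu>B" using Limp.IH(2)[OF AB(2) \<mu>(2) dis(2)] .
  have sem: "sem (tr (A \<multimap> B)) True \<nu> = orth2 (reals A \<nu>A) (rev \<nu>A) (sem (tr B) False \<nu>B) \<nu>B \<nu>"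
  proof -
    have "sem (dual (tr A)) False (rev \<nu>A) = reals A \<nu>A" using sem_dual[OF fB(2), of False] semA by simp
    then show ?thesis using \<mu> \<nu> fB(1) by (simp add: tr_Limp)
  qed
  show ?case unfolding sem
  proof (intro equalityI subsetI)
    fix e assume e: "e \<in> orth2 (reals A \<nu>A) (rev \<nu>A) (sem (tr B) False \<nu>B) \<nu>B \<nu>"
    have ok: "elt_ok \<nu> e" using e by (simp add: orth2_def)
    obtain v where v: "v \<notin> vars e" using elt_okD(3)[OF ok] ex_new_if_finite infinite_UNIV_nat by metis
    have "hyp v A \<nu>A \<in> reals A \<nu>A" using real_hyp[OF AB(1)] by (simp add: reals_def elt_ok_hyp)
    moreover have "marker B \<nu>B \<in> sem (tr B) False \<nu>B"
      using sem_orth[of "tr B" False \<nu>B] semB by (simp add: orth_def elt_ok_marker reals_def real_def)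
    moreover have "compat3 (rev \<nu>A) \<nu>B e (hyp v A \<nu>A) (marker B \<nu>B)" using v dis by (auto simp: compat3_def)
    ultimately have "pole (e \<oplus> hyp v A \<nu>A \<oplus> marker B \<nu>B)" using orth2D[OF e] by blast
    then have "real e (A \<multimap> B) (\<nu>B @ rev \<nu>A)" using real_abs v \<mu>(2) by blast
    then show "e \<in> reals (A \<multimap> B) \<nu>" using ok \<nu>(1) by (simp add: reals_def)
  next
    fix e assume "e \<in> reals (A \<multimap> B) \<nu>"
    then have ok: "elt_ok (\<nu>B @ rev \<nu>A) e" and r: "real e (A \<multimap> B) (\<nu>B @ rev \<nu>A)" using \<nu>(1) by (auto simp: reals_def)
    have "pole (e \<oplus> a \<oplus> b)" if a: "a \<in> reals A \<nu>A" and b: "b \<in> sem (tr B) False \<nu>B"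
      and c: "compat3 (rev \<nu>A) \<nu>B e a b" for a b
    proof -
      have ra: "elt_ok \<nu>A a" "real a A \<nu>A" using a by (auto simp: reals_def)
      have "real (e \<oplus> a) B \<nu>B"
        using c by (intro real_app[OF r ra(2) ok ra(1) \<mu>(2)]) (auto simp: compat3_def)
      moreover have "elt_ok \<nu>B (e \<oplus> a)" using elt_okD(1)[OF ok] by (intro elt_ok_join[OF ok ra(1)]) auto
      ultimately have "e \<oplus> a \<in> sem (tr B) True \<nu>B" by (simp add: semB reals_def)
      moreover have "compat \<nu>B (e \<oplus> a) b" using c by (auto simp: compat3_def compat_def)
      ultimately show ?thesis using sem_pole[of "e \<oplus> a" "tr B" True] b by simp
    qed
    then show "e \<in> orth2 (reals A \<nu>A) (rev \<nu>A) (sem (tr B) False \<nu>B) \<nu>B \<nu>"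
      using ok \<nu>(1) by (simp add: orth2_def)
  qed
qed

end

context acg_llg
begin

subsection \<open>Soundness of the rules\<close>

text \<open>One counter-element per formula, mutually disjoint: a sequent is read as the Par of its
  formulas.\<close>

primrec tests :: "nat form list \<Rightarrow> nat list \<Rightarrow> ('a, 'p) elt set" where
  "tests [] \<nu> = {Elt {} {} {} {#}}"
| "tests (A # \<Gamma>) \<nu> = {D \<oplus> d | D d. D \<in> tests \<Gamma> (take (scard G \<Gamma>) \<nu>) \<and> d \<in> sem A False (drop (scard G \<Gamma>) \<nu>)
     \<and> su D \<inter> su d = {} \<and> vars D \<inter> vars d = {}}"

lemma join_unit: "Elt {} {} {} {#} \<oplus> d = d" "d \<oplus> Elt {} {} {} {#} = d"
  by (auto intro: elt_eqI)

lemma unit_simps: "su (Elt {} {} {} {#}) = {}" "vars (Elt {} {} {} {#}) = {}"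
  by (simp_all add: vars_def)

lemma tests_single: "tests [A] \<nu> = sem A False \<nu>"
  by (auto simp: join_unit unit_simps)

lemma tests_append:
  "length \<nu>\<Delta> = scard G \<Delta> \<Longrightarrow> length \<nu>\<Gamma> = scard G \<Gamma> \<Longrightarrow> D \<in> tests (\<Gamma> @ \<Delta>) (\<nu>\<Delta> @ \<nu>\<Gamma>) \<longleftrightarrow>
     (\<exists>D1 D2. D = D1 \<oplus> D2 \<and> D1 \<in> tests \<Delta> \<nu>\<Delta> \<and> D2 \<in> tests \<Gamma> \<nu>\<Gamma> \<and> su D1 \<inter> su D2 = {} \<and> vars D1 \<inter> vars D2 = {})"
proof (induction \<Gamma> arbitrary: D \<nu>\<Gamma>)
  case Nil
  then show ?case by (auto simp: join_unit unit_simps)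
next
  case (Cons A \<Gamma>)
  have len: "length \<nu>\<Gamma> = scard G \<Gamma> + fcard G A" using Cons.prems(2) unfolding scard_Cons .
  obtain \<nu>' \<nu>A where \<nu>: "\<nu>\<Gamma> = \<nu>' @ \<nu>A" "length \<nu>' = scard G \<Gamma>" using split_length[OF len] by metis
  have 1: "D \<in> tests ((A # \<Gamma>) @ \<Delta>) (\<nu>\<Delta> @ \<nu>\<Gamma>) \<longleftrightarrow> (\<exists>D0 d. D = D0 \<oplus> d \<and> D0 \<in> tests (\<Gamma> @ \<Delta>) (\<nu>\<Delta> @ \<nu>')
      \<and> d \<in> sem A False \<nu>A \<and> su D0 \<inter> su d = {} \<and> vars D0 \<inter> vars d = {})"
    using \<nu> Cons.prems(1) by (simp add: scard_append)
  have 2: "D2 \<in> tests (A # \<Gamma>) \<nu>\<Gamma> \<longleftrightarrow> (\<exists>D0 d. D2 = D0 \<oplus> d \<and> D0 \<in> tests \<Gamma> \<nu>'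
      \<and> d \<in> sem A False \<nu>A \<and> su D0 \<inter> su d = {} \<and> vars D0 \<inter> vars d = {})" for D2
    using \<nu> by simp
  show ?case unfolding 1 2 Cons.IH[OF Cons.prems(1) \<nu>(2)]
  proof (intro iffI; elim exE conjE)
    fix D0 d D1 D2
    assume "D = D0 \<oplus> d" "d \<in> sem A False \<nu>A" "su D0 \<inter> su d = {}" "vars D0 \<inter> vars d = {}" "D0 = D1 \<oplus> D2"
      "D1 \<in> tests \<Delta> \<nu>\<Delta>" "D2 \<in> tests \<Gamma> \<nu>'" "su D1 \<inter> su D2 = {}" "vars D1 \<inter> vars D2 = {}"
    note * = this
    then have "D = D1 \<oplus> (D2 \<oplus> d)" "su D1 \<inter> su (D2 \<oplus> d) = {}" "vars D1 \<inter> vars (D2 \<oplus> d) = {}"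
      "su D2 \<inter> su d = {}" "vars D2 \<inter> vars d = {}"
      by (auto simp: join_assoc)
    with * show "\<exists>D1 D2. D = D1 \<oplus> D2 \<and> D1 \<in> tests \<Delta> \<nu>\<Delta> \<and> (\<exists>D0 d. D2 = D0 \<oplus> d \<and> D0 \<in> tests \<Gamma> \<nu>'
        \<and> d \<in> sem A False \<nu>A \<and> su D0 \<inter> su d = {} \<and> vars D0 \<inter> vars d = {}) \<and> su D1 \<inter> su D2 = {} \<and> vars D1 \<inter> vars D2 = {}"
      by blast
  next
    fix D1 D2 D0 d
    assume "D = D1 \<oplus> D2" "D1 \<in> tests \<Delta> \<nu>\<Delta>" "su D1 \<inter> su D2 = {}" "vars D1 \<inter> vars D2 = {}" "D2 = D0 \<oplus> d"
      "D0 \<in> tests \<Gamma> \<nu>'" "d \<in> sem A False \<nu>A" "su D0 \<inter> su d = {}" "vars D0 \<inter> vars d = {}"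
    note * = this
    then have "D = (D1 \<oplus> D0) \<oplus> d" "su (D1 \<oplus> D0) \<inter> su d = {}" "vars (D1 \<oplus> D0) \<inter> vars d = {}"
      "su D1 \<inter> su D0 = {}" "vars D1 \<inter> vars D0 = {}"
      by (auto simp: join_assoc)
    with * show "\<exists>D0 d. D = D0 \<oplus> d \<and> (\<exists>D1 D2. D0 = D1 \<oplus> D2 \<and> D1 \<in> tests \<Delta> \<nu>\<Delta> \<and> D2 \<in> tests \<Gamma> \<nu>'
        \<and> su D1 \<inter> su D2 = {} \<and> vars D1 \<inter> vars D2 = {}) \<and> d \<in> sem A False \<nu>A \<and> su D0 \<inter> su d = {} \<and> vars D0 \<inter> vars d = {}"
      by blast
  qed
qed

lemma tests_joinI:
  "D1 \<in> tests \<Delta> \<nu>\<Delta> \<Longrightarrow> D2 \<in> tests \<Gamma> \<nu>\<Gamma> \<Longrightarrow> su D1 \<inter> su D2 = {} \<Longrightarrow> vars D1 \<inter> vars D2 = {} \<Longrightarrow>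
   length \<nu>\<Delta> = scard G \<Delta> \<Longrightarrow> length \<nu>\<Gamma> = scard G \<Gamma> \<Longrightarrow> D1 \<oplus> D2 \<in> tests (\<Gamma> @ \<Delta>) (\<nu>\<Delta> @ \<nu>\<Gamma>)"
  by (subst tests_append) blast+

lemma tests_joinE:
  assumes "D \<in> tests (\<Gamma> @ \<Delta>) (\<nu>\<Delta> @ \<nu>\<Gamma>)" "length \<nu>\<Delta> = scard G \<Delta>" "length \<nu>\<Gamma> = scard G \<Gamma>"
  obtains D1 D2 where "D = D1 \<oplus> D2" "D1 \<in> tests \<Delta> \<nu>\<Delta>" "D2 \<in> tests \<Gamma> \<nu>\<Gamma>" "su D1 \<inter> su D2 = {}" "vars D1 \<inter> vars D2 = {}"
  using assms(1) unfolding tests_append[OF assms(2,3)] by blast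

lemma tests_ok: "D \<in> tests \<Gamma> \<nu> \<Longrightarrow> length \<nu> = scard G \<Gamma> \<Longrightarrow> elt_ok \<nu> D"
proof (induction \<Gamma> arbitrary: D \<nu>)
  case Nil
  then show ?case by (simp add: elt_ok_def)
next
  case (Cons A \<Gamma>)
  have len: "length \<nu> = scard G \<Gamma> + fcard G A" using Cons.prems(2) unfolding scard_Cons .
  obtain \<nu>' \<nu>A where \<nu>: "\<nu> = \<nu>' @ \<nu>A" "length \<nu>' = scard G \<Gamma>" using split_length[OF len] by metis
  obtain D0 d where D: "D = D0 \<oplus> d" "D0 \<in> tests \<Gamma> \<nu>'" "d \<in> sem A False \<nu>A" using Cons.prems(1) \<nu> by auto
  from Cons.IH[OF D(2) \<nu>(2)] sem_ok[OF D(3)] show ?case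
    unfolding D(1) \<nu>(1) using elt_okD(1)[OF Cons.IH[OF D(2) \<nu>(2)]] elt_okD(1)[OF sem_ok[OF D(3)]]
    by (intro elt_ok_join) auto
qed

definition satisfies :: "'a tsym multiword \<Rightarrow> nat form list \<Rightarrow> bool" where
  "satisfies \<sigma> \<Gamma> \<longleftrightarrow> (\<forall>\<nu> D. distinct \<nu> \<longrightarrow> 0 \<notin> set \<nu> \<longrightarrow> length \<nu> = scard G \<Gamma> \<longrightarrow> D \<in> tests \<Gamma> \<nu> \<longrightarrow>
     pole (net (nm \<nu> \<sigma>) \<nu> \<oplus> D))"

lemma satisfiesD:
  "satisfies \<sigma> \<Gamma> \<Longrightarrow> distinct \<nu> \<Longrightarrow> 0 \<notin> set \<nu> \<Longrightarrow> length \<nu> = scard G \<Gamma> \<Longrightarrow> D \<in> tests \<Gamma> \<nu> \<Longrightarrow>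
   pole (net (nm \<nu> \<sigma>) \<nu> \<oplus> D)"
  by (simp add: satisfies_def)

text \<open>Feeding tests to all formulas but one leaves an element of the remaining formula, since
  that formula is the orthogonal of the tests not yet supplied.\<close>

lemma net_sem:
  assumes sat: "satisfies \<sigma> (\<Gamma> @ [A])" and der: "derivable G \<sigma> (\<Gamma> @ [A])"
    and D: "D \<in> tests \<Gamma> \<nu>\<Gamma>" and len: "length \<nu>A = fcard G A" "length \<nu>\<Gamma> = scard G \<Gamma>"
    and \<nu>: "distinct (\<nu>A @ \<nu>\<Gamma>)" "0 \<notin> set (\<nu>A @ \<nu>\<Gamma>)" and fresh: "set \<nu>A \<inter> su D = {}"
  shows "net (nm (\<nu>A @ \<nu>\<Gamma>) \<sigma>) (\<nu>A @ \<nu>\<Gamma>) \<oplus> D \<in> sem A True \<nu>A" (is "?e \<in> _")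
proof -
  have sA: "scard G [A] = fcard G A" using scard_Cons[of A "[]"] by simp
  have l: "length (\<nu>A @ \<nu>\<Gamma>) = scard G (\<Gamma> @ [A])" using len sA by (simp add: scard_append)
  have okD: "elt_ok \<nu>\<Gamma> D" using tests_ok[OF D len(2)] .
  have ok: "elt_ok \<nu>A ?e"
    by (rule elt_ok_join[OF elt_ok_net okD]) (use derivable_verts_nm[OF der l] in auto)
  have "pole (d \<oplus> ?e)" if d: "d \<in> sem A False \<nu>A" and c: "compat \<nu>A d ?e" for d
  proof -
    have "su d \<inter> su D = {}" "vars d \<inter> vars D = {}" using c fresh by (auto simp: compat_def)
    then have "d \<oplus> D \<in> tests (\<Gamma> @ [A]) (\<nu>A @ \<nu>\<Gamma>)"
      using d by (intro tests_joinI[OF _ D]) (simp_all only: tests_single sA len)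
    from satisfiesD[OF sat \<nu> l this] show ?thesis by (simp add: join_left_commute)
  qed
  then have "?e \<in> orth (sem A False \<nu>A) \<nu>A" using ok by (simp add: orth_def)
  then show ?thesis using sem_orth[of A True \<nu>A] by simp
qed

text \<open>The same for the first formula of a sequent, whose names come last.\<close>

lemma net_sem':
  assumes sat: "satisfies \<sigma> (A # \<Delta>)" and der: "derivable G \<sigma> (A # \<Delta>)"
    and D: "D \<in> tests \<Delta> \<nu>\<Delta>" and len: "length \<nu>A = fcard G A" "length \<nu>\<Delta> = scard G \<Delta>"
    and \<nu>: "distinct (\<nu>\<Delta> @ \<nu>A)" "0 \<notin> set (\<nu>\<Delta> @ \<nu>A)" and fresh: "set \<nu>A \<inter> su D = {}"
  shows "net (nm (\<nu>\<Delta> @ \<nu>A) \<sigma>) (\<nu>\<Delta> @ \<nu>A) \<oplus> D \<in> sem A True \<nu>A" (is "?e \<in> _")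
proof -
  have sA: "scard G [A] = fcard G A" using scard_Cons[of A "[]"] by simp
  have l: "length (\<nu>\<Delta> @ \<nu>A) = scard G (A # \<Delta>)" using len by (simp only: scard_Cons length_append)
  have okD: "elt_ok \<nu>\<Delta> D" using tests_ok[OF D len(2)] .
  have ok: "elt_ok \<nu>A ?e"
    by (rule elt_ok_join[OF elt_ok_net okD]) (use derivable_verts_nm[OF der l] in auto)
  have "pole (d \<oplus> ?e)" if d: "d \<in> sem A False \<nu>A" and c: "compat \<nu>A d ?e" for d
  proof -
    have "su D \<inter> su d = {}" "vars D \<inter> vars d = {}" using c fresh by (auto simp: compat_def)
    then have "D \<oplus> d \<in> tests (A # \<Delta>) (\<nu>\<Delta> @ \<nu>A)"
      using d D len by auto
    from satisfiesD[OF sat \<nu> l this] show ?thesis by (simp add: join_ac)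
  qed
  then have "?e \<in> orth (sem A False \<nu>A) \<nu>A" using ok by (simp add: orth_def)
  then show ?thesis using sem_orth[of A True \<nu>A] by simp
qed

text \<open>Cut replaces a union by a simulating net with fewer names. The pole is stable under this
  because the ports of hypotheses and conclusion lie outside \<open>X\<close>.\<close>

lemma pole_hide:
  assumes p: "pole e" and ok: "elt_ok [] d" and hy: "hy e = hy d" "ou e = ou d"
    and sim: "simulates X (ed e) (ed d)" and su: "su e = su d \<union> X" "su d \<inter> X = {}"
    and X: "0 \<notin> X" "finite X"
  shows "pole d"
proof -
  obtain B \<nu> t \<Gamma> \<pi> where t: "ou e = {#(B, \<nu>)#}" "typed \<Sigma> \<Gamma> t B" "hy e = (\<lambda>(x, A). (x, A, \<pi> x)) ` set \<Gamma>"
    "open_realizes N n (ed e) (su e) (ctx \<Gamma>) \<pi> (map_term g t) (\<phi> B) \<nu>"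
    using p unfolding pole_def by blast
  have S: "su e - X = su d" using su by blast
  have "set \<nu> \<subseteq> su d" using ok t(1) hy(2) by (auto simp: elt_ok_def)
  then have 1: "set \<nu> \<inter> X = {}" using su(2) by blast
  have 2: "set (\<pi> x) \<inter> X = {}" if "x \<in> fst ` ctx \<Gamma>" for x
  proof -
    from that obtain A where "(x, A) \<in> set \<Gamma>" by (auto simp: image_image)
    then have "(x, A, \<pi> x) \<in> hy d" using t(3) hy(1) by force
    then have "set (\<pi> x) \<subseteq> su d" using ok by (force simp: elt_ok_def)
    then show ?thesis using su(2) by blast
  qed
  have "verts (ed d) \<subseteq> insert 0 (su e - X)" unfolding S using elt_okD(4)[OF ok] .
  from open_realizes_hide[OF t(4) sim this X 1 2]
  have "open_realizes N n (ed d) (su d) (ctx \<Gamma>) \<pi> (map_term g t) (\<phi> B) \<nu>" unfolding S .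
  then show ?thesis using t hy unfolding pole_def by auto
qed

text \<open>Once the side formulas are fed with tests, one premise is an element of \<open>A\<close>
  and the other an element of its dual. Their join is in the pole, and hiding the cut names gives
  the composite.\<close>

lemma satisfies_cut:
  assumes s\<sigma>: "satisfies \<sigma> (\<Gamma> @ [A])" and d\<sigma>: "derivable G \<sigma> (\<Gamma> @ [A])"
    and s\<tau>: "satisfies \<tau> (dual A # \<Delta>)" and d\<tau>: "derivable G \<tau> (dual A # \<Delta>)"
  shows "satisfies (mw_comp (scard G \<Delta>) (fcard G A) \<tau> \<sigma>) (\<Gamma> @ \<Delta>)" (is "satisfies ?\<sigma> _")
  unfolding satisfies_def
proof (intro allI impI)
  fix \<nu> D assume \<nu>: "distinct \<nu>" "0 \<notin> set \<nu>" "length \<nu> = scard G (\<Gamma> @ \<Delta>)" and D: "D \<in> tests (\<Gamma> @ \<Delta>) \<nu>"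
  obtain \<nu>\<Delta> \<nu>\<Gamma> where sp: "\<nu> = \<nu>\<Delta> @ \<nu>\<Gamma>" "length \<nu>\<Delta> = scard G \<Delta>" "length \<nu>\<Gamma> = scard G \<Gamma>"
    using \<nu>(3) unfolding scard_append by (rule split_length)
  obtain D1 D2 where D12: "D = D1 \<oplus> D2" "D1 \<in> tests \<Delta> \<nu>\<Delta>" "D2 \<in> tests \<Gamma> \<nu>\<Gamma>" "su D1 \<inter> su D2 = {}" "vars D1 \<inter> vars D2 = {}"
    using D unfolding sp(1) by (rule tests_joinE[OF _ sp(2,3)])
  have ok1: "elt_ok \<nu>\<Delta> D1" and ok2: "elt_ok \<nu>\<Gamma> D2" using tests_ok D12 sp by blast+
  have sub: "set \<nu>\<Delta> \<subseteq> su D1" "set \<nu>\<Gamma> \<subseteq> su D2" using elt_okD(1) ok1 ok2 by blast+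
  \<comment> \<open>The cut names must avoid all names used inside the tests, not only those of the
    interface.\<close>
  have fin: "finite (insert 0 (su D))" using elt_okD(2) ok1 ok2 D12(1) by auto
  obtain \<nu>A where \<nu>A: "distinct \<nu>A" "length \<nu>A = fcard G A" "set \<nu>A \<inter> insert 0 (su D) = {}"
    using fresh_list[OF fin] by blast
  have fr: "set \<nu>A \<inter> su D1 = {}" "set \<nu>A \<inter> su D2 = {}" "0 \<notin> set \<nu>A" using \<nu>A(3) D12(1) by auto
  have dis: "distinct (\<nu>\<Delta> @ \<nu>A @ \<nu>\<Gamma>)" "0 \<notin> set (\<nu>\<Delta> @ \<nu>A @ \<nu>\<Gamma>)" using \<nu> sp(1) \<nu>A(1) fr sub by auto
  let ?e1 = "net (nm (\<nu>A @ \<nu>\<Gamma>) \<sigma>) (\<nu>A @ \<nu>\<Gamma>) \<oplus> D2" and ?e2 = "net (nm (\<nu>\<Delta> @ rev \<nu>A) \<tau>) (\<nu>\<Delta> @ rev \<nu>A) \<oplus> D1"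
  have e1: "?e1 \<in> sem A True \<nu>A"
    by (rule net_sem[OF s\<sigma> d\<sigma> D12(3) \<nu>A(2) sp(3) _ _ fr(2)]) (use dis in auto)
  have "?e2 \<in> sem (dual A) True (rev \<nu>A)"
    by (rule net_sem'[OF s\<tau> d\<tau> D12(2) _ sp(2)]) (use dis \<nu>A(2) fr(1) in \<open>auto simp: fcard_dual\<close>)
  then have e2: "?e2 \<in> sem A False \<nu>A" using sem_dual[OF \<nu>A(2), of True] by simp
  have "compat \<nu>A ?e1 ?e2" using D12(4,5) sub fr dis(1) by (auto simp: compat_def)
  then have p: "pole (?e1 \<oplus> ?e2)" using sem_pole[OF e1] e2 by simp
  have der: "derivable G ?\<sigma> (\<Gamma> @ \<Delta>)" using derivable.Cut[OF d\<sigma> d\<tau>] .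
  show "pole (net (nm \<nu> ?\<sigma>) \<nu> \<oplus> D)"
  proof (rule pole_hide[OF p])
    have okD: "elt_ok [] D" using elt_ok_join[OF ok1 ok2, of "[]"] D12(1) by simp
    show "elt_ok [] (net (nm \<nu> ?\<sigma>) \<nu> \<oplus> D)"
      by (rule elt_ok_join[OF elt_ok_net okD]) (use derivable_verts_nm[OF der \<nu>(3)] in auto)
    show "simulates (set \<nu>A) (ed (?e1 \<oplus> ?e2)) (ed (net (nm \<nu> ?\<sigma>) \<nu> \<oplus> D))"
    proof -
      have "length (ss (\<Gamma> @ [A])) = fcard G A + scard G \<Gamma>" "length (ss (dual A # \<Delta>)) = scard G \<Delta> + fcard G A"
        by (simp_all add: scard_append scard_Cons fcard_dual del: sbound.simps(2))
      then have "simulates (set \<nu>A) (nm (\<nu>\<Delta> @ rev \<nu>A) \<tau> \<union> nm (\<nu>A @ \<nu>\<Gamma>) \<sigma>) (nm (\<nu>\<Delta> @ \<nu>\<Gamma>) ?\<sigma>)"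
        by (rule simulates_comp[OF derivable_well_typed[OF d\<sigma>] _ derivable_well_typed[OF d\<tau>] _ dis(1) sp(2) \<nu>A(2) sp(3)])
      moreover have "verts (ed D) \<inter> set \<nu>A = {}"
        using elt_okD(4)[OF ok1] elt_okD(4)[OF ok2] fr D12(1) by auto
      ultimately have "simulates (set \<nu>A) (nm (\<nu>\<Delta> @ rev \<nu>A) \<tau> \<union> nm (\<nu>A @ \<nu>\<Gamma>) \<sigma> \<union> ed D) (nm (\<nu>\<Delta> @ \<nu>\<Gamma>) ?\<sigma> \<union> ed D)"
        by (rule simulates_Un)
      moreover have "nm (\<nu>\<Delta> @ rev \<nu>A) \<tau> \<union> nm (\<nu>A @ \<nu>\<Gamma>) \<sigma> \<union> ed D = ed (?e1 \<oplus> ?e2)" using D12(1) by auto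
      ultimately show ?thesis using sp(1) by simp
    qed
    show "su (?e1 \<oplus> ?e2) = su (net (nm \<nu> ?\<sigma>) \<nu> \<oplus> D) \<union> set \<nu>A" using D12(1) sp(1) by auto
    show "su (net (nm \<nu> ?\<sigma>) \<nu> \<oplus> D) \<inter> set \<nu>A = {}" using D12(1) sp(1) sub fr by auto
  qed (use D12(1) fr in \<open>auto simp: add.commute\<close>)
qed

text \<open>A test for the tensor is an \<open>orth2\<close> element, and it accepts the pair of
  elements obtained from the two premises.\<close>

lemma satisfies_tensor:
  assumes s\<sigma>: "satisfies \<sigma> (\<Gamma> @ [A])" and d\<sigma>: "derivable G \<sigma> (\<Gamma> @ [A])"
    and s\<tau>: "satisfies \<tau> (B # \<Delta>)" and d\<tau>: "derivable G \<tau> (B # \<Delta>)"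
  shows "satisfies (mw_tensor (scard G \<Delta>) (fcard G A) (fcard G B) \<sigma> \<tau>) (\<Gamma> @ [A \<otimes>\<^sub>f B] @ \<Delta>)" (is "satisfies ?\<sigma> _")
  unfolding satisfies_def
proof (intro allI impI)
  fix \<nu> D assume \<nu>: "distinct \<nu>" "0 \<notin> set \<nu>" "length \<nu> = scard G (\<Gamma> @ [A \<otimes>\<^sub>f B] @ \<Delta>)"
    and D: "D \<in> tests (\<Gamma> @ [A \<otimes>\<^sub>f B] @ \<Delta>) \<nu>"
  have sAB: "scard G [A \<otimes>\<^sub>f B] = fcard G A + fcard G B" using scard_Cons[of "A \<otimes>\<^sub>f B" "[]"] fcard_Tensor by simp
  have "length \<nu> = scard G \<Delta> + (fcard G A + (fcard G B + scard G \<Gamma>))" using \<nu>(3) unfolding scard_append sAB by simp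
  then obtain \<nu>\<Delta> \<nu>A \<nu>B \<nu>\<Gamma> where sp: "\<nu> = \<nu>\<Delta> @ \<nu>A @ \<nu>B @ \<nu>\<Gamma>"
    "length \<nu>\<Delta> = scard G \<Delta>" "length \<nu>A = fcard G A" "length \<nu>B = fcard G B" "length \<nu>\<Gamma> = scard G \<Gamma>"
    by (rule split_length4)
  have "D \<in> tests (\<Gamma> @ ([A \<otimes>\<^sub>f B] @ \<Delta>)) ((\<nu>\<Delta> @ (\<nu>A @ \<nu>B)) @ \<nu>\<Gamma>)" using D sp(1) by simp
  then obtain D0 D2 where D0: "D = D0 \<oplus> D2" "D0 \<in> tests ([A \<otimes>\<^sub>f B] @ \<Delta>) (\<nu>\<Delta> @ (\<nu>A @ \<nu>B))" "D2 \<in> tests \<Gamma> \<nu>\<Gamma>"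
    "su D0 \<inter> su D2 = {}" "vars D0 \<inter> vars D2 = {}"
    by (rule tests_joinE) (use sp sAB in \<open>simp_all only: scard_append length_append\<close>)
  from D0(2) obtain D1 d where D1: "D0 = D1 \<oplus> d" "D1 \<in> tests \<Delta> \<nu>\<Delta>" "d \<in> tests [A \<otimes>\<^sub>f B] (\<nu>A @ \<nu>B)"
    "su D1 \<inter> su d = {}" "vars D1 \<inter> vars d = {}"
    by (rule tests_joinE) (use sp sAB in \<open>simp_all only: length_append\<close>)
  have d: "d \<in> orth2 (sem A True \<nu>A) \<nu>A (sem B True \<nu>B) \<nu>B (\<nu>A @ \<nu>B)"
    using D1(3) sp(3,4) unfolding tests_single by simp
  have ok1: "elt_ok \<nu>\<Delta> D1" and ok2: "elt_ok \<nu>\<Gamma> D2" and okd: "elt_ok (\<nu>A @ \<nu>B) d"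
    using tests_ok D1 D0 sp d by (auto simp: orth2_def)
  have sub: "set \<nu>\<Delta> \<subseteq> su D1" "set \<nu>\<Gamma> \<subseteq> su D2" "set \<nu>A \<subseteq> su d" "set \<nu>B \<subseteq> su d"
    using elt_okD(1)[OF ok1] elt_okD(1)[OF ok2] elt_okD(1)[OF okd] by auto
  have dj: "su d \<inter> su D1 = {}" "su d \<inter> su D2 = {}" "su D1 \<inter> su D2 = {}"
    "vars d \<inter> vars D1 = {}" "vars d \<inter> vars D2 = {}" "vars D1 \<inter> vars D2 = {}"
    using D0(4,5) D1(1,4,5) by auto
  let ?e1 = "net (nm (\<nu>A @ \<nu>\<Gamma>) \<sigma>) (\<nu>A @ \<nu>\<Gamma>) \<oplus> D2" and ?e2 = "net (nm (\<nu>\<Delta> @ \<nu>B) \<tau>) (\<nu>\<Delta> @ \<nu>B) \<oplus> D1"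
  have e1: "?e1 \<in> sem A True \<nu>A"
    by (rule net_sem[OF s\<sigma> d\<sigma> D0(3) sp(3,5)]) (use \<nu> sp(1) sub dj in auto)
  have e2: "?e2 \<in> sem B True \<nu>B"
    by (rule net_sem'[OF s\<tau> d\<tau> D1(2) sp(4,2)]) (use \<nu> sp(1) sub dj in auto)
  have dn: "set \<nu>A \<inter> set \<nu>B = {}" using \<nu>(1) sp(1) by auto
  have s12: "su ?e1 = set \<nu>A \<union> su D2" "su ?e2 = set \<nu>B \<union> su D1" using sub by auto
  have "compat3 \<nu>A \<nu>B d ?e1 ?e2"
  proof -
    have "set \<nu>A \<inter> su D1 = {}" "set \<nu>B \<inter> su D2 = {}" "su D2 \<inter> su D1 = {}" using sub dj by blast+
    then show ?thesis using dj dn unfolding compat3_def s12 by auto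
  qed
  then have "pole (d \<oplus> ?e1 \<oplus> ?e2)" using orth2D[OF d e1 e2] by blast
  moreover have "d \<oplus> ?e1 \<oplus> ?e2 = net (nm \<nu> ?\<sigma>) \<nu> \<oplus> D"
  proof -
    have v: "verts (edges \<sigma>) \<subseteq> {1..scard G (\<Gamma> @ [A])}" "verts (edges \<tau>) \<subseteq> {1..scard G \<Delta> + fcard G B}"
      using derivable_verts[OF d\<sigma>] derivable_verts[OF d\<tau>] unfolding scard_Cons by blast+
    have "nm \<nu> ?\<sigma> = nm (\<nu>A @ \<nu>\<Gamma>) \<sigma> \<union> nm (\<nu>\<Delta> @ \<nu>B) \<tau>" unfolding sp(1) by (rule nm_mw_tensor[OF sp(2-4) v])
    then show ?thesis using D0(1) D1(1) sp(1) by (intro elt_eqI) auto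
  qed
  ultimately show "pole (net (nm \<nu> ?\<sigma>) \<nu> \<oplus> D)" by simp
qed

text \<open>Completed on the side formulas, the net passes all pair tests for the two components and
  so belongs to the interpretation of Par; the given test is on the opposite side.\<close>

lemma satisfies_par:
  assumes s\<sigma>: "satisfies \<sigma> (\<Gamma> @ [A, B])" and d\<sigma>: "derivable G \<sigma> (\<Gamma> @ [A, B])"
  shows "satisfies \<sigma> (\<Gamma> @ [Par A B])"
  unfolding satisfies_def
proof (intro allI impI)
  fix \<nu> D assume \<nu>: "distinct \<nu>" "0 \<notin> set \<nu>" "length \<nu> = scard G (\<Gamma> @ [Par A B])"
    and D: "D \<in> tests (\<Gamma> @ [Par A B]) \<nu>"
  have sP: "scard G [Par A B] = fcard G B + fcard G A" using scard_Cons[of "Par A B" "[]"] fcard_Par by simp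
  have sAB: "scard G [A, B] = fcard G B + fcard G A" using scard_Cons[of A "[B]"] scard_Cons[of B "[]"] by simp
  have l: "length \<nu> = (fcard G B + fcard G A) + scard G \<Gamma>" using \<nu>(3) unfolding scard_append sP by simp
  obtain \<nu>P \<nu>\<Gamma> where 1: "\<nu> = \<nu>P @ \<nu>\<Gamma>" "length \<nu>P = fcard G B + fcard G A" "length \<nu>\<Gamma> = scard G \<Gamma>"
    using split_length[OF l] .
  obtain \<nu>B \<nu>A where 2: "\<nu>P = \<nu>B @ \<nu>A" "length \<nu>B = fcard G B" "length \<nu>A = fcard G A" using split_length[OF 1(2)] .
  obtain d D2 where D2: "D = d \<oplus> D2" "d \<in> tests [Par A B] \<nu>P" "D2 \<in> tests \<Gamma> \<nu>\<Gamma>" "su d \<inter> su D2 = {}" "vars d \<inter> vars D2 = {}"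
    using D unfolding 1(1) by (rule tests_joinE) (use 1 sP in simp_all)
  have d: "d \<in> sem (Par A B) False \<nu>P" using D2(2) unfolding tests_single .
  have okd: "elt_ok \<nu>P d" using sem_ok[OF d] .
  have ok2: "elt_ok \<nu>\<Gamma> D2" using tests_ok[OF D2(3) 1(3)] .
  have sub: "set \<nu>P \<subseteq> su d" "set \<nu>\<Gamma> \<subseteq> su D2" using elt_okD(1) okd ok2 by blast+
  let ?e = "net (nm \<nu> \<sigma>) \<nu> \<oplus> D2"
  have se: "su ?e = set \<nu>P \<union> su D2" using sub 1(1) by auto
  have l': "length \<nu> = scard G (\<Gamma> @ [A, B])" using l sAB by (simp only: scard_append)
  have "pole (?e \<oplus> a \<oplus> b)" if a: "a \<in> sem A False \<nu>A" and b: "b \<in> sem B False \<nu>B"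
    and c: "compat3 \<nu>A \<nu>B ?e a b" for a b
  proof -
    have ab: "su b \<inter> su a = {}" "vars b \<inter> vars a = {}" using c by (auto simp: compat3_def)
    have "tests [A, B] (\<nu>B @ \<nu>A) = {D \<oplus> d |D d. D \<in> tests [B] \<nu>B \<and> d \<in> sem A False \<nu>A \<and> su D \<inter> su d = {} \<and> vars D \<inter> vars d = {}}"
      using 2(2) scard_Cons[of B "[]"] by simp
    then have t: "b \<oplus> a \<in> tests [A, B] (\<nu>B @ \<nu>A)" using a b ab unfolding tests_single by blast
    have "su a \<inter> su D2 \<subseteq> set \<nu>A" "su b \<inter> su D2 \<subseteq> set \<nu>B" using c unfolding compat3_def se by blast+
    then have "su (b \<oplus> a) \<inter> su D2 = {}" using sub(1) D2(4) 2(1) by auto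
    moreover have "vars (b \<oplus> a) \<inter> vars D2 = {}" using c by (auto simp: compat3_def)
    ultimately have "(b \<oplus> a) \<oplus> D2 \<in> tests (\<Gamma> @ [A, B]) ((\<nu>B @ \<nu>A) @ \<nu>\<Gamma>)"
      using 1 2 sAB by (intro tests_joinI[OF t D2(3)]) simp_all
    then have "pole (net (nm \<nu> \<sigma>) \<nu> \<oplus> ((b \<oplus> a) \<oplus> D2))" using satisfiesD[OF s\<sigma> \<nu>(1,2) l'] 1(1) 2(1) by simp
    then show ?thesis by (simp add: join_ac)
  qed
  moreover have "elt_ok \<nu>P ?e"
    by (rule elt_ok_join[OF elt_ok_net ok2]) (use derivable_verts_nm[OF d\<sigma> l'] 1(1) in auto)
  ultimately have "?e \<in> sem (Par A B) True \<nu>P" using 2 by (simp add: orth2_def)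
  moreover have "compat \<nu>P ?e d" unfolding compat_def se using D2(4,5) by auto
  ultimately have "pole (?e \<oplus> d)" using sem_pole[of ?e "Par A B" True \<nu>P d] d by simp
  then show "pole (net (nm \<nu> \<sigma>) \<nu> \<oplus> D)" using D2(1) by (simp add: join_ac)
qed

text \<open>Joining is commutative, so a test for one order of the formulas is also one for the
  other, and the named net is the same.\<close>

lemma satisfies_exchange:
  assumes s\<sigma>: "satisfies \<sigma> (\<Gamma> @ [A, B] @ \<Delta>)" and d\<sigma>: "derivable G \<sigma> (\<Gamma> @ [A, B] @ \<Delta>)"
  shows "satisfies (mw_exchange (scard G \<Delta>) (fcard G B) (fcard G A) \<sigma>) (\<Gamma> @ [B, A] @ \<Delta>)" (is "satisfies ?\<sigma> _")
  unfolding satisfies_def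
proof (intro allI impI)
  fix \<nu> D assume \<nu>: "distinct \<nu>" "0 \<notin> set \<nu>" "length \<nu> = scard G (\<Gamma> @ [B, A] @ \<Delta>)"
    and D: "D \<in> tests (\<Gamma> @ [B, A] @ \<Delta>) \<nu>"
  have sAB: "scard G [A, B] = fcard G B + fcard G A" for A B using scard_Cons[of A "[B]"] scard_Cons[of B "[]"] by simp
  have "length \<nu> = scard G \<Delta> + (fcard G A + (fcard G B + scard G \<Gamma>))" using \<nu>(3) unfolding scard_append sAB by simp
  then obtain \<nu>\<Delta> \<nu>A \<nu>B \<nu>\<Gamma> where sp: "\<nu> = \<nu>\<Delta> @ \<nu>A @ \<nu>B @ \<nu>\<Gamma>"
    "length \<nu>\<Delta> = scard G \<Delta>" "length \<nu>A = fcard G A" "length \<nu>B = fcard G B" "length \<nu>\<Gamma> = scard G \<Gamma>"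
    by (rule split_length4)
  have "D \<in> tests (\<Gamma> @ ([B, A] @ \<Delta>)) ((\<nu>\<Delta> @ (\<nu>A @ \<nu>B)) @ \<nu>\<Gamma>)" using D sp(1) by simp
  then obtain D0 D2 where D0: "D = D0 \<oplus> D2" "D0 \<in> tests ([B, A] @ \<Delta>) (\<nu>\<Delta> @ (\<nu>A @ \<nu>B))" "D2 \<in> tests \<Gamma> \<nu>\<Gamma>"
    "su D0 \<inter> su D2 = {}" "vars D0 \<inter> vars D2 = {}"
    by (rule tests_joinE) (use sp sAB in \<open>simp_all only: scard_append length_append\<close>)
  from D0(2) obtain D1 d where D1: "D0 = D1 \<oplus> d" "D1 \<in> tests \<Delta> \<nu>\<Delta>" "d \<in> tests [B, A] (\<nu>A @ \<nu>B)"
    "su D1 \<inter> su d = {}" "vars D1 \<inter> vars d = {}"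
    by (rule tests_joinE) (use sp sAB in \<open>simp_all only: length_append\<close>)
  have two: "tests [A, B] (\<nu>B @ \<nu>A) = {D \<oplus> d |D d. D \<in> tests [B] \<nu>B \<and> d \<in> sem A False \<nu>A \<and> su D \<inter> su d = {} \<and> vars D \<inter> vars d = {}}"
    if "length \<nu>B = fcard G B" for A B \<nu>A \<nu>B
    using that scard_Cons[of B "[]"] by simp
  obtain a b where ab: "d = a \<oplus> b" "a \<in> sem A False \<nu>A" "b \<in> sem B False \<nu>B" "su a \<inter> su b = {}" "vars a \<inter> vars b = {}"
    using D1(3) unfolding two[OF sp(3)] tests_single by blast
  have "b \<oplus> a \<in> tests [A, B] (\<nu>B @ \<nu>A)" unfolding two[OF sp(4)] tests_single using ab by blast
  then have "d \<in> tests [A, B] (\<nu>B @ \<nu>A)" using ab(1) by (simp add: join_commute)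
  then have "D0 \<in> tests ([A, B] @ \<Delta>) (\<nu>\<Delta> @ (\<nu>B @ \<nu>A))"
    unfolding D1(1) by (intro tests_joinI D1) (use sp sAB in \<open>simp_all only: length_append\<close>)
  then have "D \<in> tests (\<Gamma> @ ([A, B] @ \<Delta>)) ((\<nu>\<Delta> @ (\<nu>B @ \<nu>A)) @ \<nu>\<Gamma>)"
    unfolding D0(1) by (intro tests_joinI D0) (use sp sAB in \<open>simp_all only: length_append scard_append\<close>)
  moreover have "length (\<nu>\<Delta> @ \<nu>B @ \<nu>A @ \<nu>\<Gamma>) = scard G (\<Gamma> @ [A, B] @ \<Delta>)"
    unfolding scard_append sAB using sp by simp
  moreover have "distinct (\<nu>\<Delta> @ \<nu>B @ \<nu>A @ \<nu>\<Gamma>)" "0 \<notin> set (\<nu>\<Delta> @ \<nu>B @ \<nu>A @ \<nu>\<Gamma>)"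
    using \<nu>(1,2) sp(1) by auto
  ultimately have "pole (net (nm (\<nu>\<Delta> @ \<nu>B @ \<nu>A @ \<nu>\<Gamma>) \<sigma>) (\<nu>\<Delta> @ \<nu>B @ \<nu>A @ \<nu>\<Gamma>) \<oplus> D)"
    using satisfiesD[OF s\<sigma>] by simp
  moreover have "nm \<nu> ?\<sigma> = nm (\<nu>\<Delta> @ \<nu>B @ \<nu>A @ \<nu>\<Gamma>) \<sigma>"
    unfolding sp(1) by (rule nm_mw_exchange[OF sp(2-4) derivable_verts[OF d\<sigma>]])
  moreover have "net E \<nu> = (net E (\<nu>\<Delta> @ \<nu>B @ \<nu>A @ \<nu>\<Gamma>) :: ('a, 'p) elt)" for E
    unfolding sp(1) net_def by (simp add: Un_ac)
  ultimately show "pole (net (nm \<nu> ?\<sigma>) \<nu> \<oplus> D)" by simp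
qed

text \<open>The identity net is the bundle of wires that carries the element tested on the dual side
  over to the interface of \<open>A\<close>, where it meets its opponent.\<close>

lemma satisfies_id: "satisfies (mw_id (fbound (lit_bound G) A)) [dual A, A]" (is "satisfies ?\<sigma> _")
  unfolding satisfies_def
proof (intro allI impI)
  fix \<nu> D assume \<nu>: "distinct \<nu>" "0 \<notin> set \<nu>" "length \<nu> = scard G [dual A, A]" and D: "D \<in> tests [dual A, A] \<nu>"
  have l: "length \<nu> = fcard G A + fcard G A"
    using \<nu>(3) scard_Cons[of "dual A" "[A]"] scard_Cons[of A "[]"] fcard_dual[of A] by simp
  obtain \<nu>A \<nu>' where sp: "\<nu> = \<nu>A @ \<nu>'" "length \<nu>A = fcard G A" "length \<nu>' = fcard G A" using split_length[OF l] .
  obtain d b where db: "D = d \<oplus> b" "d \<in> tests [A] \<nu>A" "b \<in> sem (dual A) False \<nu>'" "su d \<inter> su b = {}" "vars d \<inter> vars b = {}"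
    using D sp scard_Cons[of A "[]"] by auto
  have d: "d \<in> sem A False \<nu>A" using db(2) unfolding tests_single .
  have b: "b \<in> sem A True (rev \<nu>')" using db(3) sem_dual[of "rev \<nu>'" A False] sp(3) by simp
  have sub: "set \<nu>A \<subseteq> su d" "set \<nu>' \<subseteq> su b" using elt_okD(1)[OF sem_ok[OF d]] elt_okD(1)[OF sem_ok[OF b]] by auto
  have "b \<oplus> net (if True then wires (fs A) (rev \<nu>') \<nu>A else wires (fs A) \<nu>A (rev \<nu>')) \<nu>A \<in> sem A True \<nu>A"
    by (rule sem_wire[OF b]) (use sp \<nu> sub db(4) in auto)
  then have e: "b \<oplus> net (wires (fs A) (rev \<nu>') \<nu>A) \<nu>A \<in> sem A True \<nu>A" by simp
  have "compat \<nu>A (b \<oplus> net (wires (fs A) (rev \<nu>') \<nu>A) \<nu>A) d" using db(4,5) by (auto simp: compat_def)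
  then have "pole (b \<oplus> net (wires (fs A) (rev \<nu>') \<nu>A) \<nu>A \<oplus> d)" using sem_pole[OF e] d by simp
  moreover have "b \<oplus> net (wires (fs A) (rev \<nu>') \<nu>A) \<nu>A \<oplus> d = net (nm \<nu> ?\<sigma>) \<nu> \<oplus> D"
    using nm_mw_id[OF is_boundary_f sp(2,3)] db(1) sub sp(1) by (intro elt_eqI) auto
  ultimately show "pole (net (nm \<nu> ?\<sigma>) \<nu> \<oplus> D)" by simp
qed

text \<open>The assumption on the lexicon enters here: \<open>lx c\<close> realizes
  \<open>g c\<close>, so by adequacy it is an element of its type.\<close>

lemma satisfies_lex:
  assumes c: "c \<in> constants \<Sigma>"
  shows "satisfies (lx c) [tr (ctype \<Sigma> c)]"
  unfolding satisfies_def
proof (intro allI impI)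
  let ?A = "ctype \<Sigma> c"
  fix \<nu> D assume \<nu>: "distinct \<nu>" "0 \<notin> set \<nu>" "length \<nu> = scard G [tr ?A]" and D: "D \<in> tests [tr ?A] \<nu>"
  have l: "length \<nu> = wd (\<phi> ?A)" using \<nu>(3) scard_Cons[of "tr ?A" "[]"] fcard_tr[OF ctypes[OF c]] by simp
  have d: "D \<in> sem (tr ?A) False \<nu>" using D unfolding tests_single .
  have R: "realizes N n (\<phi> ?A) (nm \<nu> (lx c)) (set \<nu>) \<nu> (g c)" using lx_realizes[OF c \<nu>(1,2) l] .
  have "real (net (nm \<nu> (lx c)) \<nu>) ?A \<nu>"
    using realizes_open[OF R, of "\<lambda>_. []"] typed.const[OF c] by (intro realI[of _ "[]" "Const c"]) auto
  moreover have "elt_ok \<nu> (net (nm \<nu> (lx c)) \<nu> :: ('a, 'p) elt)"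
    using realizes_ok[OF R] by (intro elt_ok_net) (simp add: net_ok_def)
  ultimately have "net (nm \<nu> (lx c)) \<nu> \<in> sem (tr ?A) True \<nu>"
    unfolding type_sem[OF ctypes[OF c] l \<nu>(1)] by (simp add: reals_def)
  moreover have "compat \<nu> (net (nm \<nu> (lx c)) \<nu>) D" by (auto simp: compat_def)
  ultimately show "pole (net (nm \<nu> (lx c)) \<nu> \<oplus> D)" using sem_pole[of _ "tr ?A" True] d by simp
qed

lemma derivable_satisfies: "derivable G \<sigma> \<Gamma> \<Longrightarrow> satisfies \<sigma> \<Gamma>"
proof (induction rule: derivable.induct)
  case (Lex \<sigma> \<Gamma>)
  then show ?case using satisfies_lex unfolding lexicon by auto
next
  case (Id A)
  then show ?case using satisfies_id by blast
next
  case (Cut \<sigma> \<Gamma> A \<tau> \<Delta>)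
  from satisfies_cut[OF Cut.IH(1) Cut.hyps(1) Cut.IH(2) Cut.hyps(2)] show ?case .
next
  case (Ex \<sigma> \<Gamma> A B \<Delta>)
  from satisfies_exchange[OF Ex.IH Ex.hyps] show ?case .
next
  case (Par \<sigma> \<Gamma> A B)
  from satisfies_par[OF Par.IH Par.hyps] show ?case .
next
  case (Tensor \<sigma> \<Gamma> A \<tau> B \<Delta>)
  from satisfies_tensor[OF Tensor.IH(1) Tensor.hyps(1) Tensor.IH(2) Tensor.hyps(2)] show ?case .
qed

theorem derivable_typed:
  assumes der: "derivable G \<sigma> [tr A]" and A: "A \<in> types_over \<Sigma>"
    and \<nu>: "length \<nu> = wd (\<phi> A)" "distinct \<nu>" "0 \<notin> set \<nu>"
  obtains t where "typed \<Sigma> [] t A" "realizes N n (\<phi> A) (nm \<nu> \<sigma>) (set \<nu>) \<nu> (map_term g t)"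
proof -
  have "marker A \<nu> \<in> sem (tr A) False \<nu>"
    using sem_orth[of "tr A" False \<nu>] type_sem[OF A \<nu>(1,2)] by (simp add: orth_def elt_ok_marker reals_def real_def)
  moreover have "length \<nu> = scard G [tr A]" using \<nu>(1) scard_Cons[of "tr A" "[]"] fcard_tr[OF A] by simp
  ultimately have "pole (net (nm \<nu> \<sigma>) \<nu> \<oplus> marker A \<nu>)"
    using satisfiesD[OF derivable_satisfies[OF der] \<nu>(2,3)] unfolding tests_single by blast
  then have "real (net (nm \<nu> \<sigma>) \<nu>) A \<nu>" by (simp add: real_def)
  then obtain t \<Gamma> \<pi> where t: "typed \<Sigma> \<Gamma> t A" "hy (net (nm \<nu> \<sigma>) \<nu> :: ('a, 'p) elt) = (\<lambda>(x, A). (x, A, \<pi> x)) ` set \<Gamma>"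
    "open_realizes N n (ed (net (nm \<nu> \<sigma>) \<nu> :: ('a, 'p) elt)) (su (net (nm \<nu> \<sigma>) \<nu> :: ('a, 'p) elt) \<union> set \<nu>) (ctx \<Gamma>) \<pi> (map_term g t) (\<phi> A) \<nu>"
    by (rule poleE)
  \<comment> \<open>The net carries no hypotheses, so the term found in the pole is closed.\<close>
  have "\<Gamma> = []" using t(2) by simp
  with t have "typed \<Sigma> [] t A" "open_realizes N n (nm \<nu> \<sigma>) (set \<nu>) {} \<pi> (map_term g t) (\<phi> A) \<nu>" by simp_all
  then show thesis using that open_realizes_closed typed_map_closed by blast
qed

end

section \<open>Simple types and subject reduction\<close>

text \<open>Linearity is forgotten and variables are typed by a total environment, so subject
  reduction involves no splitting of contexts.\<close>

inductive st :: "('p, 'c) signature \<Rightarrow> (nat \<Rightarrow> 'p lty) \<Rightarrow> 'c lterm \<Rightarrow> 'p lty \<Rightarrow> bool" for \<Sigma> where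
  st_Var: "e x = A \<Longrightarrow> st \<Sigma> e (Var x) A"
| st_Const: "c \<in> constants \<Sigma> \<Longrightarrow> st \<Sigma> e (Const c) (ctype \<Sigma> c)"
| st_App: "st \<Sigma> e t (A \<multimap> B) \<Longrightarrow> st \<Sigma> e s A \<Longrightarrow> st \<Sigma> e (App t s) B"
| st_Abs: "st \<Sigma> (case_nat A e) t B \<Longrightarrow> st \<Sigma> e (Abs t) (A \<multimap> B)"

inductive_cases st_VarE: "st \<Sigma> e (Var x) A"
inductive_cases st_ConstE: "st \<Sigma> e (Const c) A"
inductive_cases st_AppE: "st \<Sigma> e (App t s) B"
inductive_cases st_AbsE: "st \<Sigma> e (Abs t) C"

text \<open>Both directions are used: weakening for substitution under binders, strengthening for
  eta.\<close>

lemma st_lift_iff: "st \<Sigma> e (lift t k) A \<longleftrightarrow> st \<Sigma> (\<lambda>i. e (if i < k then i else Suc i)) t A"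
proof (induction t arbitrary: e k A)
  case (Abs t)
  have "(\<lambda>i. case_nat C e (if i < Suc k then i else Suc i)) = case_nat C (\<lambda>i. e (if i < k then i else Suc i))" for C
    by (auto simp: fun_eq_iff split: nat.split)
  then show ?case using Abs by (auto elim!: st_AbsE intro!: st_Abs)
next
  case (Var x)
  then show ?case by (auto elim!: st_VarE intro!: st_Var)
next
  case (Const c)
  then show ?case by (auto elim!: st_ConstE intro!: st_Const)
next
  case (App t s)
  then show ?case by (auto elim!: st_AppE intro: st_App)
qed

lemma st_subst:
  "st \<Sigma> e' t A \<Longrightarrow> st \<Sigma> e s (e' k) \<Longrightarrow> (\<And>i. i < k \<Longrightarrow> e' i = e i) \<Longrightarrow> (\<And>i. i \<ge> k \<Longrightarrow> e' (Suc i) = e i) \<Longrightarrow>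
   st \<Sigma> e (subst t s k) A"
proof (induction arbitrary: e s k rule: st.induct)
  case (st_Var e' x A)
  show ?case
  proof (cases "k < x")
    case True
    then have "e (x - 1) = A" using st_Var.prems(3)[of "x - 1"] st_Var.hyps by simp
    with True show ?thesis by (simp add: st.st_Var)
  next
    case False
    then show ?thesis using st_Var by (cases "x = k") (auto intro: st.st_Var)
  qed
next
  case (st_Abs A e' t B)
  have "st \<Sigma> (case_nat A e) (subst t (lift s 0) (Suc k)) B"
  proof (rule st_Abs.IH)
    show "st \<Sigma> (case_nat A e) (lift s 0) (case_nat A e' (Suc k))"
      using st_Abs.prems(1) by (simp add: st_lift_iff)
    show "case_nat A e' i = case_nat A e i" if "i < Suc k" for i using that st_Abs.prems(2) by (cases i) auto
    show "case_nat A e' (Suc i) = case_nat A e i" if "Suc k \<le> i" for i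
      using that st_Abs.prems(3)[of "i - 1"] by (cases i) auto
  qed
  then show ?case by (simp add: st.st_Abs)
next
  case (st_App e' t A B s')
  have "st \<Sigma> e (subst t s k) (A \<multimap> B)" "st \<Sigma> e (subst s' s k) A"
    using st_App.IH st_App.prems by blast+
  then show ?case by (simp add: st.st_App)
qed (auto intro: st.intros)

lemma st_red: "red t t' \<Longrightarrow> st \<Sigma> e t A \<Longrightarrow> st \<Sigma> e t' A"
proof (induction arbitrary: e A rule: red.induct)
  case (beta t s)
  then obtain B where "st \<Sigma> e (Abs t) (B \<multimap> A)" "st \<Sigma> e s B" by (auto elim: st_AppE)
  then have "st \<Sigma> (case_nat B e) t A" by (auto elim: st_AbsE)
  then show ?case by (rule st_subst) (use \<open>st \<Sigma> e s B\<close> in auto)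
next
  case (eta t)
  then obtain B C where A: "A = B \<multimap> C" "st \<Sigma> (case_nat B e) (App (lift t 0) (Var 0)) C" by (auto elim: st_AbsE)
  then have "st \<Sigma> (case_nat B e) (lift t 0) (B \<multimap> C)" by (auto elim!: st_AppE st_VarE)
  then show ?case using A(1) by (simp add: st_lift_iff)
qed (auto elim!: st_AppE st_AbsE intro: st.intros)

lemma st_map_term:
  assumes "typed \<Sigma> \<Gamma> t A" and e: "\<And>x B. (x, B) \<in> set \<Gamma> \<Longrightarrow> e x = map_type f B"
    and g: "\<And>c e. c \<in> constants \<Sigma> \<Longrightarrow> st \<Sigma>' e (g c) (map_type f (ctype \<Sigma> c))"
  shows "st \<Sigma>' e (map_term g t) (map_type f A)"
  using assms(1) e
proof (induction arbitrary: e rule: typed.induct)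
  case (var A x)
  then show ?case by (simp add: st_Var)
next
  case (const c)
  then show ?case using g by simp
next
  case (app \<Gamma> t A B \<Delta> s)
  have "st \<Sigma>' e (map_term g t) (map_type f (A \<multimap> B))" "st \<Sigma>' e (map_term g s) (map_type f A)"
    using app.IH app.prems by auto
  then show ?case by (auto intro: st_App)
next
  case (abs \<Gamma> A \<Delta> t B)
  have "st \<Sigma>' (case_nat (map_type f A) e) (map_term g t) (map_type f B)"
    by (rule abs.IH) (use abs.prems in auto)
  then show ?case by (simp add: st_Abs)
qed

lemma map_type_Atom: "map_type Atom A = A"
  by (induction A) auto

lemma map_term_Const: "map_term Const t = t"
  by (induction t) auto

text \<open>The translation lemma applied to the identity translation of a signature into
  itself.\<close>

lemma st_typed_closed:
  assumes "typed \<Sigma> [] t A"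
  shows "st \<Sigma> e t A"
proof -
  have "st \<Sigma> e (map_term Const t) (map_type Atom A)"
    by (rule st_map_term[OF assms]) (simp_all only: list.set empty_iff map_type_Atom st_Const)
  then show ?thesis by (simp only: map_type_Atom map_term_Const)
qed

lemma st_foldl:
  "st \<Sigma> e (foldl App h ts) B \<Longrightarrow> \<exists>As. length As = length ts \<and> st \<Sigma> e h (foldr (\<multimap>) As B)"
proof (induction ts arbitrary: h)
  case (Cons t ts)
  then obtain As where As: "length As = length ts" "st \<Sigma> e (App h t) (foldr (\<multimap>) As B)" by fastforce
  then obtain A where "st \<Sigma> e h (A \<multimap> foldr (\<multimap>) As B)" by (auto elim: st_AppE)
  with As show ?case by (intro exI[of _ "A # As"]) simp
qed (intro exI[of _ "[]"], simp)

lemma foldr_Limp_eq: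
  "foldr (\<multimap>) As B = ((\<multimap>) (Atom p) ^^ length As) (Atom p) \<Longrightarrow> B = Atom p"
  by (induction As) auto

text \<open>The head constant receives as many arguments as its arity, so only the type of trees can
  remain.\<close>

lemma st_tree_term:
  assumes "st (tree_sig N n) e (tree_term \<alpha>) B"
  shows "B = Atom TreeAtom"
proof -
  obtain a ts where \<alpha>: "\<alpha> = Node a ts" by (cases \<alpha>)
  have "st (tree_sig N n) e (foldl App (Const (a, length ts)) (map tree_term ts)) B" using assms \<alpha> by simp
  from st_foldl[OF this] obtain As where As: "length As = length ts"
    "st (tree_sig N n) e (Const (a, length ts)) (foldr (\<multimap>) As B)" by auto
  from As(2) have "foldr (\<multimap>) As B = ((\<multimap>) (Atom TreeAtom) ^^ length ts) (Atom TreeAtom)"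
    by (auto elim!: st_ConstE simp: tree_sig_def)
  then show ?thesis using foldr_Limp_eq[of As B TreeAtom] As(1) by simp
qed

section \<open>Trees as terms\<close>

lemma closed_linear_foldl:
  "closed_linear h \<Longrightarrow> (\<And>t. t \<in> set ts \<Longrightarrow> closed_linear t) \<Longrightarrow> closed_linear (foldl App h ts)"
  by (induction ts arbitrary: h) (auto intro: closed_linear_App)

lemma closed_linear_Const: "closed_linear (Const c)"
  by (simp add: closed_linear_def)

lemma closed_linear_tree_term: "closed_linear (tree_term \<alpha>)"
  by (induction \<alpha>) (auto intro!: closed_linear_foldl closed_linear_Const)

lemma foldl_App_normal:
  "(\<And>t. t \<in> set ts \<Longrightarrow> \<not> (\<exists>x. red t x)) \<Longrightarrow> \<not> red (foldl App (Const c) ts) x"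
proof (induction ts arbitrary: x rule: rev_induct)
  case Nil
  then show ?case by (auto elim: red_ConstE)
next
  case (snoc t ts)
  have "foldl App (Const c) ts \<noteq> Abs b" for b by (cases ts rule: rev_cases) auto
  then show ?case using snoc by (auto simp: red_App_iff)
qed

lemma tree_term_normal: "\<not> red (tree_term \<alpha>) x"
proof (induction \<alpha> arbitrary: x)
  case (Node a ts)
  then show ?case using foldl_App_normal[of "map tree_term ts" "(a, length ts)" x] by auto
qed

lemma foldl_App_inject:
  "foldl App (Const c) ts = foldl App (Const d) us \<Longrightarrow> c = d \<and> ts = us"
proof (induction ts arbitrary: us rule: rev_induct)
  case Nil
  then show ?case by (cases us rule: rev_cases) auto
next
  case (snoc t ts)
  then show ?case by (cases us rule: rev_cases) auto
qed

lemma tree_term_inject: "tree_term \<alpha> = tree_term \<beta> \<Longrightarrow> \<alpha> = \<beta>"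
proof (induction \<alpha> arbitrary: \<beta>)
  case (Node a ts)
  obtain b us where \<beta>: "\<beta> = Node b us" by (cases \<beta>)
  have *: "a = b" "map tree_term ts = map tree_term us"
    using foldl_App_inject[of "(a, length ts)" "map tree_term ts" "(b, length us)" "map tree_term us"] Node.prems \<beta>
    by auto
  then have "ts = us" using Node.IH
    by (intro nth_equalityI) (metis length_map, metis length_map nth_map nth_mem)
  then show ?case using * \<beta> by simp
qed

text \<open>Tree terms are normal, so one reduces to the other in zero steps; thus a multiword
  related to a term spells a single tree.\<close>

lemma tree_term_equiv:
  assumes "beta_eta_equiv (tree_term \<alpha>) (tree_term \<beta>)"
  shows "\<alpha> = \<beta>"
proof -
  have "red\<^sup>*\<^sup>* (tree_term \<beta>) (tree_term \<alpha>)" using equiv_normal_form[OF assms] tree_term_normal by blast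
  then have "tree_term \<beta> = tree_term \<alpha>" using tree_term_normal by (metis converse_rtranclpE)
  then show ?thesis using tree_term_inject by metis
qed

section \<open>Multiwords of the tree constructors\<close>

text \<open>The list \<open>cs\<close> holds the entry and exit vertices of the children that are still to be visited.\<close>

fun visit :: "'a \<Rightarrow> nat \<Rightarrow> nat \<Rightarrow> nat \<Rightarrow> nat \<Rightarrow> (nat \<times> nat) list \<Rightarrow> 'a tsym edge set" where
  "visit l k j a b [] = {(a, [Sym l j k], b)}"
| "visit l k j a b ((a', b') # cs) = insert (a, [Sym l j k], a') (visit l k (Suc j) b' b cs)"

text \<open>The vertex order forced by nested implications: the first child comes last, and inside
  its dual block the exit, a source, precedes the entry, a target.\<close>

definition flat :: "(nat \<times> nat) list \<Rightarrow> nat list" where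
  "flat cs = concat (rev (map (\<lambda>(a, b). [b, a]) cs))"

lemma flat_Cons: "flat ((a, b) # cs) = flat cs @ rev [a, b]"
  by (simp add: flat_def)

lemma flat_Nil: "flat [] = []"
  by (simp add: flat_def)

lemma set_flat: "set (flat cs) = fst ` set cs \<union> snd ` set cs"
  by (induction cs) (auto simp: flat_def)

lemma matched_visit:
  "distinct (a # b # flat cs) \<Longrightarrow>
   matched (insert a (snd ` set cs)) (insert b (fst ` set cs)) (visit l k j a b cs)"
proof (induction l k j a b cs rule: visit.induct)
  case (1 l k j a b)
  then show ?case by (simp add: matched_def bij_betw_def)
next
  case (2 l k j a b a' b' cs)
  have d: "distinct (b' # b # flat cs)" "a' \<noteq> b'" "a' \<noteq> b" "a' \<notin> set (flat cs)" "a \<noteq> b'" "a \<notin> set (flat cs)"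
    using "2.prems" by (auto simp: flat_Cons)
  have "matched {a} {a'} {(a, [Sym l j k], a')}" by (simp add: matched_def bij_betw_def)
  from matched_Un[OF this "2.IH"[OF d(1)]]
  have "matched ({a} \<union> insert b' (snd ` set cs)) ({a'} \<union> insert b (fst ` set cs))
      ({(a, [Sym l j k], a')} \<union> visit l k (Suc j) b' b cs)"
    using d unfolding set_flat by auto
  then show ?case by (simp add: insert_commute)
qed

lemma verts_visit: "distinct (a # b # flat cs) \<Longrightarrow> verts (visit l k j a b cs) = {a, b} \<union> set (flat cs)"
  by (drule matched_visit[of _ _ _ l k j], drule matched_verts) (simp add: set_flat ac_simps insert_commute)

lemma ren_visit:
  "ren h (visit l k j a b cs) = visit l k j (h a) (h b) (map (map_prod h h) cs)"
  by (induction l k j a b cs rule: visit.induct) (auto simp: ren_def)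

abbreviation (input) tree_type :: "nat \<Rightarrow> tree_atom lty" where
  "tree_type k \<equiv> ((\<multimap>) (Atom TreeAtom) ^^ k) (Atom TreeAtom)"

text \<open>The word read when the walk around a node of arity \<open>k\<close> has traversed the
  children \<open>ts\<close> and stands at the exit of the last one.\<close>

definition prefix_word :: "'a \<Rightarrow> nat \<Rightarrow> 'a ptree list \<Rightarrow> 'a tsym list" where
  "prefix_word l k ts = concat (map (\<lambda>(i, t). Sym l i k # encode t) (zip [0..<length ts] ts))"

lemma prefix_word_snoc: "prefix_word l k (ts @ [t]) = prefix_word l k ts @ Sym l (length ts) k # encode t"
  by (simp add: prefix_word_def)

text \<open>\<open>encode\<close> groups each child with the letter after it, the walk groups it
  with the letter before it; the lemma shifts between the two.\<close>

lemma encode_prefix: "encode (Node l ts) = prefix_word l (length ts) ts @ [Sym l (length ts) (length ts)]"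
proof -
  have "Sym l 0 k # concat (map (\<lambda>(w, i). w @ [Sym l i k]) (zip (map encode ts) [1..<Suc (length ts)])) =
      prefix_word l k ts @ [Sym l (length ts) k]" for k
  proof (induction ts rule: rev_induct)
    case Nil
    then show ?case by (simp add: prefix_word_def)
  next
    case (snoc t ts)
    have "zip (map encode (ts @ [t])) [1..<Suc (length (ts @ [t]))] =
        zip (map encode ts) [1..<Suc (length ts)] @ [(encode t, Suc (length ts))]"
    proof -
      have "[1..<Suc (length (ts @ [t]))] = [1..<Suc (length ts)] @ [Suc (length ts)]" by simp
      then show ?thesis by (simp only: map_append zip_append length_map length_upt diff_Suc_1 zip.simps list.map) simp
    qed
    with snoc show ?case by (simp add: prefix_word_snoc)
  qed
  then show ?thesis by simp
qed

lemma wd_tree_type: "wd (tree_type k) = 2 * k + 2"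
  by (induction k) auto

text \<open>\<open>P\<close> is the part already walked, from \<open>a\<close> through the children
  \<open>ts\<close> to \<open>c\<close>, and \<open>cs\<close> are the argument ports still open.
  Supplying the next argument extends \<open>P\<close> by an edge into the child and by the path of
  the child, and moves \<open>c\<close> to the exit of that child.\<close>

lemma realizes_visit:
  assumes l: "l \<in> N" "k \<le> n"
  shows "length ts + length cs = k \<Longrightarrow> set ts \<subseteq> Tr N n \<Longrightarrow> path_net P a (prefix_word l k ts) c \<Longrightarrow>
    finite S \<Longrightarrow> verts P \<subseteq> S \<Longrightarrow> {a, b, c} \<union> set (flat cs) \<subseteq> S \<Longrightarrow> distinct (b # flat cs) \<Longrightarrow> 0 \<notin> set (b # flat cs) \<Longrightarrow>
    c \<noteq> 0 \<Longrightarrow> insert a (insert c (verts P)) \<inter> set (b # flat cs) = {} \<Longrightarrow> closed_linear u \<Longrightarrow>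
    beta_eta_equiv u (foldl App (Const (l, k)) (map tree_term ts)) \<Longrightarrow>
    realizes N n (tree_type (length cs)) (P \<union> visit l k (length ts) c b cs) S ([a, b] @ flat cs) u"
proof (induction cs arbitrary: ts P c S u)
  case Nil
  \<comment> \<open>All children are visited; the last edge carries the letter with equal indices
    and leads to the exit of the node.\<close>
  have p: "path_net (P \<union> {(c, [Sym l k k], b)}) a (prefix_word l k ts @ [Sym l k k]) b"
    using Nil.prems by (intro path_net_append[OF Nil.prems(3) path_net_single]) (auto simp: verts_def)
  moreover have "encode (Node l ts) = prefix_word l k ts @ [Sym l k k]"
    using encode_prefix[of l ts] Nil.prems(1) by (simp del: encode.simps)
  moreover have "Node l ts \<in> Tr N n" using l Nil.prems(1,2) by (intro Tr.intros) auto
  moreover have "beta_eta_equiv u (tree_term (Node l ts))" using Nil.prems(1,12) by simp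
  moreover have "net_ok (P \<union> {(c, [Sym l k k], b)}) S [a, b]"
    using Nil.prems by (auto simp: net_ok_def verts_insert)
  ultimately show ?case using Nil.prems(1,11) by (auto simp: flat_Nil)
next
  case (Cons ab cs)
  obtain a' b' where ab: "ab = (a', b')" by force
  let ?j = "length ts" and ?E = "P \<union> visit l k (length ts) c b (ab # cs)"
  have fl: "set (flat (ab # cs)) = {a', b'} \<union> set (flat cs)" by (auto simp: ab flat_Cons)
  have d: "distinct (b # flat cs)" "a' \<noteq> b'" "a' \<noteq> b" "b' \<noteq> b" "a' \<notin> set (flat cs)" "b' \<notin> set (flat cs)"
    using Cons.prems(7) by (auto simp: ab flat_Cons)
  have nz: "a' \<noteq> 0" "b' \<noteq> 0" "0 \<notin> set (b # flat cs)" using Cons.prems(8) fl by auto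
  have S: "{a, b, c, a', b'} \<union> set (flat cs) \<subseteq> S" using Cons.prems(6) fl by auto
  have dj: "insert a (insert c (verts P)) \<inter> ({b, a', b'} \<union> set (flat cs)) = {}" using Cons.prems(10) fl by auto
  have E: "?E = (P \<union> {(c, [Sym l ?j k], a')}) \<union> visit l k (Suc ?j) b' b cs" by (simp add: ab)
  have "verts (visit l k (Suc ?j) b' b cs) = {b', b} \<union> set (flat cs)"
    using d by (intro verts_visit) auto
  then have ok: "net_ok ?E S ([a, b] @ flat (ab # cs))"
    using Cons.prems(4,5) S fl unfolding E net_ok_def by (auto simp: verts_insert)
  have lenB: "length ([a, b] @ flat cs) = wd (tree_type (length cs))"
    unfolding wd_tree_type by (induction cs) (auto simp: flat_def)
  have "realizes N n (tree_type (length cs)) (?E \<union> F) (S \<union> Q) ([a, b] @ flat cs) (App u v)"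
    if F: "realizes N n (Atom TreeAtom) F Q [a', b'] v" "Q \<inter> S \<subseteq> set [a', b']" for F Q v
  proof -
    obtain \<alpha> where \<alpha>: "\<alpha> \<in> Tr N n" "path_net F a' (encode \<alpha>) b'" "beta_eta_equiv v (tree_term \<alpha>)"
      and okF: "net_ok F Q [a', b']" "closed_linear v" using F(1) by auto
    have vF: "verts F \<subseteq> Q" "finite Q" using okF(1) \<alpha>(2) by (auto simp: net_ok_def path_net_def)
    have tF: "(\<lambda>e. tgt e) ` F \<subseteq> verts F" "(\<lambda>e. tgt e) ` P \<subseteq> verts P" by (auto simp: verts_def)
    have tF': "a' \<notin> (\<lambda>e. tgt e) ` F" using path_net_start[OF \<alpha>(2)] .
    have FS: "x \<in> {a', b'}" if "x \<in> verts F" "x \<in> S" for x using that vF F(2) by auto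
    have "path_net (P \<union> {(c, [Sym l ?j k], a')}) a (prefix_word l k ts @ [Sym l ?j k]) a'"
      using dj nz Cons.prems(9) tF(2) by (intro path_net_append[OF Cons.prems(3) path_net_single]) auto
    then have "path_net (P \<union> {(c, [Sym l ?j k], a')} \<union> F) a ((prefix_word l k ts @ [Sym l ?j k]) @ encode \<alpha>) b'"
    proof (rule path_net_append[OF _ \<alpha>(2)])
      show "insert a ((\<lambda>e. tgt e) ` (P \<union> {(c, [Sym l ?j k], a')})) \<inter> (\<lambda>e. tgt e) ` F = {}"
      proof (rule equals0I)
        fix x assume x: "x \<in> insert a ((\<lambda>e. tgt e) ` (P \<union> {(c, [Sym l ?j k], a')})) \<inter> (\<lambda>e. tgt e) ` F"
        then have xS: "x = a \<or> x \<in> verts P \<or> x = a'" using tF by auto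
        then have "x \<in> S" using S Cons.prems(5) by auto
        then have "x \<in> {a', b'}" using FS x tF by auto
        moreover have "x \<noteq> a'" using x tF' by auto
        ultimately have "x = b'" by simp
        then show False using xS dj d(2) by auto
      qed
    qed
    then have p: "path_net (P \<union> {(c, [Sym l ?j k], a')} \<union> F) a (prefix_word l k (ts @ [\<alpha>])) b'"
      by (simp add: prefix_word_snoc)
    let ?P = "P \<union> {(c, [Sym l ?j k], a')} \<union> F"
    have vP: "verts ?P = verts P \<union> {c, a'} \<union> verts F" by (auto simp: verts_insert)
    have "realizes N n (tree_type (length cs)) (?P \<union> visit l k (length (ts @ [\<alpha>])) b' b cs) (S \<union> Q) ([a, b] @ flat cs) (App u v)"
    proof (rule Cons.IH[OF _ _ p])
      show "length (ts @ [\<alpha>]) + length cs = k" using Cons.prems(1) by simp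
      show "set (ts @ [\<alpha>]) \<subseteq> Tr N n" using Cons.prems(2) \<alpha>(1) by simp
      show "finite (S \<union> Q)" using Cons.prems(4) vF by simp
      show "verts ?P \<subseteq> S \<union> Q" unfolding vP using Cons.prems(5) S vF by auto
      show "{a, b, b'} \<union> set (flat cs) \<subseteq> S \<union> Q" using S by auto
      show "distinct (b # flat cs)" "0 \<notin> set (b # flat cs)" "b' \<noteq> 0" using d nz by auto
      show "insert a (insert b' (verts ?P)) \<inter> set (b # flat cs) = {}"
      proof (rule equals0I)
        fix x assume x: "x \<in> insert a (insert b' (verts ?P)) \<inter> set (b # flat cs)"
        then have xS: "x \<in> S" using S by auto
        have "x \<notin> verts F" using FS[OF _ xS] x d by auto
        then show False using x dj d unfolding vP by auto
      qed
      show "closed_linear (App u v)" using closed_linear_App Cons.prems(11) okF(2) by blast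
      show "beta_eta_equiv (App u v) (foldl App (Const (l, k)) (map tree_term (ts @ [\<alpha>])))"
      proof -
        let ?w = "foldl App (Const (l, k)) (map tree_term ts)"
        have "closed_linear ?w"
          by (intro closed_linear_foldl closed_linear_Const) (auto simp: closed_linear_tree_term)
        then have "beta_eta_equiv (App u v) (App ?w v)" "beta_eta_equiv (App ?w v) (App ?w (tree_term \<alpha>))"
          using beta_eta_equiv_App_left[OF Cons.prems(12,11) okF(2)] beta_eta_equiv_App_right[OF \<alpha>(3) _ okF(2)] by blast+
        then show ?thesis using beta_eta_equiv_trans by simp
      qed
    qed
    moreover have "?P \<union> visit l k (length (ts @ [\<alpha>])) b' b cs = ?E \<union> F" unfolding E by auto
    ultimately show ?thesis by simp
  qed
  then have "realizes N n (Atom TreeAtom \<multimap> tree_type (length cs)) ?E S (([a, b] @ flat cs) @ rev [a', b']) u"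
    using ok Cons.prems(11) unfolding realizes_Limp[OF lenB] by (simp add: ab flat_Cons)
  then show ?case by (simp add: ab flat_Cons)
qed

text \<open>Vertices 1 and 2 are entry and exit of the node. The first child has the largest
  numbers, and of its two vertices the exit has the smaller one, so that \<open>flat\<close> yields
  increasing numbers.\<close>

primrec cpos :: "nat \<Rightarrow> (nat \<times> nat) list" where
  "cpos 0 = []"
| "cpos (Suc k) = (2 * k + 4, 2 * k + 3) # cpos k"

lemma flat_cpos: "[1, 2] @ flat (cpos k) = [1..<2 * k + 3]"
proof (induction k)
  case 0
  then show ?case by (simp add: flat_Nil upt_rec)
next
  case (Suc k)
  have "[1, 2] @ flat (cpos (Suc k)) = ([1, 2] @ flat (cpos k)) @ [2 * k + 3, 2 * k + 4]"
    by (simp add: flat_Cons)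
  also have "\<dots> = [1..<2 * k + 3] @ [2 * k + 3, 2 * k + 4]" unfolding Suc ..
  also have "\<dots> = [1..<2 * Suc k + 3]" by (simp add: numeral_eq_Suc)
  finally show ?case .
qed

lemma length_cpos: "length (cpos k) = k"
  by (induction k) auto

definition tree_mw :: "'a \<times> nat \<Rightarrow> 'a tsym multiword" where
  "tree_mw c = Multiword (visit (fst c) (snd c) 0 1 2 (cpos (snd c))) {#}"

lemma flat_map: "flat (map (map_prod h h) cs) = map h (flat cs)"
  by (induction cs) (auto simp: flat_def)

lemma nm_tree_mw:
  assumes "length \<nu> = 2 * k + 2"
  obtains a b cs where "\<nu> = [a, b] @ flat cs" "length cs = k" "nm \<nu> (tree_mw (l, k)) = visit l k 0 a b cs"
proof -
  let ?cs = "map (map_prod (at \<nu>) (at \<nu>)) (cpos k)"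
  have "[at \<nu> 1, at \<nu> 2] @ flat ?cs = map (at \<nu>) ([1, 2] @ flat (cpos k))" by (simp add: flat_map)
  also have "\<dots> = map (at \<nu>) [1..<Suc (length \<nu>)]" unfolding flat_cpos assms by (simp add: numeral_eq_Suc)
  also have "\<dots> = \<nu>" by (rule nth_equalityI) (auto simp: at_def simp del: upt_Suc)
  finally have 1: "\<nu> = [at \<nu> 1, at \<nu> 2] @ flat ?cs" by simp
  have "nm \<nu> (tree_mw (l, k)) = visit l k 0 (at \<nu> 1) (at \<nu> 2) ?cs"
    by (simp add: nm_def tree_mw_def ren_visit)
  from that[OF 1 _ this] show thesis by (simp add: length_cpos)
qed

lemma tree_mw_realizes:
  fixes l :: 'a
  assumes l: "l \<in> N" "k \<le> n" and \<nu>: "distinct \<nu>" "0 \<notin> set \<nu>" "length \<nu> = wd (tree_type k)"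
  shows "realizes N n (tree_type k) (nm \<nu> (tree_mw (l, k))) (set \<nu>) \<nu> (Const (l, k))"
proof -
  obtain a b cs where cs: "\<nu> = [a, b] @ flat cs" "length cs = k" "nm \<nu> (tree_mw (l, k)) = visit l k 0 a b cs"
    by (rule nm_tree_mw[of \<nu> k l]) (use \<nu>(3) wd_tree_type[of k] in simp_all)
  have "realizes N n (tree_type (length cs)) ({} \<union> visit l k (length ([] :: 'a ptree list)) a b cs) (set \<nu>) ([a, b] @ flat cs) (Const (l, k))"
  proof (rule realizes_visit[OF l])
    \<comment> \<open>The walk begins with the empty path at the entry, hence
      \<open>c = a\<close>.\<close>
    show "path_net {} a (prefix_word l k []) a" by (simp add: path_net_def prefix_word_def)
    show "beta_eta_equiv (Const (l, k)) (foldl App (Const (l, k)) (map tree_term []))"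
      by (simp add: beta_eta_equiv_refl)
  qed (use cs \<nu> in \<open>auto simp: closed_linear_Const\<close>)
  then show ?thesis using cs by simp
qed

lemma sel_tree_type:
  "length \<nu> = 2 * k + 2 \<Longrightarrow> \<nu> = [a, b] @ flat cs \<Longrightarrow> length cs = k \<Longrightarrow>
   sel True (tsg (tree_type k)) \<nu> = insert a (snd ` set cs) \<and> sel False (tsg (tree_type k)) \<nu> = insert b (fst ` set cs)"
proof (induction k arbitrary: \<nu> cs)
  case 0
  then show ?case by (auto simp: sel_def flat_Nil)
next
  case (Suc k)
  obtain a' b' cs' where cs: "cs = (a', b') # cs'" "length cs' = k" using Suc.prems(3) by (cases cs) auto
  let ?\<nu> = "[a, b] @ flat cs'"
  have \<nu>: "\<nu> = ?\<nu> @ [b', a']" using Suc.prems(2) cs by (simp add: flat_Cons)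
  have l: "length ?\<nu> = 2 * k + 2" using Suc.prems(1) \<nu> by simp
  have "sel c (tsg (tree_type (Suc k))) \<nu> = sel c (tsg (tree_type k)) ?\<nu> \<union> sel c [True, False] [b', a']" for c
  proof -
    have "tsg (tree_type (Suc k)) = tsg (tree_type k) @ [True, False]" by simp
    then show ?thesis unfolding \<nu> using wd_tree_type[of k] l by (simp only: sel_append)
  qed
  with Suc.IH[OF l refl cs(2)] show ?case using cs by (auto simp: sel_def)
qed

lemma tree_mw_typed:
  assumes l: "l \<in> N" "k \<le> n"
  shows "well_typed (tree_alphabet N n) (tsg (tree_type k)) (tree_mw (l, k))"
proof (rule well_typedI[OF wd_tree_type])
  show "matched (sel True (tsg (tree_type k)) \<nu>) (sel False (tsg (tree_type k)) \<nu>)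
      (ren (at \<nu>) (edges (tree_mw (l, k))))" if \<nu>: "distinct \<nu>" "length \<nu> = 2 * k + 2" for \<nu>
  proof -
    obtain a b cs where cs: "\<nu> = [a, b] @ flat cs" "length cs = k" "nm \<nu> (tree_mw (l, k)) = visit l k 0 a b cs"
      by (rule nm_tree_mw[OF \<nu>(2), of l])
    have "ren (at \<nu>) (edges (tree_mw (l, k))) = visit l k 0 a b cs" using cs(3) by (simp add: nm_def tree_mw_def)
    then show ?thesis using sel_tree_type[OF \<nu>(2) cs(1,2)] matched_visit[of a b cs l k 0] \<nu>(1) cs(1) by simp
  qed
  have "set ([1, 2] @ flat (cpos k)) = {1..2 * k + 2}" "distinct ([1, 2] @ flat (cpos k))"
    unfolding flat_cpos by auto
  then show "verts (edges (tree_mw (l, k))) \<subseteq> {1..2 * k + 2}"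
    using verts_visit[of 1 2 "cpos k" l k 0] by (auto simp: tree_mw_def)
  have "label e \<in> lists (tree_alphabet N n)"
    if "e \<in> visit l k j a b cs" "j + length cs = k" for e j a b cs
    using that l
  proof (induction l k j a b cs rule: visit.induct)
    case (2 l k j a b a' b' cs)
    then show ?case by (auto simp: tree_alphabet_def)
  qed (auto simp: tree_alphabet_def)
  then show "label e \<in> lists (tree_alphabet N n)" if "e \<in> edges (tree_mw (l, k))" for e
    using that length_cpos[of k] by (simp add: tree_mw_def)
  show "\<exists>w\<in>lists (tree_alphabet N n). c = cyclic w" if "c \<in># cycles (tree_mw (l, k))" for c
    using that by (simp add: tree_mw_def)
qed

section \<open>The grammar of a tree abstract categorial grammar\<close>

lemma path_net_singleton: "path_net {e} a w b \<Longrightarrow> label e = w"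
proof -
  assume "path_net {e} a w b"
  then obtain es where es: "set es = {e}" "distinct (map (\<lambda>e. tgt e) es)" "concat (map (\<lambda>e. label e) es) = w"
    by (auto simp: path_net_def)
  have "distinct es" using es(2) by (simp add: distinct_map)
  then have "length es = 1" using es(1) distinct_card[of es] by simp
  then show ?thesis using es by (cases es) auto
qed

lemma matched_singleton:
  assumes "matched {a} {b} E"
  obtains w where "E = {(a, w, b)}"
proof -
  have E: "fst ` E = {a}" "inj_on fst E" "(\<lambda>e. tgt e) ` E = {b}" using assms by (auto simp: matched_def bij_betw_def)
  then obtain e where e: "e \<in> E" by blast
  have "e' = e" if "e' \<in> E" for e'
  proof -
    have "fst e' \<in> fst ` E" "fst e \<in> fst ` E" using e that by blast+
    then have "fst e' = fst e" unfolding E(1) by simp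
    then show ?thesis using inj_onD[OF E(2)] e that by blast
  qed
  then have "E = {e}" using e by blast
  then have "E = {(a, label e, b)}" using E by (cases e) simp
  then show thesis by (rule that)
qed

text \<open>A path made of a single edge is labelled by the whole encoding, and a path excludes the
  loop at 0, so there are no cyclic words.\<close>

lemma realizes_single_edge:
  assumes "well_typed T [True, False] \<sigma>" "realizes N n (Atom p) (nm [1, 2] \<sigma>) S [1, 2] u"
  obtains \<alpha> where "\<alpha> \<in> Tr N n" "regular \<sigma>" "edges \<sigma> = {(1, encode \<alpha>, 2)}" "beta_eta_equiv u (tree_term \<alpha>)"
proof -
  obtain \<alpha> where \<alpha>: "\<alpha> \<in> Tr N n" "path_net (nm [1, 2] \<sigma>) 1 (encode \<alpha>) 2" "beta_eta_equiv u (tree_term \<alpha>)"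
    using assms(2) by auto
  have reg: "cycles \<sigma> = {#}" using path_net_no_loop[OF \<alpha>(2), of 0 "[]"] by (auto simp: nm_def split: if_splits)
  have "matched (sel True [True, False] [1, 2]) (sel False [True, False] [1, 2]) (ren (at [1, 2]) (edges \<sigma>))"
    using assms(1) by (simp add: well_typed_def)
  moreover have "ren (at [1, 2]) (edges \<sigma>) = edges \<sigma>"
  proof (rule ren_ident)
    fix x assume "x \<in> verts (edges \<sigma>)"
    then have "x \<in> {1..2}" using well_typedD(1)[OF assms(1)] by auto
    then have "x = 1 \<or> x = 2" by auto
    then show "at [1, 2] x = x" by (auto simp: at_def)
  qed
  moreover have "sel True [True, False] [1, 2] = {1}" "sel False [True, False] [1, 2] = {2}" by (auto simp: sel_def)
  ultimately have "matched {1} {2} (edges \<sigma>)" and nm: "nm [1, 2] \<sigma> = edges \<sigma>" using reg by (simp_all add: nm_def)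
  from this(1) obtain w where w: "edges \<sigma> = {(1, w, 2)}" by (rule matched_singleton)
  have "w = encode \<alpha>" using path_net_singleton[of "(1, w, 2)" 1 "encode \<alpha>" 2] \<alpha>(2) unfolding nm w by simp
  with \<alpha> w reg show thesis by (intro that[of \<alpha>]) (simp_all add: regular_def)
qed

context acg_llg
begin

lemma derivable_tr_well_typed:
  assumes "derivable G \<sigma> [tr A]" "A \<in> types_over \<Sigma>"
  shows "well_typed (alphabet G) (tsg (\<phi> A)) \<sigma>"
  using derivable_well_typed[OF assms(1)] unfolding ss_Cons ss_Nil fs_tr[OF assms(2)] append_Nil .

lemma llg_language_eq:
  assumes S: "S \<in> atoms \<Sigma>" "f S = Atom TreeAtom" "llg_start G = \<iota> S"
  shows "llg_language G =
    encode ` {\<alpha> \<in> Tr N n. \<exists>t. typed \<Sigma> [] t (Atom S) \<and> beta_eta_equiv (tree_term \<alpha>) (map_term g t)}" (is "_ = encode ` ?L")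
proof
  have AS: "Atom S \<in> types_over \<Sigma>" using S(1) by (simp add: types_over_def)
  have trS: "tr (Atom S) = Pos (llg_start G)" using S(3) by (simp add: tr_Atom)
  have wt: "well_typed (alphabet G) [True, False] \<sigma>" if "derivable G \<sigma> [tr (Atom S)]" for \<sigma>
    using derivable_tr_well_typed[OF that AS] S(2) by simp
  show "llg_language G \<subseteq> encode ` ?L"
  proof
    fix w assume "w \<in> llg_language G"
    then obtain \<sigma> i j where \<sigma>: "derivable G \<sigma> [tr (Atom S)]" "edges \<sigma> = {(i, w, j)}"
      by (auto simp: llg_language_def trS)
    obtain t where t: "typed \<Sigma> [] t (Atom S)" "realizes N n (\<phi> (Atom S)) (nm [1, 2] \<sigma>) (set [1, 2]) [1, 2] (map_term g t)"
      by (rule derivable_typed[OF \<sigma>(1) AS, of "[1, 2]"]) (simp_all add: S(2))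
    have "realizes N n (Atom TreeAtom) (nm [1, 2] \<sigma>) (set [1, 2]) [1, 2] (map_term g t)"
      using t(2) by (simp only: map_type.simps S(2))
    from wt[OF \<sigma>(1)] this obtain \<alpha> where \<alpha>: "\<alpha> \<in> Tr N n" "edges \<sigma> = {(1, encode \<alpha>, 2)}" "beta_eta_equiv (map_term g t) (tree_term \<alpha>)"
      by (rule realizes_single_edge)
    have "\<alpha> \<in> ?L" using \<alpha>(1) t(1) beta_eta_equiv_sym[OF \<alpha>(3)] by blast
    moreover have "w = encode \<alpha>" using \<sigma>(2) \<alpha>(2) by simp
    ultimately show "w \<in> encode ` ?L" by blast
  qed
  show "encode ` ?L \<subseteq> llg_language G"
  proof (rule image_subsetI)
    fix \<alpha> assume "\<alpha> \<in> ?L"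
    then obtain t where t: "typed \<Sigma> [] t (Atom S)" "beta_eta_equiv (tree_term \<alpha>) (map_term g t)" by blast
    obtain \<sigma> where \<sigma>: "derivable G \<sigma> [tr (Atom S)]"
      "\<And>\<nu>. length \<nu> = wd (\<phi> (Atom S)) \<Longrightarrow> distinct \<nu> \<Longrightarrow> 0 \<notin> set \<nu> \<Longrightarrow>
        realizes N n (\<phi> (Atom S)) (nm \<nu> \<sigma>) (set \<nu>) \<nu> (map_term g t)"
      using typed_derivable[OF t(1)] by blast
    have "realizes N n (\<phi> (Atom S)) (nm [1, 2] \<sigma>) (set [1, 2]) [1, 2] (map_term g t)"
      by (rule \<sigma>(2)) (simp_all add: S(2))
    then have "realizes N n (Atom TreeAtom) (nm [1, 2] \<sigma>) (set [1, 2]) [1, 2] (map_term g t)"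
      by (simp only: map_type.simps S(2))
    from wt[OF \<sigma>(1)] this obtain \<beta> where \<beta>: "regular \<sigma>" "edges \<sigma> = {(1, encode \<beta>, 2)}" "beta_eta_equiv (map_term g t) (tree_term \<beta>)"
      by (rule realizes_single_edge)
    \<comment> \<open>The multiword spells some tree \<open>\<beta>\<close> equivalent to the image
      of \<open>t\<close>; uniqueness of normal forms identifies it with
      \<open>\<alpha>\<close>.\<close>
    have "\<alpha> = \<beta>" using tree_term_equiv[OF beta_eta_equiv_trans[OF t(2) \<beta>(3)]] .
    then show "encode \<alpha> \<in> llg_language G" using \<sigma>(1) \<beta>(1,2) unfolding llg_language_def trS by blast
  qed
qed

lemma is_llg_acg:
  assumes "is_signature \<Sigma>" "finite (alphabet G)" "S \<in> atoms \<Sigma>" "f S = Atom TreeAtom" "llg_start G = \<iota> S"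
  shows "is_llg G"
proof -
  have fin: "finite (atoms \<Sigma>)" "finite (constants \<Sigma>)" using assms(1) by (auto simp: is_signature_def)
  have "set \<Gamma> \<subseteq> forms_over G \<and> is_multiword (alphabet G) (sbound (lit_bound G) \<Gamma>) \<sigma>"
    if "(\<sigma>, \<Gamma>) \<in> lexicon G" for \<sigma> \<Gamma>
  proof -
    have "set \<Gamma> \<subseteq> forms_over G" using that ctypes tr_forms_over unfolding lexicon by auto
    then show ?thesis using lex[OF that] is_multiword_iff_well_typed[OF is_boundary_s] by blast
  qed
  moreover have "lit_bound G (llg_start G) = Boundary 2 {1}" using assms(3-5) by (simp add: lit atm)
  moreover have "{1..2} - {1} = {2::nat}" by auto
  moreover have "finite (lexicon G)" using fin by (simp add: lexicon)
  ultimately show ?thesis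
    using fin assms(2,3,5) is_boundary_lit unfolding is_llg_def lits by (auto simp: rights_def)
qed

end

primrec trans_type :: "('p \<Rightarrow> nat) \<Rightarrow> 'p lty \<Rightarrow> nat form" where
  "trans_type \<iota> (Atom p) = Pos (\<iota> p)"
| "trans_type \<iota> (A \<multimap> B) = Par (dual (trans_type \<iota> A)) (trans_type \<iota> B)"

definition acg_grammar :: "'a set \<Rightarrow> nat \<Rightarrow> ('p, 'c) signature \<Rightarrow> ('p \<Rightarrow> tree_atom lty) \<Rightarrow> ('p \<Rightarrow> nat) \<Rightarrow>
    ('c \<Rightarrow> 'a tsym multiword) \<Rightarrow> 'p \<Rightarrow> (nat, 'a tsym) llg" where
  "acg_grammar N n \<Sigma> f \<iota> lx S =
    \<lparr>literals = \<iota> ` atoms \<Sigma>, lit_bound = (\<lambda>P. tbound (f (inv_into (atoms \<Sigma>) \<iota> P))), alphabet = tree_alphabet N n,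
     lexicon = (\<lambda>c. (lx c, [trans_type \<iota> (ctype \<Sigma> c)])) ` constants \<Sigma>, llg_start = \<iota> S\<rparr>"

lemma acg_llg_acg_grammar:
  assumes "inj_on \<iota> (atoms \<Sigma>)" "\<And>c. c \<in> constants \<Sigma> \<Longrightarrow> ctype \<Sigma> c \<in> types_over \<Sigma>"
    and "\<And>c. c \<in> constants \<Sigma> \<Longrightarrow> well_typed (tree_alphabet N n) (tsg (map_type f (ctype \<Sigma> c))) (lx c)"
    and "\<And>c \<nu>. c \<in> constants \<Sigma> \<Longrightarrow> distinct \<nu> \<Longrightarrow> 0 \<notin> set \<nu> \<Longrightarrow> length \<nu> = wd (map_type f (ctype \<Sigma> c)) \<Longrightarrow>
      realizes N n (map_type f (ctype \<Sigma> c)) (nm \<nu> (lx c)) (set \<nu>) \<nu> (g c)"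
  shows "acg_llg N n \<Sigma> f g \<iota> (inv_into (atoms \<Sigma>) \<iota>) (acg_grammar N n \<Sigma> f \<iota> lx S) lx (trans_type \<iota>)"
proof
  show "inv_into (atoms \<Sigma>) \<iota> (\<iota> p) = p" if "p \<in> atoms \<Sigma>" for p using assms(1) that by simp
  show "well_typed (alphabet (acg_grammar N n \<Sigma> f \<iota> lx S)) (tsg (map_type f (ctype \<Sigma> c))) (lx c)" if "c \<in> constants \<Sigma>" for c
    using assms(3)[OF that] by (simp add: acg_grammar_def)
qed (simp_all add: acg_grammar_def assms(2,4))

lemma tree_type_over: "tree_type k \<in> types_over (tree_sig N n)"
  by (induction k) (auto simp: types_over_def tree_sig_def)

lemma typed_tree_sig_multiword:
  fixes N :: "'a set"
  assumes "typed (tree_sig N n) [] u A"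
  obtains \<sigma> where "well_typed (tree_alphabet N n) (tsg A) \<sigma>"
    "\<And>\<nu>. distinct \<nu> \<Longrightarrow> 0 \<notin> set \<nu> \<Longrightarrow> length \<nu> = wd A \<Longrightarrow> realizes N n A (nm \<nu> \<sigma>) (set \<nu>) \<nu> u"
proof -
  \<comment> \<open>The tree signature has one atom, so a constant numbering is injective on
    it.\<close>
  let ?\<Sigma> = "tree_sig N n :: (tree_atom, 'a \<times> nat) signature" and ?\<iota> = "\<lambda>_ :: tree_atom. 0 :: nat"
  interpret acg_llg N n ?\<Sigma> Atom Const ?\<iota> "inv_into (atoms ?\<Sigma>) ?\<iota>" "acg_grammar N n ?\<Sigma> Atom ?\<iota> tree_mw TreeAtom" tree_mw "trans_type ?\<iota>"
  proof (rule acg_llg_acg_grammar)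
    show "inj_on ?\<iota> (atoms ?\<Sigma>)" by (simp add: tree_sig_def)
    fix c assume "c \<in> constants ?\<Sigma>"
    then obtain l k where c: "c = (l, k)" "l \<in> N" "k \<le> n" "ctype ?\<Sigma> c = tree_type k" by (auto simp: tree_sig_def)
    show "ctype ?\<Sigma> c \<in> types_over ?\<Sigma>" using tree_type_over c by simp
    show "well_typed (tree_alphabet N n) (tsg (map_type Atom (ctype ?\<Sigma> c))) (tree_mw c)"
      unfolding map_type_Atom c(4) unfolding c(1) by (rule tree_mw_typed[OF c(2,3)])
    show "realizes N n (map_type Atom (ctype ?\<Sigma> c)) (nm \<nu> (tree_mw c)) (set \<nu>) \<nu> (Const c)"
      if "distinct \<nu>" "0 \<notin> set \<nu>" "length \<nu> = wd (map_type Atom (ctype ?\<Sigma> c))" for \<nu>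
      using that unfolding map_type_Atom c(4) unfolding c(1) by (rule tree_mw_realizes[OF c(2,3)])
  qed
  obtain \<sigma> where \<sigma>: "derivable (acg_grammar N n ?\<Sigma> Atom ?\<iota> tree_mw TreeAtom) \<sigma> [trans_type ?\<iota> A]"
    "\<And>\<nu>. length \<nu> = wd (\<phi> A) \<Longrightarrow> distinct \<nu> \<Longrightarrow> 0 \<notin> set \<nu> \<Longrightarrow> realizes N n (\<phi> A) (nm \<nu> \<sigma>) (set \<nu>) \<nu> (map_term Const u)"
    using typed_derivable[OF assms] by blast
  show thesis
  proof (rule that)
    show "well_typed (tree_alphabet N n) (tsg A) \<sigma>"
      using derivable_tr_well_typed[OF \<sigma>(1) typed_type[OF assms]] by (simp add: map_type_Atom acg_grammar_def)
    show "realizes N n A (nm \<nu> \<sigma>) (set \<nu>) \<nu> u" if "distinct \<nu>" "0 \<notin> set \<nu>" "length \<nu> = wd A" for \<nu>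
      using \<sigma>(2)[of \<nu>] that by (simp add: map_type_Atom map_term_Const)
  qed
qed

section \<open>Start symbols that are not mapped to the type of trees\<close>

text \<open>A tree equivalent to the image of a term is a normal form of it, so it would inherit the
  type assigned to the start symbol, whereas a tree term has no type but that of trees.\<close>

lemma tree_language_empty:
  assumes "is_tree_acg N n G" "type_map G (start G) \<noteq> Atom TreeAtom"
  shows "tree_language N n G = {}"
proof (rule equals0I)
  fix \<alpha> assume "\<alpha> \<in> tree_language N n G"
  then obtain t where t: "typed (abstr_sig G) [] t (Atom (start G))" "beta_eta_equiv (tree_term \<alpha>) (map_term (const_map G) t)"
    by (auto simp: tree_language_def)
  let ?e = "\<lambda>_. Atom TreeAtom"
  have "st (tree_sig N n) ?e (map_term (const_map G) t) (map_type (type_map G) (Atom (start G)))"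
  proof (rule st_map_term[OF t(1)])
    show "st (tree_sig N n) e (const_map G c) (map_type (type_map G) (ctype (abstr_sig G) c))"
      if "c \<in> constants (abstr_sig G)" for c e
      using assms(1) that by (intro st_typed_closed) (auto simp: is_tree_acg_def is_acg_def is_signature_map_def)
  qed simp
  moreover have "red\<^sup>*\<^sup>* (map_term (const_map G) t) (tree_term \<alpha>)"
    using equiv_normal_form[OF t(2)] tree_term_normal by blast
  moreover have "st (tree_sig N n) ?e u' B" if "red\<^sup>*\<^sup>* u u'" "st (tree_sig N n) ?e u B" for u u' B
    using that by (induction rule: rtranclp_induct) (auto intro: st_red)
  ultimately have "st (tree_sig N n) ?e (tree_term \<alpha>) (type_map G (start G))" by auto
  from st_tree_term[OF this] assms(2) show False by simp
qed

text \<open>Literals counted with sign. With an empty lexicon only sequents of total 0 are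
  derivable, since identities have total 0 and the rules preserve it, while the start sequent has
  total 1.\<close>

primrec balance :: "'l form \<Rightarrow> int" where
  "balance (Pos P) = 1"
| "balance (Neg P) = - 1"
| "balance (A \<otimes>\<^sub>f B) = balance A + balance B"
| "balance (Par A B) = balance A + balance B"

lemma balance_dual: "balance (dual A) = - balance A"
  by (induction A) auto

lemma derivable_balance: "derivable G \<sigma> \<Gamma> \<Longrightarrow> lexicon G = {} \<Longrightarrow> sum_list (map balance \<Gamma>) = 0"
  by (induction rule: derivable.induct) (auto simp: balance_dual)

lemma finite_tree_alphabet: "finite N \<Longrightarrow> finite (tree_alphabet N n)"
proof -
  assume "finite N"
  then have "finite ((\<lambda>(a, i, k). Sym a i k) ` (N \<times> {..n} \<times> {..n}))" by simp
  moreover have "tree_alphabet N n \<subseteq> (\<lambda>(a, i, k). Sym a i k) ` (N \<times> {..n} \<times> {..n})"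
    by (force simp: tree_alphabet_def)
  ultimately show ?thesis by (rule rev_finite_subset)
qed

theorem mainTheorem3:
  fixes N :: "'a set" and n :: nat and L :: "'a ptree set"
    and G :: "('p, 'c, tree_atom, 'a \<times> nat) acg"
  assumes "finite N"
    and "is_tree_acg N n G"
    and "L = tree_language N n G"
  shows "\<exists>G' :: (nat, 'a tsym) llg.
           is_llg G' \<and> alphabet G' = tree_alphabet N n \<and> llg_language G' = encode ` L"
proof (cases "type_map G (start G) = Atom TreeAtom")
  case True
  let ?\<Sigma> = "abstr_sig G" and ?f = "type_map G" and ?g = "const_map G"
  have G: "is_signature ?\<Sigma>" "start G \<in> atoms ?\<Sigma>"
    "\<And>c. c \<in> constants ?\<Sigma> \<Longrightarrow> typed (tree_sig N n) [] (?g c) (map_type ?f (ctype ?\<Sigma> c))"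
    using assms(2) by (auto simp: is_tree_acg_def is_acg_def is_signature_map_def)
  then have "finite (atoms ?\<Sigma>)" by (simp add: is_signature_def)
  \<comment> \<open>Literals of the grammar are natural numbers, so the finitely many atoms are
    numbered injectively.\<close>
  then obtain \<iota> :: "'p \<Rightarrow> nat" where \<iota>: "inj_on \<iota> (atoms ?\<Sigma>)" using finite_imp_inj_to_nat_seg by blast
  \<comment> \<open>Each constant is sent to a typed object term, whose multiword is chosen as its
    lexicon entry.\<close>
  have "\<exists>\<sigma>. well_typed (tree_alphabet N n) (tsg (map_type ?f (ctype ?\<Sigma> c))) \<sigma> \<and>
      (\<forall>\<nu>. distinct \<nu> \<longrightarrow> 0 \<notin> set \<nu> \<longrightarrow> length \<nu> = wd (map_type ?f (ctype ?\<Sigma> c)) \<longrightarrow>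
        realizes N n (map_type ?f (ctype ?\<Sigma> c)) (nm \<nu> \<sigma>) (set \<nu>) \<nu> (?g c))" if "c \<in> constants ?\<Sigma>" for c
    by (rule typed_tree_sig_multiword[OF G(3)[OF that]]) blast
  then obtain lx where lx: "\<And>c. c \<in> constants ?\<Sigma> \<Longrightarrow> well_typed (tree_alphabet N n) (tsg (map_type ?f (ctype ?\<Sigma> c))) (lx c)"
    "\<And>c \<nu>. c \<in> constants ?\<Sigma> \<Longrightarrow> distinct \<nu> \<Longrightarrow> 0 \<notin> set \<nu> \<Longrightarrow> length \<nu> = wd (map_type ?f (ctype ?\<Sigma> c)) \<Longrightarrow>
        realizes N n (map_type ?f (ctype ?\<Sigma> c)) (nm \<nu> (lx c)) (set \<nu>) \<nu> (?g c)"
    by metis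
  let ?G = "acg_grammar N n ?\<Sigma> ?f \<iota> lx (start G)"
  interpret acg_llg N n ?\<Sigma> ?f ?g \<iota> "inv_into (atoms ?\<Sigma>) \<iota>" ?G lx "trans_type \<iota>"
  proof (rule acg_llg_acg_grammar[OF \<iota> _ lx])
    show "ctype ?\<Sigma> c \<in> types_over ?\<Sigma>" if "c \<in> constants ?\<Sigma>" for c using G(1) that by (simp add: is_signature_def)
  qed
  have G': "alphabet ?G = tree_alphabet N n" "llg_start ?G = \<iota> (start G)" by (simp_all add: acg_grammar_def)
  have "is_llg ?G" by (rule is_llg_acg[OF G(1) _ G(2) True G'(2)]) (simp add: G'(1) finite_tree_alphabet assms(1))
  moreover have "llg_language ?G = encode ` L"
    unfolding assms(3) tree_language_def by (rule llg_language_eq[OF G(2) True G'(2)])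
  ultimately show ?thesis using G'(1) by blast
next
  case False
  \<comment> \<open>One literal with the boundary of a tree and nothing in the lexicon: a legal
    grammar with empty language.\<close>
  let ?G = "\<lparr>literals = {0 :: nat}, lit_bound = (\<lambda>_. Boundary 2 {1}), alphabet = tree_alphabet N n, lexicon = {}, llg_start = 0\<rparr>"
  have "{1..2} - {1} = {2::nat}" by auto
  then have "is_llg ?G" using finite_tree_alphabet[OF assms(1)] by (simp add: is_llg_def is_boundary_def rights_def)
  moreover have "llg_language ?G = {}" by (auto simp: llg_language_def dest: derivable_balance)
  ultimately show ?thesis using tree_language_empty[OF assms(2) False] assms(3) by (intro exI[of _ ?G]) simp
qed

end
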